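(* Let $K_\nu$ be the completion of an algebraic number field at a place $\nu$ (finite or archimedean), with normalized absolute value $|\cdot|$, self-dual Haar measure $dy$ and Fourier transform $\mathcal{F}\varphi(x)=\int_{K_\nu}\varphi(y)\lambda(-xy)\,dy$. Let $A$ be multiplication by $\log|y|$, $B=\mathcal{F}^{-1}M\mathcal{F}$ with $M$ multiplication by $\log|x|$, and $K=i(BA-AB)$, defined on Schwartz–Bruhat functions on $K_\nu$ vanishing in a neighbourhood of $0$. Then $K$ is bounded for the $L^2(K_\nu,dy)$ norm, hence extends to a bounded (hermitian) operator on $L^2(K_\nu,dy)$.
   Context: At a finite place $\lambda(x)=\exp(2\pi i\,\mathrm{Tr}(x))$ (trace to $\mathbb{Q}_p$, $p$-adic fractional part), at an archimedean place $\lambda(x)=\exp(-2\pi i\,\mathrm{Tr}(x))$; $dy$ is self-dual for $\lambda$; for $K_\nu=\mathbb{C}$, $|z|=z\overline z$. *)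

theory Defs
  imports "HOL-Analysis.Analysis" "HOL-Computational_Algebra.Primes"
begin

section \<open>Number fields and their completions\<close>

definition number_field :: "'a::field_char_0 set \<Rightarrow> bool" where
  "number_field F \<longleftrightarrow>
     0 \<in> F \<and> 1 \<in> F \<and>
     (\<forall>x\<in>F. \<forall>y\<in>F. x + y \<in> F \<and> x - y \<in> F \<and> x * y \<in> F) \<and>
     (\<forall>x\<in>F. inverse x \<in> F) \<and>
     (\<exists>B. finite B \<and> B \<subseteq> F \<and>
        (\<forall>x\<in>F. \<exists>c::'a \<Rightarrow> rat. x = (\<Sum>b\<in>B. of_rat (c b) * b)))"

text \<open>
  A place of a number field is represented by a nontrivial absolute value
  \<open>x \<mapsto> dist x 0\<close>; its completion is a complete valued field containing the number
  field \<open>F\<close> (identified with its image) as a dense subfield. The metric need not be the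
  normalized absolute value, which is defined further below.
\<close>

definition completion_at_place :: "'k::{field_char_0, complete_space} set \<Rightarrow> bool" where
  "completion_at_place F \<longleftrightarrow>
     number_field F \<and>
     (\<forall>x y z::'k. dist (x + z) (y + z) = dist x y) \<and>
     (\<forall>x y::'k. dist (x * y) 0 = dist x 0 * dist y 0) \<and>
     (\<exists>x\<in>F. x \<noteq> 0 \<and> dist x 0 \<noteq> 1) \<and>
     closure F = UNIV"

definition finite_place :: "'k::{field_char_0, complete_space} itself \<Rightarrow> bool" where
  "finite_place _ \<longleftrightarrow> (\<forall>x y::'k. dist (x + y) 0 \<le> max (dist x 0) (dist y 0))"

text \<open>
  At an archimedean place the completion is isomorphic, as a topological field, to the
  reals or to the complex numbers. The isomorphism is unique in the real case and unique
  up to complex conjugation in the complex case, so that the notions transported along it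
  below do not depend on its choice.
\<close>

definition topological_field_iso ::
    "('a::{field, topological_space} \<Rightarrow> 'b::{field, topological_space}) \<Rightarrow> bool" where
  "topological_field_iso e \<longleftrightarrow>
     e 1 = 1 \<and> (\<forall>x y. e (x + y) = e x + e y) \<and> (\<forall>x y. e (x * y) = e x * e y) \<and>
     homeomorphism UNIV UNIV e (inv e)"


section \<open>The normalized absolute value\<close>

text \<open>
  At a finite place \<open>cball 0 1\<close> is the ring of integers, \<open>ball 0 1\<close> its maximal ideal,
  and the balls \<open>ball x 1\<close> with \<open>x \<in> cball 0 1\<close> are the residue classes.
\<close>

definition residue_card :: "'k::{field_char_0, complete_space} itself \<Rightarrow> nat" where
  "residue_card _ = card ((\<lambda>x::'k. ball x 1) ` cball 0 1)"

definition uniformizer :: "'k::{field_char_0, complete_space} \<Rightarrow> bool" where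
  "uniformizer \<pi> \<longleftrightarrow> \<pi> \<noteq> 0 \<and> ball 0 1 = (\<lambda>x. \<pi> * x) ` cball 0 1"

definition place_ord :: "'k::{field_char_0, complete_space} \<Rightarrow> int" where
  "place_ord x = (THE m. \<exists>\<pi>::'k. uniformizer \<pi> \<and> dist x 0 = dist \<pi> 0 powi m)"

definition normalized_abs :: "'k::{field_char_0, complete_space} \<Rightarrow> real" where
  "normalized_abs x =
     (if finite_place TYPE('k)
      then (if x = 0 then 0 else real (residue_card TYPE('k)) powi (- place_ord x))
      else (THE r.
        (\<exists>(e::real \<Rightarrow> 'k) t. topological_field_iso e \<and> x = e t \<and> r = \<bar>t\<bar>) \<or>
        (\<exists>(e::complex \<Rightarrow> 'k) z. topological_field_iso e \<and> x = e z \<and> of_real r = z * cnj z)))"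


section \<open>Trace and additive character\<close>

definition basis_over :: "'k::field set \<Rightarrow> 'k set \<Rightarrow> bool" where
  "basis_over L B \<longleftrightarrow> finite B \<and>
     (\<forall>x. \<exists>!c. (\<forall>b\<in>B. c b \<in> L) \<and> (\<forall>b. b \<notin> B \<longrightarrow> c b = 0) \<and> x = (\<Sum>b\<in>B. c b * b))"

definition coords_over :: "'k::field set \<Rightarrow> 'k set \<Rightarrow> 'k \<Rightarrow> 'k \<Rightarrow> 'k" where
  "coords_over L B x =
     (THE c. (\<forall>b\<in>B. c b \<in> L) \<and> (\<forall>b. b \<notin> B \<longrightarrow> c b = 0) \<and> x = (\<Sum>b\<in>B. c b * b))"

text \<open>The trace of multiplication by \<open>x\<close>, as an endomorphism of the \<open>L\<close>-vector space \<open>'k\<close>.\<close>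

definition field_trace :: "'k::field set \<Rightarrow> 'k \<Rightarrow> 'k" where
  "field_trace L x = (let B = (SOME B. basis_over L B) in \<Sum>b\<in>B. coords_over L B (x * b) b)"

definition residue_char :: "'k::{field_char_0, complete_space} itself \<Rightarrow> nat" where
  "residue_char _ = (THE p. prime p \<and> dist (of_nat p :: 'k) 0 < 1)"

text \<open>
  The \<open>p\<close>-adic fractional part of an element of the closure of the rationals (which is the
  field of \<open>p\<close>-adic numbers): its representative in \<open>\<int>[1/p] \<inter> [0,1)\<close> modulo \<open>p\<close>-adic integers.
\<close>

definition frac_part :: "'k::{field_char_0, complete_space} \<Rightarrow> rat" where
  "frac_part y = (THE r. (\<exists>a n. r = of_int a / of_nat (residue_char TYPE('k)) ^ n) \<and>
      0 \<le> r \<and> r < 1 \<and> dist y (of_rat r) \<le> 1)"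

definition arch_trace :: "'k::{field_char_0, complete_space} \<Rightarrow> real" where
  "arch_trace x = (THE t.
     (\<exists>e::real \<Rightarrow> 'k. topological_field_iso e \<and> x = e t) \<or>
     (\<exists>(e::complex \<Rightarrow> 'k) z. topological_field_iso e \<and> x = e z \<and> of_real t = z + cnj z))"

definition place_char :: "'k::{field_char_0, complete_space} \<Rightarrow> complex" where
  "place_char x =
     (if finite_place TYPE('k)
      then exp (2 * of_real pi * \<i> * of_rat (frac_part (field_trace (closure \<rat>) x)))
      else exp (- 2 * of_real pi * \<i> * of_real (arch_trace x)))"


section \<open>Schwartz--Bruhat functions\<close>

text \<open>
  \<open>D [b\<^sub>1, \<dots>, b\<^sub>n]\<close> is the iterated partial derivative of \<open>f\<close> in the directions
  \<open>b\<^sub>n, \<dots>, b\<^sub>1\<close>.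
\<close>

definition schwartz_function :: "('a::euclidean_space \<Rightarrow> complex) \<Rightarrow> bool" where
  "schwartz_function f \<longleftrightarrow> (\<exists>D. D [] = f \<and>
     (\<forall>bs\<in>lists Basis.
        (\<forall>x. (D bs has_derivative (\<lambda>h. \<Sum>b\<in>Basis. (h \<bullet> b) *\<^sub>R D (b # bs) x)) (at x)) \<and>
        (\<forall>k::nat. bounded (range (\<lambda>x. norm x ^ k * norm (D bs x))))))"

definition schwartz_bruhat :: "('k::{field_char_0, complete_space} \<Rightarrow> complex) \<Rightarrow> bool" where
  "schwartz_bruhat \<phi> \<longleftrightarrow>
     (if finite_place TYPE('k)
      then (\<forall>x. \<exists>\<epsilon>>0. \<forall>y. dist x y < \<epsilon> \<longrightarrow> \<phi> y = \<phi> x) \<and>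
           (\<exists>C. compact C \<and> (\<forall>x. x \<notin> C \<longrightarrow> \<phi> x = 0))
      else (\<exists>e::real \<Rightarrow> 'k. topological_field_iso e \<and> schwartz_function (\<phi> \<circ> e)) \<or>
           (\<exists>e::complex \<Rightarrow> 'k. topological_field_iso e \<and> schwartz_function (\<phi> \<circ> e)))"

definition schwartz_bruhat_off_zero ::
    "('k::{field_char_0, complete_space} \<Rightarrow> complex) set" where
  "schwartz_bruhat_off_zero = {\<phi>. schwartz_bruhat \<phi> \<and> (\<exists>\<epsilon>>0. \<forall>x\<in>ball 0 \<epsilon>. \<phi> x = 0)}"


section \<open>Fourier transform and self-dual measure\<close>

definition fourier ::
    "'k::{field_char_0, complete_space} measure \<Rightarrow> ('k \<Rightarrow> complex) \<Rightarrow> 'k \<Rightarrow> complex" where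
  "fourier M \<phi> x = (\<integral>y. \<phi> y * place_char (- (x * y)) \<partial>M)"

definition inv_fourier ::
    "'k::{field_char_0, complete_space} measure \<Rightarrow> ('k \<Rightarrow> complex) \<Rightarrow> 'k \<Rightarrow> complex" where
  "inv_fourier M \<psi> x = (\<integral>y. \<psi> y * place_char (x * y) \<partial>M)"

definition haar_measure :: "'k::{field_char_0, complete_space} measure \<Rightarrow> bool" where
  "haar_measure M \<longleftrightarrow>
     sets M = sets borel \<and>
     (\<forall>a. distr M borel (\<lambda>x. a + x) = M) \<and>
     (\<forall>C. compact C \<longrightarrow> emeasure M C < \<infinity>) \<and>
     (\<forall>U. open U \<and> U \<noteq> {} \<longrightarrow> 0 < emeasure M U)"

definition self_dual_haar_measure :: "'k::{field_char_0, complete_space} measure \<Rightarrow> bool" where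
  "self_dual_haar_measure M \<longleftrightarrow>
     haar_measure M \<and> (\<forall>\<phi>. schwartz_bruhat \<phi> \<longrightarrow> inv_fourier M (fourier M \<phi>) = \<phi>)"


section \<open>The operators\<close>

text \<open>
  Here \<open>ln 0 = 0\<close>, which is harmless as points are null sets. On Schwartz--Bruhat functions
  vanishing near \<open>0\<close> all functions to which \<open>fourier\<close> and \<open>inv_fourier\<close> are applied
  are integrable.
\<close>

definition log_mult ::
    "('k::{field_char_0, complete_space} \<Rightarrow> complex) \<Rightarrow> 'k \<Rightarrow> complex" where
  "log_mult \<phi> y = of_real (ln (normalized_abs y)) * \<phi> y"

definition log_mult_dual ::
    "'k::{field_char_0, complete_space} measure \<Rightarrow> ('k \<Rightarrow> complex) \<Rightarrow> 'k \<Rightarrow> complex" where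
  "log_mult_dual M \<phi> = inv_fourier M (log_mult (fourier M \<phi>))"

definition conductor_commutator ::
    "'k::{field_char_0, complete_space} measure \<Rightarrow> ('k \<Rightarrow> complex) \<Rightarrow> 'k \<Rightarrow> complex" where
  "conductor_commutator M \<phi> x =
     \<i> * (log_mult_dual M (log_mult \<phi>) x - log_mult (log_mult_dual M \<phi>) x)"


section \<open>Operators on square-integrable functions\<close>

text \<open>Elements of \<open>L\<^sup>2\<close> are represented by functions, to be read up to equality almost everywhere.\<close>

definition L2 :: "'a measure \<Rightarrow> ('a \<Rightarrow> complex) set" where
  "L2 M = {f \<in> borel_measurable M. integrable M (\<lambda>x. (cmod (f x))\<^sup>2)}"

definition L2_norm :: "'a measure \<Rightarrow> ('a \<Rightarrow> complex) \<Rightarrow> real" where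
  "L2_norm M f = sqrt (\<integral>x. (cmod (f x))\<^sup>2 \<partial>M)"

definition L2_inner :: "'a measure \<Rightarrow> ('a \<Rightarrow> complex) \<Rightarrow> ('a \<Rightarrow> complex) \<Rightarrow> complex" where
  "L2_inner M f g = (\<integral>x. f x * cnj (g x) \<partial>M)"

text \<open>Linearity and the norm bound imply that \<open>T\<close> respects equality almost everywhere.\<close>

definition L2_bounded_operator ::
    "'a measure \<Rightarrow> (('a \<Rightarrow> complex) \<Rightarrow> 'a \<Rightarrow> complex) \<Rightarrow> bool" where
  "L2_bounded_operator M T \<longleftrightarrow>
     (\<forall>f\<in>L2 M. T f \<in> L2 M) \<and>
     (\<forall>f\<in>L2 M. \<forall>g\<in>L2 M. AE x in M. T (\<lambda>y. f y + g y) x = T f x + T g x) \<and>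
     (\<forall>f\<in>L2 M. \<forall>c. AE x in M. T (\<lambda>y. c * f y) x = c * T f x) \<and>
     (\<exists>C. \<forall>f\<in>L2 M. L2_norm M (T f) \<le> C * L2_norm M f)"

definition L2_hermitian ::
    "'a measure \<Rightarrow> (('a \<Rightarrow> complex) \<Rightarrow> 'a \<Rightarrow> complex) \<Rightarrow> bool" where
  "L2_hermitian M T \<longleftrightarrow> (\<forall>f\<in>L2 M. \<forall>g\<in>L2 M. L2_inner M (T f) g = L2_inner M f (T g))"

end

theory Submission
  imports Defs "HOL-Probability.Probability" "HOL-Computational_Algebra.Fundamental_Theorem_Algebra"
begin

text \<open>The operator \<open>B\<close> is a Fourier multiplier, so formally a convolution, and
  off the diagonal its kernel is of size 1/|x - y|. Commuting it with multiplication by log|y|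
  inserts the factor log|y| - log|x|. Hence the commutator should be the integral operator with
  kernel -i (log|y| - log|x|) k(x - y), where k is even and 0 <= k(z) <= C/|z|. Up to the constant C
  this kernel is dominated by S(x,y) = |log|x| - log|y|| / |x - y|, which is homogeneous of degree
  -1, and the zero of the numerator tames the singularity on the diagonal. Substituting y = x t
  shows that the weight |y|^(-1/2) is an eigenfunction of S, with eigenvalue the integral of
  |log|t|| |t|^(-1/2) / |1 - t|. That integral converges at 0, 1 and infinity because a ball of
  radius r has volume O(r). Schur's test then bounds the operator on L2, and the symmetry of the
  kernel together with Fubini makes it hermitian. The lemmas are
  \<open>schur_kernel_integral\<close>, \<open>schur_const_finite\<close>, \<open>schur_test\<close>
  and \<open>T_hermitian\<close>.

  The logarithm is not the transform of an integrable function, so the convolution needs a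
  justification. One writes log|x| as the integral over a parameter t of c_t - g_t(x), where the g_t
  are dilates of one function and have nonnegative transforms D_t: Gaussians at an archimedean place
  (Frullani's integral), indicators of balls at a finite place (a sum over the integers). For fixed
  x the function \<open>\<psi>\<close>(y) = (log|y| - log|x|) \<open>\<phi>\<close>(y) vanishes at
  x. Thus the inverse transform of its transform vanishes at x, and the constants c_t drop out. What
  remains is minus the convolution of \<open>\<psi>\<close> with D_t, and D_t integrates over t to
  k. This is \<open>commutator_formula\<close>; it holds for x other than 0, which is almost
  everywhere, so the integral operator is the required extension
  (\<open>commutator_bounded\<close>).

  Everything else verifies the hypotheses of this argument at each place. If the metric is not
  ultrametric, Ostrowski's theorem and the algebraicity of the number field identify the completion
  with the reals or the complex numbers (\<open>ex_topological_field_iso\<close>). There the measure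
  is a multiple of Lebesgue measure, multiplication by the logarithm preserves Schwartz functions
  vanishing near 0, and Fourier transforms of Schwartz functions decay rapidly. If the metric is
  ultrametric, the closure of the rationals is a p-adic field, and lifting a basis of the integers
  modulo p gives a finite basis over it (\<open>basis_X\<close>). From that basis come the trace, a
  continuous nontrivial character, compactness of the ring of integers, a uniformizer and the
  volumes of balls. Locally constant functions of compact support have transforms that vanish far
  out.\<close>

section \<open>Measurable group operations and uniqueness of Haar measure\<close>

lemma countable_dense_imp_countable_basis:
  fixes S :: "'a::metric_space set"
  assumes "countable S" "closure S = UNIV"
  obtains B :: "'a set set" where "countable B" "topological_basis B"
proof
  let ?B = "(\<lambda>(s, n::nat). ball s (1 / Suc n)) ` (S \<times> UNIV)"
  show "countable ?B" using assms(1) by auto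
  show "topological_basis ?B"
  proof (rule topological_basisI)
    show "open b" if "b \<in> ?B" for b using that by auto
    fix U :: "'a set" and x assume U: "open U" "x \<in> U"
    then obtain e where e: "e > 0" "ball x e \<subseteq> U" by (auto simp: open_contains_ball)
    obtain n :: nat where n: "1 / Suc n < e / 2" using e(1) nat_approx_posE[of "e/2"] by (auto simp: inverse_eq_divide)
    have "x \<in> closure S" using assms(2) by simp
    moreover have "0 < 1 / real (Suc n)" by simp
    ultimately obtain s where s: "s \<in> S" "dist s x < 1 / Suc n" unfolding closure_approachable by blast
    have "ball s (1 / Suc n) \<subseteq> ball x e"
    proof
      fix y assume "y \<in> ball s (1 / Suc n)"
      then have "dist x y < e" using s(2) n dist_triangle[of x y s] by (simp add: dist_commute) 
      then show "y \<in> ball x e" by simp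
    qed
    moreover have "ball s (1/Suc n) \<in> ?B" "x \<in> ball s (1/Suc n)"
      using s by (auto simp del: of_nat_Suc)
    ultimately show "\<exists>B'\<in>?B. x \<in> B' \<and> B' \<subseteq> U" using e(2) by (meson order_trans)
  qed
qed

text \<open>With a countable basis every open subset of the square is a countable union of open
  rectangles, so it belongs to the product sigma-algebra. This is applied to subtraction and
  multiplication of a completion, where the countable dense number field provides the basis.\<close>

lemma borel_measurable_pair_continuous:
  fixes f :: "'a::topological_space \<times> 'a \<Rightarrow> 'c::topological_space" and B :: "'a set set"
  assumes "countable B" "topological_basis B" "continuous_on UNIV f"
  shows "f \<in> borel_measurable (borel \<Otimes>\<^sub>M borel)"
proof (rule borel_measurableI)
  fix U :: "'c set" assume "open U"
  then have oU: "open (f -` U)" by (intro open_vimage assms(3))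
  obtain X where X: "X \<subseteq> (\<lambda>(a, b). a \<times> b) ` (B \<times> B)" "\<Union>X = f -` U"
    using topological_basis_prod[OF assms(2) assms(2), unfolded topological_basis_def, THEN conjunct2, rule_format, OF oU]
    by (elim exE conjE) (rule that)
  have "countable X" by (rule countable_subset[OF X(1)]) (intro countable_image countable_SIGMA assms(1))
  moreover have "x \<in> sets (borel \<Otimes>\<^sub>M borel)" if "x \<in> X" for x
    using that X(1) topological_basis_open[OF assms(2)] by (auto intro!: pair_measureI)
  ultimately have "\<Union>X \<in> sets (borel \<Otimes>\<^sub>M borel :: ('a \<times> 'a) measure)"
    by (intro sets.countable_Union) auto
  then show "f -` U \<inter> space (borel \<Otimes>\<^sub>M borel) \<in> sets (borel \<Otimes>\<^sub>M borel)"
    using X(2) by (simp add: space_pair_measure)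
qed

text \<open>Subtraction alone suffices: negation is \<open>0 - w\<close>, and a sum is a difference
  with a negated term.\<close>

lemma
  assumes sub: "(\<lambda>(x, y). x - y) \<in> borel \<Otimes>\<^sub>M borel \<rightarrow>\<^sub>M (borel :: 'a::{ab_group_add, topological_space} measure)"
  shows measurable_diff_of_pair: "f \<in> R \<rightarrow>\<^sub>M borel \<Longrightarrow> g \<in> R \<rightarrow>\<^sub>M borel \<Longrightarrow> (\<lambda>w. f w - g w :: 'a) \<in> R \<rightarrow>\<^sub>M borel"
    and measurable_uminus_of_pair: "(uminus :: 'a \<Rightarrow> 'a) \<in> borel \<rightarrow>\<^sub>M borel"
    and measurable_add_of_pair: "f \<in> R \<rightarrow>\<^sub>M borel \<Longrightarrow> g \<in> R \<rightarrow>\<^sub>M borel \<Longrightarrow> (\<lambda>w. f w + g w :: 'a) \<in> R \<rightarrow>\<^sub>M borel"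
proof -
  show "(\<lambda>w. f w - g w) \<in> R \<rightarrow>\<^sub>M borel" if "f \<in> R \<rightarrow>\<^sub>M borel" "g \<in> R \<rightarrow>\<^sub>M borel"
    using measurable_compose[OF measurable_Pair[OF that] sub] by simp
  have "(\<lambda>w. 0 - w) \<in> borel \<rightarrow>\<^sub>M (borel :: 'a measure)"
    using measurable_compose[OF measurable_Pair[OF measurable_const measurable_ident, of 0 borel borel] sub] by simp
  then show neg: "(uminus :: 'a \<Rightarrow> 'a) \<in> borel \<rightarrow>\<^sub>M borel" by simp
  show "(\<lambda>w. f w + g w) \<in> R \<rightarrow>\<^sub>M borel" if "f \<in> R \<rightarrow>\<^sub>M borel" "g \<in> R \<rightarrow>\<^sub>M borel"
    using measurable_compose[OF measurable_Pair[OF that(1) measurable_compose[OF that(2) neg]] sub] by simp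
qed

text \<open>
  Uniqueness of Haar measure, from the double integral of \<open>1\<^bsub>A\<^esub>(x) 1\<^bsub>B\<^esub>(x + y)\<close>.
\<close>

lemma translation_invariant_measures:
  fixes \<mu> \<nu> :: "'a::{ab_group_add, topological_space} measure"
  assumes sets[measurable_cong]: "sets \<mu> = sets borel" "sets \<nu> = sets borel"
    and sf: "sigma_finite_measure \<mu>" "sigma_finite_measure \<nu>"
    and sub: "(\<lambda>(x, y). x - y) \<in> borel \<Otimes>\<^sub>M borel \<rightarrow>\<^sub>M (borel :: 'a measure)"
    and inv: "\<And>a. distr \<mu> borel ((+) a) = \<mu>" "\<And>a. distr \<nu> borel ((+) a) = \<nu>"
    and A[measurable]: "A \<in> sets borel" and B[measurable]: "B \<in> sets borel"
  shows "emeasure \<mu> A * emeasure \<nu> B = emeasure \<mu> B * emeasure \<nu> (uminus -` A)"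
proof -
  interpret \<mu>: sigma_finite_measure \<mu> by fact
  interpret \<nu>: sigma_finite_measure \<nu> by fact
  interpret P: pair_sigma_finite \<mu> \<nu> ..
  have sp: "space \<mu> = UNIV" "space \<nu> = UNIV"
    using sets_eq_imp_space_eq[OF sets(1)] sets_eq_imp_space_eq[OF sets(2)] by auto
  have [measurable]: "(\<lambda>w. fst w + snd w) \<in> \<mu> \<Otimes>\<^sub>M \<nu> \<rightarrow>\<^sub>M borel" "(\<lambda>w. - snd w + fst w) \<in> \<mu> \<Otimes>\<^sub>M \<nu> \<rightarrow>\<^sub>M borel"
    "(\<lambda>w. fst w - snd w) \<in> \<mu> \<Otimes>\<^sub>M \<nu> \<rightarrow>\<^sub>M borel"
    by (intro measurable_add_of_pair[OF sub] measurable_diff_of_pair[OF sub]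
        measurable_compose[OF _ measurable_uminus_of_pair[OF sub]]; simp)+
  have [measurable]: "(+) a \<in> borel \<rightarrow>\<^sub>M borel" "(\<lambda>x. x + a) \<in> borel \<rightarrow>\<^sub>M borel"
    "(\<lambda>x. a - x) \<in> borel \<rightarrow>\<^sub>M borel" "(\<lambda>x. x - a) \<in> borel \<rightarrow>\<^sub>M borel" for a :: 'a
    by (intro measurable_add_of_pair[OF sub] measurable_diff_of_pair[OF sub]; simp)+
  have neg[measurable]: "uminus \<in> borel \<rightarrow>\<^sub>M (borel :: 'a measure)" by (rule measurable_uminus_of_pair[OF sub])
  have shift: "(\<integral>\<^sup>+x. f (a + x) \<partial>m) = (\<integral>\<^sup>+x. f x \<partial>m)"
    if [measurable]: "f \<in> borel_measurable borel" and m: "distr m borel ((+) a) = m" "sets m = sets borel"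
    for m :: "'a measure" and f :: "'a \<Rightarrow> ennreal" and a
  proof -
    have [measurable]: "(+) a \<in> m \<rightarrow>\<^sub>M borel" using m(2) measurable_cong_sets[of m borel borel borel] by simp
    show ?thesis by (subst (2) m(1)[symmetric], subst nn_integral_distr) auto
  qed
  have "emeasure \<mu> A * emeasure \<nu> B = (\<integral>\<^sup>+x. indicator A x * (\<integral>\<^sup>+y. indicator B y \<partial>\<nu>) \<partial>\<mu>)"
    by (simp add: nn_integral_multc)
  also have "\<dots> = (\<integral>\<^sup>+x. indicator A x * (\<integral>\<^sup>+y. indicator B (x + y) \<partial>\<nu>) \<partial>\<mu>)"
    using shift[of "indicator B" \<nu>] inv(2) sets(2) by simp
  also have "\<dots> = (\<integral>\<^sup>+x. \<integral>\<^sup>+y. indicator A x * indicator B (x + y) \<partial>\<nu> \<partial>\<mu>)"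
    by (subst nn_integral_cmult) auto
  also have "\<dots> = (\<integral>\<^sup>+y. \<integral>\<^sup>+x. indicator A x * indicator B (x + y) \<partial>\<mu> \<partial>\<nu>)"
    by (subst P.Fubini') auto
  also have "\<dots> = (\<integral>\<^sup>+y. \<integral>\<^sup>+x. indicator A (- y + x) * indicator B x \<partial>\<mu> \<partial>\<nu>)"
  proof (rule nn_integral_cong)
    fix y
    show "(\<integral>\<^sup>+x. indicator A x * indicator B (x + y) \<partial>\<mu>) = (\<integral>\<^sup>+x. indicator A (- y + x) * indicator B x \<partial>\<mu>)"
      using shift[of "\<lambda>x. indicator A x * indicator B (x + y)" \<mu> "- y"] inv(1) sets(1) by simp
  qed
  also have "\<dots> = (\<integral>\<^sup>+x. \<integral>\<^sup>+y. indicator A (- y + x) * indicator B x \<partial>\<nu> \<partial>\<mu>)"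
    by (subst P.Fubini') auto
  \<comment> \<open>Translating \<open>y\<close> by \<open>x\<close> turns \<open>- y + x\<close>
    into \<open>- y\<close>, which separates the two variables.\<close>
  also have "\<dots> = (\<integral>\<^sup>+x. \<integral>\<^sup>+y. indicator A (- y) * indicator B x \<partial>\<nu> \<partial>\<mu>)"
  proof (rule nn_integral_cong)
    fix x
    show "(\<integral>\<^sup>+y. indicator A (- y + x) * indicator B x \<partial>\<nu>) = (\<integral>\<^sup>+y. indicator A (- y) * indicator B x \<partial>\<nu>)"
      using shift[of "\<lambda>y. indicator A (- y + x) * indicator B x" \<nu> "x"] inv(2) sets(2) by simp
  qed
  also have "\<dots> = (\<integral>\<^sup>+x. (\<integral>\<^sup>+y. indicator (uminus -` A) y \<partial>\<nu>) * indicator B x \<partial>\<mu>)"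
    by (subst nn_integral_multc[symmetric]) (auto simp: indicator_def of_bool_def)
  also have "\<dots> = emeasure \<mu> B * emeasure \<nu> (uminus -` A)"
  proof -
    have "uminus -` A \<in> sets borel" using measurable_sets[OF neg A] by simp
    then show ?thesis using sets by (subst nn_integral_cmult) (auto simp: mult.commute)
  qed
  finally show ?thesis .
qed

section \<open>An integrable radial weight\<close>

text \<open>The minimum is the power -3/4 near 0 and the power -5/4 near infinity. When balls of
  radius r have volume O(r) the critical exponent is -1, so the weight is integrable with a margin
  of 1/4 at both ends; that margin absorbs logarithms.\<close>

definition radial_weight :: "real \<Rightarrow> real" where
  "radial_weight s = min (s powr (- 3 / 4)) (s powr (- 5 / 4))"

lemma radial_weight_nonneg: "0 \<le> radial_weight s" by (simp add: radial_weight_def)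

lemma radial_weight_measurable[measurable]: "radial_weight \<in> borel_measurable borel"
  unfolding radial_weight_def by measurable

text \<open>A dyadic decomposition: for \<open>s\<close> at most 1 the layer between consecutive
  powers of 1/2 containing \<open>s\<close> gives one summand, for larger \<open>s\<close> the layer
  between powers of 2. Whole balls replace layers, so that only volumes of balls enter
  later.\<close>

lemma radial_weight_le_suminf:
  assumes "s \<ge> 0"
  shows "ennreal (radial_weight s) \<le>
    (\<Sum>n. ennreal (2 powr (3/4 * (real n + 1))) * indicator {..2 powr (- real n)} s
        + ennreal (2 powr (- (5/4) * real n)) * indicator {..2 powr (real n + 1)} s)"
    (is "_ \<le> suminf ?f")
proof -
  have "\<exists>n. ennreal (radial_weight s) \<le> ?f n"
  proof (cases "s = 0")
    case True
    then show ?thesis by (simp add: radial_weight_def)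
  next
    case False
    then have s: "s > 0" using assms by simp
    show ?thesis
    proof (cases "s \<le> 1")
      case True
      define n where "n = nat \<lfloor>- log 2 s\<rfloor>"
      have l: "log 2 s \<le> 0" using True s by simp
      then have n: "real n \<le> - log 2 s" "- log 2 s < real n + 1" unfolding n_def by linarith+
      have "s \<le> 2 powr (- real n)" using n(1) s by (simp add: le_powr_iff)
      moreover have "s powr (- 3 / 4) \<le> 2 powr (3/4 * (real n + 1))"
      proof -
        have "s powr (- 3 / 4) = 2 powr (log 2 s * (- 3/4))" using s by (simp add: powr_def log_def)
        also have "\<dots> \<le> 2 powr (3/4 * (real n + 1))" using n(2) by (intro powr_mono) auto
        finally show ?thesis .
      qed
      ultimately have "ennreal (radial_weight s) \<le> ennreal (2 powr (3/4 * (real n + 1))) * indicator {..2 powr (- real n)} s"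
        by (auto simp: radial_weight_def intro!: ennreal_leI)
      then show ?thesis by (intro exI[of _ n]) (simp add: add_increasing2)
    next
      case False
      define n where "n = nat \<lfloor>log 2 s\<rfloor>"
      have l: "log 2 s \<ge> 0" using False s by simp
      then have n: "real n \<le> log 2 s" "log 2 s < real n + 1" unfolding n_def by linarith+
      have "s \<le> 2 powr (real n + 1)" using n(2) s by (simp add: le_powr_iff)
      moreover have "s powr (- 5 / 4) \<le> 2 powr (- (5/4) * real n)"
      proof -
        have "s powr (- 5 / 4) = 2 powr (log 2 s * (- 5/4))" using s by (simp add: powr_def log_def)
        also have "\<dots> \<le> 2 powr (- (5/4) * real n)" using n(1) by (intro powr_mono) auto
        finally show ?thesis .
      qed
      ultimately have "ennreal (radial_weight s) \<le> ennreal (2 powr (- (5/4) * real n)) * indicator {..2 powr (real n + 1)} s"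
        by (auto simp: radial_weight_def intro!: ennreal_leI)
      then show ?thesis by (intro exI[of _ n]) (simp add: add_increasing)
    qed
  qed
  then obtain n where "ennreal (radial_weight s) \<le> ?f n" ..
  also have "?f n \<le> suminf ?f" using sum_le_suminf[of ?f "{n}"] by (simp add: summableI)
  finally show ?thesis .
qed

text \<open>Inserting the volume bound, the \<open>n\<close>-th dyadic summand is at most 4 V
  2^(-n/4): the growth of the weight and the decay of the volume (or conversely) miss each other by
  the exponent 1/4. A geometric series remains.\<close>

lemma radial_weight_integral:
  fixes N :: "'a \<Rightarrow> real"
  assumes [measurable]: "N \<in> borel_measurable M" and N: "\<And>x. 0 \<le> N x" and V: "0 \<le> V"
    and vol: "\<And>r. 0 < r \<Longrightarrow> emeasure M {x \<in> space M. N x \<le> r} \<le> ennreal (V * r)"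
  shows "(\<integral>\<^sup>+x. ennreal (radial_weight (N x)) \<partial>M) < \<infinity>"
proof -
  let ?q = "2 powr (- (1/4)) :: real"
  have q: "0 < ?q" "?q < 1" by (auto simp: powr_less_one)
  have "(\<integral>\<^sup>+x. ennreal (radial_weight (N x)) \<partial>M) \<le> (\<integral>\<^sup>+x. (\<Sum>n. ennreal (2 powr (3/4 * (real n + 1))) * indicator {..2 powr (- real n)} (N x)
        + ennreal (2 powr (- (5/4) * real n)) * indicator {..2 powr (real n + 1)} (N x)) \<partial>M)"
    by (intro nn_integral_mono radial_weight_le_suminf N)
  also have "\<dots> = (\<Sum>n. ennreal (2 powr (3/4 * (real n + 1))) * emeasure M {x \<in> space M. N x \<le> 2 powr (- real n)}
        + ennreal (2 powr (- (5/4) * real n)) * emeasure M {x \<in> space M. N x \<le> 2 powr (real n + 1)})"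
  proof (subst nn_integral_suminf, measurable, intro suminf_cong)
    fix n :: nat
    have ind: "indicator {..r} (N x) = (indicator {x \<in> space M. N x \<le> r} x :: ennreal)" if "x \<in> space M" for r x
      using that by (cases "N x \<le> r") auto
    show "(\<integral>\<^sup>+x. ennreal (2 powr (3/4 * (real n + 1))) * indicator {..2 powr (- real n)} (N x)
        + ennreal (2 powr (- (5/4) * real n)) * indicator {..2 powr (real n + 1)} (N x) \<partial>M) =
      ennreal (2 powr (3/4 * (real n + 1))) * emeasure M {x \<in> space M. N x \<le> 2 powr (- real n)}
        + ennreal (2 powr (- (5/4) * real n)) * emeasure M {x \<in> space M. N x \<le> 2 powr (real n + 1)}"
      (is "?l = _")
    proof -
      have "?l = (\<integral>\<^sup>+x. ennreal (2 powr (3/4 * (real n + 1))) * indicator {x \<in> space M. N x \<le> 2 powr (- real n)} x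
        + ennreal (2 powr (- (5/4) * real n)) * indicator {x \<in> space M. N x \<le> 2 powr (real n + 1)} x \<partial>M)"
        by (intro nn_integral_cong) (simp only: ind)
      then show ?thesis by (simp add: nn_integral_add nn_integral_cmult)
    qed
  qed
  also have "\<dots> \<le> (\<Sum>n. ennreal (4 * V * ?q ^ n))"
  proof (rule suminf_le[OF _ summableI summableI])
    fix n :: nat
    have "ennreal (2 powr (3/4 * (real n + 1))) * emeasure M {x \<in> space M. N x \<le> 2 powr (- real n)}
        + ennreal (2 powr (- (5/4) * real n)) * emeasure M {x \<in> space M. N x \<le> 2 powr (real n + 1)}
      \<le> ennreal (2 powr (3/4 * (real n + 1))) * ennreal (V * 2 powr (- real n))
        + ennreal (2 powr (- (5/4) * real n)) * ennreal (V * 2 powr (real n + 1))"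
      by (rule add_mono; rule mult_left_mono; (rule vol)?; simp)
    also have "\<dots> = ennreal (2 powr (3/4 * (real n + 1)) * (V * 2 powr (- real n)) + 2 powr (- (5/4) * real n) * (V * 2 powr (real n + 1)))"
      using V by (simp add: ennreal_plus ennreal_mult)
    also have "\<dots> \<le> ennreal (4 * V * ?q ^ n)"
    proof (intro ennreal_leI)
      have qn: "?q ^ n = 2 powr (- (real n / 4))" by (simp add: powr_realpow[symmetric] powr_powr)
      have e: "3/4 * (real n + 1) + - real n = 3/4 + - (real n / 4)" "- (5/4) * real n + (real n + 1) = 1 + - (real n / 4)"
        by (simp_all add: field_simps)
      have "(2::real) powr (3/4 * (real n + 1)) * 2 powr (- real n) = 2 powr (3/4) * 2 powr (- (real n / 4))"
        by (simp only: powr_add[symmetric] e)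
      then have "2 powr (3/4 * (real n + 1)) * (V * 2 powr (- real n)) = V * 2 powr (3/4) * ?q ^ n"
        unfolding qn by (simp add: mult_ac)
      moreover have "(2::real) powr (- (5/4) * real n) * 2 powr (real n + 1) = 2 powr 1 * 2 powr (- (real n / 4))"
        by (simp only: powr_add[symmetric] e)
      then have "2 powr (- (5/4) * real n) * (V * 2 powr (real n + 1)) = V * 2 * ?q ^ n"
        unfolding qn by (simp add: mult_ac)
      moreover have "2 powr (3/4) \<le> (2::real)" using powr_mono[of "3/4" 1 "2::real"] by simp
      ultimately show "2 powr (3/4 * (real n + 1)) * (V * 2 powr (- real n)) + 2 powr (- (5/4) * real n) * (V * 2 powr (real n + 1)) \<le> 4 * V * ?q ^ n"
        using V mult_right_mono[of "2 powr (3/4)" "2::real" "V * ?q ^ n"] by (simp only:) (simp add: algebra_simps)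
    qed
    finally show "ennreal (2 powr (3/4 * (real n + 1))) * emeasure M {x \<in> space M. N x \<le> 2 powr (- real n)}
        + ennreal (2 powr (- (5/4) * real n)) * emeasure M {x \<in> space M. N x \<le> 2 powr (real n + 1)} \<le> ennreal (4 * V * ?q ^ n)" .
  qed
  also have "\<dots> < \<infinity>"
  proof -
    have "summable (\<lambda>n. 4 * V * ?q ^ n)" using q by (intro summable_mult summable_geometric) auto
    then have "(\<Sum>n. ennreal (4 * V * ?q ^ n)) = ennreal (\<Sum>n. 4 * V * ?q ^ n)"
      using V q by (intro suminf_ennreal2) auto
    then show ?thesis by simp
  qed
  finally show ?thesis .
qed

text \<open>The inequality ln u < u for u = s^(1/4) and for u = s^(-1/4).\<close>

lemma abs_ln_le_powr: "\<bar>ln s\<bar> \<le> 4 * (s powr (1/4) + s powr (- (1/4)))" if "s > 0" for s :: real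
proof -
  have "ln (s powr (1/4)) < s powr (1/4)" "ln (s powr (- (1/4))) < s powr (- (1/4))"
    by (rule ln_less_self, use that in simp)+
  then have "ln s \<le> 4 * s powr (1/4)" "- ln s \<le> 4 * s powr (- (1/4))" unfolding ln_powr by linarith+
  then show ?thesis using powr_ge_zero[of s "1/4"] powr_ge_zero[of s "- (1/4)"] unfolding abs_le_iff distrib_left by linarith
qed

text \<open>Extends the behaviour of the weight near 0 up to the cut-off 8 used in
  \<open>schur_kernel_weight_bound\<close>; beyond 1 the two powers differ by the bounded factor
  s^(1/2).\<close>

lemma powr_le_radial_weight_small:
  assumes "0 < s" "s \<le> 8" shows "s powr (- 3/4) \<le> 8 * radial_weight s"
proof -
  have "s powr (1/2) \<le> 8 powr 1"
    using assms powr_mono2[of "1/2" s 8] powr_mono[of "1/2" 1 "8::real"] by simp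
  then have "s powr (- 5/4) * s powr (1/2) \<le> s powr (- 5/4) * 8" by (intro mult_left_mono) auto
  then have "s powr (- 3/4) \<le> 8 * s powr (- 5/4)" by (simp flip: powr_add add: mult.commute)
  then show ?thesis using powr_ge_zero[of s "-3/4"] by (auto simp: radial_weight_def min_def)
qed

text \<open>A value bounded by \<open>B\<close> and by \<open>B\<close> s^(-2) leaves room on both
  sides of the weight, enough for the factors s^(1/4) and s^(-1/4) that dominate the logarithm. The
  last bound compares such a function with the Schur weight s^(-1/2).\<close>

lemma weight_bound_small:
  assumes "0 < s" "b \<le> B" "s\<^sup>2 * b \<le> B" "0 \<le> b"
  shows "b \<le> B * radial_weight s" "\<bar>ln s\<bar> * b \<le> 8 * B * radial_weight s"
    "b * s powr (1/2) \<le> B"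
proof -
  have B: "0 \<le> B" using assms by simp
  have p2: "s\<^sup>2 = s powr 2" using assms by simp
  have b2: "b \<le> B * s powr (- 2)"
  proof -
    have "s powr (- 2) * s powr 2 = 1" using assms(1) by (simp only: powr_add[symmetric]) simp
    then have "b = s powr (- 2) * (s powr 2 * b)" by (simp add: mult.assoc[symmetric] del: powr_numeral)
    also have "\<dots> \<le> s powr (- 2) * B" using assms(3) unfolding p2 by (intro mult_left_mono) auto
    finally show ?thesis by (simp add: mult.commute)
  qed
  have *: "b \<le> B * radial_weight s \<and> b * s powr (1/2) \<le> B \<and> b * s powr (1/4) \<le> B * radial_weight s \<and> b * s powr (- (1/4)) \<le> B * radial_weight s"
  proof (cases "s \<le> 1")
    case True
    have r: "radial_weight s = s powr (- 3/4)" unfolding radial_weight_def using True assms(1) powr_mono'[of "- 5/4" "- 3/4" s] by simp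
    have e: "1 \<le> s powr (- 3/4)" "s powr (1/2) \<le> 1" "s powr (1/4) \<le> 1" "s powr (-(1/4)) \<le> s powr (- 3/4)"
      using True assms(1) powr_mono'[of "- 3/4" 0 s] powr_mono'[of 0 "1/2" s] powr_mono'[of 0 "1/4" s] powr_mono'[of "- 3/4" "- (1/4)" s] by simp_all
    have "b \<le> B * s powr (- 3/4)" using mult_mono[OF assms(2) e(1)] B by simp
    moreover have "b * s powr (1/2) \<le> B" using mult_mono[OF assms(2) e(2)] B by simp
    moreover have "b * s powr (1/4) \<le> b * 1" using e(3) assms(4) by (intro mult_left_mono)
    moreover have "b * s powr (-(1/4)) \<le> B * s powr (- 3/4)" using mult_mono[OF assms(2) e(4)] B by simp
    ultimately show ?thesis unfolding r by auto
  next
    case False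
    have r: "radial_weight s = s powr (- 5/4)" unfolding radial_weight_def using False powr_mono[of "- 5/4" "- 3/4" s] by simp
    have m: "b * s powr e \<le> B * s powr (e - 2)" for e
    proof -
      have "b * s powr e \<le> B * s powr (- 2) * s powr e" using b2 by (intro mult_right_mono) auto
      also have "\<dots> = B * s powr (e - 2)" by (simp add: mult.assoc flip: powr_add)
      finally show ?thesis .
    qed
    have n: "B * s powr e \<le> B * s powr (- 5/4)" if "e \<le> - 5/4" for e
      using that False B by (intro mult_left_mono powr_mono) auto
    have "B * s powr (- 3/2) \<le> B * 1" using False B powr_mono[of "- 3/2" 0 s] by (intro mult_left_mono) auto
    then have "b * s powr (1/2) \<le> B" using m[of "1/2"] by simp
    moreover have "b \<le> B * s powr (- 5/4)" using order_trans[OF b2 n[of "-2"]] by simp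
    moreover have "b * s powr (1/4) \<le> B * s powr (- 5/4)" using order_trans[OF m n, of "1/4"] by simp
    moreover have "b * s powr (-(1/4)) \<le> B * s powr (- 5/4)" using order_trans[OF m n, of "-(1/4)"] by simp
    ultimately show ?thesis unfolding r by blast
  qed
  then show "b \<le> B * radial_weight s" "b * s powr (1/2) \<le> B" by auto
  have "\<bar>ln s\<bar> * b \<le> 4 * (s powr (1/4) + s powr (- (1/4))) * b"
    by (intro mult_right_mono abs_ln_le_powr assms)
  also have "\<dots> = 4 * (b * s powr (1/4)) + 4 * (b * s powr (-(1/4)))" by (simp add: algebra_simps)
  finally show "\<bar>ln s\<bar> * b \<le> 8 * B * radial_weight s" using * by linarith
qed

lemma ennreal_square_finite:
  fixes a :: ennreal assumes "a\<^sup>2 < \<infinity>" shows "a < \<infinity>"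
  using assms by (cases "a = \<top>") (auto simp: power2_eq_square less_top[symmetric])

section \<open>Fields with a normalized absolute value and a Haar measure\<close>

text \<open>Common ground for all places. The factor 2 in \<open>N_add\<close> accommodates the
  complex numbers, where \<open>N\<close> is the square of the modulus. For the same reason
  \<open>ln_N_near_1\<close> has a square root; it makes the quotient of log|t| by |1 - t|
  integrable near 1. \<open>vol_scale\<close> speaks of balls only; the scaling of arbitrary
  integrals is deduced from uniqueness of Haar measure.\<close>

locale normed_haar =
  fixes M :: "'k::{field, topological_space} measure" and N :: "'k \<Rightarrow> real" and V :: real
  assumes sets_M[measurable_cong]: "sets M = sets borel"
    and M_translate: "distr M borel ((+) a) = M"
    and pair_diff: "(\<lambda>(x, y). x - y) \<in> borel \<Otimes>\<^sub>M borel \<rightarrow>\<^sub>M (borel :: 'k measure)"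
    and pair_mult: "(\<lambda>(x, y). x * y) \<in> borel \<Otimes>\<^sub>M borel \<rightarrow>\<^sub>M (borel :: 'k measure)"
    and singleton_borel: "{0 :: 'k} \<in> sets borel"
    and N_measurable[measurable]: "N \<in> borel_measurable borel"
    and N_nonneg[simp]: "0 \<le> N x"
    and N_eq_0[simp]: "N x = 0 \<longleftrightarrow> x = 0"
    and N_mult: "N (x * y) = N x * N y"
    and N_add: "N (x + y) \<le> 2 * (N x + N y)"
    and vol_pos: "0 < emeasure M {x. N x \<le> 1}"
    and vol_scale: "a \<noteq> 0 \<Longrightarrow> emeasure M {x. N x \<le> N a} = ennreal (N a) * emeasure M {x. N x \<le> 1}"
    and V_nonneg: "0 \<le> V"
    and vol_bound: "0 < r \<Longrightarrow> emeasure M {x. N x \<le> r} \<le> ennreal (V * r)"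
    and ln_N_near_1: "N (1 - t) \<le> 1 / 4 \<Longrightarrow> \<bar>ln (N t)\<bar> \<le> 4 * sqrt (N (1 - t))"
begin

lemma space_M[simp]: "space M = UNIV"
  using sets_eq_imp_space_eq[OF sets_M] by simp

lemma measurable_diff'[measurable (raw)]:
  "f \<in> R \<rightarrow>\<^sub>M borel \<Longrightarrow> g \<in> R \<rightarrow>\<^sub>M borel \<Longrightarrow> (\<lambda>w. f w - g w :: 'k) \<in> R \<rightarrow>\<^sub>M borel"
  by (rule measurable_diff_of_pair[OF pair_diff])

lemma measurable_add'[measurable (raw)]:
  "f \<in> R \<rightarrow>\<^sub>M borel \<Longrightarrow> g \<in> R \<rightarrow>\<^sub>M borel \<Longrightarrow> (\<lambda>w. f w + g w :: 'k) \<in> R \<rightarrow>\<^sub>M borel"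
  by (rule measurable_add_of_pair[OF pair_diff])

lemma measurable_mult'[measurable (raw)]:
  assumes "f \<in> R \<rightarrow>\<^sub>M borel" "g \<in> R \<rightarrow>\<^sub>M borel"
  shows "(\<lambda>w. f w * g w :: 'k) \<in> R \<rightarrow>\<^sub>M borel"
  using measurable_compose[OF measurable_Pair[OF assms] pair_mult] by simp

lemma measurable_uminus'[measurable (raw)]:
  "f \<in> R \<rightarrow>\<^sub>M borel \<Longrightarrow> (\<lambda>w. - f w :: 'k) \<in> R \<rightarrow>\<^sub>M borel"
  by (rule measurable_compose[OF _ measurable_uminus_of_pair[OF pair_diff]])

lemma N_0[simp]: "N 0 = 0" and N_1[simp]: "N 1 = 1"
proof -
  show "N 0 = 0" by simp
  have "N 1 * N 1 = N 1 * 1" by (simp flip: N_mult)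
  moreover have "N 1 \<noteq> 0" by simp
  ultimately show "N 1 = 1" by (simp only: mult_cancel_left) blast
qed

lemma N_minus[simp]: "N (- x) = N x"
proof -
  have "N (- 1) * N (- 1) = 1" by (simp flip: N_mult)
  then have "N (- 1) = 1" using N_nonneg[of "- 1"] by (metis abs_of_nonneg abs_square_eq_1 power2_eq_square)
  then show ?thesis using N_mult[of "- 1" x] by simp
qed

lemma N_commute: "N (x - y) = N (y - x)"
  using N_minus[of "x - y"] by simp

lemma N_pos[simp]: "0 < N x \<longleftrightarrow> x \<noteq> 0"
  using N_nonneg[of x] N_eq_0[of x] by linarith

lemma N_inverse: "N (inverse x) = inverse (N x)"
proof (cases "x = 0")
  case False
  then have "N x * N (inverse x) = 1" by (simp flip: N_mult)
  then show ?thesis by (rule inverse_unique[symmetric])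
qed simp

lemma null_0: "emeasure M {0} = 0"
proof (rule ccontr)
  assume *: "emeasure M {0} \<noteq> 0"
  have le: "emeasure M {0} \<le> ennreal (V * r)" if "r > 0" for r
    by (rule order_trans[OF emeasure_mono vol_bound[OF that]]) (use that in auto)
  then have "emeasure M {0} < \<infinity>" using le[of 1] by (simp add: less_top[symmetric] top_unique) (metis ennreal_neq_top neq_top_trans)
  then obtain m where m: "emeasure M {0} = ennreal m" "m > 0"
    using * by (metis ennreal_cases ennreal_0 infinity_ennreal_def less_irrefl order_le_less)
  \<comment> \<open>This radius makes the volume bound smaller than half of
    \<open>m\<close>.\<close>
  have "m \<le> V * (m / (2 * (V + 1)))" using le[of "m / (2 * (V + 1))"] m V_nonneg by (simp add: ennreal_le_iff)
  then have "m * (2 * (V + 1)) \<le> V * m" using V_nonneg by (simp add: field_simps)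
  then show False using m(2) V_nonneg by (simp add: algebra_simps) (smt (verit) mult_nonneg_nonneg)
qed

lemma AE_nonzero: "AE x in M. x \<noteq> 0"
  by (rule AE_I[where N="{0}"]) (auto simp: null_0 sets_M singleton_borel)

lemma AE_nonzeroI: "(\<And>x. x \<noteq> 0 \<Longrightarrow> P x) \<Longrightarrow> AE x in M. P x"
  using AE_nonzero by eventually_elim auto

lemma sigma_finite_M: "sigma_finite_measure M"
proof
  show "\<exists>A. countable A \<and> A \<subseteq> sets M \<and> \<Union>A = space M \<and> (\<forall>a\<in>A. emeasure M a \<noteq> \<infinity>)"
  proof (intro exI conjI ballI)
    let ?A = "range (\<lambda>n::nat. {x. N x \<le> real n + 1})"
    show "countable ?A" by simp
    show "?A \<subseteq> sets M" by (auto simp: sets_M)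
    show "\<Union>?A = space M"
    proof -
      have "\<exists>n. N x \<le> real n + 1" for x using real_arch_simple[of "N x"] by (metis add.commute add_increasing zero_le_one)
      then show ?thesis by auto
    qed
    fix a assume "a \<in> ?A"
    then obtain n :: nat where "a = {x. N x \<le> real n + 1}" by auto
    then show "emeasure M a \<noteq> \<infinity>" using neq_top_trans[OF ennreal_neq_top vol_bound[of "real n + 1"]] by simp
  qed
qed

sublocale sigma_finite_measure M by (rule sigma_finite_M)
sublocale MM: pair_sigma_finite M M ..

lemma nn_integral_translate:
  assumes [measurable]: "f \<in> borel_measurable borel"
  shows "(\<integral>\<^sup>+x. f (a + x) \<partial>M) = (\<integral>\<^sup>+x. f x \<partial>M)"
  by (subst (2) M_translate[of a, symmetric], subst nn_integral_distr) auto

lemma vol_finite: "emeasure M {x. N x \<le> 1} \<noteq> \<infinity>"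
  using neq_top_trans[OF ennreal_neq_top vol_bound[of 1]] by simp

text \<open>The image of \<open>M\<close> under multiplication by \<open>a\<close> is again
  translation invariant, hence proportional to \<open>M\<close>; the factor is read off from the
  unit ball.\<close>

lemma nn_integral_scale:
  assumes a: "a \<noteq> 0" and f[measurable]: "f \<in> borel_measurable borel"
  shows "(\<integral>\<^sup>+x. f x \<partial>M) = ennreal (N a) * (\<integral>\<^sup>+x. f (a * x) \<partial>M)"
proof -
  define \<nu> where "\<nu> = distr M borel ((*) a)"
  have [measurable]: "(*) b \<in> borel \<rightarrow>\<^sub>M borel" for b :: 'k by measurable
  have sets_\<nu>[measurable_cong]: "sets \<nu> = sets borel" by (simp add: \<nu>_def)
  have inv: "distr \<nu> borel ((+) b) = \<nu>" for b
  proof -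
    have "distr \<nu> borel ((+) b) = distr M borel (\<lambda>x. a * (b / a + x))"
      unfolding \<nu>_def using a by (subst distr_distr) (auto simp: o_def distrib_left)
    also have "\<dots> = distr (distr M borel ((+) (b / a))) borel ((*) a)"
      by (subst distr_distr) (auto simp: o_def)
    finally show ?thesis by (simp add: M_translate \<nu>_def)
  qed
  have em: "emeasure \<nu> B = emeasure M ((*) a -` B)" if "B \<in> sets borel" for B
    unfolding \<nu>_def using that by (subst emeasure_distr) auto
  have vA: "ennreal (N a) * emeasure \<nu> {x. N x \<le> 1} = emeasure M {x. N x \<le> 1}"
  proof -
    have "N (a * x) \<le> 1 \<longleftrightarrow> N x \<le> N (inverse a)" for x
      unfolding N_mult N_inverse using a N_pos[of a] by (simp add: field_simps)
    then have "(*) a -` {x. N x \<le> 1} = {x. N x \<le> N (inverse a)}" by auto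
    then have "emeasure \<nu> {x. N x \<le> 1} = ennreal (N (inverse a)) * emeasure M {x. N x \<le> 1}"
      using a by (subst em) (auto simp: vol_scale[of "inverse a"])
    then have "ennreal (N a) * emeasure \<nu> {x. N x \<le> 1} = ennreal (N a * N (inverse a)) * emeasure M {x. N x \<le> 1}"
      by (simp add: ennreal_mult' mult.assoc)
    then show ?thesis using a by (simp add: N_inverse)
  qed
  have "sigma_finite_measure \<nu>"
  proof
    show "\<exists>A. countable A \<and> A \<subseteq> sets \<nu> \<and> \<Union>A = space \<nu> \<and> (\<forall>a\<in>A. emeasure \<nu> a \<noteq> \<infinity>)"
    proof (intro exI conjI ballI)
      let ?A = "range (\<lambda>n::nat. {x. N x \<le> real n + 1})"
      show "countable ?A" by simp
      show "?A \<subseteq> sets \<nu>" by (auto simp: sets_\<nu>)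
      show "\<Union>?A = space \<nu>"
      proof -
        have "\<exists>n. N x \<le> real n + 1" for x using real_arch_simple[of "N x"] by (metis add.commute add_increasing zero_le_one)
        then show ?thesis by (auto simp: \<nu>_def)
      qed
      fix A assume "A \<in> ?A"
      then obtain n :: nat where A: "A = {x. N x \<le> real n + 1}" by auto
      have "(*) a -` A = {x. N x \<le> (real n + 1) / N a}" using a by (auto simp: A N_mult field_simps)
      moreover have "A \<in> sets borel" unfolding A by measurable
      ultimately show "emeasure \<nu> A \<noteq> \<infinity>"
        using neq_top_trans[OF ennreal_neq_top vol_bound[of "(real n + 1) / N a"]] a by (simp add: em)
    qed
  qed
  have main: "ennreal (N a) * emeasure \<nu> B = emeasure M B" if B: "B \<in> sets borel" for B
  proof -
    \<comment> \<open>Uniqueness with the unit ball as reference set, which is symmetric, so the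
      reflection disappears.\<close>
    have "emeasure \<nu> {x. N x \<le> 1} * emeasure M B = emeasure \<nu> B * emeasure M (uminus -` {x. N x \<le> 1})"
      by (rule translation_invariant_measures[OF sets_\<nu> sets_M \<open>sigma_finite_measure \<nu>\<close> sigma_finite_M pair_diff inv M_translate _ B]) measurable
    moreover have "uminus -` {x. N x \<le> 1} = {x. N x \<le> 1}" by auto
    ultimately have "emeasure M B * emeasure M {x. N x \<le> 1} = ennreal (N a) * emeasure \<nu> B * emeasure M {x. N x \<le> 1}"
      by (metis vA mult.assoc mult.commute)
    moreover have "emeasure M {x. N x \<le> 1} \<noteq> 0" using vol_pos by auto
    ultimately show ?thesis using vol_finite
      by (simp add: mult.commute[of _ "emeasure M {x. N x \<le> 1}"] ennreal_mult_cancel_left)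
  qed
  have "M = scale_measure (ennreal (N a)) \<nu>"
    by (rule measure_eqI) (auto simp: sets_M sets_\<nu> main)
  then have "(\<integral>\<^sup>+x. f x \<partial>M) = ennreal (N a) * (\<integral>\<^sup>+x. f x \<partial>\<nu>)"
    by (metis f nn_integral_scale_measure measurable_cong_sets sets_\<nu>)
  also have "(\<integral>\<^sup>+x. f x \<partial>\<nu>) = (\<integral>\<^sup>+x. f (a * x) \<partial>M)"
    unfolding \<nu>_def by (subst nn_integral_distr) auto
  finally show ?thesis .
qed

lemma radial_weight_N: "(\<integral>\<^sup>+x. ennreal (radial_weight (N x)) \<partial>M) < \<infinity>"
  by (rule radial_weight_integral[where V=V]) (auto simp: V_nonneg vol_bound)

lemma integrable_radial_weight: "integrable M (\<lambda>x. radial_weight (N x))"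
  using radial_weight_N by (intro integrableI_bounded) (auto simp: radial_weight_nonneg)

section \<open>The dominating kernel and its Schur constant\<close>

text \<open>Homogeneous of degree -1 under a common dilation of nonzero arguments, since the
  logarithm turns the dilation into an additive constant that cancels. On the diagonal the value is
  0, by division by 0.\<close>

definition schur_kernel :: "'k \<Rightarrow> 'k \<Rightarrow> real" where
  "schur_kernel x y = \<bar>ln (N x) - ln (N y)\<bar> / N (x - y)"

lemma schur_kernel_nonneg: "0 \<le> schur_kernel x y" by (simp add: schur_kernel_def)

lemma schur_kernel_sym: "schur_kernel x y = schur_kernel y x"
  by (simp add: schur_kernel_def N_commute abs_minus_commute)

lemma schur_kernel_measurable[measurable (raw)]:
  assumes [measurable]: "f \<in> R \<rightarrow>\<^sub>M borel" "g \<in> R \<rightarrow>\<^sub>M borel"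
  shows "(\<lambda>w. schur_kernel (f w) (g w)) \<in> borel_measurable R"
  unfolding schur_kernel_def by measurable

definition schur_const :: ennreal where
  "schur_const = (\<integral>\<^sup>+t. ennreal (schur_kernel 1 t * N t powr (- 1 / 2)) \<partial>M)"

text \<open>Three regions. Near \<open>t = 1\<close> the logarithm vanishes like the square root of
  |1 - t|, leaving the exponent -1/2 at that point. For |t| at most 8 away from 1 only the
  singularity |t|^(-1/2) log|t| at 0 matters. For larger |t| the denominator is comparable to |t|
  and the decay is that of |t|^(-3/2) log|t|. The constant is generous; the middle region asks for
  1152.\<close>

lemma schur_kernel_weight_bound:
  "schur_kernel 1 t * N t powr (- 1 / 2) \<le> 2000 * (radial_weight (N t) + radial_weight (N (1 - t)))"
proof (cases "t = 0 \<or> t = 1")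
  case True
  then show ?thesis using radial_weight_nonneg by (auto simp: schur_kernel_def)
next
  case False
  then have t0: "N t > 0" and t1: "N (1 - t) > 0" by auto
  let ?a = "N t" and ?b = "N (1 - t)"
  have k: "schur_kernel 1 t = \<bar>ln ?a\<bar> / ?b" by (simp add: schur_kernel_def)
  show ?thesis
  proof (cases "?b \<le> 1 / 4")
    case True
    have "1 \<le> 2 * (?b + ?a)" using N_add[of "1 - t" t] by simp
    then have a: "?a \<ge> 1/4" using True by simp
    have "?a powr (- 1/2) \<le> (1/4) powr (- 1/2)" using a by (intro powr_mono2') auto
    also have "(1/4::real) powr (- 1/2) = 2"
    proof -
      have "(1/4::real) powr (- 1/2) = ((1/2) powr 2) powr (- 1/2)" by (simp add: power2_eq_square)
      also have "\<dots> = 2" by (subst powr_powr) (simp add: powr_minus)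
      finally show ?thesis .
    qed
    finally have a2: "?a powr (- 1/2) \<le> 2" .
    have "schur_kernel 1 t \<le> 4 * sqrt ?b / ?b" unfolding k using ln_N_near_1[OF True] t1 by (intro divide_right_mono) auto
    also have "\<dots> = 4 * ?b powr (- 1/2)" using t1 powr_diff[of ?b "1/2" 1] by (simp add: powr_half_sqrt)
    finally have "schur_kernel 1 t * ?a powr (- 1/2) \<le> 4 * ?b powr (- 1/2) * 2"
      using a2 by (intro mult_mono) (auto simp: schur_kernel_nonneg)
    then have "schur_kernel 1 t * ?a powr (- 1/2) \<le> 8 * ?b powr (- 1/2)" by simp
    moreover have "?b powr (- 1/2) \<le> ?b powr (- 3/4)" using True t1 by (intro powr_mono') auto
    moreover have "?b powr (- 3/4) \<le> 8 * radial_weight ?b" using True t1 by (intro powr_le_radial_weight_small) auto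
    ultimately show ?thesis using radial_weight_nonneg[of ?a] radial_weight_nonneg[of ?b] unfolding distrib_left by linarith
  next
    case b: False
    show ?thesis
    proof (cases "?a \<le> 8")
      case True
      have p: "?a powr (1/4) * ?a powr (- 1/2) = ?a powr (- (1/4))" "?a powr (-(1/4)) * ?a powr (- 1/2) = ?a powr (- 3/4)"
        by (simp_all flip: powr_add)
      have "schur_kernel 1 t \<le> \<bar>ln ?a\<bar> / (1/4)" unfolding k using b by (intro divide_left_mono) auto
      also have "\<dots> \<le> 16 * (?a powr (1/4) + ?a powr (- (1/4)))" using abs_ln_le_powr[OF t0] by simp
      finally have "schur_kernel 1 t * ?a powr (- 1/2) \<le> 16 * (?a powr (1/4) + ?a powr (- (1/4))) * ?a powr (- 1/2)"
        by (rule mult_right_mono) simp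
      also have "\<dots> = 16 * (?a powr (- (1/4)) + ?a powr (- 3/4))" using p by (simp add: algebra_simps)
      finally have *: "schur_kernel 1 t * ?a powr (- 1/2) \<le> 16 * (?a powr (- (1/4)) + ?a powr (- 3/4))" .
      have "?a powr (1/2) \<le> 8 powr 1"
        using True powr_mono2[of "1/2" ?a 8] powr_mono[of "1/2" 1 "8::real"] by simp
      then have "?a powr (- 3/4) * ?a powr (1/2) \<le> ?a powr (- 3/4) * 8" by (intro mult_left_mono) auto
      then have "?a powr (- (1/4)) \<le> 8 * ?a powr (- 3/4)" by (simp flip: powr_add add: mult.commute)
      moreover have "?a powr (- 3/4) \<le> 8 * radial_weight ?a" using True t0 by (intro powr_le_radial_weight_small) auto
      ultimately show ?thesis using * radial_weight_nonneg[of ?a] radial_weight_nonneg[of ?b] unfolding distrib_left by linarith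
    next
      case a: False
      have "?a \<le> 2 * (?b + 1)" using N_add[of "t - 1" 1] N_commute[of t 1] by simp
      then have bb: "?b \<ge> ?a / 4" using a by simp
      have p: "?a powr (1/4) * ?a powr (- 1/2) / ?a = ?a powr (- 5/4)" "?a powr (-(1/4)) * ?a powr (- 1/2) / ?a = ?a powr (- 7/4)"
        using t0 powr_diff[of ?a "-1/4" 1] powr_diff[of ?a "-3/4" 1] by (simp_all flip: powr_add)
      have "schur_kernel 1 t \<le> \<bar>ln ?a\<bar> / (?a / 4)" unfolding k using bb t0 t1 by (intro divide_left_mono) auto
      also have "\<dots> \<le> 16 * (?a powr (1/4) + ?a powr (- (1/4))) / ?a" using abs_ln_le_powr[OF t0] t0 by (simp add: field_simps)
      finally have "schur_kernel 1 t * ?a powr (- 1/2) \<le> 16 * (?a powr (1/4) + ?a powr (- (1/4))) / ?a * ?a powr (- 1/2)"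
        by (rule mult_right_mono) simp
      also have "\<dots> = 16 * (?a powr (- 5/4) + ?a powr (- 7/4))" using p by (simp add: algebra_simps add_divide_distrib)
      finally have "schur_kernel 1 t * ?a powr (- 1/2) \<le> 16 * (?a powr (- 5/4) + ?a powr (- 7/4))" .
      moreover have "?a powr (- 7/4) \<le> ?a powr (- 5/4)" using a by (intro powr_mono) auto
      moreover have "?a powr (- 5/4) = radial_weight ?a" using a powr_mono[of "- 5/4" "- 3/4" ?a] by (simp add: radial_weight_def)
      ultimately show ?thesis using radial_weight_nonneg[of ?a] radial_weight_nonneg[of ?b] unfolding distrib_left by linarith
    qed
  qed
qed

lemma schur_const_finite: "schur_const < \<infinity>"
proof -
  have "schur_const \<le> (\<integral>\<^sup>+t. ennreal (2000 * (radial_weight (N t) + radial_weight (N (1 - t)))) \<partial>M)"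
    unfolding schur_const_def by (intro nn_integral_mono ennreal_leI schur_kernel_weight_bound)
  also have "\<dots> = 2000 * ((\<integral>\<^sup>+t. ennreal (radial_weight (N t)) \<partial>M) + (\<integral>\<^sup>+t. ennreal (radial_weight (N (1 - t))) \<partial>M))"
    by (simp add: ennreal_mult ennreal_plus radial_weight_nonneg nn_integral_cmult nn_integral_add)
  also have "(\<integral>\<^sup>+t. ennreal (radial_weight (N (1 - t))) \<partial>M) = (\<integral>\<^sup>+t. ennreal (radial_weight (N (- 1 + t))) \<partial>M)"
    by (intro nn_integral_cong) (simp add: N_commute)
  also have "\<dots> = (\<integral>\<^sup>+t. ennreal (radial_weight (N t)) \<partial>M)"
    by (rule nn_integral_translate[of "\<lambda>t. ennreal (radial_weight (N t))" "- 1"]) measurable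
  finally show ?thesis using radial_weight_N by (auto simp: ennreal_mult_less_top ennreal_add_less_top intro: le_less_trans)
qed

text \<open>Substituting \<open>y = x * t\<close> and using homogeneity pulls out a power of |x|:
  the weight \<open>N y powr (- 1 / 2)\<close> is an eigenfunction of the kernel with eigenvalue
  \<open>schur_const\<close>. The exponent -1/2 makes the same weight serve both variables.\<close>

lemma schur_kernel_integral:
  assumes "x \<noteq> 0"
  shows "(\<integral>\<^sup>+y. ennreal (schur_kernel x y * N y powr (- 1 / 2)) \<partial>M) = schur_const * ennreal (N x powr (- 1 / 2))"
proof -
  have "(\<integral>\<^sup>+y. ennreal (schur_kernel x y * N y powr (- 1 / 2)) \<partial>M)
      = ennreal (N x) * (\<integral>\<^sup>+t. ennreal (schur_kernel x (x * t) * N (x * t) powr (- 1 / 2)) \<partial>M)"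
    by (rule nn_integral_scale[OF assms]) measurable
  also have "\<dots> = ennreal (N x) * (\<integral>\<^sup>+t. ennreal (N x powr (- 1 / 2) / N x) * ennreal (schur_kernel 1 t * N t powr (- 1 / 2)) \<partial>M)"
  proof (intro arg_cong[where f="(*) (ennreal (N x))"] nn_integral_cong)
    fix t
    have "x - x * t = x * (1 - t)" by (simp add: algebra_simps)
    then have "schur_kernel x (x * t) * N (x * t) powr (- 1 / 2) = N x powr (- 1 / 2) / N x * (schur_kernel 1 t * N t powr (- 1 / 2))"
      using assms by (cases "t = 0") (auto simp: schur_kernel_def N_mult ln_mult powr_mult)
    then show "ennreal (schur_kernel x (x * t) * N (x * t) powr (- 1 / 2)) = ennreal (N x powr (- 1 / 2) / N x) * ennreal (schur_kernel 1 t * N t powr (- 1 / 2))"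
      by (simp add: ennreal_mult'[symmetric] schur_kernel_nonneg)
  qed
  also have "\<dots> = ennreal (N x) * (ennreal (N x powr (- 1 / 2) / N x) * schur_const)"
    unfolding schur_const_def by (subst nn_integral_cmult) auto
  also have "\<dots> = ennreal (N x powr (- 1 / 2)) * schur_const"
    using assms by (simp add: mult.assoc[symmetric] ennreal_mult'[symmetric])
  finally show ?thesis by (simp add: mult.commute)
qed

end

section \<open>Schur's test and the hermitian integral operator\<close>

locale schur_operator = normed_haar +
  fixes K :: "'a \<Rightarrow> 'a \<Rightarrow> complex" and C :: real
  assumes K_pair: "(\<lambda>(x, y). K x y) \<in> borel_measurable (borel \<Otimes>\<^sub>M borel)"
    and C_nonneg: "0 \<le> C"
    and K_bound: "x \<noteq> 0 \<Longrightarrow> y \<noteq> 0 \<Longrightarrow> cmod (K x y) \<le> C * schur_kernel x y"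
    and K_herm: "K x y = cnj (K y x)"
begin

lemma K_measurable[measurable (raw)]:
  assumes "f \<in> R \<rightarrow>\<^sub>M borel" "g \<in> R \<rightarrow>\<^sub>M borel"
  shows "(\<lambda>w. K (f w) (g w)) \<in> borel_measurable R"
  using measurable_compose[OF measurable_Pair[OF assms] K_pair] by simp

definition T :: "('a \<Rightarrow> complex) \<Rightarrow> 'a \<Rightarrow> complex" where
  "T f x = (\<integral>y. K x y * f y \<partial>M)"

text \<open>The Bochner integral in \<open>T\<close> is 0 by convention where it does not converge.
  \<open>G\<close> majorizes \<open>T\<close> at every point, and where it is finite the integral
  defining \<open>T\<close> converges absolutely.\<close>

definition G :: "('a \<Rightarrow> complex) \<Rightarrow> 'a \<Rightarrow> ennreal" where
  "G f x = (\<integral>\<^sup>+y. ennreal (cmod (K x y * f y)) \<partial>M)"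

definition sq_norm :: "('a \<Rightarrow> complex) \<Rightarrow> ennreal" where
  "sq_norm f = (\<integral>\<^sup>+y. ennreal ((cmod (f y))\<^sup>2) \<partial>M)"

lemma G_measurable[measurable]:
  assumes [measurable]: "f \<in> borel_measurable M"
  shows "G f \<in> borel_measurable M"
  unfolding G_def by measurable

lemma T_measurable[measurable]:
  assumes [measurable]: "f \<in> borel_measurable M"
  shows "T f \<in> borel_measurable M"
  unfolding T_def by measurable

text \<open>With p = |y|^(-1/2) the majorant S(x,y) |f(y)| is the product of the square roots of S p
  and of S |f|^2 / p. By Cauchy-Schwarz and the eigenfunction identity the square of
  \<open>G\<close> at \<open>x\<close> is at most a constant times p(x) times the integral of S
  |f|^2 / p. Integrating over \<open>x\<close>, the identity applies once more by symmetry of S and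
  the weights cancel.\<close>

lemma schur_test:
  assumes f[measurable]: "f \<in> borel_measurable M"
  shows "(\<integral>\<^sup>+x. (G f x)\<^sup>2 \<partial>M) \<le> (ennreal C * schur_const)\<^sup>2 * sq_norm f"
proof -
  let ?p = "\<lambda>y. N y powr (- 1 / 2)"
  let ?F = "\<lambda>y. (cmod (f y))\<^sup>2 * N y powr (1 / 2)"
  have pt: "(G f x)\<^sup>2 \<le> ennreal C ^ 2 * schur_const * (\<integral>\<^sup>+y. ennreal (?p x * schur_kernel x y * ?F y) \<partial>M)" if x: "x \<noteq> 0" for x
  proof -
    have "G f x \<le> (\<integral>\<^sup>+y. ennreal C * (ennreal (sqrt (schur_kernel x y * ?p y)) * ennreal (sqrt (schur_kernel x y * ?F y))) \<partial>M)"
      unfolding G_def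
    proof (intro nn_integral_mono_AE AE_nonzeroI)
      fix y :: 'a assume y: "y \<noteq> 0"
      have pp: "?p y * N y powr (1/2) = 1" using y by (simp flip: powr_add)
      have "sqrt (schur_kernel x y * ?p y) * sqrt (schur_kernel x y * ?F y) = sqrt ((schur_kernel x y * cmod (f y))\<^sup>2 * (?p y * N y powr (1/2)))"
        unfolding real_sqrt_mult[symmetric] power2_eq_square by (rule arg_cong[where f=sqrt]) (simp only: mult_ac)
      also have "\<dots> = schur_kernel x y * cmod (f y)" unfolding pp by (simp add: schur_kernel_nonneg abs_mult)
      finally have "C * (sqrt (schur_kernel x y * ?p y) * sqrt (schur_kernel x y * ?F y)) = C * schur_kernel x y * cmod (f y)" by simp
      also have "\<dots> \<ge> cmod (K x y * f y)"
        unfolding norm_mult by (intro mult_right_mono K_bound x y) auto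
      finally have "ennreal (cmod (K x y * f y)) \<le> ennreal (C * (sqrt (schur_kernel x y * ?p y) * sqrt (schur_kernel x y * ?F y)))"
        by (rule ennreal_leI)
      then show "ennreal (cmod (K x y * f y)) \<le> ennreal C * (ennreal (sqrt (schur_kernel x y * ?p y)) * ennreal (sqrt (schur_kernel x y * ?F y)))"
        using C_nonneg by (simp add: ennreal_mult' schur_kernel_nonneg)
    qed
    also have "\<dots> = ennreal C * (\<integral>\<^sup>+y. ennreal (sqrt (schur_kernel x y * ?p y)) * ennreal (sqrt (schur_kernel x y * ?F y)) \<partial>M)"
      by (subst nn_integral_cmult) auto
    finally have "(G f x)\<^sup>2 \<le> (ennreal C * (\<integral>\<^sup>+y. ennreal (sqrt (schur_kernel x y * ?p y)) * ennreal (sqrt (schur_kernel x y * ?F y)) \<partial>M))\<^sup>2"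
      by (intro power_mono) auto
    also have "\<dots> = (ennreal C)\<^sup>2 * (\<integral>\<^sup>+y. ennreal (sqrt (schur_kernel x y * ?p y)) * ennreal (sqrt (schur_kernel x y * ?F y)) \<partial>M)\<^sup>2"
      by (rule power_mult_distrib)
    also have "\<dots> \<le> (ennreal C)\<^sup>2 * ((\<integral>\<^sup>+y. (ennreal (sqrt (schur_kernel x y * ?p y)))\<^sup>2 \<partial>M) * (\<integral>\<^sup>+y. (ennreal (sqrt (schur_kernel x y * ?F y)))\<^sup>2 \<partial>M))"
      by (intro mult_left_mono Cauchy_Schwarz_nn_integral) auto
    also have "(\<integral>\<^sup>+y. (ennreal (sqrt (schur_kernel x y * ?p y)))\<^sup>2 \<partial>M) = schur_const * ennreal (?p x)"
      by (subst schur_kernel_integral[OF x, symmetric]) (simp add: ennreal_power schur_kernel_nonneg)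
    also have "(\<integral>\<^sup>+y. (ennreal (sqrt (schur_kernel x y * ?F y)))\<^sup>2 \<partial>M) = (\<integral>\<^sup>+y. ennreal (schur_kernel x y * ?F y) \<partial>M)"
      by (simp add: ennreal_power schur_kernel_nonneg)
    also have "(ennreal C)\<^sup>2 * (schur_const * ennreal (?p x) * (\<integral>\<^sup>+y. ennreal (schur_kernel x y * ?F y) \<partial>M))
       = (ennreal C)\<^sup>2 * schur_const * (\<integral>\<^sup>+y. ennreal (?p x) * ennreal (schur_kernel x y * ?F y) \<partial>M)"
      by (subst nn_integral_cmult) (auto simp: mult_ac)
    also have "\<dots> = (ennreal C)\<^sup>2 * schur_const * (\<integral>\<^sup>+y. ennreal (?p x * schur_kernel x y * ?F y) \<partial>M)"
      by (simp add: ennreal_mult'[symmetric] schur_kernel_nonneg mult_ac)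
    finally show ?thesis .
  qed
  have "(\<integral>\<^sup>+x. (G f x)\<^sup>2 \<partial>M) \<le> (\<integral>\<^sup>+x. ennreal C ^ 2 * schur_const * (\<integral>\<^sup>+y. ennreal (?p x * schur_kernel x y * ?F y) \<partial>M) \<partial>M)"
    by (intro nn_integral_mono_AE AE_nonzeroI pt)
  also have "\<dots> = ennreal C ^ 2 * schur_const * (\<integral>\<^sup>+x. \<integral>\<^sup>+y. ennreal (?p x * schur_kernel x y * ?F y) \<partial>M \<partial>M)"
    by (subst nn_integral_cmult) auto
  also have "(\<integral>\<^sup>+x. \<integral>\<^sup>+y. ennreal (?p x * schur_kernel x y * ?F y) \<partial>M \<partial>M) = (\<integral>\<^sup>+y. \<integral>\<^sup>+x. ennreal (?p x * schur_kernel x y * ?F y) \<partial>M \<partial>M)"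
    by (subst MM.Fubini') auto
  also have "\<dots> = (\<integral>\<^sup>+y. schur_const * ennreal ((cmod (f y))\<^sup>2) \<partial>M)"
  proof (intro nn_integral_cong_AE AE_nonzeroI)
    fix y :: 'a assume y: "y \<noteq> 0"
    have "(\<integral>\<^sup>+x. ennreal (?p x * schur_kernel x y * ?F y) \<partial>M) = (\<integral>\<^sup>+x. ennreal (schur_kernel y x * ?p x) * ennreal (?F y) \<partial>M)"
      by (intro nn_integral_cong) (simp add: ennreal_mult'[symmetric] schur_kernel_nonneg schur_kernel_sym[of _ y] mult_ac)
    also have "\<dots> = schur_const * ennreal (?p y) * ennreal (?F y)"
      by (subst nn_integral_multc, measurable, simp only: schur_kernel_integral[OF y])
    also have "\<dots> = schur_const * ennreal ((cmod (f y))\<^sup>2 * (?p y * N y powr (1/2)))"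
      by (simp add: mult.assoc ennreal_mult'[symmetric] mult_ac)
    also have "?p y * N y powr (1/2) = 1" using y by (simp flip: powr_add)
    finally show "(\<integral>\<^sup>+x. ennreal (?p x * schur_kernel x y * ?F y) \<partial>M) = schur_const * ennreal ((cmod (f y))\<^sup>2)" by simp
  qed
  also have "\<dots> = schur_const * sq_norm f" unfolding sq_norm_def by (subst nn_integral_cmult) auto
  finally show ?thesis by (simp add: power2_eq_square mult_ac)
qed

lemma sq_norm_L2: "f \<in> L2 M \<Longrightarrow> sq_norm f = ennreal ((L2_norm M f)\<^sup>2)"
  unfolding L2_def sq_norm_def L2_norm_def by (simp add: nn_integral_eq_integral)

lemma sq_norm_finite_imp_L2: "f \<in> borel_measurable M \<Longrightarrow> sq_norm f < \<infinity> \<Longrightarrow> f \<in> L2 M"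
  unfolding L2_def sq_norm_def by (auto intro!: integrableI_bounded)

lemma norm_T_le_G: "ennreal (cmod (T f x)) \<le> G f x"
  unfolding T_def G_def
  by (cases "integrable M (\<lambda>y. K x y * f y)") (auto intro: integral_norm_bound_ennreal simp: not_integrable_integral_eq)

definition op_bound :: real where "op_bound = C * enn2real schur_const"

lemma op_bound_nonneg: "0 \<le> op_bound" by (simp add: op_bound_def C_nonneg)

lemma ennreal_op_bound: "ennreal op_bound = ennreal C * schur_const"
  unfolding op_bound_def using schur_const_finite C_nonneg by (simp add: ennreal_mult less_top)

lemma G_L2:
  assumes "f \<in> L2 M"
  shows "(\<integral>\<^sup>+x. (G f x)\<^sup>2 \<partial>M) \<le> ennreal ((op_bound * L2_norm M f)\<^sup>2)"
proof -
  have [measurable]: "f \<in> borel_measurable M" using assms by (simp add: L2_def)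
  have "L2_norm M f \<ge> 0" by (simp add: L2_norm_def)
  then show ?thesis
    using schur_test[of f] assms op_bound_nonneg
    by (simp add: sq_norm_L2 ennreal_op_bound[symmetric] ennreal_power ennreal_mult'[symmetric] power_mult_distrib)
qed

lemma T_bounded:
  assumes f: "f \<in> L2 M"
  shows "T f \<in> L2 M" "L2_norm M (T f) \<le> op_bound * L2_norm M f"
proof -
  have [measurable]: "f \<in> borel_measurable M" using f by (simp add: L2_def)
  have "sq_norm (T f) \<le> (\<integral>\<^sup>+x. (G f x)\<^sup>2 \<partial>M)"
    unfolding sq_norm_def by (intro nn_integral_mono) (simp add: ennreal_power[symmetric] power_mono norm_T_le_G)
  also note G_L2[OF f]
  finally have le: "sq_norm (T f) \<le> ennreal ((op_bound * L2_norm M f)\<^sup>2)" .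
  then show *: "T f \<in> L2 M" by (intro sq_norm_finite_imp_L2) (auto intro: le_less_trans)
  have "(L2_norm M (T f))\<^sup>2 \<le> (op_bound * L2_norm M f)\<^sup>2" using le by (simp add: sq_norm_L2[OF *])
  then show "L2_norm M (T f) \<le> op_bound * L2_norm M f"
    by (rule power2_le_imp_le) (simp add: op_bound_nonneg L2_norm_def)
qed

text \<open>\<open>G f\<close> is square integrable, therefore finite almost everywhere.\<close>

lemma T_integrable:
  assumes f: "f \<in> L2 M"
  shows "AE x in M. integrable M (\<lambda>y. K x y * f y)"
proof -
  have [measurable]: "f \<in> borel_measurable M" using f by (simp add: L2_def)
  have "(\<integral>\<^sup>+x. (G f x)\<^sup>2 \<partial>M) \<noteq> \<infinity>" using neq_top_trans[OF ennreal_neq_top G_L2[OF f]] by simp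
  then have "AE x in M. (G f x)\<^sup>2 \<noteq> \<infinity>" by (intro nn_integral_PInf_AE) auto
  then show ?thesis
  proof eventually_elim
    fix x assume "(G f x)\<^sup>2 \<noteq> \<infinity>"
    then have "(G f x)\<^sup>2 < \<infinity>" unfolding infinity_ennreal_def less_top .
    then have "G f x < \<infinity>" by (rule ennreal_square_finite)
    then show "integrable M (\<lambda>y. K x y * f y)" unfolding G_def by (intro integrableI_bounded) auto
  qed
qed

lemma T_add:
  assumes "f \<in> L2 M" "g \<in> L2 M"
  shows "AE x in M. T (\<lambda>y. f y + g y) x = T f x + T g x"
  using T_integrable[OF assms(1)] T_integrable[OF assms(2)]
  by eventually_elim (simp add: T_def distrib_left)

lemma T_cmult: "T (\<lambda>y. c * f y) x = c * T f x"
proof -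
  have "T (\<lambda>y. c * f y) x = (\<integral>y. c * (K x y * f y) \<partial>M)" unfolding T_def by (simp add: mult_ac)
  then show ?thesis by (simp add: T_def)
qed

text \<open>Fubini and the symmetry of the kernel. Absolute convergence of the double integral is
  Cauchy-Schwarz applied to \<open>G f\<close> and the modulus of \<open>g\<close>.\<close>

lemma T_hermitian:
  assumes f: "f \<in> L2 M" and g: "g \<in> L2 M"
  shows "L2_inner M (T f) g = L2_inner M f (T g)"
proof -
  have [measurable]: "f \<in> borel_measurable M" "g \<in> borel_measurable M" using f g by (simp_all add: L2_def)
  have "(\<integral>\<^sup>+x. G f x * ennreal (cmod (g x)) \<partial>M)\<^sup>2 \<le> (\<integral>\<^sup>+x. (G f x)\<^sup>2 \<partial>M) * (\<integral>\<^sup>+x. (ennreal (cmod (g x)))\<^sup>2 \<partial>M)"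
    by (rule Cauchy_Schwarz_nn_integral) auto
  also have "(\<integral>\<^sup>+x. (ennreal (cmod (g x)))\<^sup>2 \<partial>M) = ennreal ((L2_norm M g)\<^sup>2)"
    using sq_norm_L2[OF g] by (simp add: sq_norm_def ennreal_power)
  also have "(\<integral>\<^sup>+x. (G f x)\<^sup>2 \<partial>M) * ennreal ((L2_norm M g)\<^sup>2) < \<infinity>"
    using G_L2[OF f] by (auto simp: ennreal_mult_less_top intro: le_less_trans)
  finally have fin: "(\<integral>\<^sup>+x. G f x * ennreal (cmod (g x)) \<partial>M) < \<infinity>"
    by (rule ennreal_square_finite)
  have [measurable]: "cnj \<in> borel_measurable borel"
    by (intro borel_measurable_continuous_onI continuous_intros)
  have "integrable (M \<Otimes>\<^sub>M M) (\<lambda>(x, y). K x y * f y * cnj (g x))"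
  proof (rule integrableI_bounded)
    show m[measurable]: "(\<lambda>(x, y). K x y * f y * cnj (g x)) \<in> borel_measurable (M \<Otimes>\<^sub>M M)" by measurable
    have "(\<integral>\<^sup>+z. ennreal (cmod (case z of (x, y) \<Rightarrow> K x y * f y * cnj (g x))) \<partial>(M \<Otimes>\<^sub>M M))
      = (\<integral>\<^sup>+x. \<integral>\<^sup>+y. ennreal (cmod (K x y * f y * cnj (g x))) \<partial>M \<partial>M)"
      by (subst nn_integral_fst[symmetric, OF measurable_compose[OF measurable_compose[OF m borel_measurable_norm] measurable_ennreal]]) simp
    also have "\<dots> = (\<integral>\<^sup>+x. G f x * ennreal (cmod (g x)) \<partial>M)"
      unfolding G_def by (subst nn_integral_multc[symmetric]) (auto simp: norm_mult ennreal_mult')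
    finally show "(\<integral>\<^sup>+z. ennreal (cmod (case z of (x, y) \<Rightarrow> K x y * f y * cnj (g x))) \<partial>(M \<Otimes>\<^sub>M M)) < \<infinity>"
      using fin by simp
  qed
  then have "(\<integral>y. \<integral>x. K x y * f y * cnj (g x) \<partial>M \<partial>M) = (\<integral>x. \<integral>y. K x y * f y * cnj (g x) \<partial>M \<partial>M)"
    by (rule MM.Fubini_integral)
  moreover have "(\<integral>y. K x y * f y * cnj (g x) \<partial>M) = T f x * cnj (g x)" for x by (simp add: T_def)
  moreover have "(\<integral>x. K x y * f y * cnj (g x) \<partial>M) = f y * cnj (T g y)" for y
  proof -
    have "(\<integral>x. K x y * f y * cnj (g x) \<partial>M) = (\<integral>x. f y * cnj (K y x * g x) \<partial>M)"
      by (intro Bochner_Integration.integral_cong) (auto simp: K_herm[of _ y] mult_ac)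
    then show ?thesis by (simp add: T_def integral_cnj del: complex_cnj_mult)
  qed
  ultimately show ?thesis by (simp only: L2_inner_def)
qed

lemma T_bounded_operator: "L2_bounded_operator M T"
  unfolding L2_bounded_operator_def using T_bounded T_add T_cmult by blast

lemma T_L2_hermitian: "L2_hermitian M T"
  unfolding L2_hermitian_def using T_hermitian by blast

end

section \<open>The commutator as an integral operator\<close>

text \<open>Isolates what the computation of the commutator uses of a Schwartz-Bruhat function:
  quadratic decay of the function and of its transform, and pointwise Fourier inversion. The two
  kinds of places are thereby treated alike.\<close>

definition fourier_admissible :: "'k::{field_char_0, complete_space} measure \<Rightarrow> ('k \<Rightarrow> complex) \<Rightarrow> bool" where
  "fourier_admissible M \<phi> \<longleftrightarrow> \<phi> \<in> borel_measurable M \<and>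
     (\<exists>B. \<forall>y. cmod (\<phi> y) \<le> B \<and> (normalized_abs y)\<^sup>2 * cmod (\<phi> y) \<le> B) \<and>
     (\<exists>B. \<forall>y. cmod (fourier M \<phi> y) \<le> B \<and> (normalized_abs y)\<^sup>2 * cmod (fourier M \<phi> y) \<le> B) \<and>
     inv_fourier M (fourier M \<phi>) = \<phi>"

text \<open>
  \<open>D t\<close> is the Fourier transform of \<open>g t\<close>, and \<open>c t - g t\<close> integrates over the parameter \<open>t\<close>
  to the logarithm of the absolute value: dilating a nonnegative positive definite function over all
  scales turns \<open>F\<^sup>-\<^sup>1 log F\<close> into an absolutely convergent superposition of convolutions.
\<close>

locale log_decomposition = normed_haar M normalized_abs V + pm: sigma_finite_measure \<kappa>
  for M :: "'k::{field_char_0, complete_space} measure" and V :: real and \<kappa> :: "'t measure" +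
  fixes c :: "'t \<Rightarrow> real" and g D :: "'t \<Rightarrow> 'k \<Rightarrow> real" and C :: real
  assumes char_measurable[measurable]: "(place_char :: 'k \<Rightarrow> complex) \<in> borel_measurable borel"
    and char_norm[simp]: "cmod (place_char (x :: 'k)) = 1"
    and char_add: "place_char (x + y :: 'k) = place_char x * place_char y"
    and c_measurable[measurable]: "c \<in> borel_measurable \<kappa>"
    and g_pair: "(\<lambda>(t, x). g t x) \<in> borel_measurable (\<kappa> \<Otimes>\<^sub>M borel)"
    and D_pair: "(\<lambda>(t, x). D t x) \<in> borel_measurable (\<kappa> \<Otimes>\<^sub>M borel)"
    and g_integrable: "integrable M (g t)"
    and g_abs: "x \<noteq> 0 \<Longrightarrow> (\<integral>\<^sup>+t. ennreal \<bar>c t - g t x\<bar> \<partial>\<kappa>) \<le> ennreal \<bar>ln (normalized_abs x)\<bar>"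
    and g_ln: "x \<noteq> 0 \<Longrightarrow> (\<integral>t. c t - g t x \<partial>\<kappa>) = ln (normalized_abs x)"
    and D_nonneg: "0 \<le> D t x"
    and D_even: "D t (- x) = D t x"
    and D_fourier: "(\<integral>y. complex_of_real (g t y) * place_char (y * x) \<partial>M) = complex_of_real (D t x)"
    and C_nonneg: "0 \<le> C"
    and D_bound: "x \<noteq> 0 \<Longrightarrow> (\<integral>\<^sup>+t. ennreal (D t x) \<partial>\<kappa>) \<le> ennreal (C / normalized_abs x)"
begin

abbreviation N :: "'k \<Rightarrow> real" where "N \<equiv> normalized_abs"

sublocale MK: pair_sigma_finite M \<kappa> ..

lemma g_measurable[measurable (raw)]:
  assumes "f \<in> R \<rightarrow>\<^sub>M \<kappa>" "h \<in> R \<rightarrow>\<^sub>M borel"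
  shows "(\<lambda>w. g (f w) (h w)) \<in> borel_measurable R"
  using measurable_compose[OF measurable_Pair[OF assms] g_pair] by simp

lemma D_measurable[measurable (raw)]:
  assumes "f \<in> R \<rightarrow>\<^sub>M \<kappa>" "h \<in> R \<rightarrow>\<^sub>M borel"
  shows "(\<lambda>w. D (f w) (h w)) \<in> borel_measurable R"
  using measurable_compose[OF measurable_Pair[OF assms] D_pair] by simp

text \<open>On functions vanishing at the point of evaluation, the logarithmic multiplier is minus
  convolution with \<open>k\<close>. Its exact shape is never computed; positivity, evenness and the
  bound \<open>C / N x\<close> are enough.\<close>

definition k :: "'k \<Rightarrow> real" where
  "k x = (\<integral>t. D t x \<partial>\<kappa>)"

lemma k_measurable[measurable]: "k \<in> borel_measurable borel"
  unfolding k_def by measurable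

lemma D_t_integrable: "x \<noteq> 0 \<Longrightarrow> integrable \<kappa> (\<lambda>t. D t x)"
  using D_bound[of x] D_nonneg by (intro integrableI_bounded) (auto intro: le_less_trans)

lemma k_nonneg: "0 \<le> k x" by (simp add: k_def D_nonneg)

lemma k_even: "k (- x) = k x" by (simp add: k_def D_even)

lemma k_bound: "x \<noteq> 0 \<Longrightarrow> k x \<le> C / N x"
  using D_bound[of x] D_t_integrable[of x] C_nonneg
  by (simp add: k_def nn_integral_eq_integral D_nonneg)

definition K :: "'k \<Rightarrow> 'k \<Rightarrow> complex" where
  "K x y = - \<i> * of_real ((ln (N y) - ln (N x)) * k (x - y))"

sublocale schur_operator M N V K C
proof
  show "(\<lambda>(x, y). K x y) \<in> borel_measurable (borel \<Otimes>\<^sub>M borel)"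
    unfolding K_def by measurable
  show "0 \<le> C" by (rule C_nonneg)
  show "K x y = cnj (K y x)" for x y
    using k_even[of "x - y"] by (simp add: K_def algebra_simps)
  show "cmod (K x y) \<le> C * schur_kernel x y" if "x \<noteq> 0" "y \<noteq> 0" for x y
  proof (cases "x = y")
    case False
    then have "\<bar>ln (N y) - ln (N x)\<bar> * k (x - y) \<le> \<bar>ln (N y) - ln (N x)\<bar> * (C / N (x - y))"
      by (intro mult_left_mono k_bound) auto
    then show ?thesis by (simp add: K_def norm_mult schur_kernel_def k_nonneg abs_mult abs_minus_commute mult.commute del: of_real_mult of_real_diff)
  qed (simp add: K_def schur_kernel_def)
qed

text \<open>Pointwise quadratic decay compares \<open>f\<close>, also after multiplication by the
  logarithm, with the integrable weight.\<close>

lemma admissible_bounds: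
  assumes f[measurable]: "f \<in> borel_measurable M" and B: "\<And>y. cmod (f y) \<le> B" "\<And>y. (N y)\<^sup>2 * cmod (f y) \<le> B"
  shows "integrable M f" "integrable M (\<lambda>y. of_real (ln (N y)) * f y)" "f \<in> L2 M"
    "cmod (f y) * N y powr (1/2) \<le> B"
proof -
  have b0: "0 \<le> B" using B(1)[of 0] norm_ge_zero order_trans by blast
  have i: "integrable M (\<lambda>y. B * radial_weight (N y))" "integrable M (\<lambda>y. 8 * B * radial_weight (N y))"
    "integrable M (\<lambda>y. B * (B * radial_weight (N y)))"
    using integrable_radial_weight by simp_all
  have w: "cmod (f y) \<le> B * radial_weight (N y)" "\<bar>ln (N y)\<bar> * cmod (f y) \<le> 8 * B * radial_weight (N y)" if "y \<noteq> 0" for y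
    using weight_bound_small[of "N y" "cmod (f y)" B] B that by auto
  show fi: "integrable M f"
    by (rule Bochner_Integration.integrable_bound[OF i(1)]) (use w b0 in \<open>auto intro!: AE_nonzeroI simp: radial_weight_nonneg\<close>)
  show "integrable M (\<lambda>y. of_real (ln (N y)) * f y)"
    by (rule Bochner_Integration.integrable_bound[OF i(2)]) (use w b0 in \<open>auto intro!: AE_nonzeroI simp: radial_weight_nonneg norm_mult\<close>)
  have "integrable M (\<lambda>y. (cmod (f y))\<^sup>2)"
  proof (rule Bochner_Integration.integrable_bound[OF i(3)])
    show "AE y in M. norm ((cmod (f y))\<^sup>2) \<le> norm (B * (B * radial_weight (N y)))"
      using AE_nonzero
    proof eventually_elim
      case (elim y)
      have "cmod (f y) * cmod (f y) \<le> B * (B * radial_weight (N y))" using B(1) w(1)[OF elim] b0 by (intro mult_mono) auto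
      then show ?case using b0 by (simp add: power2_eq_square radial_weight_nonneg abs_mult)
    qed
  qed measurable
  then show "f \<in> L2 M" by (simp add: L2_def)
  show "cmod (f y) * N y powr (1/2) \<le> B"
    using weight_bound_small(3)[of "N y" "cmod (f y)" B] B b0 by (cases "y = 0") auto
qed

lemma fourier_measurable[measurable]:
  assumes [measurable]: "f \<in> borel_measurable M"
  shows "fourier M f \<in> borel_measurable M"
  unfolding fourier_def by measurable

lemma char_0[simp]: "place_char (0::'k) = 1"
proof -
  have "place_char (0::'k) * place_char (0::'k) = place_char (0::'k) * 1" using char_add[of 0 0] by simp
  moreover have "place_char (0::'k) \<noteq> 0" using char_norm[of 0] by (metis norm_zero zero_neq_one)
  ultimately show ?thesis by (simp only: mult_cancel_left) blast
qed

text \<open>For fixed \<open>x\<close> the scalar log|x| may be moved inside, so the commutator at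
  \<open>x\<close> is \<open>\<i>\<close> times the logarithmic multiplier applied to
  \<open>\<psi>\<close>, a function that vanishes at \<open>x\<close>. Because of that zero the
  divergent constants of the superposition disappear and each \<open>g t\<close> acts as convolution
  with \<open>D t\<close>. Two exchanges of integrals produce the kernel \<open>k\<close>.\<close>

lemma commutator_formula:
  assumes adm: "fourier_admissible M \<phi>" "fourier_admissible M (log_mult \<phi>)" and x: "x \<noteq> 0"
  shows "conductor_commutator M \<phi> x = T \<phi> x"
proof -
  let ?\<phi>1 = "log_mult \<phi>"
  have [measurable]: "\<phi> \<in> borel_measurable M" "?\<phi>1 \<in> borel_measurable M"
    using adm by (auto simp: fourier_admissible_def)
  obtain B0 where B0: "\<And>y. cmod (\<phi> y) \<le> B0" "\<And>y. (N y)\<^sup>2 * cmod (\<phi> y) \<le> B0"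
    using adm(1) by (auto simp: fourier_admissible_def)
  obtain B1 where B1: "\<And>y. cmod (?\<phi>1 y) \<le> B1" "\<And>y. (N y)\<^sup>2 * cmod (?\<phi>1 y) \<le> B1"
    using adm(2) by (auto simp: fourier_admissible_def)
  obtain B2 where B2: "\<And>y. cmod (fourier M \<phi> y) \<le> B2" "\<And>y. (N y)\<^sup>2 * cmod (fourier M \<phi> y) \<le> B2"
    using adm(1) by (auto simp: fourier_admissible_def)
  obtain B3 where B3: "\<And>y. cmod (fourier M ?\<phi>1 y) \<le> B3" "\<And>y. (N y)\<^sup>2 * cmod (fourier M ?\<phi>1 y) \<le> B3"
    using adm(2) by (auto simp: fourier_admissible_def)
  note bd = admissible_bounds[OF _ B0] admissible_bounds[OF _ B1] admissible_bounds[OF _ B2] admissible_bounds[OF _ B3]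
  have i\<phi>: "integrable M \<phi>" "integrable M ?\<phi>1" by (auto intro!: bd)
  have iF: "integrable M (fourier M \<phi>)" "integrable M (fourier M ?\<phi>1)"
    "integrable M (\<lambda>y. of_real (ln (N y)) * fourier M \<phi> y)" "integrable M (\<lambda>y. of_real (ln (N y)) * fourier M ?\<phi>1 y)"
    by (auto intro!: bd)
  have ichar: "integrable M (\<lambda>y. f y * place_char (a * y))" if "integrable M f" for f :: "'k \<Rightarrow> complex" and a
    using that by (rule Bochner_Integration.integrable_bound) (use that in \<open>auto simp: norm_mult\<close>)
  define \<psi> where "\<psi> y = of_real (ln (N y) - ln (N x)) * \<phi> y" for y
  define \<Phi> where "\<Phi> y = fourier M ?\<phi>1 y - of_real (ln (N x)) * fourier M \<phi> y" for y
  have [measurable]: "\<psi> \<in> borel_measurable M" "\<Phi> \<in> borel_measurable M" unfolding \<psi>_def \<Phi>_def by measurable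
  have \<psi>_eq: "\<psi> y = ?\<phi>1 y - of_real (ln (N x)) * \<phi> y" for y by (simp add: \<psi>_def log_mult_def algebra_simps)
  have i\<psi>: "integrable M \<psi>" unfolding \<psi>_eq[abs_def] using i\<phi> by auto
  have i\<Phi>: "integrable M \<Phi>" unfolding \<Phi>_def[abs_def] using iF by auto
  have iln\<Phi>: "integrable M (\<lambda>\<xi>. of_real (ln (N \<xi>)) * \<Phi> \<xi>)"
    unfolding \<Phi>_def[abs_def] right_diff_distrib mult.left_commute[of _ "of_real (ln (N x))"] using iF by auto
  have \<Phi>_fourier: "\<Phi> \<xi> = (\<integral>y. \<psi> y * place_char (- (\<xi> * y)) \<partial>M)" for \<xi>
  proof -
    have "(\<integral>y. \<psi> y * place_char (- (\<xi> * y)) \<partial>M) = (\<integral>y. ?\<phi>1 y * place_char (- \<xi> * y) - of_real (ln (N x)) * (\<phi> y * place_char (- \<xi> * y)) \<partial>M)"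
      by (simp add: \<psi>_eq algebra_simps)
    also have "\<dots> = (\<integral>y. ?\<phi>1 y * place_char (- \<xi> * y) \<partial>M) - (\<integral>y. of_real (ln (N x)) * (\<phi> y * place_char (- \<xi> * y)) \<partial>M)"
      by (intro Bochner_Integration.integral_diff ichar i\<phi> integrable_mult_right)
    finally show ?thesis by (simp add: \<Phi>_def fourier_def)
  qed
  \<comment> \<open>Fourier inversion for \<open>\<phi>\<close> and for
    \<open>log_mult \<phi>\<close> at \<open>x\<close>: the two values cancel because
    \<open>\<psi>\<close> vanishes there.\<close>
  have inv0: "(\<integral>\<xi>. \<Phi> \<xi> * place_char (x * \<xi>) \<partial>M) = 0"
  proof -
    have "(\<integral>\<xi>. \<Phi> \<xi> * place_char (x * \<xi>) \<partial>M) = (\<integral>\<xi>. fourier M ?\<phi>1 \<xi> * place_char (x * \<xi>) - of_real (ln (N x)) * (fourier M \<phi> \<xi> * place_char (x * \<xi>)) \<partial>M)"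
      by (simp add: \<Phi>_def algebra_simps)
    also have "\<dots> = (\<integral>\<xi>. fourier M ?\<phi>1 \<xi> * place_char (x * \<xi>) \<partial>M) - (\<integral>\<xi>. of_real (ln (N x)) * (fourier M \<phi> \<xi> * place_char (x * \<xi>)) \<partial>M)"
      by (intro Bochner_Integration.integral_diff ichar iF integrable_mult_right)
    also have "\<dots> = inv_fourier M (fourier M ?\<phi>1) x - of_real (ln (N x)) * inv_fourier M (fourier M \<phi>) x"
      by (simp add: inv_fourier_def)
    also have "\<dots> = 0" using adm by (simp add: fourier_admissible_def log_mult_def)
    finally show ?thesis .
  qed
  have comm: "conductor_commutator M \<phi> x = \<i> * (\<integral>\<xi>. of_real (ln (N \<xi>)) * \<Phi> \<xi> * place_char (x * \<xi>) \<partial>M)"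
  proof -
    have "(\<integral>\<xi>. of_real (ln (N \<xi>)) * \<Phi> \<xi> * place_char (x * \<xi>) \<partial>M)
      = (\<integral>\<xi>. of_real (ln (N \<xi>)) * fourier M ?\<phi>1 \<xi> * place_char (x * \<xi>) - of_real (ln (N x)) * (of_real (ln (N \<xi>)) * fourier M \<phi> \<xi> * place_char (x * \<xi>)) \<partial>M)"
      by (simp add: \<Phi>_def algebra_simps)
    also have "\<dots> = (\<integral>\<xi>. of_real (ln (N \<xi>)) * fourier M ?\<phi>1 \<xi> * place_char (x * \<xi>) \<partial>M) - (\<integral>\<xi>. of_real (ln (N x)) * (of_real (ln (N \<xi>)) * fourier M \<phi> \<xi> * place_char (x * \<xi>)) \<partial>M)"
      by (intro Bochner_Integration.integral_diff ichar iF integrable_mult_right)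
    finally show ?thesis by (simp add: conductor_commutator_def log_mult_dual_def inv_fourier_def log_mult_def[abs_def])
  qed
  let ?e = "\<lambda>\<xi>. \<Phi> \<xi> * place_char (x * \<xi>)"
  have ie: "integrable M ?e" by (rule ichar[OF i\<Phi>])
  \<comment> \<open>The logarithm is replaced by its superposition for nonzero \<open>\<xi>\<close>;
    the point 0 is null.\<close>
  have "(\<integral>\<xi>. of_real (ln (N \<xi>)) * \<Phi> \<xi> * place_char (x * \<xi>) \<partial>M) = (\<integral>\<xi>. \<integral>t. of_real (c t - g t \<xi>) * ?e \<xi> \<partial>\<kappa> \<partial>M)"
  proof (rule integral_cong_AE)
    show "AE \<xi> in M. of_real (ln (N \<xi>)) * \<Phi> \<xi> * place_char (x * \<xi>) = (\<integral>t. of_real (c t - g t \<xi>) * ?e \<xi> \<partial>\<kappa>)"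
      using AE_nonzero
    proof eventually_elim
      case (elim \<xi>)
      have "(\<integral>t. complex_of_real (c t - g t \<xi>) * ?e \<xi> \<partial>\<kappa>) = (\<integral>t. complex_of_real (c t - g t \<xi>) \<partial>\<kappa>) * ?e \<xi>"
        by simp
      also have "(\<integral>t. complex_of_real (c t - g t \<xi>) \<partial>\<kappa>) = of_real (ln (N \<xi>))"
        unfolding g_ln[OF elim, symmetric] by (rule integral_complex_of_real)
      finally show ?case by (simp only: mult.assoc)
    qed
  qed measurable
  \<comment> \<open>Fubini applies since by \<open>g_abs\<close> the superposition of absolute
    values is at most |log|\<open>\<xi>\<close>||, and the logarithm times \<open>\<Phi>\<close> is
    integrable.\<close>
  also have "\<dots> = (\<integral>t. \<integral>\<xi>. of_real (c t - g t \<xi>) * ?e \<xi> \<partial>M \<partial>\<kappa>)"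
  proof (rule MK.Fubini_integral[symmetric], rule MK.Fubini_integrable)
    show m[measurable]: "(\<lambda>(\<xi>, t). of_real (c t - g t \<xi>) * ?e \<xi>) \<in> borel_measurable (M \<Otimes>\<^sub>M \<kappa>)" by measurable
    have gi: "integrable \<kappa> (\<lambda>t. c t - g t \<xi>)" and gn: "(\<integral>t. \<bar>c t - g t \<xi>\<bar> \<partial>\<kappa>) \<le> \<bar>ln (N \<xi>)\<bar>" if "\<xi> \<noteq> 0" for \<xi>
    proof -
      show gi: "integrable \<kappa> (\<lambda>t. c t - g t \<xi>)"
        using g_abs[OF that] by (intro integrableI_bounded) (auto intro: le_less_trans)
      then show "(\<integral>t. \<bar>c t - g t \<xi>\<bar> \<partial>\<kappa>) \<le> \<bar>ln (N \<xi>)\<bar>"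
        using g_abs[OF that] by (simp add: nn_integral_eq_integral)
    qed
    show "AE \<xi> in M. integrable \<kappa> (\<lambda>t. case (\<xi>, t) of (\<xi>, t) \<Rightarrow> of_real (c t - g t \<xi>) * ?e \<xi>)"
      using AE_nonzero
    proof eventually_elim
      case (elim \<xi>)
      have "integrable \<kappa> (\<lambda>t. complex_of_real (c t - g t \<xi>))" by (rule integrable_of_real[OF gi[OF elim]])
      then show ?case by simp
    qed
    show "integrable M (\<lambda>\<xi>. \<integral>t. norm (case (\<xi>, t) of (\<xi>, t) \<Rightarrow> of_real (c t - g t \<xi>) * ?e \<xi>) \<partial>\<kappa>)"
    proof (rule Bochner_Integration.integrable_bound[OF iln\<Phi>])
      show "AE \<xi> in M. norm (\<integral>t. norm (case (\<xi>, t) of (\<xi>, t) \<Rightarrow> of_real (c t - g t \<xi>) * ?e \<xi>) \<partial>\<kappa>) \<le> norm (of_real (ln (N \<xi>)) * \<Phi> \<xi>)"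
        using AE_nonzero
      proof eventually_elim
        case (elim \<xi>)
        have "(\<integral>t. norm (complex_of_real (c t - g t \<xi>) * ?e \<xi>) \<partial>\<kappa>) = (\<integral>t. \<bar>c t - g t \<xi>\<bar> * cmod (\<Phi> \<xi>) \<partial>\<kappa>)"
          by (simp add: norm_mult del: of_real_diff)
        also have "\<dots> \<le> \<bar>ln (N \<xi>)\<bar> * cmod (\<Phi> \<xi>)" using gn[OF elim] by (simp add: mult_right_mono)
        finally show ?case by (simp add: norm_mult)
      qed
    qed measurable
  qed
  also have "\<dots> = (\<integral>t. - (\<integral>y. \<psi> y * of_real (D t (x - y)) \<partial>M) \<partial>\<kappa>)"
  proof (rule Bochner_Integration.integral_cong[OF refl])
    fix t
    have gb: "integrable M (\<lambda>\<xi>. of_real (g t \<xi>) * ?e \<xi>)"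
    proof -
      obtain Bp where Bp: "\<And>\<xi>. cmod (\<Phi> \<xi>) \<le> Bp"
      proof
        show "cmod (\<Phi> \<xi>) \<le> B3 + \<bar>ln (N x)\<bar> * B2" for \<xi>
          unfolding \<Phi>_def using norm_triangle_ineq4[of "fourier M ?\<phi>1 \<xi>" "of_real (ln (N x)) * fourier M \<phi> \<xi>"]
            B3(1)[of \<xi>] mult_left_mono[OF B2(1)[of \<xi>], of "\<bar>ln (N x)\<bar>"] by (simp add: norm_mult)
      qed
      have "integrable M (\<lambda>\<xi>. Bp * g t \<xi>)" using g_integrable by simp
      then show ?thesis
      proof (rule Bochner_Integration.integrable_bound)
        have "Bp \<ge> 0" using Bp[of 0] norm_ge_zero order_trans by blast
        then show "AE \<xi> in M. norm (of_real (g t \<xi>) * ?e \<xi>) \<le> norm (Bp * g t \<xi>)"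
          using Bp by (auto simp: norm_mult abs_mult mult.commute[of Bp] intro!: mult_left_mono)
        show "(\<lambda>\<xi>. of_real (g t \<xi>) * ?e \<xi>) \<in> borel_measurable M"
          using borel_measurable_integrable[OF g_integrable[of t]] by measurable
      qed
    qed
    have gm[measurable]: "g t \<in> borel_measurable borel"
      using borel_measurable_integrable[OF g_integrable[of t]] measurable_cong_sets[OF sets_M refl] by blast
    have "(\<integral>\<xi>. of_real (c t - g t \<xi>) * ?e \<xi> \<partial>M) = (\<integral>\<xi>. of_real (c t) * ?e \<xi> - of_real (g t \<xi>) * ?e \<xi> \<partial>M)"
      by (simp add: algebra_simps)
    also have "\<dots> = (\<integral>\<xi>. of_real (c t) * ?e \<xi> \<partial>M) - (\<integral>\<xi>. of_real (g t \<xi>) * ?e \<xi> \<partial>M)"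
      by (intro Bochner_Integration.integral_diff integrable_mult_right ie gb)
    \<comment> \<open>The constant contributes \<open>c t\<close> times the value of
      \<open>\<psi>\<close> at \<open>x\<close>, that is 0.\<close>
    also have "(\<integral>\<xi>. of_real (c t) * ?e \<xi> \<partial>M) = 0" using inv0 by simp
    also have "(\<integral>\<xi>. of_real (g t \<xi>) * ?e \<xi> \<partial>M) = (\<integral>\<xi>. \<integral>y. of_real (g t \<xi>) * place_char (x * \<xi>) * (\<psi> y * place_char (- (\<xi> * y))) \<partial>M \<partial>M)"
      unfolding integral_mult_right_zero \<Phi>_fourier by (simp only: mult_ac)
    also have "\<dots> = (\<integral>y. \<integral>\<xi>. of_real (g t \<xi>) * place_char (x * \<xi>) * (\<psi> y * place_char (- (\<xi> * y))) \<partial>M \<partial>M)"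
    proof (rule MM.Fubini_integral[symmetric], rule MM.Fubini_integrable)
      show "(\<lambda>(\<xi>, y). of_real (g t \<xi>) * place_char (x * \<xi>) * (\<psi> y * place_char (- (\<xi> * y)))) \<in> borel_measurable (M \<Otimes>\<^sub>M M)"
        by measurable
      have "integrable M (\<lambda>\<xi>. \<bar>g t \<xi>\<bar> * (\<integral>y. cmod (\<psi> y) \<partial>M))" using g_integrable by auto
      then show "integrable M (\<lambda>\<xi>. \<integral>y. norm (case (\<xi>, y) of (\<xi>, y) \<Rightarrow> of_real (g t \<xi>) * place_char (x * \<xi>) * (\<psi> y * place_char (- (\<xi> * y)))) \<partial>M)"
        by (simp add: norm_mult)
      have "integrable M (\<lambda>y. of_real (g t \<xi>) * place_char (x * \<xi>) * (\<psi> y * place_char (- \<xi> * y)))" for \<xi>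
        by (intro integrable_mult_right ichar i\<psi>)
      then show "AE \<xi> in M. integrable M (\<lambda>y. case (\<xi>, y) of (\<xi>, y) \<Rightarrow> of_real (g t \<xi>) * place_char (x * \<xi>) * (\<psi> y * place_char (- (\<xi> * y))))"
        by simp
    qed
    also have "\<dots> = (\<integral>y. \<psi> y * of_real (D t (x - y)) \<partial>M)"
    proof (rule Bochner_Integration.integral_cong[OF refl])
      fix y
      have "(\<integral>\<xi>. of_real (g t \<xi>) * place_char (x * \<xi>) * (\<psi> y * place_char (- (\<xi> * y))) \<partial>M) = (\<integral>\<xi>. \<psi> y * (of_real (g t \<xi>) * place_char (\<xi> * (x - y))) \<partial>M)"
      proof (rule Bochner_Integration.integral_cong[OF refl])
        fix \<xi>
        have "place_char (\<xi> * (x - y)) = place_char (x * \<xi>) * place_char (- (\<xi> * y))"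
          unfolding char_add[symmetric] by (simp add: algebra_simps)
        then show "of_real (g t \<xi>) * place_char (x * \<xi>) * (\<psi> y * place_char (- (\<xi> * y))) = \<psi> y * (of_real (g t \<xi>) * place_char (\<xi> * (x - y)))"
          by (simp add: mult_ac)
      qed
      then show "(\<integral>\<xi>. of_real (g t \<xi>) * place_char (x * \<xi>) * (\<psi> y * place_char (- (\<xi> * y))) \<partial>M) = \<psi> y * of_real (D t (x - y))"
        by (simp add: D_fourier)
    qed
    finally show "(\<integral>\<xi>. of_real (c t - g t \<xi>) * ?e \<xi> \<partial>M) = - (\<integral>y. \<psi> y * of_real (D t (x - y)) \<partial>M)" by simp
  qed
  also have "\<dots> = - (\<integral>t. \<integral>y. \<psi> y * of_real (D t (x - y)) \<partial>M \<partial>\<kappa>)" by simp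
  also have "(\<integral>t. \<integral>y. \<psi> y * of_real (D t (x - y)) \<partial>M \<partial>\<kappa>) = (\<integral>y. \<integral>t. \<psi> y * of_real (D t (x - y)) \<partial>\<kappa> \<partial>M)"
  proof (rule MK.Fubini_integral, rule MK.Fubini_integrable)
    show "(\<lambda>(y, t). \<psi> y * of_real (D t (x - y))) \<in> borel_measurable (M \<Otimes>\<^sub>M \<kappa>)" by measurable
    have nz: "AE y in M. x - y \<noteq> 0"
    proof -
      have [measurable]: "{x} \<in> sets M" "{0::'k} \<in> sets borel" by (simp_all add: sets_M)
      have "emeasure M {x} = (\<integral>\<^sup>+y. indicator {x} y \<partial>M)" by simp
      also have "\<dots> = (\<integral>\<^sup>+y. indicator {0} (- x + y) \<partial>M)"
        by (intro nn_integral_cong) (auto simp: indicator_def)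
      also have "\<dots> = 0" using nn_integral_translate[of "indicator {0}" "- x"] by (simp add: null_0 sets_M)
      finally show ?thesis by (intro AE_I[where N="{x}"]) auto
    qed
    show "AE y in M. integrable \<kappa> (\<lambda>t. case (y, t) of (y, t) \<Rightarrow> \<psi> y * of_real (D t (x - y)))"
      using nz by eventually_elim (auto intro!: integrable_mult_right integrable_of_real D_t_integrable)
    have eq: "(\<integral>t. norm (\<psi> y * of_real (D t (x - y))) \<partial>\<kappa>) = cmod (\<psi> y) * k (x - y)" for y
      by (simp add: norm_mult D_nonneg k_def)
    \<comment> \<open>The zero of log|y| - log|x| compensates the singularity of \<open>k\<close>:
      the integrand is the modulus of \<open>K x y * \<phi> y\<close>. Since \<open>\<phi>\<close>
      is at most \<open>B0\<close> times the Schur weight, the eigenfunction identity bounds the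
      integral.\<close>
    have "integrable M (\<lambda>y. cmod (\<psi> y) * k (x - y))"
    proof (rule integrableI_bounded)
      have "(\<integral>\<^sup>+y. ennreal (norm (cmod (\<psi> y) * k (x - y))) \<partial>M) \<le> (\<integral>\<^sup>+y. ennreal (C * B0) * ennreal (schur_kernel x y * N y powr (- 1 / 2)) \<partial>M)"
      proof (intro nn_integral_mono_AE AE_nonzeroI)
        fix y :: 'k assume y: "y \<noteq> 0"
        have "cmod (\<psi> y) * k (x - y) = cmod (K x y) * cmod (\<phi> y)"
          by (simp add: \<psi>_def K_def norm_mult abs_mult k_nonneg mult_ac del: of_real_mult of_real_diff)
        also have "\<dots> \<le> C * schur_kernel x y * cmod (\<phi> y)" by (intro mult_right_mono K_bound x y) auto
        also have "\<dots> \<le> C * schur_kernel x y * (B0 * N y powr (- 1/2))"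
        proof (intro mult_left_mono)
          have "cmod (\<phi> y) = cmod (\<phi> y) * N y powr (1/2) * N y powr (- 1/2)" using y by (simp add: mult.assoc flip: powr_add)
          also have "\<dots> \<le> B0 * N y powr (- 1/2)" by (intro mult_right_mono bd) auto
          finally show "cmod (\<phi> y) \<le> B0 * N y powr (- 1/2)" .
        qed (simp add: C_nonneg schur_kernel_nonneg)
        finally have le: "cmod (\<psi> y) * k (x - y) \<le> C * B0 * (schur_kernel x y * N y powr (- 1/2))" by (simp add: mult_ac)
        show "ennreal (norm (cmod (\<psi> y) * k (x - y))) \<le> ennreal (C * B0) * ennreal (schur_kernel x y * N y powr (- 1 / 2))"
          using le C_nonneg order_trans[OF norm_ge_zero B0(1)[of 0]] by (subst ennreal_mult'[symmetric]) (auto simp: schur_kernel_nonneg k_nonneg abs_mult intro!: ennreal_leI)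
      qed
      also have "\<dots> = ennreal (C * B0) * (schur_const * ennreal (N x powr (- 1/2)))"
        by (subst nn_integral_cmult, measurable, simp only: schur_kernel_integral[OF x])
      also have "\<dots> < \<infinity>" using schur_const_finite by (auto simp: ennreal_mult_less_top)
      finally show "(\<integral>\<^sup>+y. ennreal (norm (cmod (\<psi> y) * k (x - y))) \<partial>M) < \<infinity>" .
    qed measurable
    then show "integrable M (\<lambda>y. \<integral>t. norm (case (y, t) of (y, t) \<Rightarrow> \<psi> y * of_real (D t (x - y))) \<partial>\<kappa>)"
      by (simp add: eq)
  qed
  also have "(\<integral>y. \<integral>t. \<psi> y * of_real (D t (x - y)) \<partial>\<kappa> \<partial>M) = (\<integral>y. \<psi> y * of_real (k (x - y)) \<partial>M)"
    unfolding k_def by (simp flip: integral_complex_of_real)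
  finally have "conductor_commutator M \<phi> x = \<i> * - (\<integral>y. \<psi> y * of_real (k (x - y)) \<partial>M)"
    unfolding comm by simp
  also have "\<dots> = (\<integral>y. (- \<i>) * (\<psi> y * of_real (k (x - y))) \<partial>M)" by simp
  also have "\<dots> = T \<phi> x"
    unfolding T_def by (intro Bochner_Integration.integral_cong) (simp_all add: \<psi>_def K_def mult_ac)
  finally show ?thesis .
qed

text \<open>The integral operator \<open>T\<close> is the extension: it is bounded and hermitian on
  all of L2, and it agrees with the commutator on \<open>S\<close> except possibly at 0, a null
  set.\<close>

theorem commutator_bounded:
  assumes adm: "\<And>\<phi>. \<phi> \<in> S \<Longrightarrow> fourier_admissible M \<phi> \<and> fourier_admissible M (log_mult \<phi>)"
  shows "(\<exists>C. \<forall>\<phi>\<in>S. conductor_commutator M \<phi> \<in> L2 M \<and>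
            L2_norm M (conductor_commutator M \<phi>) \<le> C * L2_norm M \<phi>) \<and>
         (\<exists>T. L2_bounded_operator M T \<and> L2_hermitian M T \<and>
            (\<forall>\<phi>\<in>S. AE x in M. T \<phi> x = conductor_commutator M \<phi> x))"
proof -
  have eq: "conductor_commutator M \<phi> x = T \<phi> x" if "\<phi> \<in> S" "x \<noteq> 0" for \<phi> x
    using commutator_formula adm that by blast
  have L2: "\<phi> \<in> L2 M" if "\<phi> \<in> S" for \<phi>
    using adm[OF that] admissible_bounds(3)[of \<phi>] by (auto simp: fourier_admissible_def)
  have ae: "AE x in M. T \<phi> x = conductor_commutator M \<phi> x" if "\<phi> \<in> S" for \<phi>
    using AE_nonzero by eventually_elim (simp add: eq that)
  have meas: "conductor_commutator M \<phi> \<in> borel_measurable M" if "\<phi> \<in> S" for \<phi>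
  proof -
    have [measurable]: "\<phi> \<in> borel_measurable M" using L2[OF that] by (simp add: L2_def)
    have [measurable]: "{0::'k} \<in> sets M" by (simp add: sets_M singleton_borel)
    \<comment> \<open>The commutator differs from the measurable function \<open>T \<phi>\<close> at
      most at the point 0, which gives its measurability.\<close>
    have "(\<lambda>x. if x \<in> {0} then conductor_commutator M \<phi> 0 else T \<phi> x) \<in> borel_measurable M" by measurable
    also have "(\<lambda>x. if x \<in> {0} then conductor_commutator M \<phi> 0 else T \<phi> x) = conductor_commutator M \<phi>"
      by (auto simp: eq that)
    finally show ?thesis .
  qed
  have "conductor_commutator M \<phi> \<in> L2 M \<and> L2_norm M (conductor_commutator M \<phi>) \<le> op_bound * L2_norm M \<phi>" if "\<phi> \<in> S" for \<phi>
  proof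
    have [measurable]: "T \<phi> \<in> borel_measurable M" "conductor_commutator M \<phi> \<in> borel_measurable M"
      using L2[OF that] meas[OF that] by (auto simp: L2_def)
    have aesq: "AE x in M. (cmod (T \<phi> x))\<^sup>2 = (cmod (conductor_commutator M \<phi> x))\<^sup>2"
      using ae[OF that] by eventually_elim simp
    have "integrable M (\<lambda>x. (cmod (T \<phi> x))\<^sup>2)" using T_bounded(1)[OF L2[OF that]] by (simp add: L2_def)
    then show "conductor_commutator M \<phi> \<in> L2 M"
      unfolding L2_def using meas[OF that] integrable_cong_AE[OF _ _ aesq] by simp
    have "L2_norm M (conductor_commutator M \<phi>) = L2_norm M (T \<phi>)"
      unfolding L2_norm_def using integral_cong_AE[OF _ _ aesq] by simp
    then show "L2_norm M (conductor_commutator M \<phi>) \<le> op_bound * L2_norm M \<phi>" using T_bounded(2)[OF L2[OF that]] by simp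
  qed
  then show ?thesis using T_bounded_operator T_L2_hermitian ae by blast
qed

end

section \<open>Schwartz functions on Euclidean space and multiplication by the logarithm\<close>

text \<open>The norm to the power of the dimension is the radial quantity whose balls have volume
  proportional to the radius.\<close>

lemma radial_weight_lborel:
  "integrable lborel (\<lambda>x::'a::euclidean_space. radial_weight (norm x ^ DIM('a)))"
proof -
  have "(\<integral>\<^sup>+x. ennreal (radial_weight (norm (x::'a) ^ DIM('a))) \<partial>lborel) < \<infinity>"
  proof (rule radial_weight_integral[where V="unit_ball_vol (DIM('a))"])
    fix r :: real assume r: "0 < r"
    have "{x \<in> space lborel. norm (x::'a) ^ DIM('a) \<le> r} = cball 0 (root DIM('a) r)"
    proof (rule set_eqI)
      fix x :: 'a
      have "norm x ^ DIM('a) \<le> r \<longleftrightarrow> norm x ^ DIM('a) \<le> root DIM('a) r ^ DIM('a)" using r by simp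
      also have "\<dots> \<longleftrightarrow> norm x \<le> root DIM('a) r" using r by (intro power_mono_iff) auto
      finally show "x \<in> {x \<in> space lborel. norm x ^ DIM('a) \<le> r} \<longleftrightarrow> x \<in> cball 0 (root DIM('a) r)" by simp
    qed
    then show "emeasure lborel {x \<in> space lborel. norm (x::'a) ^ DIM('a) \<le> r} \<le> ennreal (unit_ball_vol (DIM('a)) * r)"
      using r by (simp add: emeasure_cball)
  qed (auto simp: less_imp_le)
  then show ?thesis by (intro integrableI_bounded) (auto simp: radial_weight_nonneg)
qed

text \<open>Coinductive form of \<open>schwartz_function\<close>: membership in a family closed under derivatives.\<close>

definition schwartz_family :: "('a::euclidean_space \<Rightarrow> complex) set \<Rightarrow> bool" where
  "schwartz_family S \<longleftrightarrow> (\<forall>g\<in>S.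
     (\<exists>G. (\<forall>b\<in>Basis. G b \<in> S) \<and> (\<forall>x. (g has_derivative (\<lambda>h. \<Sum>b\<in>Basis. (h \<bullet> b) *\<^sub>R G b x)) (at x))) \<and>
     (\<forall>k::nat. bounded (range (\<lambda>x. norm x ^ k * norm (g x)))))"

text \<open>A choice of partial derivatives for every member of the family, iterated along a list of
  directions, yields the function \<open>D\<close> that the definition asks for.\<close>

lemma schwartz_functionI:
  assumes S: "schwartz_family S" and f: "f \<in> S"
  shows "schwartz_function f"
proof -
  have "\<forall>g\<in>S. \<exists>G. (\<forall>b\<in>Basis. G b \<in> S) \<and> (\<forall>x. (g has_derivative (\<lambda>h. \<Sum>b\<in>Basis. (h \<bullet> b) *\<^sub>R G b x)) (at x))"
    using S by (simp add: schwartz_family_def)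
  then obtain G where G: "\<And>g b. g \<in> S \<Longrightarrow> b \<in> Basis \<Longrightarrow> G g b \<in> S"
    "\<And>g x. g \<in> S \<Longrightarrow> (g has_derivative (\<lambda>h. \<Sum>b\<in>Basis. (h \<bullet> b) *\<^sub>R G g b x)) (at x)"
    by metis
  define D where "D bs = foldr (\<lambda>b g. G g b) bs f" for bs
  have D: "D bs \<in> S" if "bs \<in> lists Basis" for bs
    using that by (induction bs) (auto simp: D_def f G)
  show ?thesis
    unfolding schwartz_function_def
  proof (intro exI[of _ D] conjI ballI)
    show "D [] = f" by (simp add: D_def)
    fix bs :: "'a list" assume "bs \<in> lists Basis"
    note bs = D[OF this]
    show "\<forall>x. (D bs has_derivative (\<lambda>h. \<Sum>b\<in>Basis. (h \<bullet> b) *\<^sub>R D (b # bs) x)) (at x)"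
      using G(2)[OF bs] by (simp add: D_def)
    show "\<forall>k::nat. bounded (range (\<lambda>x. norm x ^ k * norm (D bs x)))"
      using S bs by (simp add: schwartz_family_def)
  qed
qed

lemma schwartz_functionE:
  assumes "schwartz_function f"
  obtains S where "schwartz_family S" "f \<in> S"
proof -
  obtain D where D: "D [] = f" "\<And>bs x. bs \<in> lists Basis \<Longrightarrow> (D bs has_derivative (\<lambda>h. \<Sum>b\<in>Basis. (h \<bullet> b) *\<^sub>R D (b # bs) x)) (at x)"
    "\<And>bs k. bs \<in> lists Basis \<Longrightarrow> bounded (range (\<lambda>x. norm x ^ k * norm (D bs x)))"
    using assms unfolding schwartz_function_def by blast
  show ?thesis
  proof
    show "f \<in> D ` lists Basis" using D(1) by (metis image_eqI lists.Nil)
    show "schwartz_family (D ` lists Basis)"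
      unfolding schwartz_family_def
    proof (intro ballI conjI allI)
      fix g assume "g \<in> D ` lists Basis"
      then obtain bs where bs: "bs \<in> lists Basis" "g = D bs" by auto
      show "bounded (range (\<lambda>x. norm x ^ k * norm (g x)))" for k using D(3) bs by simp
      show "\<exists>G. (\<forall>b\<in>Basis. G b \<in> D ` lists Basis) \<and> (\<forall>x. (g has_derivative (\<lambda>h. \<Sum>b\<in>Basis. (h \<bullet> b) *\<^sub>R G b x)) (at x))"
        using D(2)[OF bs(1)] bs by (intro exI[of _ "\<lambda>b. D (b # bs)"]) auto
    qed
  qed
qed

lemma has_derivative_basis_unique:
  fixes g :: "'a::euclidean_space \<Rightarrow> complex"
  assumes "(g has_derivative (\<lambda>h. \<Sum>b\<in>Basis. (h \<bullet> b) *\<^sub>R G b)) (at x)"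
    and "open U" "x \<in> U" "\<And>y. y \<in> U \<Longrightarrow> g y = 0" and b: "b \<in> Basis"
  shows "G b = 0"
proof -
  have "((\<lambda>_. 0) has_derivative (\<lambda>h. \<Sum>b\<in>Basis. (h \<bullet> b) *\<^sub>R G b)) (at x)"
    using has_derivative_transform_within_open[OF assms(1-3)] assms(4) by auto
  then have "(\<lambda>h. \<Sum>b\<in>Basis. (h \<bullet> b) *\<^sub>R G b) = (\<lambda>_. 0)"
    by (rule has_derivative_unique) simp
  then have "(\<Sum>c\<in>Basis. (b \<bullet> c) *\<^sub>R G c) = 0" by metis
  moreover have "(\<Sum>c\<in>Basis. (b \<bullet> c) *\<^sub>R G c) = (\<Sum>c\<in>Basis. if c = b then G c else 0)"
    using b by (intro sum.cong) (auto simp: inner_Basis)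
  ultimately show ?thesis using b by simp
qed

lemma schwartz_family_vanishing:
  assumes S: "schwartz_family S" and U: "open U"
  shows "schwartz_family {g \<in> S. \<forall>x\<in>U. g x = 0}"
  unfolding schwartz_family_def
proof (intro ballI conjI allI)
  fix g assume g: "g \<in> {g \<in> S. \<forall>x\<in>U. g x = 0}"
  then show "bounded (range (\<lambda>x. norm x ^ k * norm (g x)))" for k using S by (auto simp: schwartz_family_def)
  obtain G where G: "\<forall>b\<in>Basis. G b \<in> S" "\<forall>x. (g has_derivative (\<lambda>h. \<Sum>b\<in>Basis. (h \<bullet> b) *\<^sub>R G b x)) (at x)"
    using S g unfolding schwartz_family_def by blast
  have "G b x = 0" if "b \<in> Basis" "x \<in> U" for b x
    using has_derivative_basis_unique[of g "\<lambda>b. G b x" x U b] G(2) U g that by blast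
  then show "\<exists>G. (\<forall>b\<in>Basis. G b \<in> {g \<in> S. \<forall>x\<in>U. g x = 0}) \<and> (\<forall>x. (g has_derivative (\<lambda>h. \<Sum>b\<in>Basis. (h \<bullet> b) *\<^sub>R G b x)) (at x))"
    using G by blast
qed

text \<open>The gradient of ln|x| is x/|x|^2 and that of 1/|x|^2 is -2x/|x|^4. Closing under
  coordinates, 1/|x|^2, logarithm, scalars and sums therefore gives a family stable under partial
  derivatives.\<close>

inductive_set log_closure :: "('a::euclidean_space \<Rightarrow> complex) set \<Rightarrow> ('a \<Rightarrow> complex) set" for S where
  base: "g \<in> S \<Longrightarrow> g \<in> log_closure S"
| add: "f \<in> log_closure S \<Longrightarrow> g \<in> log_closure S \<Longrightarrow> (\<lambda>x. f x + g x) \<in> log_closure S"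
| scale: "g \<in> log_closure S \<Longrightarrow> (\<lambda>x. of_real r * g x) \<in> log_closure S"
| coord: "g \<in> log_closure S \<Longrightarrow> c \<in> Basis \<Longrightarrow> (\<lambda>x. of_real (x \<bullet> c) * g x) \<in> log_closure S"
| inv: "g \<in> log_closure S \<Longrightarrow> (\<lambda>x. of_real (inverse (x \<bullet> x)) * g x) \<in> log_closure S"
| log: "g \<in> log_closure S \<Longrightarrow> (\<lambda>x. of_real (ln (norm x)) * g x) \<in> log_closure S"

text \<open>The multiplier \<open>m\<close> may be singular at 0: inside the ball the product and
  all derivatives of \<open>g\<close> vanish, outside it the ordinary product rule applies.\<close>

lemma has_derivative_mult_vanishing:
  fixes g :: "'a::euclidean_space \<Rightarrow> complex" and m :: "'a \<Rightarrow> real"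
  assumes \<epsilon>: "\<epsilon> > 0" "\<And>x. x \<in> ball 0 \<epsilon> \<Longrightarrow> g x = 0"
    and g: "(g has_derivative (\<lambda>h. \<Sum>b\<in>Basis. (h \<bullet> b) *\<^sub>R G b)) (at x)"
    and m: "x \<noteq> 0 \<Longrightarrow> (m has_derivative (\<lambda>h. \<Sum>b\<in>Basis. (h \<bullet> b) * m' b)) (at x)"
  shows "((\<lambda>x. of_real (m x) * g x) has_derivative (\<lambda>h. \<Sum>b\<in>Basis. (h \<bullet> b) *\<^sub>R (of_real (m' b) * g x + of_real (m x) * G b))) (at x)"
proof (cases "x \<in> ball 0 \<epsilon>")
  case True
  have "G b = 0" if "b \<in> Basis" for b
    using has_derivative_basis_unique[OF g open_ball True] \<epsilon>(2) that by blast
  moreover have "g x = 0" using True \<epsilon> by blast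
  moreover have "((\<lambda>x. of_real (m x) * g x) has_derivative (\<lambda>_. 0)) (at x)"
    by (rule has_derivative_transform_within_open[OF has_derivative_const open_ball True]) (simp add: \<epsilon>(2))
  ultimately show ?thesis by simp
next
  case False
  then have "x \<noteq> 0" using \<epsilon> by auto
  have "((\<lambda>x. complex_of_real (m x)) has_derivative (\<lambda>h. of_real (\<Sum>b\<in>Basis. (h \<bullet> b) * m' b))) (at x)"
    by (rule has_derivative_of_real[OF m[OF \<open>x \<noteq> 0\<close>]])
  from has_derivative_mult[OF this g]
  show ?thesis
    by (rule has_derivative_eq_rhs) (auto simp: fun_eq_iff sum_distrib_left sum_distrib_right sum.distrib[symmetric] scaleR_conv_of_real algebra_simps intro!: sum.cong)
qed

lemma log_closure_vanishing:
  assumes "\<And>g. g \<in> S \<Longrightarrow> \<forall>x\<in>U. g x = 0" "f \<in> log_closure S" "x \<in> U"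
  shows "f x = 0"
  using assms(2) by induction (use assms in auto)

lemma bounded_range_le:
  assumes "bounded (range (h :: 'a \<Rightarrow> real))" obtains B where "\<And>x. h x \<le> B"
proof -
  obtain B where "\<forall>x\<in>range h. norm x \<le> B" using assms bounded_iff by blast
  then have "h x \<le> B" for x using abs_ge_self[of "h x"] by (auto intro: order_trans)
  then show ?thesis by (rule that)
qed

lemma bounded_range_nonneg: "(\<And>x. 0 \<le> h x) \<Longrightarrow> (\<And>x. h x \<le> (B::real)) \<Longrightarrow> bounded (range h)"
  unfolding bounded_iff by (intro exI[of _ B]) auto

text \<open>Derivatives stay in the family by the product rule. The decay survives because outside
  the ball of radius \<open>\<epsilon>\<close> each multiplier is at most a constant plus the norm,
  which costs one more power of the norm.\<close>

lemma schwartz_family_log_closure: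
  fixes S :: "('a::euclidean_space \<Rightarrow> complex) set"
  assumes S: "schwartz_family S" and \<epsilon>: "\<epsilon> > 0" and van: "\<And>g. g \<in> S \<Longrightarrow> \<forall>x\<in>ball 0 \<epsilon>. g x = 0"
  shows "schwartz_family (log_closure S)"
proof -
  let ?W = "log_closure S"
  let ?D = "\<lambda>g G. (\<forall>b\<in>Basis. G b \<in> ?W) \<and> (\<forall>x. (g has_derivative (\<lambda>h. \<Sum>b\<in>Basis. (h \<bullet> b) *\<^sub>R G b x)) (at x))"
  have deriv_mult: "\<exists>G'. ?D (\<lambda>x. of_real (m x) * g x) G'"
    if g: "g \<in> ?W" "?D g G" and m: "\<And>x. x \<noteq> 0 \<Longrightarrow> (m has_derivative (\<lambda>h. \<Sum>b\<in>Basis. (h \<bullet> b) * m' b x)) (at x)"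
      and m': "\<And>b. b \<in> Basis \<Longrightarrow> (\<lambda>x. of_real (m' b x) * g x) \<in> ?W"
      and mG: "\<And>g. g \<in> ?W \<Longrightarrow> (\<lambda>x. of_real (m x) * g x) \<in> ?W" for m m' g G
  proof (intro exI[of _ "\<lambda>b x. of_real (m' b x) * g x + of_real (m x) * G b x"] conjI ballI allI)
    show "(\<lambda>x. of_real (m' b x) * g x + of_real (m x) * G b x) \<in> ?W" if "b \<in> Basis" for b
      using m'[OF that] mG g(2) that by (intro log_closure.add) auto
    fix x
    show "((\<lambda>x. of_real (m x) * g x) has_derivative
        (\<lambda>h. \<Sum>b\<in>Basis. (h \<bullet> b) *\<^sub>R (of_real (m' b x) * g x + of_real (m x) * G b x))) (at x)"
      using log_closure_vanishing[OF van g(1)] g(2) m \<epsilon> by (intro has_derivative_mult_vanishing) auto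
  qed
  have bdd_mult: "bounded (range (\<lambda>x. norm x ^ k * norm (of_real (m x) * g x)))"
    if g: "g \<in> ?W" "\<And>k. bounded (range (\<lambda>x. norm x ^ k * norm (g x)))"
      and m: "\<And>x. norm x \<ge> \<epsilon> \<Longrightarrow> \<bar>m x\<bar> \<le> A + norm x" for m :: "'a \<Rightarrow> real" and A g k
  proof -
    obtain B1 where B1: "\<And>x. norm x ^ k * norm (g x) \<le> B1"
      using bounded_range_le[OF g(2)[of k]] by blast
    obtain B2 where B2: "\<And>x. norm x ^ Suc k * norm (g x) \<le> B2"
      using bounded_range_le[OF g(2)[of "Suc k"]] by blast
    have "norm x ^ k * norm (of_real (m x) * g x) \<le> \<bar>A\<bar> * B1 + B2" for x
    proof (cases "norm x \<ge> \<epsilon>")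
      case True
      have "norm x ^ k * norm (of_real (m x) * g x) = \<bar>m x\<bar> * (norm x ^ k * norm (g x))" by (simp add: norm_mult)
      also have "\<dots> \<le> (\<bar>A\<bar> + norm x) * (norm x ^ k * norm (g x))" using m[OF True] by (intro mult_right_mono) auto
      also have "\<dots> = \<bar>A\<bar> * (norm x ^ k * norm (g x)) + norm x ^ Suc k * norm (g x)" by (simp add: algebra_simps)
      also have "\<dots> \<le> \<bar>A\<bar> * B1 + B2" by (intro add_mono mult_left_mono B1 B2) auto
      finally show ?thesis .
    next
      case False
      then have "g x = 0" using log_closure_vanishing[OF van g(1), of x] by auto
      moreover have "0 \<le> B1" by (rule order_trans[OF _ B1[of 0]]) simp
      moreover have "0 \<le> B2" by (rule order_trans[OF _ B2[of 0]]) simp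
      ultimately show ?thesis by simp
    qed
    then show ?thesis by (intro bounded_range_nonneg[where B="\<bar>A\<bar> * B1 + B2"]) auto
  qed
  have inner_sum: "(\<Sum>b\<in>Basis. (h \<bullet> b) * (x \<bullet> b)) = h \<bullet> x" for h x :: 'a
    by (rule euclidean_inner[symmetric])
  have all: "(\<exists>G. ?D g G) \<and> (\<forall>k::nat. bounded (range (\<lambda>x. norm x ^ k * norm (g x))))" if "g \<in> ?W" for g
    using that
  proof induction
    case (base g)
    then obtain G where "\<forall>b\<in>Basis. G b \<in> S" "\<forall>x. (g has_derivative (\<lambda>h. \<Sum>b\<in>Basis. (h \<bullet> b) *\<^sub>R G b x)) (at x)"
      "\<forall>k::nat. bounded (range (\<lambda>x. norm x ^ k * norm (g x)))"
      using S unfolding schwartz_family_def by blast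
    then show ?case by (intro conjI exI[of _ G]) (auto intro: log_closure.base)
  next
    case (add f g)
    obtain F where F: "?D f F" using add.IH(1)[THEN conjunct1] ..
    obtain G where G: "?D g G" using add.IH(2)[THEN conjunct1] ..
    note FG = F G
    have "\<exists>G. ?D (\<lambda>x. f x + g x) G"
    proof (intro exI[of _ "\<lambda>b x. F b x + G b x"] conjI ballI allI)
      show "(\<lambda>x. F b x + G b x) \<in> ?W" if "b \<in> Basis" for b using FG that by (intro log_closure.add) auto
      fix x
      have "(f has_derivative (\<lambda>h. \<Sum>b\<in>Basis. (h \<bullet> b) *\<^sub>R F b x)) (at x)" "(g has_derivative (\<lambda>h. \<Sum>b\<in>Basis. (h \<bullet> b) *\<^sub>R G b x)) (at x)"
        using FG by simp_all
      from has_derivative_add[OF this]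
      show "((\<lambda>x. f x + g x) has_derivative (\<lambda>h. \<Sum>b\<in>Basis. (h \<bullet> b) *\<^sub>R (F b x + G b x))) (at x)"
        by (simp add: scaleR_add_right sum.distrib)
    qed
    moreover have "bounded (range (\<lambda>x. norm x ^ k * norm (f x + g x)))" for k
    proof -
      obtain B1 where B1: "\<And>x. norm x ^ k * norm (f x) \<le> B1" using bounded_range_le[OF add.IH(1)[THEN conjunct2, rule_format]] by blast
      obtain B2 where B2: "\<And>x. norm x ^ k * norm (g x) \<le> B2" using bounded_range_le[OF add.IH(2)[THEN conjunct2, rule_format]] by blast
      have "norm x ^ k * norm (f x + g x) \<le> B1 + B2" for x
      proof -
        have "norm x ^ k * norm (f x + g x) \<le> norm x ^ k * (norm (f x) + norm (g x))"
          by (intro mult_left_mono norm_triangle_ineq) auto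
        then show ?thesis using B1[of x] B2[of x] by (simp add: distrib_left)
      qed
      then show ?thesis by (intro bounded_range_nonneg[where B="B1 + B2"]) auto
    qed
    ultimately show ?case by (intro conjI allI)
  next
    case (scale g r)
    obtain G where G: "?D g G" using scale.IH[THEN conjunct1] ..
    have "\<exists>G'. ?D (\<lambda>x. of_real r * g x) G'"
      by (rule deriv_mult[OF scale(1) G, of "\<lambda>_. r" "\<lambda>_ _. 0"])
        (use log_closure.scale[OF scale(1), of 0] in \<open>auto intro: log_closure.scale\<close>)
    moreover have "bounded (range (\<lambda>x. norm x ^ k * norm (of_real r * g x)))" for k
      by (rule bdd_mult[OF scale(1), of "\<lambda>_. r" "\<bar>r\<bar>"]) (use scale.IH[THEN conjunct2] in auto)
    ultimately show ?case by (intro conjI allI)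
  next
    case (coord g c)
    obtain G where G: "?D g G" using coord.IH[THEN conjunct1] ..
    have "\<exists>G'. ?D (\<lambda>x. of_real (x \<bullet> c) * g x) G'"
    proof (rule deriv_mult[OF coord(1) G, of "\<lambda>x. x \<bullet> c" "\<lambda>b x. c \<bullet> b"])
      show "((\<lambda>x. x \<bullet> c) has_derivative (\<lambda>h. \<Sum>b\<in>Basis. h \<bullet> b * (c \<bullet> b))) (at x)" for x
        unfolding inner_sum by (rule has_derivative_inner_left[OF has_derivative_ident])
    qed (use coord.hyps in \<open>auto intro: log_closure.scale log_closure.coord\<close>)
    moreover have "bounded (range (\<lambda>x. norm x ^ k * norm (of_real (x \<bullet> c) * g x)))" for k
      by (rule bdd_mult[OF coord(1), of "\<lambda>x. x \<bullet> c" 0])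
        (use coord.IH[THEN conjunct2] coord.hyps in \<open>auto intro: Basis_le_norm\<close>)
    ultimately show ?case by (intro conjI allI)
  next
    case (inv g)
    obtain G where G: "?D g G" using inv.IH[THEN conjunct1] ..
    have "\<exists>G'. ?D (\<lambda>x. of_real (inverse (x \<bullet> x)) * g x) G'"
    proof (rule deriv_mult[OF inv(1) G, of "\<lambda>x. inverse (x \<bullet> x)" "\<lambda>b x. - 2 * ((x \<bullet> b) * (inverse (x \<bullet> x) * inverse (x \<bullet> x)))"])
      fix x :: 'a assume x: "x \<noteq> 0"
      have "((\<lambda>x. inverse (x \<bullet> x)) has_derivative (\<lambda>h. - (inverse (x \<bullet> x) * (x \<bullet> h + h \<bullet> x) * inverse (x \<bullet> x)))) (at x)"
        by (rule Deriv.has_derivative_inverse[OF _ has_derivative_inner[OF has_derivative_ident has_derivative_ident]]) (use x in simp)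
      then show "((\<lambda>x. inverse (x \<bullet> x)) has_derivative (\<lambda>h. \<Sum>b\<in>Basis. h \<bullet> b * (- 2 * ((x \<bullet> b) * (inverse (x \<bullet> x) * inverse (x \<bullet> x)))))) (at x)"
      proof (rule has_derivative_eq_rhs, intro ext)
        fix h
        have "(\<Sum>b\<in>Basis. h \<bullet> b * (- 2 * ((x \<bullet> b) * (inverse (x \<bullet> x) * inverse (x \<bullet> x))))) = (\<Sum>b\<in>Basis. (h \<bullet> b) * (x \<bullet> b)) * (- 2 * (inverse (x \<bullet> x) * inverse (x \<bullet> x)))"
          unfolding sum_distrib_right by (intro sum.cong) auto
        then show "- (inverse (x \<bullet> x) * (x \<bullet> h + h \<bullet> x) * inverse (x \<bullet> x)) = (\<Sum>b\<in>Basis. h \<bullet> b * (- 2 * ((x \<bullet> b) * (inverse (x \<bullet> x) * inverse (x \<bullet> x)))))"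
          unfolding inner_sum by (simp add: inner_commute[of x h])
      qed
    next
      fix b :: 'a assume b: "b \<in> Basis"
      have "(\<lambda>x. of_real (- 2) * (of_real (x \<bullet> b) * (of_real (inverse (x \<bullet> x)) * (of_real (inverse (x \<bullet> x)) * g x)))) \<in> ?W"
        by (intro log_closure.scale log_closure.coord log_closure.inv inv.hyps b)
      then show "(\<lambda>x. of_real (- 2 * ((x \<bullet> b) * (inverse (x \<bullet> x) * inverse (x \<bullet> x)))) * g x) \<in> ?W"
        by (simp add: mult.assoc)
    qed (rule log_closure.inv)
    moreover have "bounded (range (\<lambda>x. norm x ^ k * norm (of_real (inverse (x \<bullet> x)) * g x)))" for k
    proof (rule bdd_mult[OF inv(1), of "\<lambda>x. inverse (x \<bullet> x)" "inverse (\<epsilon>\<^sup>2)"])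
      fix x :: 'a assume "\<epsilon> \<le> norm x"
      then have "\<epsilon>\<^sup>2 \<le> x \<bullet> x" using \<epsilon> by (simp add: dot_square_norm power_mono)
      then have "inverse (x \<bullet> x) \<le> inverse (\<epsilon>\<^sup>2)" using \<epsilon> by (intro le_imp_inverse_le) auto
      then show "\<bar>inverse (x \<bullet> x)\<bar> \<le> inverse (\<epsilon>\<^sup>2) + norm x" using norm_ge_zero[of x] by (simp add: abs_of_nonneg del: norm_ge_zero)
    qed (use inv.IH[THEN conjunct2] in auto)
    ultimately show ?case by (intro conjI allI)
  next
    case (log g)
    obtain G where G: "?D g G" using log.IH[THEN conjunct1] ..
    have "\<exists>G'. ?D (\<lambda>x. of_real (ln (norm x)) * g x) G'"
    proof (rule deriv_mult[OF log(1) G, of "\<lambda>x. ln (norm x)" "\<lambda>b x. (x \<bullet> b) * inverse (x \<bullet> x)"])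
      fix x :: 'a assume x: "x \<noteq> 0"
      have "((\<lambda>x. ln (norm x)) has_derivative (\<lambda>h. (h \<bullet> sgn x) * inverse (norm x))) (at x)"
      proof -
        have "(norm has_derivative (\<lambda>h. h \<bullet> sgn x)) (at x)" by (rule has_derivative_norm[OF x])
        then show ?thesis
          by (intro DERIV_compose_FDERIV[OF DERIV_ln_divide[unfolded divide_inverse mult_1]]) (use x in simp_all)
      qed
      then show "((\<lambda>x. ln (norm x)) has_derivative (\<lambda>h. \<Sum>b\<in>Basis. h \<bullet> b * ((x \<bullet> b) * inverse (x \<bullet> x)))) (at x)"
      proof (rule has_derivative_eq_rhs, intro ext)
        fix h
        have "(\<Sum>b\<in>Basis. h \<bullet> b * ((x \<bullet> b) * inverse (x \<bullet> x))) = (\<Sum>b\<in>Basis. (h \<bullet> b) * (x \<bullet> b)) * inverse (x \<bullet> x)"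
          unfolding sum_distrib_right by (intro sum.cong) auto
        then show "(h \<bullet> sgn x) * inverse (norm x) = (\<Sum>b\<in>Basis. h \<bullet> b * ((x \<bullet> b) * inverse (x \<bullet> x)))"
          unfolding inner_sum by (simp add: sgn_div_norm dot_square_norm power2_eq_square field_simps)
      qed
    next
      fix b :: 'a assume b: "b \<in> Basis"
      have "(\<lambda>x. of_real (x \<bullet> b) * (of_real (inverse (x \<bullet> x)) * g x)) \<in> ?W"
        by (intro log_closure.scale log_closure.coord log_closure.inv log.hyps b)
      then show "(\<lambda>x. of_real ((x \<bullet> b) * inverse (x \<bullet> x)) * g x) \<in> ?W"
        by (simp add: mult.assoc)
    qed (rule log_closure.log)
    moreover have "bounded (range (\<lambda>x. norm x ^ k * norm (of_real (ln (norm x)) * g x)))" for k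
    proof (rule bdd_mult[OF log(1), of "\<lambda>x. ln (norm x)" "inverse \<epsilon>"])
      fix x :: 'a assume x: "\<epsilon> \<le> norm x"
      then have n: "0 < norm x" using \<epsilon> by linarith
      have "ln (norm x) < norm x" by (rule ln_less_self[OF n])
      moreover have "ln (inverse (norm x)) < inverse (norm x)" by (rule ln_less_self) (use n in simp)
      moreover have "inverse (norm x) \<le> inverse \<epsilon>" using x \<epsilon> by (intro le_imp_inverse_le) auto
      moreover have "0 < inverse \<epsilon>" using \<epsilon> by simp
      ultimately show "\<bar>ln (norm x)\<bar> \<le> inverse \<epsilon> + norm x" using n by (simp only: ln_inverse)
    qed (use log.IH[THEN conjunct2] in auto)
    ultimately show ?case by (intro conjI allI)
  qed
  then show ?thesis unfolding schwartz_family_def by blast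
qed

text \<open>The factor \<open>r\<close> will be the dimension, since the normalized absolute value
  is the norm raised to it.\<close>

lemma schwartz_function_ln_mult:
  fixes f :: "'a::euclidean_space \<Rightarrow> complex"
  assumes "schwartz_function f" "\<epsilon> > 0" "\<And>x. x \<in> ball 0 \<epsilon> \<Longrightarrow> f x = 0"
  shows "schwartz_function (\<lambda>x. of_real (r * ln (norm x)) * f x)"
proof -
  obtain S where S: "schwartz_family S" "f \<in> S" by (rule schwartz_functionE[OF assms(1)])
  let ?S = "{g \<in> S. \<forall>x\<in>ball 0 \<epsilon>. g x = 0}"
  have "schwartz_family (log_closure ?S)"
    by (rule schwartz_family_log_closure[OF schwartz_family_vanishing[OF S(1) open_ball] assms(2)]) auto
  moreover have "(\<lambda>x. of_real r * (of_real (ln (norm x)) * f x)) \<in> log_closure ?S"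
    by (intro log_closure.scale log_closure.log log_closure.base) (use assms S in auto)
  ultimately show ?thesis using schwartz_functionI by (simp add: mult.assoc)
qed

lemma schwartz_family_continuous:
  assumes "schwartz_family S" "g \<in> S"
  shows "continuous_on UNIV g"
proof -
  obtain G where "\<forall>x. (g has_derivative (\<lambda>h. \<Sum>b\<in>Basis. (h \<bullet> b) *\<^sub>R G b x)) (at x)"
    using assms unfolding schwartz_family_def by blast
  then have "isCont g x" for x using has_derivative_continuous[of g _ x UNIV] by blast
  then show ?thesis by (simp add: continuous_on_eq_continuous_at)
qed

lemma schwartz_family_bounded:
  assumes "schwartz_family S" "g \<in> S"
  obtains B where "\<And>x. norm x ^ k * norm (g x) \<le> B"
proof -
  have "bounded (range (\<lambda>x. norm x ^ k * norm (g x)))" using assms unfolding schwartz_family_def by blast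
  then show ?thesis using bounded_range_le that by blast
qed

lemma schwartz_family_integrable:
  fixes g :: "'a::euclidean_space \<Rightarrow> complex"
  assumes S: "schwartz_family S" "g \<in> S"
  shows "integrable lborel g"
proof -
  obtain B1 where B1: "\<And>x. norm x ^ 0 * norm (g x) \<le> B1"
    using schwartz_family_bounded[OF S] by blast
  obtain B2 where B2: "\<And>x. norm x ^ (DIM('a) * 2) * norm (g x) \<le> B2"
    using schwartz_family_bounded[OF S] by blast
  let ?B = "max B1 B2"
  have [measurable]: "g \<in> borel_measurable borel"
    by (intro borel_measurable_continuous_onI schwartz_family_continuous[OF S])
  show ?thesis
  proof (rule Bochner_Integration.integrable_bound)
    show "integrable lborel (\<lambda>x::'a. ?B * radial_weight (norm x ^ DIM('a)))"
      by (intro integrable_mult_right radial_weight_lborel)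
    show "AE x in lborel. norm (g x) \<le> norm (?B * radial_weight (norm x ^ DIM('a)))"
    proof (rule AE_mp[OF AE_lborel_singleton[of "0::'a"] AE_I2], rule impI)
      fix x :: 'a assume "x \<noteq> 0"
      then have "norm (g x) \<le> ?B * radial_weight (norm x ^ DIM('a))"
        using B1[of x] B2[of x] by (intro weight_bound_small(1)) (auto simp: power_mult)
      then show "norm (g x) \<le> norm (?B * radial_weight (norm x ^ DIM('a)))" by simp
    qed
  qed simp
qed

section \<open>Decay of Fourier transforms of Schwartz functions\<close>

text \<open>The increment \<open>f (y + b) - f y\<close> has integral 0 by translation invariance.
  It is also the integral of the derivative along the segment, and by Fubini and invariance again
  its integral over \<open>y\<close> is the integral of the derivative. No boundary terms
  occur.\<close>

lemma integral_derivative_eq_0: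
  fixes f :: "'a::euclidean_space \<Rightarrow> complex"
  assumes f: "\<And>x. (f has_derivative f' x) (at x)" and b: "continuous_on UNIV (\<lambda>x. f' x b)"
    and int: "integrable lborel f" "integrable lborel (\<lambda>x. f' x b)"
  shows "(\<integral>x. f' x b \<partial>lborel) = 0"
proof -
  let ?g = "\<lambda>x. f' x b"
  have g[measurable]: "?g \<in> borel_measurable borel" by (intro borel_measurable_continuous_onI b)
  have shift_int: "integrable lborel (\<lambda>y. h (y + a))" "(\<integral>y. h (y + a) \<partial>lborel) = (\<integral>y. h y \<partial>lborel)"
    if h: "integrable lborel h" for h :: "'a \<Rightarrow> complex" and a
  proof -
    have m: "h \<in> borel_measurable borel" using borel_measurable_integrable[OF h] by simp
    have "integrable (distr lborel borel ((+) a)) h" "(\<integral>y. h y \<partial>distr lborel borel ((+) a)) = (\<integral>y. h y \<partial>lborel)"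
      using h by (simp_all add: lborel_distr_plus)
    then show "integrable lborel (\<lambda>y. h (y + a))" "(\<integral>y. h (y + a) \<partial>lborel) = (\<integral>y. h y \<partial>lborel)"
      using m by (simp_all add: integrable_distr_eq integral_distr add.commute)
  qed
  have ftc: "f (y + b) - f y = (\<integral>s. indicator {0..1} s *\<^sub>R ?g (y + s *\<^sub>R b) \<partial>lborel)" for y
  proof -
    have "(\<integral>s. indicator {0..1} s *\<^sub>R ?g (y + s *\<^sub>R b) \<partial>lborel) = f (y + 1 *\<^sub>R b) - f (y + 0 *\<^sub>R b)"
    proof (rule integral_FTC_atLeastAtMost)
      fix s :: real
      have "((\<lambda>s. f (y + s *\<^sub>R b)) has_derivative (\<lambda>h. f' (y + s *\<^sub>R b) (h *\<^sub>R b))) (at s within {0..1})"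
        by (rule has_derivative_compose[of "\<lambda>s. y + s *\<^sub>R b" _ _ _ f, OF _ f]) (auto intro!: derivative_eq_intros)
      moreover have "f' (y + s *\<^sub>R b) (h *\<^sub>R b) = h *\<^sub>R f' (y + s *\<^sub>R b) b" for h
        using linear_cmul[OF has_derivative_linear[OF f]] by blast
      ultimately show "((\<lambda>s. f (y + s *\<^sub>R b)) has_vector_derivative ?g (y + s *\<^sub>R b)) (at s within {0..1})"
        by (simp add: has_vector_derivative_def)
    qed (auto intro!: continuous_on_compose2[OF b] continuous_intros)
    then show ?thesis by simp
  qed
  have "0 = (\<integral>y. f (y + b) - f y \<partial>lborel)"
    using shift_int[OF int(1), of b] int(1) by simp
  also have "\<dots> = (\<integral>y. \<integral>s. indicator {0..1} s *\<^sub>R ?g (y + s *\<^sub>R b) \<partial>lborel \<partial>lborel)" by (simp only: ftc)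
  also have "\<dots> = (\<integral>s. \<integral>y. indicator {0..1} s *\<^sub>R ?g (y + s *\<^sub>R b) \<partial>lborel \<partial>lborel)"
  proof (rule lborel_pair.Fubini_integral, rule lborel_pair.Fubini_integrable)
    show "(\<lambda>(s, y). indicator {0..1} s *\<^sub>R ?g (y + s *\<^sub>R b)) \<in> borel_measurable (lborel \<Otimes>\<^sub>M lborel)"
      by measurable
    have eq: "(\<integral>y. norm (case (s, y) of (s, y) \<Rightarrow> indicator {0..1} s *\<^sub>R ?g (y + s *\<^sub>R b)) \<partial>lborel) = indicator {0..1} s * (\<integral>y. norm (?g y) \<partial>lborel)" for s :: real
    proof -
      have "(\<integral>y. complex_of_real (norm (?g (y + s *\<^sub>R b))) \<partial>lborel) = (\<integral>y. complex_of_real (norm (?g y)) \<partial>lborel)"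
        by (rule shift_int) (use int in auto)
      then have "(\<integral>y. norm (?g (y + s *\<^sub>R b)) \<partial>lborel) = (\<integral>y. norm (?g y) \<partial>lborel)"
        by (simp only: integral_complex_of_real of_real_eq_iff)
      then show ?thesis by simp
    qed
    show "integrable lborel (\<lambda>s. \<integral>y. norm (case (s, y) of (s, y) \<Rightarrow> indicator {0..1} s *\<^sub>R ?g (y + s *\<^sub>R b)) \<partial>lborel)"
      unfolding eq by (intro integrable_mult_left integrable_real_indicator) auto
    show "AE s in lborel. integrable lborel (\<lambda>y. case (s, y) of (s, y) \<Rightarrow> indicator {0..1} s *\<^sub>R ?g (y + s *\<^sub>R b))"
      using shift_int(1)[OF int(2)] by simp
  qed
  also have "\<dots> = (\<integral>s. indicator {0..1::real} s *\<^sub>R (\<integral>y. ?g y \<partial>lborel) \<partial>lborel)"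
    using shift_int(2)[OF int(2)] by simp
  also have "\<dots> = (\<integral>y. ?g y \<partial>lborel)" by simp
  finally show ?thesis by simp
qed

definition euclidean_fourier :: "real \<Rightarrow> ('a::euclidean_space \<Rightarrow> complex) \<Rightarrow> 'a \<Rightarrow> complex" where
  "euclidean_fourier \<alpha> f \<eta> = (\<integral>y. f y * cis (\<alpha> * (y \<bullet> \<eta>)) \<partial>lborel)"

text \<open>Integration by parts: the derivative of \<open>g\<close> times the exponential has
  integral 0.\<close>

lemma euclidean_fourier_derivative:
  fixes g :: "'a::euclidean_space \<Rightarrow> complex"
  assumes S: "schwartz_family S" "g \<in> S" and GS: "\<forall>b\<in>Basis. G b \<in> S"
    and G: "\<forall>x. (g has_derivative (\<lambda>h. \<Sum>b\<in>Basis. (h \<bullet> b) *\<^sub>R G b x)) (at x)" and b: "b \<in> Basis"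
  shows "cmod (euclidean_fourier \<alpha> (G b) \<eta>) = \<bar>\<alpha> * (b \<bullet> \<eta>)\<bar> * cmod (euclidean_fourier \<alpha> g \<eta>)"
proof -
  let ?c = "\<lambda>y. cis (\<alpha> * (y \<bullet> \<eta>))"
  have ic: "integrable lborel (\<lambda>y. f y * ?c y)" if "integrable lborel f" for f :: "'a \<Rightarrow> complex"
  proof (rule Bochner_Integration.integrable_bound[OF that])
    have [measurable]: "?c \<in> borel_measurable borel" by (intro borel_measurable_continuous_onI continuous_intros)
    show "(\<lambda>y. f y * ?c y) \<in> borel_measurable lborel" using borel_measurable_integrable[OF that] by measurable
  qed (auto simp: norm_mult)
  have basis: "(\<Sum>c\<in>Basis. (b \<bullet> c) *\<^sub>R G c x) = G b x" for x
  proof -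
    have "(\<Sum>c\<in>Basis. (b \<bullet> c) *\<^sub>R G c x) = (\<Sum>c\<in>Basis. if c = b then G c x else 0)"
      using b by (intro sum.cong) (auto simp: inner_Basis)
    then show ?thesis using b by simp
  qed
  let ?f' = "\<lambda>x h. g x * (of_real (\<alpha> * (h \<bullet> \<eta>)) * (\<i> * ?c x)) + (\<Sum>b\<in>Basis. (h \<bullet> b) *\<^sub>R G b x) * ?c x"
  have dc: "(?c has_derivative (\<lambda>h. of_real (\<alpha> * (h \<bullet> \<eta>)) * (\<i> * ?c x))) (at x)" for x
  proof -
    have "((\<lambda>y. \<alpha> * (y \<bullet> \<eta>)) has_derivative (\<lambda>h. \<alpha> * (h \<bullet> \<eta>))) (at x)"
      by (intro bounded_linear.has_derivative[OF _ has_derivative_ident] bounded_linear_intros)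
    then have "((\<lambda>y. \<i> * of_real (\<alpha> * (y \<bullet> \<eta>))) has_derivative (\<lambda>h. \<i> * of_real (\<alpha> * (h \<bullet> \<eta>)))) (at x)"
      by (rule has_derivative_mult_right[OF has_derivative_of_real])
    from has_derivative_compose[OF this DERIV_exp[unfolded has_field_derivative_def]]
    have "((\<lambda>y. exp (\<i> * of_real (\<alpha> * (y \<bullet> \<eta>)))) has_derivative (\<lambda>h. exp (\<i> * of_real (\<alpha> * (x \<bullet> \<eta>))) * (\<i> * of_real (\<alpha> * (h \<bullet> \<eta>))))) (at x)" .
    then show ?thesis by (simp add: cis_conv_exp mult_ac)
  qed
  have d: "((\<lambda>y. g y * ?c y) has_derivative ?f' x) (at x)" for x
    by (rule has_derivative_mult[OF G[rule_format] dc])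
  have f'b: "?f' x b = (\<i> * of_real (\<alpha> * (b \<bullet> \<eta>))) * (g x * ?c x) + G b x * ?c x" for x
    by (simp add: basis mult_ac)
  note iG = ic[OF schwartz_family_integrable[OF S(1) GS[rule_format, OF b]]] and ig = ic[OF schwartz_family_integrable[OF S]]
  have "(\<integral>x. ?f' x b \<partial>lborel) = 0"
  proof (rule integral_derivative_eq_0[OF d])
    show "continuous_on UNIV (\<lambda>x. ?f' x b)"
      unfolding f'b by (intro continuous_intros schwartz_family_continuous[OF S] schwartz_family_continuous[OF S(1) GS[rule_format, OF b]])
    show "integrable lborel (\<lambda>y. g y * ?c y)" by (rule ig)
    show "integrable lborel (\<lambda>x. ?f' x b)" unfolding f'b by (intro Bochner_Integration.integrable_add integrable_mult_right ig iG)
  qed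
  then have "(\<i> * of_real (\<alpha> * (b \<bullet> \<eta>))) * euclidean_fourier \<alpha> g \<eta> + euclidean_fourier \<alpha> (G b) \<eta> = 0"
    unfolding f'b using ig iG by (simp add: euclidean_fourier_def)
  then have "euclidean_fourier \<alpha> (G b) \<eta> = - ((\<i> * of_real (\<alpha> * (b \<bullet> \<eta>))) * euclidean_fourier \<alpha> g \<eta>)"
    by (simp add: eq_neg_iff_add_eq_0 add.commute)
  then show ?thesis by (simp add: norm_mult abs_mult)
qed

text \<open>Repeated integration by parts in one direction bounds a power of that coordinate times
  the transform; some coordinate is always comparable to the norm.\<close>

lemma euclidean_fourier_decay:
  fixes f :: "'a::euclidean_space \<Rightarrow> complex"
  assumes f: "schwartz_function f" and \<alpha>: "\<alpha> \<noteq> 0"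
  obtains B where "\<And>\<eta>. norm \<eta> ^ k * cmod (euclidean_fourier \<alpha> f \<eta>) \<le> B"
proof -
  obtain S where S: "schwartz_family S" "f \<in> S" by (rule schwartz_functionE[OF f])
  have coord: "\<exists>B. \<forall>\<eta>. \<bar>\<alpha> * (b \<bullet> \<eta>)\<bar> ^ k * cmod (euclidean_fourier \<alpha> g \<eta>) \<le> B" if g: "g \<in> S" and b: "b \<in> Basis" for g b k
    using g
  proof (induction k arbitrary: g)
    case 0
    have "cmod (euclidean_fourier \<alpha> g \<eta>) \<le> (\<integral>y. norm (g y) \<partial>lborel)" for \<eta>
    proof -
      have "cmod (euclidean_fourier \<alpha> g \<eta>) \<le> (\<integral>y. norm (g y * cis (\<alpha> * (y \<bullet> \<eta>))) \<partial>lborel)"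
        unfolding euclidean_fourier_def by (rule integral_norm_bound)
      then show ?thesis by (simp add: norm_mult)
    qed
    then show ?case by auto
  next
    case (Suc k)
    obtain G where G: "\<forall>b\<in>Basis. G b \<in> S" "\<forall>x. (g has_derivative (\<lambda>h. \<Sum>b\<in>Basis. (h \<bullet> b) *\<^sub>R G b x)) (at x)"
      using S(1) Suc.prems unfolding schwartz_family_def by blast
    obtain B where "\<forall>\<eta>. \<bar>\<alpha> * (b \<bullet> \<eta>)\<bar> ^ k * cmod (euclidean_fourier \<alpha> (G b) \<eta>) \<le> B" using Suc.IH G(1) b by blast
    then show ?case
      unfolding euclidean_fourier_derivative[OF S(1) Suc.prems G b] by (intro exI[of _ B]) (simp add: mult_ac)
  qed
  then have "\<forall>b\<in>Basis. \<exists>B. \<forall>\<eta>. \<bar>\<alpha> * (b \<bullet> \<eta>)\<bar> ^ k * cmod (euclidean_fourier \<alpha> f \<eta>) \<le> B" using S(2) by blast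
  then obtain B where B: "\<And>b \<eta>. b \<in> Basis \<Longrightarrow> \<bar>\<alpha> * (b \<bullet> \<eta>)\<bar> ^ k * cmod (euclidean_fourier \<alpha> f \<eta>) \<le> B b" by metis
  have Bnn: "0 \<le> B b" if "b \<in> Basis" for b using order_trans[OF _ B[OF that, of 0]] by (simp add: zero_le_mult_iff)
  let ?d = "real DIM('a)"
  have "norm \<eta> ^ k * cmod (euclidean_fourier \<alpha> f \<eta>) \<le> (?d / \<bar>\<alpha>\<bar>) ^ k * (\<Sum>b\<in>Basis. B b)" for \<eta>
  proof -
    \<comment> \<open>The norm is at most the sum of the absolute coordinates, so one of them is at
      least the average \<open>norm \<eta> / ?d\<close>.\<close>
    have "\<exists>b\<in>Basis. norm \<eta> \<le> ?d * \<bar>b \<bullet> \<eta>\<bar>"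
    proof (rule ccontr)
      assume "\<not> ?thesis"
      then have "(\<Sum>b\<in>Basis. \<bar>\<eta> \<bullet> b\<bar>) < (\<Sum>b\<in>(Basis::'a set). norm \<eta> / ?d)"
        by (intro sum_strict_mono) (auto simp: not_le field_simps inner_commute)
      also have "\<dots> = norm \<eta>" by simp
      finally show False using norm_le_l1[of \<eta>] by simp
    qed
    then obtain b where b: "b \<in> Basis" "norm \<eta> \<le> ?d * \<bar>b \<bullet> \<eta>\<bar>" by blast
    have "norm \<eta> ^ k \<le> (?d / \<bar>\<alpha>\<bar> * \<bar>\<alpha> * (b \<bullet> \<eta>)\<bar>) ^ k" using b \<alpha> by (intro power_mono) (auto simp: abs_mult)
    then have "norm \<eta> ^ k * cmod (euclidean_fourier \<alpha> f \<eta>) \<le> (?d / \<bar>\<alpha>\<bar> * \<bar>\<alpha> * (b \<bullet> \<eta>)\<bar>) ^ k * cmod (euclidean_fourier \<alpha> f \<eta>)"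
      by (intro mult_right_mono) auto
    also have "\<dots> = (?d / \<bar>\<alpha>\<bar>) ^ k * (\<bar>\<alpha> * (b \<bullet> \<eta>)\<bar> ^ k * cmod (euclidean_fourier \<alpha> f \<eta>))" by (simp only: power_mult_distrib mult.assoc)
    also have "\<dots> \<le> (?d / \<bar>\<alpha>\<bar>) ^ k * B b" by (intro mult_left_mono B b) auto
    also have "\<dots> \<le> (?d / \<bar>\<alpha>\<bar>) ^ k * (\<Sum>b\<in>Basis. B b)" using Bnn b by (intro mult_left_mono member_le_sum) auto
    finally show ?thesis .
  qed
  then show ?thesis by (rule that)
qed

section \<open>Gaussians, a Frullani integral and superpositions of dilates\<close>

text \<open>A rescaling of the characteristic function of the standard normal distribution.\<close>

lemma gaussian_fourier_real:
  assumes \<tau>: "\<tau> > 0"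
  shows "integrable lborel (\<lambda>x. complex_of_real (exp (- (\<tau> * x)\<^sup>2)) * cis (\<beta> * x))"
    and "(\<integral>x. complex_of_real (exp (- (\<tau> * x)\<^sup>2)) * cis (\<beta> * x) \<partial>lborel) = of_real (sqrt pi / \<tau> * exp (- (\<beta>\<^sup>2 / (4 * \<tau>\<^sup>2))))"
proof -
  \<comment> \<open>The frequency at which substituting \<open>sqrt 2 * \<tau> * x\<close> produces
    \<open>\<beta> * x\<close>; the same substitution turns the normal density into the Gaussian up
    to a factor.\<close>
  define t where "t = \<beta> / (sqrt 2 * \<tau>)"
  let ?n = "\<lambda>x. complex_of_real (std_normal_density x) * cis (t * x)"
  have [measurable]: "(\<lambda>x. cis (t * x)) \<in> borel_measurable borel" by (intro borel_measurable_continuous_onI continuous_intros)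
  have int: "integrable lborel ?n"
    by (rule Bochner_Integration.integrable_bound[OF integrable_normal_density[of 1 0]]) (auto simp: norm_mult)
  have val: "(\<integral>x. ?n x \<partial>lborel) = of_real (exp (- t\<^sup>2 / 2))"
  proof -
    have "char std_normal_distribution t = (\<integral>x. std_normal_density x *\<^sub>R iexp (t * x) \<partial>lborel)"
      unfolding char_def by (subst integral_density) auto
    then show ?thesis by (simp add: char_std_normal_distribution scaleR_conv_of_real cis_conv_exp)
  qed
  have c: "sqrt 2 * \<tau> \<noteq> 0" using \<tau> by simp
  have eq: "?n (0 + sqrt 2 * \<tau> * x) = of_real (1 / sqrt (2 * pi)) * (of_real (exp (- (\<tau> * x)\<^sup>2)) * cis (\<beta> * x))" for x
  proof -
    have "std_normal_density (sqrt 2 * \<tau> * x) = 1 / sqrt (2 * pi) * exp (- (\<tau> * x)\<^sup>2)"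
      unfolding std_normal_density_def by (simp add: power_mult_distrib)
    moreover have "t * (sqrt 2 * \<tau> * x) = \<beta> * x" using c by (simp add: t_def field_simps)
    ultimately show ?thesis by (simp only: add_0 of_real_mult mult.assoc)
  qed
  have "integrable lborel (\<lambda>x. ?n (0 + sqrt 2 * \<tau> * x))"
    by (rule lborel_integrable_real_affine[OF int c])
  then have "integrable lborel (\<lambda>x. of_real (sqrt (2 * pi)) * (of_real (1 / sqrt (2 * pi)) * (complex_of_real (exp (- (\<tau> * x)\<^sup>2)) * cis (\<beta> * x))))"
    unfolding eq by (rule integrable_mult_right)
  moreover have "of_real (sqrt (2 * pi)) * (of_real (1 / sqrt (2 * pi)) * w) = w" for w :: complex
    by (simp add: mult.assoc[symmetric] flip: of_real_mult)
  ultimately show "integrable lborel (\<lambda>x. complex_of_real (exp (- (\<tau> * x)\<^sup>2)) * cis (\<beta> * x))" by (simp only:)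
  have "(\<integral>x. ?n x \<partial>lborel) = \<bar>sqrt 2 * \<tau>\<bar> *\<^sub>R (\<integral>x. ?n (0 + sqrt 2 * \<tau> * x) \<partial>lborel)"
    by (rule lborel_integral_real_affine[OF c])
  then have "of_real (exp (- t\<^sup>2 / 2)) = of_real (sqrt 2 * \<tau> / sqrt (2 * pi)) * (\<integral>x. complex_of_real (exp (- (\<tau> * x)\<^sup>2)) * cis (\<beta> * x) \<partial>lborel)"
    unfolding eq val using \<tau> by (simp add: scaleR_conv_of_real)
  moreover have "sqrt 2 * \<tau> / sqrt (2 * pi) = \<tau> / sqrt pi" by (simp add: real_sqrt_mult)
  moreover have "- t\<^sup>2 / 2 = - (\<beta>\<^sup>2 / (4 * \<tau>\<^sup>2))" by (simp add: t_def power_divide power_mult_distrib)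
  ultimately have "of_real (exp (- (\<beta>\<^sup>2 / (4 * \<tau>\<^sup>2)))) = of_real (\<tau> / sqrt pi) * (\<integral>x. complex_of_real (exp (- (\<tau> * x)\<^sup>2)) * cis (\<beta> * x) \<partial>lborel)"
    by metis
  moreover have "of_real (sqrt pi / \<tau>) * (of_real (\<tau> / sqrt pi) * w) = w" for w :: complex
  proof -
    have "sqrt pi / \<tau> * (\<tau> / sqrt pi) = 1" using \<tau> by simp
    then show ?thesis by (simp only: mult.assoc[symmetric] of_real_mult[symmetric]) simp
  qed
  ultimately show "(\<integral>x. complex_of_real (exp (- (\<tau> * x)\<^sup>2)) * cis (\<beta> * x) \<partial>lborel) = of_real (sqrt pi / \<tau> * exp (- (\<beta>\<^sup>2 / (4 * \<tau>\<^sup>2))))"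
    by (simp only: of_real_mult)
qed

text \<open>Both the Gaussian and the character factor over an orthonormal basis, so the integral is
  a product of one-dimensional ones.\<close>

lemma gaussian_fourier:
  fixes z :: "'a::euclidean_space"
  assumes \<tau>: "\<tau> > 0"
  shows "integrable lborel (\<lambda>x::'a. exp (- (\<tau> * norm x)\<^sup>2))"
    and "(\<integral>x. complex_of_real (exp (- (\<tau> * norm x)\<^sup>2)) * cis (\<alpha> * (x \<bullet> z)) \<partial>lborel) =
      of_real ((sqrt pi / \<tau>) ^ DIM('a) * exp (- (\<alpha>\<^sup>2 * (norm z)\<^sup>2 / (4 * \<tau>\<^sup>2))))"
proof -
  interpret product_sigma_finite "\<lambda>_::'a. lborel :: real measure" ..
  let ?f = "\<lambda>(w::'a) (b::'a) (x::real). complex_of_real (exp (- (\<tau> * x)\<^sup>2)) * cis (\<alpha> * (w \<bullet> b) * x)"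
  let ?F = "\<lambda>(w::'a) (x::'a). complex_of_real (exp (- (\<tau> * norm x)\<^sup>2)) * cis (\<alpha> * (x \<bullet> w))"
  have prod_cis: "(\<Prod>b\<in>B. cis (h b)) = cis (\<Sum>b\<in>B. h b)" for h :: "'a \<Rightarrow> real" and B
    by (induction B rule: infinite_finite_induct) (auto simp: cis_mult)
  have fac: "?F w (\<Sum>b\<in>Basis. x b *\<^sub>R b) = (\<Prod>b\<in>Basis. ?f w b (x b))" for w x
  proof -
    let ?y = "\<Sum>b\<in>Basis. x b *\<^sub>R b"
    have "(norm ?y)\<^sup>2 = (\<Sum>b\<in>Basis. (x b)\<^sup>2)"
      unfolding power2_norm_eq_inner by (subst euclidean_inner) (simp add: power2_eq_square)
    then have "exp (- (\<tau> * norm ?y)\<^sup>2) = (\<Prod>b\<in>Basis. exp (- (\<tau> * x b)\<^sup>2))"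
      by (subst exp_sum[symmetric]) (auto simp: power_mult_distrib sum_distrib_left sum_negf)
    moreover have "\<alpha> * (?y \<bullet> w) = (\<Sum>b\<in>Basis. \<alpha> * (w \<bullet> b) * x b)"
      by (subst euclidean_inner) (simp add: sum_distrib_left mult_ac)
    moreover have "cis (\<Sum>b\<in>Basis. \<alpha> * (w \<bullet> b) * x b) = (\<Prod>b\<in>Basis. cis (\<alpha> * (w \<bullet> b) * x b))"
      by (rule prod_cis[symmetric])
    ultimately show ?thesis by (simp only: prod.distrib of_real_prod)
  qed
  have meas: "?F w \<in> borel_measurable borel" for w by (intro borel_measurable_continuous_onI continuous_intros)
  have pm: "(\<lambda>f. \<Sum>b\<in>Basis. f b *\<^sub>R b) \<in> (\<Pi>\<^sub>M b\<in>Basis. lborel) \<rightarrow>\<^sub>M (borel :: 'a measure)" by simp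
  have intf: "integrable lborel (?f w b)" for w b by (rule gaussian_fourier_real[OF \<tau>])
  have "integrable (\<Pi>\<^sub>M b\<in>Basis. lborel) (\<lambda>x. \<Prod>b\<in>Basis. ?f w b (x b))" for w
    by (rule product_integrable_prod) (auto intro: intf)
  then have "integrable lborel (?F w)" for w
    by (subst lborel_eq) (subst integrable_distr_eq[OF pm meas], simp only: fac)
  then have "integrable lborel (\<lambda>x. norm (?F 0 x))" by (rule integrable_norm)
  then show "integrable lborel (\<lambda>x::'a. exp (- (\<tau> * norm x)\<^sup>2))" by simp
  have "(\<integral>x. ?F z x \<partial>lborel) = (\<integral>x. (\<Prod>b\<in>Basis. ?f z b (x b)) \<partial>(\<Pi>\<^sub>M b\<in>Basis. lborel))"
    by (subst lborel_eq) (subst integral_distr[OF pm meas], simp only: fac)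
  also have "\<dots> = (\<Prod>b\<in>Basis. \<integral>x. ?f z b x \<partial>lborel)"
    by (rule product_integral_prod) (auto intro: intf)
  also have "\<dots> = (\<Prod>b\<in>Basis. of_real (sqrt pi / \<tau> * exp (- ((\<alpha> * (z \<bullet> b))\<^sup>2 / (4 * \<tau>\<^sup>2)))))"
    by (simp only: gaussian_fourier_real(2)[OF \<tau>])
  also have "\<dots> = of_real ((sqrt pi / \<tau>) ^ DIM('a) * exp (\<Sum>b\<in>Basis. - ((\<alpha> * (z \<bullet> b))\<^sup>2 / (4 * \<tau>\<^sup>2))))"
    by (simp only: of_real_prod[symmetric] prod.distrib exp_sum[OF finite_Basis] prod_constant)
  also have "(\<Sum>b\<in>Basis. - ((\<alpha> * (z \<bullet> b))\<^sup>2 / (4 * \<tau>\<^sup>2))) = - (\<alpha>\<^sup>2 * (norm z)\<^sup>2 / (4 * \<tau>\<^sup>2))"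
  proof -
    have "(norm z)\<^sup>2 = (\<Sum>b\<in>Basis. (z \<bullet> b)\<^sup>2)"
      unfolding power2_norm_eq_inner by (subst euclidean_inner) (simp add: power2_eq_square)
    then show ?thesis by (simp add: power_mult_distrib sum_negf sum_distrib_left sum_divide_distrib)
  qed
  finally show "(\<integral>x. ?F z x \<partial>lborel) = of_real ((sqrt pi / \<tau>) ^ DIM('a) * exp (- (\<alpha>\<^sup>2 * (norm z)\<^sup>2 / (4 * \<tau>\<^sup>2))))" .
qed

text \<open>The integrand is the derivative of -exp(-exp(\<open>\<beta>\<close> s)), which increases
  from -1 to 0.\<close>

lemma nn_integral_gompertz:
  fixes \<beta> :: real
  assumes \<beta>: "\<beta> > 0"
  shows "(\<integral>\<^sup>+s. ennreal (\<beta> * exp (\<beta> * s) * exp (- exp (\<beta> * s))) \<partial>lborel) = 1"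
proof -
  let ?p = "\<lambda>s. \<beta> * exp (\<beta> * s) * exp (- exp (\<beta> * s))"
  let ?F = "\<lambda>s. - exp (- exp (\<beta> * s))"
  have l1: "((\<lambda>s. exp (\<beta> * s)) \<longlongrightarrow> 0) at_bot" and l2: "filterlim (\<lambda>s. exp (\<beta> * s)) at_top at_top"
    by (rule filterlim_compose[OF exp_at_bot filterlim_tendsto_pos_mult_at_bot[OF tendsto_const \<beta> filterlim_ident]],
        rule filterlim_compose[OF exp_at_top filterlim_tendsto_pos_mult_at_top[OF tendsto_const \<beta> filterlim_ident]])
  have "(?F \<longlongrightarrow> - exp (- 0)) at_bot" by (intro tendsto_intros l1)
  then have A: "((?F \<circ> real_of_ereal) \<longlongrightarrow> -1) (at_right (-\<infinity>))"
    by (simp add: ereal_tendsto_simps)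
  have "((\<lambda>s. exp (- exp (\<beta> * s))) \<longlongrightarrow> 0) at_top"
    using l2 by (intro filterlim_compose[OF exp_at_bot]) (simp add: filterlim_uminus_at_bot)
  then have "(?F \<longlongrightarrow> - 0) at_top" by (rule tendsto_minus)
  then have B: "((?F \<circ> real_of_ereal) \<longlongrightarrow> 0) (at_left \<infinity>)"
    by (simp add: ereal_tendsto_simps)
  have si: "set_integrable lborel (einterval (-\<infinity>) \<infinity>) ?p" "(LBINT s=-\<infinity>..\<infinity>. ?p s) = 0 - (- 1)"
    by (rule interval_integral_FTC_nonneg[OF _ _ _ _ A B]; use \<beta> in \<open>auto intro!: derivative_eq_intros continuous_intros\<close>)+
  have "integrable lborel ?p" "(\<integral>s. ?p s \<partial>lborel) = 1"
    using si by (simp_all add: set_integrable_def interval_lebesgue_integral_def set_lebesgue_integral_def)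
  then show ?thesis using \<beta> by (subst nn_integral_eq_integral) auto
qed

text \<open>Frullani's integral in a logarithmic variable: \<open>h\<close> falls from 1 to 0, so
  the area between \<open>h\<close> and its translate by \<open>b\<close> is \<open>b\<close>.
  Writing the difference as an integral of the density of the previous lemma over a window of length
  \<open>b\<close> and exchanging the integrals proves it. With \<open>b\<close> the logarithm of
  |x| the translate becomes a dilated Gaussian at x.\<close>

lemma frullani_shift:
  fixes \<beta> b :: real
  assumes \<beta>: "\<beta> > 0"
  defines "h \<equiv> \<lambda>s. exp (- exp (\<beta> * s))"
  shows "(\<integral>\<^sup>+s. ennreal \<bar>h s - h (s + b)\<bar> \<partial>lborel) = ennreal \<bar>b\<bar>"
    and "(\<integral>s. h s - h (s + b) \<partial>lborel) = b"
proof -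
  let ?p = "\<lambda>s. \<beta> * exp (\<beta> * s) * exp (- exp (\<beta> * s))"
  have h_mono: "h t \<le> h s" if "s \<le> t" for s t using that \<beta> by (simp add: h_def)
  have [measurable]: "h \<in> borel_measurable borel" unfolding h_def by measurable
  have pos: "(\<integral>\<^sup>+s. ennreal (h s - h (s + b)) \<partial>lborel) = ennreal b" if b: "b \<ge> 0" for b
  proof -
    have "ennreal (h s - h (s + b)) = (\<integral>\<^sup>+u. ennreal (?p (s + u)) * indicator {0..b} u \<partial>lborel)" for s
    proof -
      have "(\<integral>\<^sup>+u. ennreal (?p (s + u)) * indicator {0..b} u \<partial>lborel) = ennreal (- h (s + b) - - h (s + 0))"
        by (rule nn_integral_FTC_Icc) (use b \<beta> in \<open>auto intro!: derivative_eq_intros simp: h_def algebra_simps\<close>)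
      then show ?thesis by simp
    qed
    then have "(\<integral>\<^sup>+s. ennreal (h s - h (s + b)) \<partial>lborel) = (\<integral>\<^sup>+s. \<integral>\<^sup>+u. ennreal (?p (s + u)) * indicator {0..b} u \<partial>lborel \<partial>lborel)" by simp
    also have "\<dots> = (\<integral>\<^sup>+u. \<integral>\<^sup>+s. ennreal (?p (s + u)) * indicator {0..b} u \<partial>lborel \<partial>lborel)"
      by (rule lborel_pair.Fubini'[symmetric]) measurable
    also have "\<dots> = (\<integral>\<^sup>+u. indicator {0..b} u \<partial>lborel)"
    proof (rule nn_integral_cong)
      fix u :: real
      have "(\<integral>\<^sup>+s. ennreal (?p (s + u)) * indicator {0..b} u \<partial>lborel) = (\<integral>\<^sup>+s. ennreal (?p (s + u)) \<partial>lborel) * indicator {0..b} u"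
        by (rule nn_integral_multc) measurable
      also have "(\<integral>\<^sup>+s. ennreal (?p (s + u)) \<partial>lborel) = (\<integral>\<^sup>+s. ennreal (?p s) \<partial>lborel)"
        using nn_integral_real_affine[of "\<lambda>s. ennreal (?p s)" 1 u] by (simp add: add.commute)
      finally show "(\<integral>\<^sup>+s. ennreal (?p (s + u)) * indicator {0..b} u \<partial>lborel) = indicator {0..b} u"
        by (simp only: nn_integral_gompertz[OF \<beta>] mult_1)
    qed
    finally show ?thesis using b by simp
  qed
  have hb: "has_bochner_integral lborel (\<lambda>s. h s - h (s + b)) b" if "b \<ge> 0" for b
    by (rule has_bochner_integral_nn_integral) (use that pos h_mono in auto)
  have 1: "(\<integral>\<^sup>+s. ennreal \<bar>h s - h (s + b)\<bar> \<partial>lborel) = ennreal \<bar>b\<bar> \<and> (\<integral>s. h s - h (s + b) \<partial>lborel) = b"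
  proof (cases "b \<ge> 0")
    case True
    then show ?thesis using pos[OF True] has_bochner_integral_integral_eq[OF hb[OF True]] h_mono by (simp add: abs_of_nonneg)
  next
    case False
    then have nb: "- b \<ge> 0" by simp
    have "(\<integral>\<^sup>+s. ennreal \<bar>h s - h (s + b)\<bar> \<partial>lborel) = (\<integral>\<^sup>+s. ennreal \<bar>h (s - b) - h s\<bar> \<partial>lborel)"
      using nn_integral_real_affine[of "\<lambda>s. ennreal \<bar>h s - h (s + b)\<bar>" 1 "- b"] by simp
    also have "\<dots> = (\<integral>\<^sup>+s. ennreal (h s - h (s + - b)) \<partial>lborel)"
    proof (rule nn_integral_cong)
      fix s show "ennreal \<bar>h (s - b) - h s\<bar> = ennreal (h s - h (s + - b))"
        using h_mono[of s "s - b"] nb by simp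
    qed
    finally have A: "(\<integral>\<^sup>+s. ennreal \<bar>h s - h (s + b)\<bar> \<partial>lborel) = ennreal \<bar>b\<bar>" using pos[OF nb] nb by simp
    have "(\<integral>s. h s - h (s + b) \<partial>lborel) = (\<integral>s. h (s - b) - h s \<partial>lborel)"
      using lborel_integral_real_affine[of 1 "\<lambda>s. h s - h (s + b)" "- b"] by simp
    also have "\<dots> = (\<integral>s. - (h s - h (s + - b)) \<partial>lborel)" by simp
    also have "\<dots> = b" using has_bochner_integral_integral_eq[OF hb[OF nb]] by (simp only: integral_minus minus_minus)
    finally show ?thesis using A by simp
  qed
  then show "(\<integral>\<^sup>+s. ennreal \<bar>h s - h (s + b)\<bar> \<partial>lborel) = ennreal \<bar>b\<bar>" "(\<integral>s. h s - h (s + b) \<partial>lborel) = b" by auto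
qed

text \<open>Recentring at \<open>t = ln a / \<beta>\<close> extracts the power of \<open>a\<close>
  and leaves a fixed function. That function is at most 2 exp(-|s|), whose integral is 4: for
  negative \<open>s\<close> the hypothesis on \<open>\<beta>\<close> and exp(-u) <= 2/u^2 are used.
  With \<open>a\<close> proportional to the squared norm this becomes the bound of order 1/|x| for
  the convolution kernel.\<close>

lemma nn_integral_dilated_gaussian:
  fixes a \<beta> :: real
  assumes a: "a > 0" and \<beta>: "\<beta> \<ge> 1"
  shows "(\<integral>\<^sup>+s. ennreal (exp (- s) * exp (- (a * exp (- (\<beta> * s))))) \<partial>lborel) \<le> ennreal (4 * a powr (- 1 / \<beta>))"
proof -
  define t where "t = ln a / \<beta>"
  let ?w = "\<lambda>s. exp (- s) * exp (- exp (- (\<beta> * s)))"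
  have w: "?w s \<le> 2 * exp (- \<bar>s\<bar>)" for s :: real
  proof (cases "s \<ge> 0")
    case True
    have "?w s \<le> exp (- s) * 1" by (intro mult_left_mono) auto
    also have "exp (- s) * 1 \<le> 2 * exp (- s)" by simp
    finally show ?thesis using True by simp
  next
    case False
    let ?x = "exp (- s)"
    have "- s \<le> - (\<beta> * s)" using False \<beta> mult_right_mono_neg[of 1 \<beta> s] by simp
    then have "exp (- exp (- (\<beta> * s))) \<le> exp (- ?x)" by simp
    also have "\<dots> \<le> 2 / ?x\<^sup>2"
    proof -
      have "1 + ?x + ?x\<^sup>2 / 2 \<le> exp ?x" by (rule exp_lower_Taylor_quadratic) simp
      moreover have "0 \<le> 1 + ?x" by (simp add: add_nonneg_nonneg)
      ultimately have "?x\<^sup>2 / 2 \<le> exp ?x" by linarith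
      then have "inverse (exp ?x) \<le> inverse (?x\<^sup>2 / 2)" by (intro le_imp_inverse_le) auto
      then show ?thesis by (simp add: exp_minus)
    qed
    finally have "?w s \<le> ?x * (2 / ?x\<^sup>2)" by (intro mult_left_mono) auto
    also have "\<dots> = 2 * exp s" by (simp add: power2_eq_square exp_minus divide_inverse)
    finally show ?thesis using False by simp
  qed
  have e1: "(\<integral>\<^sup>+s. ennreal (exp (- s)) * indicator {0..} s \<partial>lborel) = ennreal (0 - - exp (- 0))"
  proof (rule nn_integral_FTC_atLeast)
    have "((\<lambda>s::real. exp (- s)) \<longlongrightarrow> 0) at_top"
      by (rule filterlim_compose[OF exp_at_bot filterlim_uminus_at_bot_at_top])
    then show "((\<lambda>s::real. - exp (- s)) \<longlongrightarrow> 0) at_top" using tendsto_minus by fastforce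
  qed (auto intro!: derivative_eq_intros)
  have e2: "(\<integral>\<^sup>+s. ennreal (exp s) * indicator {0..} (- s) \<partial>lborel) = (\<integral>\<^sup>+s. ennreal (exp (- s)) * indicator {0..} s \<partial>lborel)"
    using nn_integral_real_affine[of "\<lambda>s. ennreal (exp (- s)) * indicator {0..} s" "-1" 0] by simp
  have "(\<integral>\<^sup>+s. ennreal (exp (- s) * exp (- (a * exp (- (\<beta> * s))))) \<partial>lborel) =
    (\<integral>\<^sup>+s. ennreal (exp (- (t + 1 * s)) * exp (- (a * exp (- (\<beta> * (t + 1 * s)))))) \<partial>lborel)"
    using nn_integral_real_affine[of "\<lambda>s. ennreal (exp (- s) * exp (- (a * exp (- (\<beta> * s)))))" 1 t] by simp
  also have "\<dots> = (\<integral>\<^sup>+s. ennreal (a powr (- 1 / \<beta>)) * ennreal (?w s) \<partial>lborel)"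
  proof (rule nn_integral_cong)
    fix s :: real
    have "exp (- (\<beta> * (t + 1 * s))) = exp (- ln a) * exp (- (\<beta> * s))"
      using \<beta> by (simp add: t_def distrib_left flip: exp_add)
    then have "a * exp (- (\<beta> * (t + 1 * s))) = exp (- (\<beta> * s))" using a by (simp add: exp_minus)
    moreover have "exp (- (t + 1 * s)) = a powr (- 1 / \<beta>) * exp (- s)"
      using a by (simp add: t_def powr_def flip: exp_add)
    ultimately show "ennreal (exp (- (t + 1 * s)) * exp (- (a * exp (- (\<beta> * (t + 1 * s)))))) = ennreal (a powr (- 1 / \<beta>)) * ennreal (?w s)"
      by (simp add: ennreal_mult'[symmetric] mult.assoc)
  qed
  also have "\<dots> = ennreal (a powr (- 1 / \<beta>)) * (\<integral>\<^sup>+s. ennreal (?w s) \<partial>lborel)"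
    by (rule nn_integral_cmult) measurable
  also have "(\<integral>\<^sup>+s. ennreal (?w s) \<partial>lborel) \<le> (\<integral>\<^sup>+s. 2 * (ennreal (exp (- s)) * indicator {0..} s + ennreal (exp s) * indicator {0..} (- s)) \<partial>lborel)"
  proof (rule nn_integral_mono)
    fix s :: real
    have "ennreal (?w s) \<le> ennreal (2 * exp (- \<bar>s\<bar>))" by (rule ennreal_leI[OF w])
    also have "\<dots> = 2 * ennreal (exp (- \<bar>s\<bar>))" by (simp add: ennreal_mult')
    also have "\<dots> \<le> 2 * (ennreal (exp (- s)) * indicator {0..} s + ennreal (exp s) * indicator {0..} (- s))"
      by (intro mult_left_mono) (auto simp: indicator_def)
    finally show "ennreal (?w s) \<le> 2 * (ennreal (exp (- s)) * indicator {0..} s + ennreal (exp s) * indicator {0..} (- s))" .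
  qed
  also have "\<dots> = 2 * (1 + 1)"
    by (subst nn_integral_cmult, measurable, subst nn_integral_add, measurable, simp only: e2 e1) simp
  also have "\<dots> = ennreal 4" by simp
  finally have "(\<integral>\<^sup>+s. ennreal (exp (- s) * exp (- (a * exp (- (\<beta> * s))))) \<partial>lborel) \<le> ennreal (a powr (- 1 / \<beta>)) * ennreal 4"
    by (simp add: mult_left_mono)
  also have "\<dots> = ennreal (4 * a powr (- 1 / \<beta>))" by (subst ennreal_mult'[symmetric]) (auto simp: mult.commute)
  finally show ?thesis .
qed

section \<open>Archimedean places\<close>

text \<open>Treats the reals and the complex numbers together. The map \<open>\<sigma>\<close> is
  the identity or conjugation, which makes the real part of a product the inner product of one
  factor with \<open>\<sigma>\<close> of the other; \<open>\<alpha>\<close> is -2 pi or -4 pi, the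
  extra 2 coming from the trace of the complex numbers.\<close>

locale arch_place =
  fixes e :: "'a::{real_normed_field, euclidean_space} \<Rightarrow> 'k::{field_char_0, complete_space}"
    and M :: "'k measure" and \<sigma> :: "'a \<Rightarrow> 'a" and \<alpha> :: real
  assumes iso: "topological_field_iso e" and sd: "self_dual_haar_measure M"
    and dim: "DIM('a) \<le> 2"
    and abs_e: "\<And>x. normalized_abs (e x) = norm x ^ DIM('a)"
    and char_e: "\<And>x y. place_char (e x * e y) = cis (\<alpha> * (x \<bullet> \<sigma> y))"
    and \<sigma>: "\<And>y. norm (\<sigma> y) = norm y" and \<alpha>: "\<alpha> \<noteq> 0"
    and sb: "\<And>\<phi>. schwartz_function (\<phi> \<circ> e) \<Longrightarrow> schwartz_bruhat \<phi>"
begin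

lemma e_add: "e (x + y) = e x + e y" and e_mult: "e (x * y) = e x * e y" and e_1: "e 1 = 1"
  and cont_e: "continuous_on UNIV e" and cont_inv: "continuous_on UNIV (inv e)"
  and e_inv[simp]: "e (inv e z) = z" and inv_e[simp]: "inv e (e x) = x"
  using iso by (auto simp: topological_field_iso_def homeomorphism_def)

lemma e_0[simp]: "e 0 = 0" using e_add[of 0 0] by simp

lemma e_minus: "e (- x) = - e x" using e_add[of x "- x"] by (simp add: eq_neg_iff_add_eq_0 add.commute)

lemma e_diff: "e (x - y) = e x - e y" using e_add[of x "- y"] by (simp add: e_minus)

lemma e_eq_0[simp]: "e x = 0 \<longleftrightarrow> x = 0" by (metis e_0 inv_e)

lemma inv_eq_0[simp]: "inv e x = 0 \<longleftrightarrow> x = 0" by (metis e_0 inv_e e_inv)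

lemma e_meas[measurable]: "e \<in> borel \<rightarrow>\<^sub>M borel" and inv_meas[measurable]: "inv e \<in> borel \<rightarrow>\<^sub>M borel"
  by (intro borel_measurable_continuous_onI cont_e cont_inv)+

lemma haar: "haar_measure M" and inversion: "schwartz_bruhat \<phi> \<Longrightarrow> inv_fourier M (fourier M \<phi>) = \<phi>"
  using sd by (auto simp: self_dual_haar_measure_def)

lemma setsM[measurable_cong]: "sets M = sets borel" using haar by (simp add: haar_measure_def)

lemma spM[simp]: "space M = UNIV" using sets_eq_imp_space_eq[OF setsM] by simp

lemma diff_pair: "(\<lambda>(x, y). x - y) \<in> borel \<Otimes>\<^sub>M borel \<rightarrow>\<^sub>M (borel :: 'k measure)"
proof -
  have "(\<lambda>w. e (inv e (fst w) - inv e (snd w))) \<in> borel \<Otimes>\<^sub>M borel \<rightarrow>\<^sub>M borel" by measurable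
  then show ?thesis by (simp add: e_diff split_beta')
qed

lemma mult_pair: "(\<lambda>(x, y). x * y) \<in> borel \<Otimes>\<^sub>M borel \<rightarrow>\<^sub>M (borel :: 'k measure)"
proof -
  have "(\<lambda>w. e (inv e (fst w) * inv e (snd w))) \<in> borel \<Otimes>\<^sub>M borel \<rightarrow>\<^sub>M borel" by measurable
  then show ?thesis by (simp add: e_mult split_beta')
qed

definition M0 :: "'a measure" where "M0 = distr M borel (inv e)"

lemma M_M0: "M = distr M0 borel e"
  unfolding M0_def by (subst distr_distr) (auto simp: o_def setsM intro!: distr_id2[symmetric])

text \<open>The transported measure is translation invariant on Euclidean space, so uniqueness of
  Haar measure with the closed unit ball as reference compares it with Lebesgue measure. The factor
  is positive because the open unit ball has positive measure, and finite by compactness.\<close>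

lemma M0_density: "\<exists>c>0. M0 = density lborel (\<lambda>_. ennreal c)"
proof -
  have s0[measurable_cong]: "sets M0 = sets borel" by (simp add: M0_def)
  have em: "emeasure M0 B = emeasure M (e ` B)" if "B \<in> sets borel" for B
  proof -
    have "emeasure M0 B = emeasure M (inv e -` B)" unfolding M0_def using that by (subst emeasure_distr) auto
    also have "inv e -` B = e ` B" by (auto intro: image_eqI[of _ e "inv e _"])
    finally show ?thesis .
  qed
  have fin: "emeasure M0 (cball 0 r) < \<infinity>" for r
    using haar compact_continuous_image[OF continuous_on_subset[OF cont_e], of "cball 0 r"]
    by (subst em) (auto simp: haar_measure_def)
  have sf: "sigma_finite_measure M0"
  proof
    show "\<exists>A. countable A \<and> A \<subseteq> sets M0 \<and> \<Union>A = space M0 \<and> (\<forall>a\<in>A. emeasure M0 a \<noteq> \<infinity>)"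
      using fin by (intro exI[of _ "range (\<lambda>n::nat. cball 0 (real n))"]) (auto simp: s0 M0_def real_arch_simple less_top[symmetric])
  qed
  have inv: "distr M0 borel ((+) a) = M0" for a
  proof -
    have "distr M0 borel ((+) a) = distr M borel (\<lambda>x. inv e (e a + x))"
    proof -
      have "a + inv e x = inv e (e a + x)" for x by (metis e_add e_inv inv_e)
      then show ?thesis unfolding M0_def by (subst distr_distr) (auto simp: o_def)
    qed
    also have "\<dots> = distr (distr M borel ((+) (e a))) borel (inv e)"
    proof -
      have "(\<lambda>x. e a + x) \<in> borel \<rightarrow>\<^sub>M borel" by (rule measurable_add_of_pair[OF diff_pair]) auto
      then have "(\<lambda>x. e a + x) \<in> M \<rightarrow>\<^sub>M borel" by simp
      then show ?thesis by (subst distr_distr) (auto simp: o_def)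
    qed
    also have "distr M borel ((+) (e a)) = M" using haar by (simp add: haar_measure_def)
    finally show ?thesis by (simp add: M0_def)
  qed
  let ?A = "cball (0::'a) 1"
  have key: "emeasure M0 ?A * emeasure lborel B = emeasure M0 B * emeasure lborel ?A" if B: "B \<in> sets borel" for B
  proof -
    have "emeasure M0 ?A * emeasure lborel B = emeasure M0 B * emeasure lborel (uminus -` ?A)"
      by (rule translation_invariant_measures[OF s0 sets_lborel sf sigma_finite_lborel _ inv lborel_distr_plus _ B]) measurable
    moreover have "uminus -` ?A = ?A" by auto
    ultimately show ?thesis by simp
  qed
  have "0 < emeasure M (e ` ball 0 1)"
  proof -
    have "e ` ball 0 1 = inv e -` ball 0 1" by (auto intro: image_eqI[of _ e "inv e _"])
    then have "open (e ` ball 0 1)" using open_vimage[OF open_ball cont_inv] by metis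
    moreover have "e ` ball 0 1 \<noteq> {}" by simp
    moreover have "\<And>U. open U \<Longrightarrow> U \<noteq> {} \<Longrightarrow> 0 < emeasure M U" using haar by (simp add: haar_measure_def)
    ultimately show ?thesis by simp
  qed
  also have "\<dots> = emeasure M0 (ball 0 1)" by (simp add: em)
  also have "\<dots> \<le> emeasure M0 ?A" by (rule emeasure_mono) (auto simp: s0)
  finally have "0 < emeasure M0 ?A" .
  then obtain m where m: "emeasure M0 ?A = ennreal m" "m > 0"
    using fin[of 1] by (cases "emeasure M0 ?A") auto
  let ?w = "unit_ball_vol (real DIM('a))"
  have w: "emeasure lborel ?A = ennreal ?w" "?w > 0" by (simp_all add: emeasure_cball)
  have w0: "?w \<noteq> 0" using w(2) by linarith
  have "M0 = density lborel (\<lambda>_. ennreal (m / ?w))"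
  proof (rule measure_eqI)
    fix B assume "B \<in> sets M0"
    then have B: "B \<in> sets borel" by (simp add: s0)
    have "emeasure M0 B = emeasure M0 B * (ennreal ?w * ennreal (1 / ?w))" using w0 by (simp flip: ennreal_mult')
    also have "\<dots> = ennreal m * emeasure lborel B * ennreal (1 / ?w)" using key[OF B] by (simp only: m(1) w(1) mult.assoc)
    also have "\<dots> = ennreal (m / ?w) * emeasure lborel B"
      using m w by (simp add: divide_inverse ennreal_mult mult_ac)
    finally show "emeasure M0 B = emeasure (density lborel (\<lambda>_. ennreal (m / ?w))) B"
      using B by (simp add: emeasure_density_const)
  qed (simp add: s0)
  then show ?thesis using m w by (intro exI[of _ "m / ?w"]) auto
qed

definition c0 :: real where "c0 = (SOME c. c > 0 \<and> M0 = density lborel (\<lambda>_. ennreal c))"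

lemma c0: "c0 > 0" "M0 = density lborel (\<lambda>_. ennreal c0)"
  using someI_ex[OF M0_density[unfolded Bex_def, simplified]] unfolding c0_def by (auto simp: greaterThan_iff)

lemma integral_M:
  fixes f :: "'k \<Rightarrow> 'b::{banach, second_countable_topology}"
  assumes [measurable]: "f \<in> borel_measurable borel"
  shows "(\<integral>x. f x \<partial>M) = c0 *\<^sub>R (\<integral>x. f (e x) \<partial>lborel)"
    and "integrable M f \<longleftrightarrow> integrable lborel (\<lambda>x. f (e x))"
proof -
  have "(\<integral>x. f x \<partial>M) = (\<integral>x. f (e x) \<partial>M0)"
    by (subst M_M0, subst integral_distr) (auto simp: M0_def)
  also have "\<dots> = (\<integral>x. c0 *\<^sub>R f (e x) \<partial>lborel)"
    unfolding c0(2) using c0(1) by (subst integral_density) auto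
  finally show "(\<integral>x. f x \<partial>M) = c0 *\<^sub>R (\<integral>x. f (e x) \<partial>lborel)" by simp
  have "integrable M f \<longleftrightarrow> integrable M0 (\<lambda>x. f (e x))"
    by (subst M_M0, subst integrable_distr_eq) (auto simp: M0_def)
  also have "\<dots> \<longleftrightarrow> integrable lborel (\<lambda>x. c0 *\<^sub>R f (e x))"
    unfolding c0(2) using c0(1) by (subst integrable_density) auto
  also have "\<dots> \<longleftrightarrow> integrable lborel (\<lambda>x. f (e x))"
  proof
    assume "integrable lborel (\<lambda>x. c0 *\<^sub>R f (e x))"
    then have "integrable lborel (\<lambda>x. inverse c0 *\<^sub>R (c0 *\<^sub>R f (e x)))" by (rule integrable_scaleR_right)
    then show "integrable lborel (\<lambda>x. f (e x))" using c0(1) by simp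
  qed (rule integrable_scaleR_right)
  finally show "integrable M f \<longleftrightarrow> integrable lborel (\<lambda>x. f (e x))" .
qed

lemma N_inv: "normalized_abs x = norm (inv e x) ^ DIM('a)" using abs_e[of "inv e x"] by simp

lemma N_meas[measurable]: "(normalized_abs :: 'k \<Rightarrow> real) \<in> borel_measurable borel"
  unfolding N_inv[abs_def] by measurable

lemma vol:
  assumes "0 \<le> r"
  shows "emeasure M {x. normalized_abs x \<le> r} = ennreal (c0 * unit_ball_vol (real DIM('a)) * r)"
proof -
  have "emeasure M {x. normalized_abs x \<le> r} = emeasure M0 (e -` {x. normalized_abs x \<le> r})"
    by (subst M_M0, subst emeasure_distr) (auto simp: M0_def)
  also have "e -` {x. normalized_abs x \<le> r} = cball 0 (root DIM('a) r)"
  proof (rule set_eqI)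
    fix x :: 'a
    have "norm x ^ DIM('a) \<le> r \<longleftrightarrow> norm x ^ DIM('a) \<le> root DIM('a) r ^ DIM('a)" using assms by simp
    also have "\<dots> \<longleftrightarrow> norm x \<le> root DIM('a) r" using assms by (intro power_mono_iff) auto
    finally show "x \<in> e -` {x. normalized_abs x \<le> r} \<longleftrightarrow> x \<in> cball 0 (root DIM('a) r)" by (simp add: abs_e)
  qed
  also have "emeasure M0 (cball 0 (root DIM('a) r)) = ennreal c0 * ennreal (unit_ball_vol (real DIM('a)) * r)"
    unfolding c0(2) using assms by (simp add: emeasure_density_const emeasure_cball)
  finally show ?thesis using c0(1) by (simp add: ennreal_mult' mult.assoc)
qed

text \<open>For the coordinate \<open>u\<close> of \<open>t\<close> one has |ln|u|| <= 2 |1 - u|. In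
  dimension 2 the square root undoes the square in the normalized value and the logarithm gains a
  factor 2; in dimension 1 a number below 1 is at most its square root.\<close>

lemma ln_near_1:
  fixes t :: 'k
  assumes "normalized_abs (1 - t) \<le> 1 / 4"
  shows "\<bar>ln (normalized_abs t)\<bar> \<le> 4 * sqrt (normalized_abs (1 - t))"
proof -
  define u where "u = inv e t"
  have t: "t = e u" "1 - t = e (1 - u)" by (simp_all add: u_def e_diff e_1)
  let ?r = "norm (1 - u)"
  have d12: "DIM('a) = 1 \<or> DIM('a) = 2" using dim DIM_positive[where 'a='a] by linarith
  have r4: "?r ^ DIM('a) \<le> 1 / 4" using assms unfolding t(2) abs_e .
  have r2: "?r \<le> 1 / 2"
  proof (rule ccontr)
    assume "\<not> ?thesis"
    then have r: "?r > 1/2" by simp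
    have "(1/2)\<^sup>2 < ?r\<^sup>2" using r by (intro power_strict_mono) auto
    then show False using d12 r4 r by (auto simp: power2_eq_square)
  qed
  have n1: "\<bar>norm u - 1\<bar> \<le> ?r" using norm_triangle_ineq3[of u 1] by (simp add: norm_minus_commute)
  then have pos: "norm u \<ge> 1/2" using r2 by linarith
  have ln: "\<bar>ln (norm u)\<bar> \<le> 2 * ?r"
  proof -
    have "u \<noteq> 0" using pos by auto
    have "ln (norm u) \<le> norm u - 1" using pos by (intro ln_le_minus_one) linarith
    then have "ln (norm u) \<le> 2 * ?r" using n1 by linarith
    have "- ln (norm u) \<le> inverse (norm u) - 1"
      using \<open>u \<noteq> 0\<close> ln_le_minus_one[of "inverse (norm u)"] by (simp add: ln_inverse)
    also have "inverse (norm u) - 1 \<le> 2 * \<bar>norm u - 1\<bar>"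
    proof -
      have "inverse (norm u) - 1 = (1 - norm u) * inverse (norm u)" using \<open>u \<noteq> 0\<close> by (simp add: field_simps)
      also have "\<dots> \<le> \<bar>norm u - 1\<bar> * inverse (norm u)" by (intro mult_right_mono) auto
      also have "\<dots> \<le> \<bar>norm u - 1\<bar> * 2"
        using pos \<open>u \<noteq> 0\<close> by (intro mult_left_mono) (auto simp: inverse_eq_divide divide_le_eq)
      finally show ?thesis by simp
    qed
    also have "2 * \<bar>norm u - 1\<bar> \<le> 2 * ?r" using n1 by (intro mult_left_mono) auto
    finally have "- ln (norm u) \<le> 2 * ?r" .
    then show ?thesis using \<open>ln (norm u) \<le> 2 * ?r\<close> by (intro abs_leI)
  qed
  have lnN: "ln (normalized_abs t) = real DIM('a) * ln (norm u)" using pos by (simp add: t abs_e ln_realpow)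
  show ?thesis
    using d12
  proof
    assume dd: "DIM('a) = 1"
    have "?r = sqrt ?r * sqrt ?r" by simp
    also have "\<dots> \<le> sqrt ?r * 1" using r2 by (intro mult_left_mono) auto
    finally show ?thesis using ln unfolding lnN t(2) abs_e dd by simp
  next
    assume dd: "DIM('a) = 2"
    show ?thesis using ln unfolding lnN t(2) abs_e dd by (simp add: abs_mult)
  qed
qed

text \<open>In dimension 2 this is (a + b)^2 <= 2 (a^2 + b^2).\<close>

lemma quasi_triangle: "normalized_abs (x + y :: 'k) \<le> 2 * (normalized_abs x + normalized_abs y)"
proof -
  define u v where "u = inv e x" and "v = inv e y"
  have xy: "x = e u" "y = e v" "x + y = e (u + v)" by (simp_all add: u_def v_def e_add)
  have d12: "DIM('a) = 1 \<or> DIM('a) = 2" using dim DIM_positive[where 'a='a] by linarith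
  have t: "norm (u + v) \<le> norm u + norm v" by (rule norm_triangle_ineq)
  have "norm (u + v) ^ DIM('a) \<le> (norm u + norm v) ^ DIM('a)" by (intro power_mono t) auto
  also have "\<dots> \<le> 2 * (norm u ^ DIM('a) + norm v ^ DIM('a))"
    using d12
  proof
    assume "DIM('a) = 2"
    then show ?thesis using sum_squares_bound[of "norm u" "norm v"] by (simp add: power2_sum)
  qed simp
  finally show ?thesis unfolding xy(3) abs_e unfolding xy(1,2) abs_e .
qed

sublocale normed_haar M normalized_abs "c0 * unit_ball_vol (real DIM('a))"
proof
  show "distr M borel ((+) a) = M" for a using haar by (simp add: haar_measure_def)
  show "(\<lambda>(x, y). x - y) \<in> borel \<Otimes>\<^sub>M borel \<rightarrow>\<^sub>M (borel :: 'k measure)" by (rule diff_pair)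
  show "(\<lambda>(x, y). x * y) \<in> borel \<Otimes>\<^sub>M borel \<rightarrow>\<^sub>M (borel :: 'k measure)" by (rule mult_pair)
  show "0 \<le> normalized_abs x" for x :: 'k by (simp add: N_inv)
  show "normalized_abs x = 0 \<longleftrightarrow> x = 0" for x :: 'k by (simp add: N_inv)
  show "normalized_abs (x * y) = normalized_abs x * normalized_abs y" for x y :: 'k
  proof -
    have "x * y = e (inv e x * inv e y)" by (simp add: e_mult)
    then have "normalized_abs (x * y) = norm (inv e x * inv e y) ^ DIM('a)" by (simp only: abs_e)
    then show ?thesis by (simp add: N_inv norm_mult power_mult_distrib)
  qed
  show "0 < emeasure M {x. normalized_abs x \<le> 1}" using c0(1) by (subst vol) auto
  show "emeasure M {x. normalized_abs x \<le> normalized_abs a} = ennreal (normalized_abs a) * emeasure M {x. normalized_abs x \<le> 1}" for a :: 'k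
  proof -
    have "0 \<le> normalized_abs a" by (simp add: N_inv)
    then show ?thesis using c0(1) by (simp add: vol mult.commute flip: ennreal_mult')
  qed
  show "0 \<le> c0 * unit_ball_vol (real DIM('a))" using c0(1) by simp
  show "0 < r \<Longrightarrow> emeasure M {x. normalized_abs x \<le> r} \<le> ennreal (c0 * unit_ball_vol (real DIM('a)) * r)" for r by (simp add: vol)
  show "sets M = sets borel" by (rule setsM)
  show "normalized_abs (x + y) \<le> 2 * (normalized_abs x + normalized_abs y)" for x y :: 'k by (rule quasi_triangle)
  show "normalized_abs (1 - t) \<le> 1 / 4 \<Longrightarrow> \<bar>ln (normalized_abs t)\<bar> \<le> 4 * sqrt (normalized_abs (1 - t))" for t :: 'k
    by (rule ln_near_1)
qed simp_all

lemma char_inv: "place_char x = cis (\<alpha> * (inv e x \<bullet> \<sigma> 1))"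
  using char_e[of "inv e x" 1] by (simp add: e_1)

text \<open>The parameter \<open>s\<close> is the logarithm of a dilation: scaling by
  \<open>exp (s / d)\<close>, with \<open>d\<close> the dimension, multiplies the normalized
  absolute value by \<open>exp s\<close>. So the Gaussian at \<open>x\<close> is the function of
  \<open>frullani_shift\<close>, with exponent \<open>2 / d\<close>, translated by log|x|, and the
  constant is its value at |x| = 1. The third function is the Fourier transform of the
  Gaussian.\<close>

sublocale log_decomposition M "c0 * unit_ball_vol (real DIM('a))" "lborel :: real measure"
  "\<lambda>s. exp (- exp ((2 / real DIM('a)) * s))"
  "\<lambda>s x. exp (- (exp (s / real DIM('a)) * norm (inv e x))\<^sup>2)"
  "\<lambda>s x. c0 * ((sqrt pi / exp (s / real DIM('a))) ^ DIM('a) * exp (- (\<alpha>\<^sup>2 * (norm (inv e x))\<^sup>2 / (4 * (exp (s / real DIM('a)))\<^sup>2))))"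
  "c0 * sqrt pi ^ DIM('a) * 4 * (\<alpha>\<^sup>2 / 4) powr (- (real DIM('a) / 2))"
proof
  have d0: "real DIM('a) > 0" by simp
  show "(place_char :: 'k \<Rightarrow> complex) \<in> borel_measurable borel"
  proof -
    have [measurable]: "(\<lambda>x. cis (\<alpha> * (x \<bullet> \<sigma> 1))) \<in> borel_measurable borel" by (intro borel_measurable_continuous_onI continuous_intros)
    have "(\<lambda>x. (\<lambda>x. cis (\<alpha> * (x \<bullet> \<sigma> 1))) (inv e x)) \<in> borel_measurable borel" by measurable
    then show ?thesis by (simp add: char_inv[abs_def])
  qed
  show "cmod (place_char (x :: 'k)) = 1" for x by (simp add: char_inv)
  show "place_char (x + y) = place_char x * place_char y" for x y :: 'k
  proof -
    have "inv e (x + y) = inv e x + inv e y" by (metis e_add e_inv inv_e)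
    then show ?thesis by (simp add: char_inv inner_add_left distrib_left cis_mult)
  qed
  show "(\<lambda>(t, x). exp (- (exp (t / real DIM('a)) * norm (inv e x))\<^sup>2)) \<in> borel_measurable (lborel \<Otimes>\<^sub>M borel)" by measurable
  show "(\<lambda>(s, x). c0 * ((sqrt pi / exp (s / real DIM('a))) ^ DIM('a) * exp (- (\<alpha>\<^sup>2 * (norm (inv e x))\<^sup>2 / (4 * (exp (s / real DIM('a)))\<^sup>2))))) \<in> borel_measurable (lborel \<Otimes>\<^sub>M borel)" by measurable
  show "integrable M (\<lambda>x. exp (- (exp (t / real DIM('a)) * norm (inv e x))\<^sup>2))" for t
    by (subst integral_M(2)) (auto intro: gaussian_fourier)
  have shift: "exp (- (exp (t / real DIM('a)) * norm (inv e x))\<^sup>2) = exp (- exp ((2 / real DIM('a)) * (t + ln (normalized_abs x))))" if x: "x \<noteq> 0" for t x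
  proof -
    have "exp ((2 / real DIM('a)) * (t + ln (normalized_abs x))) = exp (2 * (t / real DIM('a)) + 2 * ln (norm (inv e x)))"
      using x by (simp add: N_inv ln_realpow field_simps)
    also have "\<dots> = (exp (t / real DIM('a)) * norm (inv e x))\<^sup>2"
      by (simp only: exp_add exp_double power_mult_distrib) (use x in simp)
    finally show ?thesis by simp
  qed
  show "(\<integral>\<^sup>+t. ennreal \<bar>exp (- exp ((2 / real DIM('a)) * t)) - exp (- (exp (t / real DIM('a)) * norm (inv e x))\<^sup>2)\<bar> \<partial>lborel) \<le> ennreal \<bar>ln (normalized_abs x)\<bar>" if "x \<noteq> 0" for x
    unfolding shift[OF that] using frullani_shift(1)[of "2 / real DIM('a)" "ln (normalized_abs x)"] d0 by simp
  show "(\<integral>t. exp (- exp ((2 / real DIM('a)) * t)) - exp (- (exp (t / real DIM('a)) * norm (inv e x))\<^sup>2) \<partial>lborel) = ln (normalized_abs x)" if "x \<noteq> 0" for x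
    unfolding shift[OF that] using frullani_shift(2)[of "2 / real DIM('a)" "ln (normalized_abs x)"] d0 by simp
  show "0 \<le> c0 * ((sqrt pi / exp (t / real DIM('a))) ^ DIM('a) * exp (- (\<alpha>\<^sup>2 * (norm (inv e x))\<^sup>2 / (4 * (exp (t / real DIM('a)))\<^sup>2))))" for t x using c0(1) by simp
  show "c0 * ((sqrt pi / exp (t / real DIM('a))) ^ DIM('a) * exp (- (\<alpha>\<^sup>2 * (norm (inv e (- x)))\<^sup>2 / (4 * (exp (t / real DIM('a)))\<^sup>2)))) = c0 * ((sqrt pi / exp (t / real DIM('a))) ^ DIM('a) * exp (- (\<alpha>\<^sup>2 * (norm (inv e x))\<^sup>2 / (4 * (exp (t / real DIM('a)))\<^sup>2))))" for t x
  proof -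
    have "inv e (- x) = - inv e x" by (metis e_minus e_inv inv_e)
    then show ?thesis by simp
  qed
  have [measurable]: "(\<lambda>y. place_char (y * x)) \<in> borel_measurable borel" for x :: 'k
  proof -
    have "(\<lambda>y. (\<lambda>v. cis (\<alpha> * (v \<bullet> \<sigma> (inv e x)))) (inv e y)) \<in> borel_measurable borel"
      by (rule measurable_compose[OF inv_meas]) (intro borel_measurable_continuous_onI continuous_intros)
    then show ?thesis using char_e[of "inv e _" "inv e x"] by simp
  qed
  show "(\<integral>y. complex_of_real (exp (- (exp (t / real DIM('a)) * norm (inv e y))\<^sup>2)) * place_char (y * x) \<partial>M) = complex_of_real (c0 * ((sqrt pi / exp (t / real DIM('a))) ^ DIM('a) * exp (- (\<alpha>\<^sup>2 * (norm (inv e x))\<^sup>2 / (4 * (exp (t / real DIM('a)))\<^sup>2)))))" for t x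
  proof -
    have "(\<integral>y. complex_of_real (exp (- (exp (t / real DIM('a)) * norm (inv e y))\<^sup>2)) * place_char (y * x) \<partial>M)
      = c0 *\<^sub>R (\<integral>y. complex_of_real (exp (- (exp (t / real DIM('a)) * norm y)\<^sup>2)) * cis (\<alpha> * (y \<bullet> \<sigma> (inv e x))) \<partial>lborel)"
      using char_e[of _ "inv e x"] by (subst integral_M(1)) simp_all
    also have "\<dots> = c0 *\<^sub>R of_real ((sqrt pi / exp (t / real DIM('a))) ^ DIM('a) * exp (- (\<alpha>\<^sup>2 * (norm (\<sigma> (inv e x)))\<^sup>2 / (4 * (exp (t / real DIM('a)))\<^sup>2))))"
      by (simp only: gaussian_fourier(2)[OF exp_gt_zero])
    finally show ?thesis unfolding \<sigma> by (simp only: scaleR_conv_of_real of_real_mult)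
  qed
  show "0 \<le> c0 * sqrt pi ^ DIM('a) * 4 * (\<alpha>\<^sup>2 / 4) powr (- (real DIM('a) / 2))" using c0(1) by simp
  show "(\<integral>\<^sup>+t. ennreal (c0 * ((sqrt pi / exp (t / real DIM('a))) ^ DIM('a) * exp (- (\<alpha>\<^sup>2 * (norm (inv e x))\<^sup>2 / (4 * (exp (t / real DIM('a)))\<^sup>2))))) \<partial>lborel)
      \<le> ennreal (c0 * sqrt pi ^ DIM('a) * 4 * (\<alpha>\<^sup>2 / 4) powr (- (real DIM('a) / 2)) / normalized_abs x)" if x: "x \<noteq> 0" for x
  proof -
    define a where "a = \<alpha>\<^sup>2 / 4 * (norm (inv e x))\<^sup>2"
    have a: "a > 0" using x \<alpha> by (simp add: a_def)
    \<comment> \<open>The bound on the dimension enters here: the exponent must be at least 1 for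
      \<open>nn_integral_dilated_gaussian\<close>.\<close>
    have \<beta>1: "(2 / real DIM('a)) \<ge> 1" using dim d0 by (simp add: field_simps)
    have \<tau>d: "exp (t / real DIM('a)) ^ DIM('a) = exp t" for t by (simp flip: exp_of_nat_mult)
    have \<tau>2: "(exp (t / real DIM('a)))\<^sup>2 = exp ((2 / real DIM('a)) * t)" for t using exp_double[of "t / real DIM('a)"] by simp
    have eq: "c0 * ((sqrt pi / exp (t / real DIM('a))) ^ DIM('a) * exp (- (\<alpha>\<^sup>2 * (norm (inv e x))\<^sup>2 / (4 * (exp (t / real DIM('a)))\<^sup>2)))) = (c0 * sqrt pi ^ DIM('a)) * (exp (- t) * exp (- (a * exp (- ((2 / real DIM('a)) * t)))))" for t
    proof -
      have "a * exp (- ((2 / real DIM('a)) * t)) = \<alpha>\<^sup>2 * (norm (inv e x))\<^sup>2 / (4 * exp ((2 / real DIM('a)) * t))"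
        unfolding a_def exp_minus by (simp only: divide_inverse inverse_mult_distrib mult_ac)
      moreover have "sqrt pi ^ DIM('a) / exp t = sqrt pi ^ DIM('a) * exp (- t)" by (simp only: exp_minus divide_inverse)
      ultimately show ?thesis by (simp only: \<tau>2 power_divide \<tau>d mult.assoc)
    qed
    have "(\<integral>\<^sup>+t. ennreal (c0 * ((sqrt pi / exp (t / real DIM('a))) ^ DIM('a) * exp (- (\<alpha>\<^sup>2 * (norm (inv e x))\<^sup>2 / (4 * (exp (t / real DIM('a)))\<^sup>2))))) \<partial>lborel)
      = (\<integral>\<^sup>+t. ennreal (c0 * sqrt pi ^ DIM('a)) * ennreal (exp (- t) * exp (- (a * exp (- ((2 / real DIM('a)) * t))))) \<partial>lborel)"
    proof (rule nn_integral_cong)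
      show "ennreal (c0 * ((sqrt pi / exp (t / real DIM('a))) ^ DIM('a) * exp (- (\<alpha>\<^sup>2 * (norm (inv e x))\<^sup>2 / (4 * (exp (t / real DIM('a)))\<^sup>2))))) =
        ennreal (c0 * sqrt pi ^ DIM('a)) * ennreal (exp (- t) * exp (- (a * exp (- ((2 / real DIM('a)) * t)))))" for t
        unfolding eq by (rule ennreal_mult') (use c0(1) in simp)
    qed
    also have "\<dots> = ennreal (c0 * sqrt pi ^ DIM('a)) * (\<integral>\<^sup>+t. ennreal (exp (- t) * exp (- (a * exp (- ((2 / real DIM('a)) * t))))) \<partial>lborel)"
      by (rule nn_integral_cmult) measurable
    also have "\<dots> \<le> ennreal (c0 * sqrt pi ^ DIM('a)) * ennreal (4 * a powr (- 1 / (2 / real DIM('a))))"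
      by (intro mult_left_mono nn_integral_dilated_gaussian a \<beta>1) auto
    also have "\<dots> = ennreal (c0 * sqrt pi ^ DIM('a) * (4 * a powr (- 1 / (2 / real DIM('a)))))" using c0(1) by (subst ennreal_mult'[symmetric]) auto
    also have "a powr (- 1 / (2 / real DIM('a))) = (\<alpha>\<^sup>2 / 4) powr (- (real DIM('a) / 2)) / normalized_abs x"
    proof -
      have "a powr (- 1 / (2 / real DIM('a))) = (\<alpha>\<^sup>2 / 4) powr (- (real DIM('a) / 2)) * ((norm (inv e x))\<^sup>2) powr (- (real DIM('a) / 2))"
        unfolding a_def by (subst powr_mult) simp_all
      also have "((norm (inv e x))\<^sup>2) powr (- (real DIM('a) / 2)) = inverse (normalized_abs x)"
      proof -
        have n: "0 < norm (inv e x)" using x by simp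
        have "((norm (inv e x))\<^sup>2) powr (- (real DIM('a) / 2)) = (norm (inv e x) powr 2) powr (- (real DIM('a) / 2))"
          using powr_realpow[OF n, of 2] by (simp only: of_nat_numeral)
        also have "\<dots> = norm (inv e x) powr (2 * (- (real DIM('a) / 2)))" by (rule powr_powr)
        also have "2 * (- (real DIM('a) / 2)) = - real DIM('a)" by simp
        also have "norm (inv e x) powr (- real DIM('a)) = inverse (norm (inv e x) ^ DIM('a))"
          by (simp only: powr_minus powr_realpow[OF n])
        finally show ?thesis by (simp only: N_inv)
      qed
      finally show ?thesis by (simp only: divide_inverse)
    qed
    finally show ?thesis by (simp only: mult.assoc times_divide_eq_right)
  qed
qed (simp_all)

text \<open>In coordinates the transform is a multiple of the Euclidean one at
  \<open>\<sigma> (- \<xi>)\<close>, and \<open>\<sigma>\<close> preserves norms, so rapid decay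
  carries over.\<close>

lemma admissible:
  assumes f: "schwartz_function (\<phi> \<circ> e)"
  shows "fourier_admissible M \<phi>"
proof -
  obtain S where S: "schwartz_family S" "\<phi> \<circ> e \<in> S" by (rule schwartz_functionE[OF f])
  have [measurable]: "\<phi> \<circ> e \<in> borel_measurable borel"
    by (intro borel_measurable_continuous_onI schwartz_family_continuous[OF S])
  have "(\<lambda>x. (\<phi> \<circ> e) (inv e x)) \<in> borel_measurable borel" by measurable
  then have m[measurable]: "\<phi> \<in> borel_measurable borel" by simp
  have "\<exists>B. \<forall>x. norm x ^ k * norm ((\<phi> \<circ> e) x) \<le> B" for k :: nat
    using schwartz_family_bounded[OF S, of k] by blast
  then obtain B where B: "\<And>k x. norm x ^ k * norm ((\<phi> \<circ> e) x) \<le> B k" by metis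
  have F: "fourier M \<phi> (e \<xi>) = c0 *\<^sub>R euclidean_fourier \<alpha> (\<phi> \<circ> e) (\<sigma> (- \<xi>))" for \<xi>
  proof -
    have "- (e \<xi> * y) = y * e (- \<xi>)" for y by (simp add: e_minus)
    then have "fourier M \<phi> (e \<xi>) = (\<integral>y. \<phi> y * place_char (y * e (- \<xi>)) \<partial>M)" by (simp add: fourier_def)
    also have "\<dots> = c0 *\<^sub>R (\<integral>y. \<phi> (e y) * place_char (e y * e (- \<xi>)) \<partial>lborel)"
      by (rule integral_M) measurable
    finally show ?thesis by (simp add: char_e euclidean_fourier_def)
  qed
  have Fb: "\<exists>B. \<forall>y. (normalized_abs y) ^ k * cmod (fourier M \<phi> y) \<le> B" for k
  proof -
    obtain B where B: "\<And>\<eta>. norm \<eta> ^ (DIM('a) * k) * cmod (euclidean_fourier \<alpha> (\<phi> \<circ> e) \<eta>) \<le> B"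
      using euclidean_fourier_decay[OF f \<alpha>, of "DIM('a) * k"] by blast
    have "(normalized_abs y) ^ k * cmod (fourier M \<phi> y) \<le> c0 * B" for y
    proof -
      have "(normalized_abs y) ^ k * cmod (fourier M \<phi> y) = norm (inv e y) ^ (DIM('a) * k) * (c0 * cmod (euclidean_fourier \<alpha> (\<phi> \<circ> e) (\<sigma> (- inv e y))))"
        using F[of "inv e y"] c0(1) by (simp add: N_inv power_mult)
      also have "norm (inv e y) = norm (\<sigma> (- inv e y))" by (simp add: \<sigma>)
      finally show ?thesis using mult_left_mono[OF B[of "\<sigma> (- inv e y)"], of c0] c0(1) by (simp add: mult_ac o_def)
    qed
    then show ?thesis by blast
  qed
  obtain B1 where B1: "\<And>y. cmod (fourier M \<phi> y) \<le> B1" using Fb[of 0] by auto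
  obtain B2 where B2: "\<And>y. (normalized_abs y)\<^sup>2 * cmod (fourier M \<phi> y) \<le> B2" using Fb[of 2] by auto
  show ?thesis
    unfolding fourier_admissible_def
  proof (intro conjI)
    show "\<phi> \<in> borel_measurable M" by measurable
    show "inv_fourier M (fourier M \<phi>) = \<phi>" by (rule inversion[OF sb[OF f]])
    show "\<exists>B. \<forall>y. cmod (fourier M \<phi> y) \<le> B \<and> (normalized_abs y)\<^sup>2 * cmod (fourier M \<phi> y) \<le> B"
      using B1 B2 by (intro exI[of _ "max B1 B2"]) (auto intro: max.coboundedI1 max.coboundedI2)
    have "cmod (\<phi> y) \<le> B 0" "(normalized_abs y)\<^sup>2 * cmod (\<phi> y) \<le> B (DIM('a) * 2)" for y
      using B[of "inv e y" 0] B[of "inv e y" "DIM('a) * 2"] by (simp_all add: N_inv power_mult)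
    then show "\<exists>B. \<forall>y. cmod (\<phi> y) \<le> B \<and> (normalized_abs y)\<^sup>2 * cmod (\<phi> y) \<le> B"
      by (intro exI[of _ "max (B 0) (B (DIM('a) * 2))"]) (auto intro: max.coboundedI1 max.coboundedI2)
  qed
qed

lemma admissible_log:
  assumes f: "schwartz_function (\<phi> \<circ> e)" and \<epsilon>: "\<epsilon> > 0" "\<forall>x\<in>ball 0 \<epsilon>. \<phi> x = 0"
  shows "fourier_admissible M (log_mult \<phi>)"
proof (rule admissible)
  have "open (e -` ball 0 \<epsilon>)" by (intro open_vimage cont_e open_ball)
  moreover have "0 \<in> e -` ball 0 \<epsilon>" using \<epsilon> by simp
  ultimately obtain \<delta> where \<delta>: "\<delta> > 0" "ball 0 \<delta> \<subseteq> e -` ball 0 \<epsilon>" by (rule openE)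
  have "schwartz_function (\<lambda>x::'a. of_real (real DIM('a) * ln (norm x)) * (\<phi> \<circ> e) x)"
    by (rule schwartz_function_ln_mult[OF f \<delta>(1)]) (use \<delta> \<epsilon> in auto)
  also have "(\<lambda>x::'a. of_real (real DIM('a) * ln (norm x)) * (\<phi> \<circ> e) x) = log_mult \<phi> \<circ> e"
  proof
    fix x :: 'a
    have "ln (norm x ^ DIM('a)) = real DIM('a) * ln (norm x)" by (cases "x = 0") (auto simp: ln_realpow)
    then show "of_real (real DIM('a) * ln (norm x)) * (\<phi> \<circ> e) x = (log_mult \<phi> \<circ> e) x" by (simp add: log_mult_def abs_e)
  qed
  finally show "schwartz_function (log_mult \<phi> \<circ> e)" .
qed

end

section \<open>Number fields and their absolute values\<close>

text \<open>Powers of a number above 1 outgrow any linear function; Bernoulli's inequality squared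
  already gives quadratic growth of the even powers. Applied to powers of an inequality it removes
  losses that are linear in the exponent.\<close>

lemma le_1_if_power_le_linear:
  fixes r :: real
  assumes "\<And>k::nat. r ^ k \<le> A * real k + B"
  shows "r \<le> 1"
proof (rule ccontr)
  assume "\<not> r \<le> 1"
  define \<delta> where "\<delta> = r - 1"
  have \<delta>: "\<delta> > 0" "r = 1 + \<delta>" using \<open>\<not> r \<le> 1\<close> by (auto simp: \<delta>_def)
  have quad: "(real k * \<delta>)\<^sup>2 \<le> 2 * \<bar>A\<bar> * real k + \<bar>B\<bar>" for k :: nat
  proof -
    have "real k * \<delta> \<le> r ^ k" using Bernoulli_inequality[of \<delta> k] \<delta> by simp
    then have "(real k * \<delta>)\<^sup>2 \<le> (r ^ k)\<^sup>2" using \<delta> by (intro power_mono) auto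
    also have "\<dots> = r ^ (2 * k)" by (simp add: power_mult[symmetric] mult.commute)
    also have "\<dots> \<le> A * real (2 * k) + B" by (rule assms)
    also have "\<dots> \<le> \<bar>A\<bar> * real (2 * k) + \<bar>B\<bar>" by (intro add_mono mult_right_mono) auto
    finally show ?thesis by simp
  qed
  obtain k :: nat where k: "(2 * \<bar>A\<bar> + \<bar>B\<bar>) / \<delta>\<^sup>2 < real k" using reals_Archimedean2 by blast
  have "k > 0" using k \<delta> by (cases k) (auto simp: field_simps not_less)
  have "2 * \<bar>A\<bar> + \<bar>B\<bar> < \<delta>\<^sup>2 * real k" using k \<delta> by (simp add: pos_divide_less_eq mult.commute)
  then have "(2 * \<bar>A\<bar> + \<bar>B\<bar>) * real k < \<delta>\<^sup>2 * real k * real k"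
    using \<open>k > 0\<close> by (intro mult_strict_right_mono) auto
  also have "\<dots> \<le> 2 * \<bar>A\<bar> * real k + \<bar>B\<bar>" using quad[of k] by (simp add: power2_eq_square mult_ac)
  finally have "\<bar>B\<bar> * real k < \<bar>B\<bar> * 1" by (simp add: algebra_simps)
  then have "real k < 1" by (rule mult_left_less_imp_less) simp
  then show False using \<open>k > 0\<close> by simp
qed

lemma number_field_spanning:
  assumes "number_field F"
  obtains B where "finite B" "B \<subseteq> F" "\<And>x. x \<in> F \<Longrightarrow> \<exists>c::'a::field_char_0 \<Rightarrow> rat. x = (\<Sum>b\<in>B. of_rat (c b) * b)"
  using assms unfolding number_field_def by metis

lemma number_field_countable:
  assumes "number_field (F :: 'a::field_char_0 set)"
  shows "countable F"
proof -
  obtain B where B: "finite B" "\<And>x. x \<in> F \<Longrightarrow> \<exists>c::'a \<Rightarrow> rat. x = (\<Sum>b\<in>B. of_rat (c b) * b)"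
    using number_field_spanning[OF assms] by metis
  have "F \<subseteq> (\<lambda>c. \<Sum>b\<in>B. of_rat (c b) * b) ` (PiE B (\<lambda>_. UNIV :: rat set))"
  proof
    fix x assume "x \<in> F"
    then obtain c :: "'a \<Rightarrow> rat" where "x = (\<Sum>b\<in>B. of_rat (c b) * b)" using B(2) by blast
    then have "x = (\<Sum>b\<in>B. of_rat (restrict c B b) * b)" by simp
    then show "x \<in> (\<lambda>c. \<Sum>b\<in>B. of_rat (c b) * b) ` (PiE B (\<lambda>_. UNIV :: rat set))" by (intro image_eqI[where x="restrict c B"]) auto
  qed
  moreover have "countable (PiE B (\<lambda>_. UNIV :: rat set))" by (rule countable_PiE[OF B(1)]) auto
  ultimately show ?thesis by (rule countable_subset[OF _ countable_image])
qed

interpretation rat_vs: vector_space "\<lambda>q::rat. \<lambda>x::'a::field_char_0. of_rat q * x"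
  by unfold_locales (auto simp: algebra_simps of_rat_add of_rat_mult)

text \<open>Finite rational dimension. It yields algebraicity of the elements and, at finite places,
  bounds the rank of the ring of integers.\<close>

lemma rat_independent_bound:
  fixes F :: "'a::field_char_0 set"
  assumes "number_field F"
  obtains n where "\<And>X. X \<subseteq> F \<Longrightarrow> rat_vs.independent X \<Longrightarrow> finite X \<and> card X \<le> n"
proof -
  obtain B where B: "finite B" "\<And>x. x \<in> F \<Longrightarrow> \<exists>c::'a \<Rightarrow> rat. x = (\<Sum>b\<in>B. of_rat (c b) * b)"
    using number_field_spanning[OF assms] by metis
  have "F \<subseteq> rat_vs.span B"
  proof
    fix x assume "x \<in> F"
    then obtain c :: "'a \<Rightarrow> rat" where "x = (\<Sum>b\<in>B. of_rat (c b) * b)" using B(2) by blast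
    then show "x \<in> rat_vs.span B" using rat_vs.span_sum[of B "\<lambda>b. of_rat (c b) * b" B] rat_vs.span_scale rat_vs.span_base by metis
  qed
  then show ?thesis using rat_vs.independent_span_bound[OF B(1)] by (intro that[of "card B"]) blast
qed

lemma number_field_power:
  assumes "number_field F" "x \<in> F" shows "x ^ n \<in> F"
  using assms by (induction n) (auto simp: number_field_def)

text \<open>More powers of \<open>x\<close> than the dimension are linearly dependent. Dependence is
  a notion for sets, so coinciding powers are treated apart; they give the polynomial X^i -
  X^j.\<close>

lemma number_field_algebraic:
  fixes F :: "'a::field_char_0 set"
  assumes F: "number_field F" and x: "x \<in> F"
  obtains p :: "rat poly" where "p \<noteq> 0" "poly (map_poly of_rat p) x = 0"
proof -
  have ev_monom: "poly (map_poly of_rat (monom c i)) x = of_rat c * x ^ i" for c i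
    by (simp add: map_poly_monom poly_monom)
  show ?thesis
  proof (cases "inj (\<lambda>i::nat. x ^ i)")
    case False
    then obtain i j :: nat where ij: "x ^ i = x ^ j" "i \<noteq> j" by (auto simp: inj_def)
    have h: "map_poly of_rat (monom 1 i - monom 1 j) = (monom 1 i - monom 1 j :: 'a poly)"
      by (rule poly_eqI) (auto simp: coeff_map_poly of_rat_diff)
    show ?thesis
    proof
      show "monom 1 i - monom 1 j \<noteq> (0 :: rat poly)"
      proof
        assume "monom 1 i - monom 1 j = (0 :: rat poly)"
        then have "coeff (monom 1 i) i = coeff (monom (1::rat) j) i" by simp
        then show False using ij by simp
      qed
      show "poly (map_poly of_rat (monom 1 i - monom 1 j)) x = 0" unfolding h using ij by (simp add: poly_monom)
    qed
  next
    case True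
    obtain n where n: "\<And>X. X \<subseteq> F \<Longrightarrow> rat_vs.independent X \<Longrightarrow> finite X \<and> card X \<le> n"
      using rat_independent_bound[OF F] by blast
    let ?X = "(\<lambda>i::nat. x ^ i) ` {..n}"
    have "card ?X = Suc n" using True by (simp add: card_image inj_on_subset)
    then have "rat_vs.dependent ?X" using n[of ?X] number_field_power[OF F x] by force
    then obtain u where u: "(\<Sum>v\<in>?X. of_rat (u v) * v) = 0" "\<exists>v\<in>?X. u v \<noteq> 0"
      using rat_vs.dependent_finite[of ?X] by auto
    let ?p = "\<Sum>i\<le>n. monom (u (x ^ i)) i"
    have cf: "coeff ?p k = (if k \<le> n then u (x ^ k) else 0)" for k
      by (simp add: coeff_sum if_distrib cong: if_cong)
    have h: "map_poly of_rat ?p = (\<Sum>i\<le>n. monom (of_rat (u (x ^ i))) i :: 'a poly)"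
      by (rule poly_eqI) (simp add: coeff_map_poly cf coeff_sum if_distrib cong: if_cong)
    show ?thesis
    proof
      obtain k where k: "k \<le> n" "u (x ^ k) \<noteq> 0" using u(2) by auto
      then have "coeff ?p k \<noteq> 0" unfolding cf by simp
      then show "?p \<noteq> 0" by (metis coeff_0)
      have "(\<Sum>i\<le>n. of_rat (u (x ^ i)) * x ^ i) = (\<Sum>v\<in>?X. of_rat (u v) * v)"
        by (subst sum.reindex) (auto intro: inj_on_subset[OF True])
      then show "poly (map_poly of_rat ?p) x = 0" unfolding h using u(1) by (simp add: poly_sum poly_monom)
    qed
  qed
qed

locale valued_field =
  fixes F :: "'k::{field_char_0, complete_space} set"
  assumes completion: "completion_at_place F"
begin

definition av :: "'k \<Rightarrow> real" where "av x = dist x 0"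

lemma F: "number_field F" and dense: "closure F = UNIV"
  using completion by (auto simp: completion_at_place_def)

lemma dist_av: "dist x y = av (x - y)"
proof -
  have "dist (x + - y) (y + - y) = dist x y" using completion unfolding completion_at_place_def by blast
  then show ?thesis by (simp add: av_def)
qed

lemma av_mult: "av (x * y) = av x * av y"
  using completion by (auto simp: completion_at_place_def av_def)

lemma av_nonneg[simp]: "0 \<le> av x" and av_eq_0[simp]: "av x = 0 \<longleftrightarrow> x = 0" and av_pos[simp]: "0 < av x \<longleftrightarrow> x \<noteq> 0"
  by (auto simp: av_def)

lemma av_0[simp]: "av 0 = 0" by (simp add: av_def)

lemma av_1[simp]: "av 1 = 1"
proof -
  have "av 1 * av 1 = av 1 * 1" by (simp flip: av_mult)
  moreover have "av 1 \<noteq> 0" by simp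
  ultimately show ?thesis by (simp only: mult_cancel_left) blast
qed

lemma av_minus[simp]: "av (- x) = av x"
proof -
  have "av (- x) = dist 0 x" by (simp add: dist_av)
  then show ?thesis by (simp add: av_def dist_commute)
qed

lemma av_commute: "av (x - y) = av (y - x)" using av_minus[of "x - y"] by simp

lemma av_add: "av (x + y) \<le> av x + av y"
proof -
  have "av (x + y) = dist x (- y)" by (simp add: dist_av)
  also have "\<dots> \<le> dist x 0 + dist 0 (- y)" by (rule dist_triangle)
  finally show ?thesis by (simp add: dist_av)
qed

lemma av_diff: "av (x - y) \<le> av x + av y" using av_add[of x "- y"] by simp

lemma av_power: "av (x ^ n) = av x ^ n"
  by (induction n) (auto simp: av_mult)

lemma av_inverse: "av (inverse x) = inverse (av x)"
proof (cases "x = 0")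
  case False
  then have "av x * av (inverse x) = 1" by (simp flip: av_mult)
  then show ?thesis by (rule inverse_unique[symmetric])
qed simp

lemma av_divide: "av (x / y) = av x / av y"
  by (simp add: divide_inverse av_mult av_inverse)

lemma av_sum: "av (\<Sum>i\<in>A. f i) \<le> (\<Sum>i\<in>A. av (f i))"
proof (induction A rule: infinite_finite_induct)
  case (insert a A)
  then show ?case using av_add[of "f a" "sum f A"] by simp
qed auto

lemma av_of_nat_le: "av (of_nat n) \<le> real n"
  using av_sum[of "\<lambda>_. 1" "{..<n}"] by simp

lemma continuous_diff: "continuous_on UNIV (\<lambda>(x, y). x - y :: 'k)"
  unfolding continuous_on_iff
proof (intro ballI allI impI)
  fix z :: "'k \<times> 'k" and \<epsilon> :: real assume \<epsilon>: "\<epsilon> > 0"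
  have "dist (case w of (x, y) \<Rightarrow> x - y) (case z of (x, y) \<Rightarrow> x - y) < \<epsilon>" if "dist w z < \<epsilon> / 2" for w
  proof -
    have "dist (case w of (x, y) \<Rightarrow> x - y) (case z of (x, y) \<Rightarrow> x - y) = av ((fst w - fst z) - (snd w - snd z))"
      by (simp add: dist_av split_beta algebra_simps)
    also have "\<dots> \<le> dist (fst w) (fst z) + dist (snd w) (snd z)" using av_diff by (simp add: dist_av)
    also have "\<dots> < \<epsilon>" using that dist_fst_le[of w z] dist_snd_le[of w z] by linarith
    finally show ?thesis .
  qed
  then show "\<exists>d>0. \<forall>w\<in>UNIV. dist w z < d \<longrightarrow> dist (case w of (x, y) \<Rightarrow> x - y) (case z of (x, y) \<Rightarrow> x - y) < \<epsilon>"
    using \<epsilon> by (intro exI[of _ "\<epsilon> / 2"]) auto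
qed

lemma continuous_mult: "continuous_on UNIV (\<lambda>(x, y). x * y :: 'k)"
  unfolding continuous_on_iff
proof (intro ballI allI impI)
  fix z :: "'k \<times> 'k" and \<epsilon> :: real assume \<epsilon>: "\<epsilon> > 0"
  obtain a b where z: "z = (a, b)" by force
  define \<delta> where "\<delta> = min 1 (\<epsilon> / (2 * (av a + av b + 1)))"
  have s: "av a + av b + 1 > 0" using av_nonneg[of a] av_nonneg[of b] by linarith
  have \<delta>: "\<delta> > 0" "\<delta> \<le> 1" "\<delta> * (av a + av b + 1) < \<epsilon>"
  proof -
    show "\<delta> > 0" "\<delta> \<le> 1" using \<epsilon> s by (auto simp: \<delta>_def)
    have "\<delta> * (av a + av b + 1) \<le> \<epsilon> / (2 * (av a + av b + 1)) * (av a + av b + 1)"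
      using s by (intro mult_right_mono) (auto simp: \<delta>_def)
    also have "\<dots> = \<epsilon> / 2"
    proof -
      have "\<epsilon> / (2 * S) * S = \<epsilon> / 2" if "S > 0" for S using that by simp
      then show ?thesis using s by blast
    qed
    finally show "\<delta> * (av a + av b + 1) < \<epsilon>" using \<epsilon> by linarith
  qed
  have "dist (case w of (x, y) \<Rightarrow> x * y) (case z of (x, y) \<Rightarrow> x * y) < \<epsilon>" if w: "dist w z < \<delta>" for w
  proof -
    obtain x y where xy: "w = (x, y)" by force
    have 1: "av (x - a) \<le> \<delta>" "av (y - b) \<le> \<delta>"
      using w dist_fst_le[of w z] dist_snd_le[of w z] by (auto simp: xy z dist_av)
    have "x * y - a * b = (x - a) * (y - b) + (x - a) * b + a * (y - b)" by (simp add: algebra_simps)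
    then have "dist (x * y) (a * b) \<le> av ((x - a) * (y - b) + (x - a) * b) + av (a * (y - b))"
      using av_add by (simp add: dist_av)
    also have "\<dots> \<le> av ((x - a) * (y - b)) + av ((x - a) * b) + av (a * (y - b))"
      using av_add by (intro add_right_mono)
    also have "\<dots> \<le> \<delta> * 1 + \<delta> * av b + av a * \<delta>"
      unfolding av_mult using 1 \<delta> by (intro add_mono mult_mono) auto
    also have "\<dots> < \<epsilon>" using \<delta>(3) by (simp add: algebra_simps)
    finally show ?thesis by (simp add: xy z)
  qed
  then show "\<exists>d>0. \<forall>w\<in>UNIV. dist w z < d \<longrightarrow> dist (case w of (x, y) \<Rightarrow> x * y) (case z of (x, y) \<Rightarrow> x * y) < \<epsilon>"
    using \<delta> by (intro exI[of _ \<delta>]) auto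
qed

lemma countable_F: "countable F" by (rule number_field_countable[OF F])

lemma measurable_diff_pair: "(\<lambda>(x, y). x - y) \<in> borel \<Otimes>\<^sub>M borel \<rightarrow>\<^sub>M (borel :: 'k measure)"
  and measurable_mult_pair: "(\<lambda>(x, y). x * y) \<in> borel \<Otimes>\<^sub>M borel \<rightarrow>\<^sub>M (borel :: 'k measure)"
  using countable_dense_imp_countable_basis[OF countable_F dense] borel_measurable_pair_continuous continuous_diff continuous_mult
  by metis+

text \<open>The binomial theorem bounds the \<open>k\<close>-th power of |x + y| by k + 1 times the
  \<open>k\<close>-th power of the maximum, and taking roots removes the factor.\<close>

lemma ultrametric_if_bounded:
  assumes b: "\<And>n. av (of_nat n) \<le> 1"
  shows "finite_place TYPE('k)"
proof -
  have "av (x + y) \<le> max (av x) (av y)" for x y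
  proof (cases "max (av x) (av y) = 0")
    case True
    then have "av x = 0" "av y = 0" using av_nonneg[of x] av_nonneg[of y] by linarith+
    then have "x = 0" "y = 0" by simp_all
    then show ?thesis by simp
  next
    case False
    let ?m = "max (av x) (av y)"
    have m: "?m > 0" using False av_nonneg[of x] by linarith
    have "(av (x + y) / ?m) ^ k \<le> 1 * real k + 1" for k
    proof -
      have "av (x + y) ^ k = av (\<Sum>i\<le>k. of_nat (k choose i) * x ^ i * y ^ (k - i))"
        by (simp add: av_power[symmetric] binomial_ring)
      also have "\<dots> \<le> (\<Sum>i\<le>k. av (of_nat (k choose i) * x ^ i * y ^ (k - i)))" by (rule av_sum)
      also have "\<dots> \<le> (\<Sum>i\<le>k. ?m ^ k)"
      proof (rule sum_mono)
        fix i assume i: "i \<in> {..k}"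
        have "av (of_nat (k choose i) * x ^ i * y ^ (k - i)) \<le> 1 * ?m ^ i * ?m ^ (k - i)"
          unfolding av_mult av_power by (intro mult_mono power_mono b) (use m in auto)
        also have "\<dots> = ?m ^ k" using i by (simp flip: power_add)
        finally show "av (of_nat (k choose i) * x ^ i * y ^ (k - i)) \<le> ?m ^ k" .
      qed
      also have "\<dots> = (real k + 1) * ?m ^ k" by simp
      finally show ?thesis using m by (simp add: power_divide divide_le_eq)
    qed
    then have "av (x + y) / ?m \<le> 1" by (rule le_1_if_power_le_linear)
    then show ?thesis using m by (simp add: divide_le_eq)
  qed
  then show ?thesis by (simp add: finite_place_def av_def)
qed

end

section \<open>Archimedean completions are the reals or the complex numbers\<close>

locale arch_field = valued_field F for F :: "'k::{field_char_0, complete_space} set" +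
  assumes arch: "\<not> finite_place TYPE('k)"
begin

text \<open>Expansion of \<open>n\<close> in base \<open>b\<close>: there are at most m + 1 digits,
  each of value at most \<open>b\<close>.\<close>

lemma w_digits:
  assumes b: "b \<ge> 2"
  shows "n < b ^ Suc m \<Longrightarrow> av (of_nat n :: 'k) \<le> real (Suc m) * real b * max 1 (av (of_nat b :: 'k)) ^ m"
proof (induction m arbitrary: n)
  case 0
  then show ?case using av_of_nat_le[of n] by simp
next
  case (Suc m)
  let ?W = "max 1 (av (of_nat b :: 'k))"
  have W: "?W \<ge> 1" "av (of_nat b :: 'k) \<le> ?W" by auto
  have q: "n div b < b ^ Suc m" using Suc.prems b by (simp add: div_less_iff_less_mult mult.commute)
  have r: "real (n mod b) \<le> real b" using b by (simp add: less_imp_le)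
  have "of_nat n = (of_nat (n div b) * of_nat b + of_nat (n mod b) :: 'k)"
    by (metis div_mult_mod_eq of_nat_add of_nat_mult)
  then have "av (of_nat n :: 'k) \<le> av (of_nat (n div b) :: 'k) * av (of_nat b :: 'k) + av (of_nat (n mod b) :: 'k)" using av_add by (metis av_mult)
  also have "\<dots> \<le> (real (Suc m) * real b * ?W ^ m) * ?W + real b"
    using av_of_nat_le[of "n mod b"] r W Suc.IH[OF q] by (intro add_mono mult_mono) auto
  also have "\<dots> \<le> (real (Suc m) * real b * ?W ^ m) * ?W + real b * ?W ^ Suc m"
    using W one_le_power[of ?W "Suc m"] mult_left_mono[of 1 "?W ^ Suc m" "real b"] by simp
  also have "\<dots> = real (Suc (Suc m)) * real b * ?W ^ Suc m" by (simp add: algebra_simps)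
  finally show ?case .
qed

text \<open>The digit estimate for \<open>a ^ k\<close>, which has about k ln a / ln b digits in
  base \<open>b\<close>; the linear factor vanishes on taking \<open>k\<close>-th roots.\<close>

lemma w_le_powr:
  assumes a: "a \<ge> 2" and b: "b \<ge> 2"
  shows "av (of_nat a :: 'k) \<le> max 1 (av (of_nat b :: 'k)) powr (ln (real a) / ln (real b))"
proof -
  let ?W = "max 1 (av (of_nat b :: 'k))" and ?L = "ln (real a) / ln (real b)"
  have W: "?W \<ge> 1" by simp
  have L: "?L > 0" using a b by simp
  have lb: "ln (real b) > 0" using b by simp
  have P: "?W powr ?L > 0" using W by simp
  have "(av (of_nat a :: 'k) / ?W powr ?L) ^ k \<le> (real b * ?L) * real k + real b" for k
  proof -
    define m where "m = nat \<lfloor>real k * ?L\<rfloor>"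
    have m: "real m \<le> real k * ?L" "real k * ?L < real (Suc m)"
    proof -
      have gen: "real (nat \<lfloor>x\<rfloor>) \<le> x" "x < real (Suc (nat \<lfloor>x\<rfloor>))" if "x \<ge> 0" for x :: real
      proof -
        have "real (nat \<lfloor>x\<rfloor>) = of_int \<lfloor>x\<rfloor>" using that by simp
        then show "real (nat \<lfloor>x\<rfloor>) \<le> x" "x < real (Suc (nat \<lfloor>x\<rfloor>))" by linarith+
      qed
      have "0 \<le> real k * ?L" using L by (intro mult_nonneg_nonneg) auto
      from gen[OF this] show "real m \<le> real k * ?L" "real k * ?L < real (Suc m)" unfolding m_def .
    qed
    have "real (a ^ k) < real (b ^ Suc m)"
    proof -
      have "real k * ln (real a) = (real k * ?L) * ln (real b)" using lb by simp
      also have "\<dots> < real (Suc m) * ln (real b)" using m(2) lb by (rule mult_strict_right_mono)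
      finally have "ln (real a ^ k) < ln (real b ^ Suc m)" using a b by (simp only: ln_realpow)
      then show ?thesis using a b by (subst (asm) ln_less_cancel_iff) auto
    qed
    then have "a ^ k < b ^ Suc m" by (simp only: of_nat_less_iff)
    from w_digits[OF b this] have "av (of_nat a :: 'k) ^ k \<le> real (Suc m) * real b * ?W ^ m" by (simp add: av_power)
    also have "\<dots> \<le> (real k * ?L + 1) * real b * (?W powr ?L) ^ k"
    proof (intro mult_mono)
      have "?W ^ m = ?W powr real m" using W by (simp add: powr_realpow)
      also have "\<dots> \<le> ?W powr (real k * ?L)" using m W by (intro powr_mono) auto
      also have "\<dots> = (?W powr ?L) ^ k" using W by (simp add: powr_powr powr_realpow[symmetric] mult.commute)
      finally show "?W ^ m \<le> (?W powr ?L) ^ k" .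
    qed (use m L in auto)
    finally have "av (of_nat a :: 'k) ^ k \<le> (real k * ?L + 1) * real b * (?W powr ?L) ^ k" .
    then have "(av (of_nat a :: 'k) / ?W powr ?L) ^ k \<le> (real k * ?L + 1) * real b"
      using P by (simp add: power_divide divide_le_eq)
    then show ?thesis by (simp add: algebra_simps)
  qed
  then have "av (of_nat a :: 'k) / ?W powr ?L \<le> 1" by (rule le_1_if_power_le_linear)
  then show ?thesis using P by (simp only: divide_le_eq_1_pos)
qed

text \<open>Ostrowski's theorem for an unbounded absolute value.\<close>

lemma ostrowski: obtains s where "s > 0" "\<And>n. n \<ge> 1 \<Longrightarrow> av (of_nat n :: 'k) = real n powr s"
proof -
  obtain a where a: "av (of_nat a :: 'k) > 1" using ultrametric_if_bounded arch by (meson not_less)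
  have a2: "a \<ge> 2"
  proof (rule ccontr)
    assume "\<not> a \<ge> 2"
    then have "a = 0 \<or> a = 1" by linarith
    then show False using a by auto
  qed
  have w1: "av (of_nat b :: 'k) > 1" if b: "b \<ge> 2" for b
  proof (rule ccontr)
    assume "\<not> av (of_nat b :: 'k) > 1"
    then have "max 1 (av (of_nat b :: 'k)) = 1" by simp
    then show False using w_le_powr[OF a2 b] a by simp
  qed
  \<comment> \<open>Symmetric in \<open>a\<close> and \<open>b\<close>, hence an equality: the
    quotient is the same constant for all bases.\<close>
  have le: "ln (av (of_nat a :: 'k)) / ln (real a) \<le> ln (av (of_nat b :: 'k)) / ln (real b)" if ab: "a \<ge> 2" "b \<ge> 2" for a b
  proof -
    have "av (of_nat a :: 'k) \<le> av (of_nat b :: 'k) powr (ln (real a) / ln (real b))" using w_le_powr[OF ab] w1[OF ab(2)] by (simp add: max_def)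
    then have "ln (av (of_nat a :: 'k)) \<le> ln (av (of_nat b :: 'k) powr (ln (real a) / ln (real b)))" using w1[OF ab(1)] w1[OF ab(2)] ab by (subst ln_le_cancel_iff) auto
    also have "\<dots> = ln (real a) / ln (real b) * ln (av (of_nat b :: 'k))" using w1[OF ab(2)] by (simp add: ln_powr)
    finally show ?thesis using ab by (simp add: divide_le_eq mult.commute)
  qed
  define s where "s = ln (av (of_nat 2 :: 'k)) / ln 2"
  have eq: "ln (av (of_nat b :: 'k)) / ln (real b) = s" if "b \<ge> 2" for b
    using le[of b 2] le[of 2 b] that by (simp add: s_def)
  have "s > 0" unfolding s_def using w1[of 2] by simp
  moreover have "av (of_nat n :: 'k) = real n powr s" if "n \<ge> 1" for n
  proof (cases "n = 1")
    case False
    then have n: "n \<ge> 2" using that by simp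
    have "ln (av (of_nat n :: 'k)) = s * ln (real n)" using eq[OF n] n by (simp add: field_simps)
    then have "exp (ln (av (of_nat n :: 'k))) = exp (s * ln (real n))" by simp
    then show ?thesis using w1[OF n] n by (simp add: powr_def)
  qed simp
  ultimately show ?thesis by (rule that)
qed

end

locale arch_exponent = arch_field F for F :: "'k::{field_char_0, complete_space} set" +
  fixes s :: real
  assumes s: "s > 0" and av_of_nat: "n \<ge> 1 \<Longrightarrow> av (of_nat n :: 'k) = real n powr s"
begin

lemma av_of_rat: "av (of_rat q :: 'k) = \<bar>of_rat q\<bar> powr s"
proof -
  have int: "av (of_int i :: 'k) = \<bar>real_of_int i\<bar> powr s" for i
  proof (cases "i = 0")
    case False
    have "av (of_int i :: 'k) = av (of_nat (nat \<bar>i\<bar>) :: 'k)" by (cases "i \<ge> 0") (auto simp: av_minus[of "of_int i :: 'k", symmetric] simp del: av_minus)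
    also have "\<dots> = real (nat \<bar>i\<bar>) powr s" using False by (intro av_of_nat) linarith
    finally show ?thesis by simp
  qed simp
  obtain a b where ab: "quotient_of q = (a, b)" by force
  have b: "b > 0" and q: "q = of_int a / of_int b" using quotient_of_denom_pos[OF ab] quotient_of_div[OF ab] by auto
  have "av (of_rat q :: 'k) = \<bar>real_of_int a\<bar> powr s / \<bar>real_of_int b\<bar> powr s"
    unfolding q by (simp add: of_rat_divide av_divide int)
  also have "\<dots> = \<bar>of_rat q\<bar> powr s" using b unfolding q by (simp add: of_rat_divide powr_divide)
  finally show ?thesis .
qed

text \<open>On the rationals the metric is the \<open>s\<close>-th power of the usual distance, so
  their embedding is uniformly continuous and extends to the closure, the real line. Additivity and
  multiplicativity pass to limits of rational sequences.\<close>

lemma real_embedding: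
  obtains g :: "real \<Rightarrow> 'k" where "\<And>x y. g (x + y) = g x + g y" "\<And>x y. g (x * y) = g x * g y" "g 1 = 1"
    "\<And>x. av (g x) = \<bar>x\<bar> powr s"
proof -
  define f :: "real \<Rightarrow> 'k" where "f x = of_rat (SOME q. x = of_rat q)" for x
  have f_rat: "f (of_rat q) = of_rat q" for q
  proof -
    have "(of_rat q :: real) = of_rat (SOME r. (of_rat q :: real) = of_rat r)" by (rule someI[of _ q]) simp
    then have "(SOME r. (of_rat q :: real) = of_rat r) = q" by simp
    then show ?thesis by (simp only: f_def)
  qed
  have dist_f: "dist (f x) (f y) = \<bar>x - y\<bar> powr s" if xy: "x \<in> \<rat>" "y \<in> \<rat>" for x y
  proof -
    obtain q r where "x = of_rat q" "y = of_rat r" using xy by (auto elim!: Rats_cases)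
    then show ?thesis using av_of_rat[of "q - r"] by (simp add: f_rat dist_av of_rat_diff)
  qed
  have "uniformly_continuous_on \<rat> f"
    unfolding uniformly_continuous_on_def
  proof (intro allI impI)
    fix \<epsilon> :: real assume \<epsilon>: "\<epsilon> > 0"
    have "dist (f y) (f x) < \<epsilon>" if "x \<in> \<rat>" "y \<in> \<rat>" "dist y x < \<epsilon> powr (1 / s)" for x y
    proof -
      have "\<bar>y - x\<bar> powr s < (\<epsilon> powr (1 / s)) powr s"
        using that(3) s by (intro powr_less_mono2) (auto simp: dist_real_def)
      then show ?thesis using dist_f[OF that(2,1)] s \<epsilon> by (simp add: powr_powr)
    qed
    then show "\<exists>d>0. \<forall>x\<in>\<rat>. \<forall>y\<in>\<rat>. dist y x < d \<longrightarrow> dist (f y) (f x) < \<epsilon>"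
      using \<epsilon> by (intro exI[of _ "\<epsilon> powr (1 / s)"]) auto
  qed
  then obtain g where g: "uniformly_continuous_on (closure \<rat>) g" "\<And>x. x \<in> \<rat> \<Longrightarrow> f x = g x"
    using uniformly_continuous_on_extension_on_closure by metis
  have cont: "continuous_on UNIV g" using uniformly_continuous_imp_continuous[OF g(1)] by (simp add: Rats_closure_real)
  have seq: "\<exists>q. (\<forall>n. q n \<in> \<rat>) \<and> q \<longlonglongrightarrow> x" for x :: real
    using Rats_closure_real closure_sequential[of x \<rat>] by auto
  have lim: "(\<lambda>n. g (q n)) \<longlonglongrightarrow> g x" if "q \<longlonglongrightarrow> x" for q x
    using continuous_on_tendsto_compose[OF cont that] by simp
  have dist_g: "dist (g x) (g y) = \<bar>x - y\<bar> powr s" for x y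
  proof -
    obtain q where q: "\<And>n. q n \<in> \<rat>" "q \<longlonglongrightarrow> x" using seq by blast
    obtain r where r: "\<And>n. r n \<in> \<rat>" "r \<longlonglongrightarrow> y" using seq by blast
    have "(\<lambda>n. dist (g (q n)) (g (r n))) \<longlonglongrightarrow> dist (g x) (g y)" by (intro tendsto_dist lim q r)
    moreover have "(\<lambda>n. dist (g (q n)) (g (r n))) \<longlonglongrightarrow> \<bar>x - y\<bar> powr s"
    proof -
      have "(\<lambda>n. \<bar>q n - r n\<bar> powr s) \<longlonglongrightarrow> \<bar>x - y\<bar> powr s"
        using s by (intro tendsto_powr' tendsto_intros q r) auto
      then show ?thesis using dist_f[OF q(1) r(1)] g(2) q(1) r(1) by simp
    qed
    ultimately show ?thesis by (rule LIMSEQ_unique)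
  qed
  have g_rat: "g (of_rat q) = of_rat q" for q using g(2)[of "of_rat q"] f_rat by simp
  have small: "(\<lambda>n. \<bar>h n\<bar> powr s) \<longlonglongrightarrow> 0" if "h \<longlonglongrightarrow> 0" for h :: "nat \<Rightarrow> real"
  proof -
    have "(\<lambda>n. \<bar>h n\<bar> powr s) \<longlonglongrightarrow> \<bar>0\<bar> powr s" using s that by (intro tendsto_powr' tendsto_intros) auto
    then show ?thesis by simp
  qed
  have av_g: "av (g x) = \<bar>x\<bar> powr s" for x using dist_g[of x 0] g_rat[of 0] by (simp add: av_def)
  have zero: "z = 0" if "\<And>n. av z \<le> h n" "h \<longlonglongrightarrow> 0" for z h
  proof -
    have "av z \<le> 0" by (rule LIMSEQ_le_const[OF that(2)]) (use that(1) in auto)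
    then show ?thesis using av_nonneg[of z] av_eq_0[of z] by linarith
  qed
  have add: "g (x + y) = g x + g y" for x y
  proof -
    obtain q where q: "\<And>n. q n \<in> \<rat>" "q \<longlonglongrightarrow> x" using seq by blast
    obtain r where r: "\<And>n. r n \<in> \<rat>" "r \<longlonglongrightarrow> y" using seq by blast
    let ?h = "\<lambda>n. \<bar>(x + y) - (q n + r n)\<bar> powr s + (\<bar>q n - x\<bar> powr s + \<bar>r n - y\<bar> powr s)"
    have "av (g (x + y) - (g x + g y)) \<le> ?h n" for n
    proof -
      obtain a b where ab: "q n = of_rat a" "r n = of_rat b" using q(1) r(1) by (metis Rats_cases)
      have "g (q n + r n) = g (q n) + g (r n)" unfolding ab of_rat_add[symmetric] g_rat by (simp add: of_rat_add)
      then have "g (x + y) - (g x + g y) = (g (x + y) - g (q n + r n)) + ((g (q n) - g x) + (g (r n) - g y))" by simp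
      then have "av (g (x + y) - (g x + g y)) \<le> av (g (x + y) - g (q n + r n)) + av ((g (q n) - g x) + (g (r n) - g y))"
        by (simp only: av_add)
      also have "\<dots> \<le> av (g (x + y) - g (q n + r n)) + (av (g (q n) - g x) + av (g (r n) - g y))"
        by (intro add_left_mono av_add)
      finally show ?thesis by (simp only: dist_av[symmetric] dist_g)
    qed
    moreover have "?h \<longlonglongrightarrow> 0 + (0 + 0)"
    proof (intro tendsto_add small)
      show "(\<lambda>n. x + y - (q n + r n)) \<longlonglongrightarrow> 0" using tendsto_diff[OF tendsto_const[of "x + y"] tendsto_add[OF q(2) r(2)]] by simp
      show "(\<lambda>n. q n - x) \<longlonglongrightarrow> 0" using q(2) by (simp add: LIM_zero_iff)
      show "(\<lambda>n. r n - y) \<longlonglongrightarrow> 0" using r(2) by (simp add: LIM_zero_iff)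
    qed
    ultimately have "g (x + y) - (g x + g y) = 0" by (intro zero[of _ ?h]) simp_all
    then show ?thesis by simp
  qed
  have mult: "g (x * y) = g x * g y" for x y
  proof -
    obtain q where q: "\<And>n. q n \<in> \<rat>" "q \<longlonglongrightarrow> x" using seq by blast
    obtain r where r: "\<And>n. r n \<in> \<rat>" "r \<longlonglongrightarrow> y" using seq by blast
    let ?h = "\<lambda>n. \<bar>x * y - q n * r n\<bar> powr s + (\<bar>q n - x\<bar> powr s * \<bar>r n\<bar> powr s + \<bar>x\<bar> powr s * \<bar>r n - y\<bar> powr s)"
    have "av (g (x * y) - g x * g y) \<le> ?h n" for n
    proof -
      obtain a b where ab: "q n = of_rat a" "r n = of_rat b" using q(1) r(1) by (metis Rats_cases)
      have "g (q n * r n) = g (q n) * g (r n)" unfolding ab of_rat_mult[symmetric] g_rat by (simp add: of_rat_mult)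
      then have "g (x * y) - g x * g y = (g (x * y) - g (q n * r n)) + ((g (q n) - g x) * g (r n) + g x * (g (r n) - g y))" by (simp add: algebra_simps)
      then have "av (g (x * y) - g x * g y) \<le> av (g (x * y) - g (q n * r n)) + av ((g (q n) - g x) * g (r n) + g x * (g (r n) - g y))"
        by (simp only: av_add)
      also have "\<dots> \<le> av (g (x * y) - g (q n * r n)) + (av ((g (q n) - g x) * g (r n)) + av (g x * (g (r n) - g y)))"
        by (intro add_left_mono av_add)
      finally show ?thesis by (simp only: av_mult dist_av[symmetric] dist_g av_g)
    qed
    moreover have "?h \<longlonglongrightarrow> 0 + (0 * \<bar>y\<bar> powr s + \<bar>x\<bar> powr s * 0)"
    proof (intro tendsto_add tendsto_mult small tendsto_const)
      show "(\<lambda>n. x * y - q n * r n) \<longlonglongrightarrow> 0" using tendsto_diff[OF tendsto_const[of "x * y"] tendsto_mult[OF q(2) r(2)]] by simp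
      show "(\<lambda>n. q n - x) \<longlonglongrightarrow> 0" using q(2) by (simp add: LIM_zero_iff)
      show "(\<lambda>n. r n - y) \<longlonglongrightarrow> 0" using r(2) by (simp add: LIM_zero_iff)
      show "(\<lambda>n. \<bar>r n\<bar> powr s) \<longlonglongrightarrow> \<bar>y\<bar> powr s" using s by (intro tendsto_powr' tendsto_intros r) auto
    qed
    ultimately have "g (x * y) - g x * g y = 0" by (intro zero[of _ ?h]) simp_all
    then show ?thesis by simp
  qed
  have "g 1 = 1" using g_rat[of 1] by simp
  then show ?thesis using add mult av_g that by blast
qed

text \<open>Distances correspond by a power, so Cauchy sequences do too and the image is closed; it
  contains the dense subfield \<open>F\<close>, hence is everything. The same power relation gives
  continuity in both directions.\<close>

lemma isometric_embedding_iso: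
  fixes E :: "'a::{real_normed_field, complete_space} \<Rightarrow> 'k"
  assumes add: "\<And>x y. E (x + y) = E x + E y" and mult: "\<And>x y. E (x * y) = E x * E y" and E1: "E 1 = 1"
    and av: "\<And>x. av (E x) = norm x powr s" and F_sub: "F \<subseteq> range E"
  shows "topological_field_iso E"
proof -
  have E0: "E 0 = 0" using add[of 0 0] by simp
  have diff: "E (x - y) = E x - E y" for x y using add[of "x - y" y] by (simp add: eq_diff_eq)
  have dist_E: "dist (E x) (E y) = dist x y powr s" for x y
    using av[of "x - y"] by (simp add: dist_av diff dist_norm)
  have inv_dist: "dist x y = dist (E x) (E y) powr (1 / s)" for x y
    using s by (simp add: dist_E powr_powr)
  have inj: "inj E"
  proof (rule injI)
    fix x y assume "E x = E y"
    then have "dist x y = 0" by (subst inv_dist) simp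
    then show "x = y" by simp
  qed
  have "closed (range E)"
    unfolding closed_sequential_limits
  proof (intro allI impI, elim conjE)
    fix z l assume z: "\<forall>n. z n \<in> range E" "z \<longlonglongrightarrow> l"
    then have "\<forall>n. \<exists>a. z n = E a" by blast
    then have "\<exists>x. \<forall>n. z n = E (x n)" by (rule choice)
    then obtain x where x: "\<And>n. z n = E (x n)" by blast
    have "Cauchy x"
      unfolding Cauchy_def
    proof (intro allI impI)
      fix \<epsilon> :: real assume \<epsilon>: "\<epsilon> > 0"
      then have "\<epsilon> powr s > 0" by simp
      then obtain N where N: "\<forall>m\<ge>N. \<forall>n\<ge>N. dist (z m) (z n) < \<epsilon> powr s"
        using LIMSEQ_imp_Cauchy[OF z(2)] unfolding Cauchy_def by blast
      have "dist (x m) (x n) < \<epsilon>" if "m \<ge> N" "n \<ge> N" for m n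
      proof -
        have "dist (z m) (z n) powr (1 / s) < (\<epsilon> powr s) powr (1 / s)"
          using N that s by (intro powr_less_mono2) auto
        then show ?thesis using s \<epsilon> inv_dist[of "x m" "x n"] by (simp add: x powr_powr)
      qed
      then show "\<exists>N. \<forall>m\<ge>N. \<forall>n\<ge>N. dist (x m) (x n) < \<epsilon>" by blast
    qed
    then have "convergent x" by (rule Cauchy_convergent)
    then obtain y where y: "x \<longlonglongrightarrow> y" by (auto simp: convergent_def)
    have "(\<lambda>n. dist (z n) (E y)) \<longlonglongrightarrow> 0"
    proof -
      have "(\<lambda>n. dist (x n) y) \<longlonglongrightarrow> 0" using y by (rule iffD1[OF tendsto_dist_iff])
      then have "(\<lambda>n. dist (x n) y powr s) \<longlonglongrightarrow> 0 powr s"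
        by (rule tendsto_powr'[OF _ tendsto_const]) (use s in simp)
      then show ?thesis by (simp add: x dist_E)
    qed
    then have "z \<longlonglongrightarrow> E y" by (rule iffD2[OF tendsto_dist_iff])
    then have "l = E y" using z(2) by (intro LIMSEQ_unique)
    then show "l \<in> range E" by simp
  qed
  then have surj: "range E = UNIV" using dense closure_minimal[OF F_sub] by auto
  have E_inv: "E (inv E z) = z" for z using surj by (simp add: surj_f_inv_f)
  have "continuous_on UNIV E"
    unfolding continuous_on_iff
  proof (intro ballI allI impI)
    fix x and \<epsilon> :: real assume \<epsilon>: "\<epsilon> > 0"
    have "dist (E y) (E x) < \<epsilon>" if "dist y x < \<epsilon> powr (1 / s)" for y
    proof -
      have "dist y x powr s < (\<epsilon> powr (1 / s)) powr s" using that s by (intro powr_less_mono2) auto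
      then show ?thesis using s \<epsilon> by (simp add: dist_E powr_powr)
    qed
    then show "\<exists>d>0. \<forall>y\<in>UNIV. dist y x < d \<longrightarrow> dist (E y) (E x) < \<epsilon>"
      using \<epsilon> by (intro exI[of _ "\<epsilon> powr (1 / s)"]) auto
  qed
  moreover have "continuous_on UNIV (inv E)"
    unfolding continuous_on_iff
  proof (intro ballI allI impI)
    fix x and \<epsilon> :: real assume \<epsilon>: "\<epsilon> > 0"
    have "dist (inv E y) (inv E x) < \<epsilon>" if "dist y x < \<epsilon> powr s" for y
    proof -
      have "dist y x powr (1 / s) < (\<epsilon> powr s) powr (1 / s)" using that s by (intro powr_less_mono2) auto
      then show ?thesis using s \<epsilon> inv_dist[of "inv E y" "inv E x"] by (simp add: E_inv powr_powr)
    qed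
    then show "\<exists>d>0. \<forall>y\<in>UNIV. dist y x < d \<longrightarrow> dist (inv E y) (inv E x) < \<epsilon>"
      using \<epsilon> by (intro exI[of _ "\<epsilon> powr s"]) auto
  qed
  moreover have "range (inv E) = UNIV" using inj by (metis inj_imp_surj_inv)
  ultimately show ?thesis
    unfolding topological_field_iso_def homeomorphism_def
    using add mult E1 surj E_inv inv_f_f[OF inj] by simp
qed

end

lemma ring_hom_field_facts:
  fixes h :: "'a::field_char_0 \<Rightarrow> 'b::field_char_0"
  assumes add: "\<And>x y. h (x + y) = h x + h y" and mult: "\<And>x y. h (x * y) = h x * h y" and h1: "h 1 = 1"
  shows "h 0 = 0" "h (- x) = - h x" "h (x - y) = h x - h y" "h x = 0 \<longleftrightarrow> x = 0" "h (of_rat q) = of_rat q"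
    "h (inverse x) = inverse (h x)"
proof -
  show h0: "h 0 = 0" using add[of 0 0] by simp
  show m: "h (- x) = - h x" for x using add[of x "- x"] h0 by (simp add: eq_neg_iff_add_eq_0 add.commute)
  show "h (x - y) = h x - h y" using add[of x "- y"] m by simp
  have nz: "h x * h (inverse x) = 1" if "x \<noteq> 0" for x using mult[of x "inverse x"] that h1 by simp
  show z: "h x = 0 \<longleftrightarrow> x = 0" for x using nz[of x] h0 by (cases "x = 0") auto
  show inv: "h (inverse x) = inverse (h x)" for x using nz[of x] h0 by (cases "x = 0") (auto intro: inverse_unique[symmetric])
  have nat: "h (of_nat n) = of_nat n" for n by (induction n) (auto simp: h0 h1 add)
  have int: "h (of_int i) = of_int i" for i using nat m by (cases i rule: int_cases2) auto
  obtain a b where ab: "quotient_of q = (a, b)" by force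
  have "of_rat q = (of_int a / of_int b :: 'a)" "of_rat q = (of_int a / of_int b :: 'b)"
    unfolding quotient_of_div[OF ab] by (simp_all add: of_rat_divide)
  then show "h (of_rat q) = of_rat q" by (simp only: divide_inverse mult int inv)
qed

lemma poly_map_poly_hom:
  fixes h :: "'a::field_char_0 \<Rightarrow> 'b::field_char_0"
  assumes add: "\<And>x y. h (x + y) = h x + h y" and mult: "\<And>x y. h (x * y) = h x * h y" and h1: "h 1 = 1"
  shows "poly (map_poly h (p * q)) y = poly (map_poly h p) y * poly (map_poly h q) y"
    and "poly (map_poly h (map_poly of_rat r)) y = poly (map_poly of_rat r) y"
proof -
  note facts = ring_hom_field_facts[of h, OF add mult h1]
  have pC: "map_poly h (pCons a p) = pCons (h a) (map_poly h p)" for a p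
    by (rule map_poly_pCons) (rule facts(1))
  have sm: "map_poly h (smult a p) = smult (h a) (map_poly h p)" for a p
    by (rule map_poly_smult) (simp_all add: facts mult)
  have ad: "map_poly h (p + q) = map_poly h p + map_poly h q" for p q
    by (rule poly_eqI) (simp add: coeff_map_poly facts add)
  show "poly (map_poly h (p * q)) y = poly (map_poly h p) y * poly (map_poly h q) y"
    by (induction p) (simp_all add: pC sm ad facts mult_pCons_left algebra_simps)
  have "map_poly h (map_poly of_rat r) = map_poly of_rat r"
    by (rule poly_eqI) (simp add: coeff_map_poly facts)
  then show "poly (map_poly h (map_poly of_rat r)) y = poly (map_poly of_rat r) y" by simp
qed

text \<open>The fundamental theorem of algebra splits off linear factors inside the embedded complex
  numbers, so no further root can appear in the larger field.\<close>

lemma complex_embedding_closed: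
  fixes E :: "complex \<Rightarrow> 'b::field_char_0"
  assumes add: "\<And>x y. E (x + y) = E x + E y" and mult: "\<And>x y. E (x * y) = E x * E y" and E1: "E 1 = 1"
    and "p \<noteq> 0" "poly (map_poly E p) y = 0"
  shows "y \<in> range E"
  using assms(4,5)
proof (induction "degree p" arbitrary: p rule: less_induct)
  case less
  note facts = ring_hom_field_facts[of E, OF add mult E1]
  show ?case
  proof (cases "degree p = 0")
    case True
    then obtain c where "p = [:c:]" using degree_eq_zeroE by blast
    then show ?thesis using less.prems facts by (auto simp: map_poly_pCons)
  next
    case False
    then have "\<not> constant (poly p)" by (simp add: constant_degree)
    then obtain z where "poly p z = 0" using fundamental_theorem_of_algebra by blast
    then obtain q where q: "p = [:- z, 1:] * q" by (auto simp: poly_eq_0_iff_dvd dvd_def)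
    have "q \<noteq> 0" using q less.prems(1) by auto
    then have deg: "degree q < degree p" unfolding q by (subst degree_mult_eq) auto
    have "poly (map_poly E [:- z, 1:]) y = y - E z" by (simp add: map_poly_pCons facts E1)
    then have "(y - E z) * poly (map_poly E q) y = 0"
      using less.prems(2) poly_map_poly_hom(1)[of E "[:- z, 1:]" q y, OF add mult E1] by (simp only: q)
    then show ?thesis using less.hyps[OF deg \<open>q \<noteq> 0\<close>] by auto
  qed
qed

text \<open>A real polynomial splits into linear and irreducible quadratic factors, and a root of a
  quadratic one would produce a square root of -1.\<close>

lemma real_embedding_closed:
  fixes g :: "real \<Rightarrow> 'b::field_char_0"
  assumes add: "\<And>x y. g (x + y) = g x + g y" and mult: "\<And>x y. g (x * y) = g x * g y" and g1: "g 1 = 1"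
    and no_i: "\<And>j. j * j \<noteq> (- 1 :: 'b)" and "p \<noteq> 0" "poly (map_poly g p) y = 0"
  shows "y \<in> range g"
  using assms(5,6)
proof (induction "degree p" arbitrary: p rule: less_induct)
  case less
  note facts = ring_hom_field_facts[of g, OF add mult g1]
  note hom = poly_map_poly_hom(1)[of g, OF add mult g1]
  show ?case
  proof (cases "degree p = 0")
    case True
    then obtain c where "p = [:c:]" using degree_eq_zeroE by blast
    then show ?thesis using less.prems facts by (auto simp: map_poly_pCons)
  next
    case False
    have ev_re: "poly (map_poly of_real r) (of_real x) = complex_of_real (poly r x)" for r x
      by (induction r) (simp_all add: map_poly_pCons)
    have "degree (map_poly complex_of_real p) = degree p" by (rule degree_map_poly) simp
    then have "\<not> constant (poly (map_poly complex_of_real p))" using False by (simp add: constant_degree)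
    then obtain z where z: "poly (map_poly complex_of_real p) z = 0" using fundamental_theorem_of_algebra by blast
    show ?thesis
    proof (cases "Im z = 0")
      case True
      then have "z = of_real (Re z)" by (simp add: complex_eq_iff)
      then have "poly p (Re z) = 0" using z ev_re[of p "Re z"] by simp
      then obtain q where q: "p = [:- Re z, 1:] * q" by (auto simp: poly_eq_0_iff_dvd dvd_def)
      have "q \<noteq> 0" using q less.prems(1) by auto
      then have deg: "degree q < degree p" unfolding q by (subst degree_mult_eq) auto
      have "poly (map_poly g [:- Re z, 1:]) y = y - g (Re z)" by (simp add: map_poly_pCons facts g1)
      then have "(y - g (Re z)) * poly (map_poly g q) y = 0"
        using less.prems(2) hom[of "[:- Re z, 1:]" q y] by (simp only: q)
      then show ?thesis using less.hyps[OF deg \<open>q \<noteq> 0\<close>] by auto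
    next
      case im: False
      \<comment> \<open>The real minimal polynomial of the nonreal root \<open>z\<close>. It divides
        \<open>p\<close>, because the remainder has degree below 2 and vanishes at
        \<open>z\<close>.\<close>
      define Q where "Q = [:(Re z)\<^sup>2 + (Im z)\<^sup>2, - 2 * Re z, 1:]"
      have Q: "degree Q = 2" "Q \<noteq> 0" by (simp_all add: Q_def)
      have chom: "poly (map_poly complex_of_real (a * b)) z = poly (map_poly complex_of_real a) z * poly (map_poly complex_of_real b) z" for a b
        by (rule poly_map_poly_hom(1)) simp_all
      have cadd: "map_poly complex_of_real (a + b) = map_poly complex_of_real a + map_poly complex_of_real b" for a b
        by (rule poly_eqI) (simp add: coeff_map_poly)
      have Qz: "poly (map_poly complex_of_real Q) z = 0"
        by (simp add: Q_def map_poly_pCons complex_eq_iff power2_eq_square algebra_simps)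
      define r where "r = p mod Q"
      have pr: "p = Q * (p div Q) + r" unfolding r_def by (rule mult_div_mod_eq[symmetric])
      then have "poly (map_poly complex_of_real r) z = 0" using z Qz by (metis cadd chom poly_add mult_zero_left add_0)
      moreover have "degree r < 2"
      proof (cases "r = 0")
        case False
        then show ?thesis using degree_mod_less[OF Q(2), of p] Q(1) by (auto simp: r_def)
      qed simp
      then obtain a b where ab: "r = [:a, b:]" by (metis degree_0 less_2_cases_iff degree_eq_zeroE degree1_coeffs One_nat_def pCons_0_0)
      ultimately have "of_real a + of_real b * z = 0" by (simp add: map_poly_pCons algebra_simps)
      then have "b * Im z = 0" "a + b * Re z = 0" by (auto simp: complex_eq_iff)
      then have "r = 0" using im ab by simp
      then have pq: "p = Q * (p div Q)" using pr by (simp only: add_0_right)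
      have q0: "p div Q \<noteq> 0" using pq less.prems(1) by (metis mult_zero_right)
      have "degree p = degree (Q * (p div Q))" using pq by (rule arg_cong)
      also have "\<dots> = degree Q + degree (p div Q)" by (rule degree_mult_eq[OF Q(2) q0])
      finally have deg: "degree (p div Q) < degree p" using Q(1) by linarith
      have "poly (map_poly g Q) y * poly (map_poly g (p div Q)) y = 0"
        using less.prems(2) hom[of Q "p div Q" y] pq by metis
      moreover have "poly (map_poly g Q) y \<noteq> 0"
      proof
        let ?a = "g (Re z)" and ?b = "g (Im z)"
        assume "poly (map_poly g Q) y = 0"
        moreover have "poly (map_poly g Q) y = (?a * ?a + ?b * ?b) + y * (- (?a + ?a) + y)"
        proof -
          have "g ((Re z)\<^sup>2 + (Im z)\<^sup>2) = ?a * ?a + ?b * ?b" by (simp add: power2_eq_square add mult)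
          moreover have "g (- 2 * Re z) = - (?a + ?a)" using facts(2)[of "Re z + Re z"] add[of "Re z" "Re z"] by simp
          ultimately show ?thesis by (simp add: Q_def map_poly_pCons facts(1) g1)
        qed
        \<comment> \<open>Completing the square: dividing by the nonzero \<open>?b\<close> would
          give a square root of -1.\<close>
        ultimately have "(y - ?a) * (y - ?a) = - (?b * ?b)" by (simp add: algebra_simps eq_neg_iff_add_eq_0)
        then have "((y - ?a) / ?b) * ((y - ?a) / ?b) = - 1" using im facts(4)[of "Im z"] by (simp add: field_simps)
        then show False using no_i by blast
      qed
      ultimately have "poly (map_poly g (p div Q)) y = 0" by simp
      then show ?thesis by (rule less.hyps[OF deg q0])
    qed
  qed
qed

context arch_exponent
begin

text \<open>The elements of \<open>F\<close> are algebraic over the rationals, so they lie in the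
  embedded reals when -1 is not a square, and in the embedded complex numbers otherwise. In the
  second case it must be shown that the absolute value of \<open>E z\<close> depends only on the
  modulus of \<open>z\<close>.\<close>

lemma arch_iso:
  "(\<exists>e::real \<Rightarrow> 'k. topological_field_iso e) \<or> (\<exists>e::complex \<Rightarrow> 'k. topological_field_iso e)"
proof -
  obtain g :: "real \<Rightarrow> 'k" where g: "\<And>x y. g (x + y) = g x + g y" "\<And>x y. g (x * y) = g x * g y" "g 1 = 1"
    "\<And>x. av (g x) = \<bar>x\<bar> powr s" using real_embedding by metis
  note gf = ring_hom_field_facts[of g, OF g(1-3)]
  show ?thesis
  proof (cases "\<exists>j::'k. j * j = - 1")
    case False
    have "F \<subseteq> range g"
    proof
      fix y assume "y \<in> F"
      then obtain p :: "rat poly" where p: "p \<noteq> 0" "poly (map_poly of_rat p) y = 0"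
        using number_field_algebraic[OF F] by metis
      show "y \<in> range g"
      proof (rule real_embedding_closed[OF g(1-3)])
        show "\<And>j::'k. j * j \<noteq> - 1" using False by blast
        show "map_poly of_rat p \<noteq> (0 :: real poly)" using p(1) by (subst map_poly_eq_0_iff) auto
        show "poly (map_poly g (map_poly of_rat p)) y = 0"
          using p(2) poly_map_poly_hom(2)[of g, OF g(1-3)] by simp
      qed
    qed
    then have "topological_field_iso g" by (intro isometric_embedding_iso) (auto simp: g)
    then show ?thesis by blast
  next
    case True
    then obtain j :: 'k where j: "j * j = - 1" by blast
    define E where "E z = g (Re z) + g (Im z) * j" for z
    have E: "E (x + y) = E x + E y" "E (x * y) = E x * E y" "E 1 = 1" for x y
    proof -
      show "E (x + y) = E x + E y" by (simp add: E_def g algebra_simps)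
      have "E x * E y = g (Re x) * g (Re y) + g (Im x) * g (Im y) * (j * j) + (g (Re x) * g (Im y) + g (Im x) * g (Re y)) * j"
        by (simp add: E_def algebra_simps)
      then show "E (x * y) = E x * E y" by (simp add: E_def j g gf)
      show "E 1 = 1" by (simp add: E_def g gf)
    qed
    have avj: "av j = 1"
    proof -
      have "av j * av j = 1" using av_mult[of j j] by (simp add: j)
      then show ?thesis using av_nonneg[of j] by (metis abs_of_nonneg abs_square_eq_1 power2_eq_square)
    qed
    have le2: "av (E z) \<le> 2" if "cmod z = 1" for z
    proof -
      have "\<bar>Re z\<bar> powr s \<le> 1" "\<bar>Im z\<bar> powr s \<le> 1"
        using abs_Re_le_cmod[of z] abs_Im_le_cmod[of z] that s powr_mono2[of s "\<bar>Re z\<bar>" 1] powr_mono2[of s "\<bar>Im z\<bar>" 1] by auto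
      then show ?thesis using av_add[of "g (Re z)" "g (Im z) * j"] by (simp add: E_def av_mult avj g)
    qed
    have Epow: "E (z ^ n) = E z ^ n" for z n by (induction n) (auto simp: E)
    \<comment> \<open>Powers of \<open>z\<close> remain on the unit circle, where the crude bound 2
      holds; bounded powers force a value of at most 1. Inverses also lie on the circle, so equality
      follows.\<close>
    have le1: "av (E z) \<le> 1" if "cmod z = 1" for z
    proof (rule le_1_if_power_le_linear)
      show "av (E z) ^ k \<le> 0 * real k + 2" for k using le2[of "z ^ k"] that by (simp add: Epow av_power norm_power)
    qed
    have circ: "av (E z) = 1" if z: "cmod z = 1" for z
    proof -
      have "z \<noteq> 0" using z by auto
      then have "E z * E (inverse z) = 1" by (subst E(2)[symmetric]) (auto simp: E(3))
      then have "av (E z) * av (E (inverse z)) = 1" by (metis av_1 av_mult)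
      moreover have "av (E (inverse z)) \<le> 1" using le1[of "inverse z"] z by (simp add: norm_inverse)
      ultimately have "1 \<le> av (E z)" using mult_left_mono[of "av (E (inverse z))" 1 "av (E z)"] by simp
      then show ?thesis using le1[OF z] by simp
    qed
    have avE: "av (E z) = norm z powr s" for z
    proof (cases "z = 0")
      case True
      then show ?thesis using E(1)[of 0 0] by simp
    next
      case False
      have "z = of_real (cmod z) * (z / of_real (cmod z))" using False by simp
      then have "E z = E (of_real (cmod z)) * E (z / of_real (cmod z))" using E(2) by metis
      then have "av (E z) = av (E (of_real (cmod z))) * av (E (z / of_real (cmod z)))" by (simp add: av_mult)
      also have "av (E (z / of_real (cmod z))) = 1" using False by (intro circ) (simp add: norm_divide)
      finally show ?thesis by (simp add: E_def gf g)
    qed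
    have "F \<subseteq> range E"
    proof
      fix y assume "y \<in> F"
      then obtain p :: "rat poly" where p: "p \<noteq> 0" "poly (map_poly of_rat p) y = 0"
        using number_field_algebraic[OF F] by metis
      show "y \<in> range E"
      proof (rule complex_embedding_closed[OF E])
        show "map_poly of_rat p \<noteq> (0 :: complex poly)" using p(1) by (subst map_poly_eq_0_iff) auto
        show "poly (map_poly E (map_poly of_rat p)) y = 0"
          using p(2) poly_map_poly_hom(2)[of E, OF E] by simp
      qed
    qed
    then have "topological_field_iso E" by (intro isometric_embedding_iso E avE)
    then show ?thesis by blast
  qed
qed

end

theorem (in arch_field) ex_topological_field_iso:
  "(\<exists>e::real \<Rightarrow> 'k. topological_field_iso e) \<or> (\<exists>e::complex \<Rightarrow> 'k. topological_field_iso e)"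
proof -
  obtain s where "s > 0" "\<And>n. n \<ge> 1 \<Longrightarrow> av (of_nat n :: 'k) = real n powr s" using ostrowski by metis
  then interpret arch_exponent F s by unfold_locales
  show ?thesis by (rule arch_iso)
qed

section \<open>Independence of the chosen isomorphism\<close>

lemma topological_field_isoD:
  assumes "topological_field_iso e"
  shows "e 1 = 1" "e (x + y) = e x + e y" "e (x * y) = e x * e y"
    "continuous_on UNIV e" "continuous_on UNIV (inv e)" "e (inv e z) = z" "inv e (e x) = x"
  using assms by (auto simp: topological_field_iso_def homeomorphism_def)

lemma topological_field_iso_inv_comp:
  fixes e :: "'a::{field_char_0, topological_space} \<Rightarrow> 'k::{field_char_0, topological_space}"
    and e' :: "'b::{field_char_0, topological_space} \<Rightarrow> 'k"
  assumes e: "topological_field_iso e" and e': "topological_field_iso e'"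
  defines "u \<equiv> \<lambda>x. inv e (e' x)"
  shows "u (x + y) = u x + u y" "u (x * y) = u x * u y" "u 1 = 1" "continuous_on UNIV u" "e' x = e (u x)"
proof -
  note E = topological_field_isoD[OF e] and E' = topological_field_isoD[OF e']
  show "u (x + y) = u x + u y" unfolding u_def by (metis E(2,6,7) E'(2))
  show "u (x * y) = u x * u y" unfolding u_def by (metis E(3,6,7) E'(3))
  show "u 1 = 1" unfolding u_def by (metis E(1,7) E'(1))
  show "continuous_on UNIV u" unfolding u_def by (rule continuous_on_compose2[OF E(5) E'(4)]) auto
  show "e' x = e (u x)" by (simp add: u_def E)
qed

text \<open>The two maps agree on the rationals, which are dense.\<close>

lemma continuous_ring_hom_real:
  fixes u :: "real \<Rightarrow> 'b::real_normed_field"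
  assumes "\<And>x y. u (x + y) = u x + u y" "\<And>x y. u (x * y) = u x * u y" "u 1 = 1" "continuous_on UNIV u"
  shows "u x = of_real x"
proof -
  have "closed {x. u x = of_real x}" by (intro closed_Collect_eq assms continuous_intros)
  moreover have "\<rat> \<subseteq> {x. u x = of_real x}"
  proof
    fix x :: real assume "x \<in> \<rat>"
    then obtain q where "x = of_rat q" by (rule Rats_cases)
    then show "x \<in> {x. u x = of_real x}"
      using ring_hom_field_facts(5)[of u q, OF assms(1-3)] ring_hom_field_facts(5)[of "of_real :: real \<Rightarrow> 'b" q] by simp
  qed
  ultimately have "closure \<rat> \<subseteq> {x. u x = of_real x}" by (rule closure_minimal[rotated])
  then show ?thesis by (auto simp: Rats_closure_real)
qed

lemma real_iso_unique:
  fixes e e' :: "real \<Rightarrow> 'k::{field_char_0, topological_space}"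
  assumes "topological_field_iso e" "topological_field_iso e'"
  shows "e' x = e x"
proof -
  note u = topological_field_iso_inv_comp[OF assms]
  have "inv e (e' x) = of_real x" by (rule continuous_ring_hom_real[of "\<lambda>x. inv e (e' x)"]) (rule u(1-4))+
  then show ?thesis using u(5)[of x] by simp
qed

text \<open>The imaginary unit would be sent to a real number of square -1.\<close>

lemma not_real_and_complex_iso:
  fixes e :: "real \<Rightarrow> 'k::{field_char_0, topological_space}" and e' :: "complex \<Rightarrow> 'k"
  assumes "topological_field_iso e" "topological_field_iso e'"
  shows False
proof -
  let ?u = "\<lambda>x. inv e (e' x)"
  note u = topological_field_iso_inv_comp[OF assms]
  have "?u \<i> * ?u \<i> = ?u (- 1)" by (simp flip: u(2))
  also have "\<dots> = - 1" using ring_hom_field_facts(2)[of ?u 1, OF u(1-3)] u(3) by simp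
  finally show False using zero_le_square[of "?u \<i>"] by simp
qed

text \<open>The comparison map is the identity on the reals and sends the imaginary unit to one of
  the two square roots of -1.\<close>

lemma complex_iso_unique:
  fixes e e' :: "complex \<Rightarrow> 'k::{field_char_0, topological_space}"
  assumes "topological_field_iso e" "topological_field_iso e'"
  shows "(\<forall>z. e' z = e z) \<or> (\<forall>z. e' z = e (cnj z))"
proof -
  let ?u = "\<lambda>x. inv e (e' x)"
  note u = topological_field_iso_inv_comp[OF assms]
  have re: "?u (of_real x) = of_real x" for x
  proof (rule continuous_ring_hom_real)
    show "continuous_on UNIV (\<lambda>x. ?u (of_real x))"
      by (rule continuous_on_compose2[OF u(4)]) (auto intro!: continuous_intros)
  qed (use u in simp_all)
  have "?u \<i> * ?u \<i> = ?u (- 1)" by (simp flip: u(2))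
  also have "\<dots> = - 1" using ring_hom_field_facts(2)[of ?u 1, OF u(1-3)] u(3) by simp
  finally have "(?u \<i> - \<i>) * (?u \<i> + \<i>) = 0" by (simp add: algebra_simps)
  then have i: "?u \<i> = \<i> \<or> ?u \<i> = - \<i>" by (auto simp: eq_neg_iff_add_eq_0)
  have dec: "?u z = of_real (Re z) + of_real (Im z) * ?u \<i>" for z
  proof -
    have "z = of_real (Re z) + of_real (Im z) * \<i>" by (simp add: complex_eq_iff)
    then have "?u z = ?u (of_real (Re z) + of_real (Im z) * \<i>)" by (rule arg_cong)
    also have "\<dots> = ?u (of_real (Re z)) + ?u (of_real (Im z)) * ?u \<i>" by (simp only: u(1,2))
    finally show ?thesis by (simp only: re)
  qed
  show ?thesis
    using i
  proof
    assume "?u \<i> = \<i>"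
    then have "?u z = z" for z using dec[of z] by (simp add: complex_eq_iff)
    then show ?thesis using u(5) by simp
  next
    assume "?u \<i> = - \<i>"
    then have "?u z = cnj z" for z using dec[of z] by (simp add: complex_eq_iff)
    then show ?thesis using u(5) by simp
  qed
qed

context
  fixes dummy :: "'k::{field_char_0, complete_space} itself"
  assumes arch: "\<not> finite_place TYPE('k)"
begin

lemma normalized_abs_real:
  fixes e :: "real \<Rightarrow> 'k"
  assumes e: "topological_field_iso e"
  shows "normalized_abs (e t) = \<bar>t\<bar>"
proof -
  have inj: "e t = e t' \<Longrightarrow> t = t'" for t t' using topological_field_isoD(7)[OF e] by metis
  have "(THE r. (\<exists>(e'::real \<Rightarrow> 'k) t'. topological_field_iso e' \<and> e t = e' t' \<and> r = \<bar>t'\<bar>) \<or>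
        (\<exists>(e'::complex \<Rightarrow> 'k) z. topological_field_iso e' \<and> e t = e' z \<and> of_real r = z * cnj z)) = \<bar>t\<bar>"
  proof (rule the_equality)
    show "(\<exists>(e'::real \<Rightarrow> 'k) t'. topological_field_iso e' \<and> e t = e' t' \<and> \<bar>t\<bar> = \<bar>t'\<bar>) \<or>
        (\<exists>(e'::complex \<Rightarrow> 'k) z. topological_field_iso e' \<and> e t = e' z \<and> of_real \<bar>t\<bar> = z * cnj z)"
      using e by blast
    fix r
    assume "(\<exists>(e'::real \<Rightarrow> 'k) t'. topological_field_iso e' \<and> e t = e' t' \<and> r = \<bar>t'\<bar>) \<or>
        (\<exists>(e'::complex \<Rightarrow> 'k) z. topological_field_iso e' \<and> e t = e' z \<and> of_real r = z * cnj z)"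
    then show "r = \<bar>t\<bar>"
    proof (elim disjE exE conjE)
      fix e' :: "real \<Rightarrow> 'k" and t' assume *: "topological_field_iso e'" "e t = e' t'" "r = \<bar>t'\<bar>"
      then have "t = t'" using inj real_iso_unique[OF e *(1), of t'] by simp
      then show ?thesis using * by simp
    next
      fix e' :: "complex \<Rightarrow> 'k" assume "topological_field_iso e'"
      then show ?thesis using not_real_and_complex_iso[OF e] by blast
    qed
  qed
  then show ?thesis using arch by (simp add: normalized_abs_def)
qed

lemma arch_trace_real:
  fixes e :: "real \<Rightarrow> 'k"
  assumes e: "topological_field_iso e"
  shows "arch_trace (e t) = t"
proof -
  have inj: "e t = e t' \<Longrightarrow> t = t'" for t t' using topological_field_isoD(7)[OF e] by metis
  show ?thesis
    unfolding arch_trace_def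
  proof (rule the_equality)
    show "(\<exists>e'::real \<Rightarrow> 'k. topological_field_iso e' \<and> e t = e' t) \<or>
     (\<exists>(e'::complex \<Rightarrow> 'k) z. topological_field_iso e' \<and> e t = e' z \<and> of_real t = z + cnj z)"
      using e by blast
    fix r
    assume "(\<exists>e'::real \<Rightarrow> 'k. topological_field_iso e' \<and> e t = e' r) \<or>
     (\<exists>(e'::complex \<Rightarrow> 'k) z. topological_field_iso e' \<and> e t = e' z \<and> of_real r = z + cnj z)"
    then show "r = t"
    proof (elim disjE exE conjE)
      fix e' :: "real \<Rightarrow> 'k" assume *: "topological_field_iso e'" "e t = e' r"
      then show ?thesis using inj real_iso_unique[OF e *(1), of r] by simp
    next
      fix e' :: "complex \<Rightarrow> 'k" assume "topological_field_iso e'"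
      then show ?thesis using not_real_and_complex_iso[OF e] by blast
    qed
  qed
qed

text \<open>Conjugation changes neither the modulus nor the real part, so the descriptions in
  \<open>normalized_abs\<close> and \<open>arch_trace\<close> are unambiguous.\<close>

lemma complex_iso_norm_trace:
  fixes e e' :: "complex \<Rightarrow> 'k"
  assumes e: "topological_field_iso e" "topological_field_iso e'" and eq: "e z = e' z'"
  shows "z' = z \<or> z' = cnj z"
proof -
  have inj: "e t = e t' \<Longrightarrow> t = t'" for t t' using topological_field_isoD(7)[OF e(1)] by metis
  show ?thesis
    using complex_iso_unique[OF e]
  proof
    assume "\<forall>z. e' z = e z"
    then have "z = z'" using eq inj by simp
    then show ?thesis by simp
  next
    assume "\<forall>z. e' z = e (cnj z)"
    then have "z = cnj z'" using eq inj by simp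
    then show ?thesis by simp
  qed
qed

lemma normalized_abs_complex:
  fixes e :: "complex \<Rightarrow> 'k"
  assumes e: "topological_field_iso e"
  shows "normalized_abs (e z) = (norm z)\<^sup>2"
proof -
  have sq: "r = (norm z)\<^sup>2" if "complex_of_real r = z * cnj z" for r z
    using that unfolding complex_norm_square[symmetric] by (simp only: of_real_eq_iff)
  have "(THE r. (\<exists>(e'::real \<Rightarrow> 'k) t'. topological_field_iso e' \<and> e z = e' t' \<and> r = \<bar>t'\<bar>) \<or>
        (\<exists>(e'::complex \<Rightarrow> 'k) z'. topological_field_iso e' \<and> e z = e' z' \<and> of_real r = z' * cnj z')) = (norm z)\<^sup>2"
  proof (rule the_equality)
    show "(\<exists>(e'::real \<Rightarrow> 'k) t'. topological_field_iso e' \<and> e z = e' t' \<and> (norm z)\<^sup>2 = \<bar>t'\<bar>) \<or>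
        (\<exists>(e'::complex \<Rightarrow> 'k) z'. topological_field_iso e' \<and> e z = e' z' \<and> of_real ((norm z)\<^sup>2) = z' * cnj z')"
      using e complex_norm_square[of z] by blast
    fix r
    assume "(\<exists>(e'::real \<Rightarrow> 'k) t'. topological_field_iso e' \<and> e z = e' t' \<and> r = \<bar>t'\<bar>) \<or>
        (\<exists>(e'::complex \<Rightarrow> 'k) z'. topological_field_iso e' \<and> e z = e' z' \<and> of_real r = z' * cnj z')"
    then show "r = (norm z)\<^sup>2"
    proof
      assume "\<exists>(e'::real \<Rightarrow> 'k) t'. topological_field_iso e' \<and> e z = e' t' \<and> r = \<bar>t'\<bar>"
      then show ?thesis using not_real_and_complex_iso e by blast
    next
      assume "\<exists>(e'::complex \<Rightarrow> 'k) z'. topological_field_iso e' \<and> e z = e' z' \<and> of_real r = z' * cnj z'"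
      then obtain e' :: "complex \<Rightarrow> 'k" and z' where *: "topological_field_iso e'" "e z = e' z'" "of_real r = z' * cnj z'" by blast
      have "r = (norm z')\<^sup>2" by (rule sq[OF *(3)])
      then show ?thesis using complex_iso_norm_trace[OF e *(1,2)] by auto
    qed
  qed
  then show ?thesis using arch by (simp add: normalized_abs_def)
qed

lemma arch_trace_complex:
  fixes e :: "complex \<Rightarrow> 'k"
  assumes e: "topological_field_iso e"
  shows "arch_trace (e z) = 2 * Re z"
  unfolding arch_trace_def
proof (rule the_equality)
  show "(\<exists>e'::real \<Rightarrow> 'k. topological_field_iso e' \<and> e z = e' (2 * Re z)) \<or>
     (\<exists>(e'::complex \<Rightarrow> 'k) z'. topological_field_iso e' \<and> e z = e' z' \<and> of_real (2 * Re z) = z' + cnj z')"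
    using e complex_add_cnj[of z] by metis
  fix t
  assume "(\<exists>e'::real \<Rightarrow> 'k. topological_field_iso e' \<and> e z = e' t) \<or>
     (\<exists>(e'::complex \<Rightarrow> 'k) z'. topological_field_iso e' \<and> e z = e' z' \<and> of_real t = z' + cnj z')"
  then show "t = 2 * Re z"
  proof
    assume "\<exists>e'::real \<Rightarrow> 'k. topological_field_iso e' \<and> e z = e' t"
    then show ?thesis using not_real_and_complex_iso e by blast
  next
    assume "\<exists>(e'::complex \<Rightarrow> 'k) z'. topological_field_iso e' \<and> e z = e' z' \<and> of_real t = z' + cnj z'"
    then obtain e' :: "complex \<Rightarrow> 'k" and z' where *: "topological_field_iso e'" "e z = e' z'" "of_real t = z' + cnj z'" by blast
    have "t = 2 * Re z'" using *(3) unfolding complex_add_cnj by (simp only: of_real_eq_iff)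
    then show ?thesis using complex_iso_norm_trace[OF e *(1,2)] by auto
  qed
qed

lemma schwartz_bruhat_arch:
  fixes \<phi> :: "'k \<Rightarrow> complex"
  shows "schwartz_bruhat \<phi> \<longleftrightarrow> (\<exists>e::real \<Rightarrow> 'k. topological_field_iso e \<and> schwartz_function (\<phi> \<circ> e)) \<or>
    (\<exists>e::complex \<Rightarrow> 'k. topological_field_iso e \<and> schwartz_function (\<phi> \<circ> e))"
  using arch by (simp add: schwartz_bruhat_def)

lemma arch_place_real:
  fixes e :: "real \<Rightarrow> 'k"
  assumes e: "topological_field_iso e" and M: "self_dual_haar_measure M"
  shows "arch_place e M id (- 2 * pi)"
proof
  show "normalized_abs (e x) = norm x ^ DIM(real)" for x by (simp add: normalized_abs_real[OF e])
  show "place_char (e x * e y) = cis (- 2 * pi * (x \<bullet> id y))" for x y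
  proof -
    have "e x * e y = e (x * y)" by (simp add: topological_field_isoD(3)[OF e])
    then show ?thesis using arch by (simp add: place_char_def arch_trace_real[OF e] cis_conv_exp mult_ac)
  qed
  show "\<And>\<phi>. schwartz_function (\<phi> \<circ> e) \<Longrightarrow> schwartz_bruhat \<phi>" using e schwartz_bruhat_arch by blast
qed (use e M in simp_all)

lemma arch_place_complex:
  fixes e :: "complex \<Rightarrow> 'k"
  assumes e: "topological_field_iso e" and M: "self_dual_haar_measure M"
  shows "arch_place e M cnj (- 4 * pi)"
proof
  show "normalized_abs (e x) = norm x ^ DIM(complex)" for x by (simp add: normalized_abs_complex[OF e])
  show "place_char (e x * e y) = cis (- 4 * pi * (x \<bullet> cnj y))" for x y
  proof -
    have "e x * e y = e (x * y)" by (simp add: topological_field_isoD(3)[OF e])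
    moreover have "x \<bullet> cnj y = Re (x * y)" by (simp add: inner_complex_def)
    ultimately show ?thesis using arch by (simp add: place_char_def arch_trace_complex[OF e] cis_conv_exp mult_ac)
  qed
  show "\<And>\<phi>. schwartz_function (\<phi> \<circ> e) \<Longrightarrow> schwartz_bruhat \<phi>" using e schwartz_bruhat_arch by blast
qed (use e M in simp_all)

text \<open>Admissibility does not mention an isomorphism, so each \<open>\<phi>\<close> may use the
  one for which it is a Schwartz function.\<close>

lemma arch_admissible:
  fixes \<phi> :: "'k \<Rightarrow> complex"
  assumes M: "self_dual_haar_measure M" and \<phi>: "\<phi> \<in> schwartz_bruhat_off_zero"
  shows "fourier_admissible M \<phi> \<and> fourier_admissible M (log_mult \<phi>)"
proof -
  obtain \<epsilon> where \<epsilon>: "\<epsilon> > 0" "\<forall>x\<in>ball 0 \<epsilon>. \<phi> x = 0" and sb: "schwartz_bruhat \<phi>"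
    using \<phi> by (auto simp: schwartz_bruhat_off_zero_def)
  from sb[unfolded schwartz_bruhat_arch] show ?thesis
  proof (elim disjE exE conjE)
    fix e :: "real \<Rightarrow> 'k" assume e: "topological_field_iso e" "schwartz_function (\<phi> \<circ> e)"
    interpret arch_place e M id "- 2 * pi" by (rule arch_place_real[OF e(1) M])
    show ?thesis using admissible[OF e(2)] admissible_log[OF e(2) \<epsilon>] by simp
  next
    fix e :: "complex \<Rightarrow> 'k" assume e: "topological_field_iso e" "schwartz_function (\<phi> \<circ> e)"
    interpret arch_place e M cnj "- 4 * pi" by (rule arch_place_complex[OF e(1) M])
    show ?thesis using admissible[OF e(2)] admissible_log[OF e(2) \<epsilon>] by simp
  qed
qed

lemma arch_commutator_bounded:
  fixes F :: "'k set" and M :: "'k measure"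
  assumes F: "completion_at_place F" and M: "self_dual_haar_measure M"
  shows "(\<exists>C. \<forall>\<phi>\<in>schwartz_bruhat_off_zero.
            conductor_commutator M \<phi> \<in> L2 M \<and>
            L2_norm M (conductor_commutator M \<phi>) \<le> C * L2_norm M \<phi>) \<and>
         (\<exists>T. L2_bounded_operator M T \<and> L2_hermitian M T \<and>
            (\<forall>\<phi>\<in>schwartz_bruhat_off_zero. AE x in M. T \<phi> x = conductor_commutator M \<phi> x))"
proof -
  interpret arch_field F using F arch by unfold_locales
  from ex_topological_field_iso show ?thesis
  proof (elim disjE exE)
    fix e :: "real \<Rightarrow> 'k" assume e: "topological_field_iso e"
    interpret arch_place e M id "- 2 * pi" by (rule arch_place_real[OF e(1) M])
    show ?thesis by (rule commutator_bounded) (rule arch_admissible[OF M])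
  next
    fix e :: "complex \<Rightarrow> 'k" assume e: "topological_field_iso e"
    interpret arch_place e M cnj "- 4 * pi" by (rule arch_place_complex[OF e(1) M])
    show ?thesis by (rule commutator_bounded) (rule arch_admissible[OF M])
  qed
qed

end

section \<open>Finite places: the residue characteristic and the p-adic subfield\<close>

locale nonarch_field = valued_field F for F :: "'k::{field_char_0, complete_space} set" +
  assumes nonarch: "finite_place TYPE('k)"
begin

lemma av_add_max: "av (x + y) \<le> max (av x) (av y)"
  using nonarch by (simp add: finite_place_def av_def)

lemma av_add_le: "av x \<le> c \<Longrightarrow> av y \<le> c \<Longrightarrow> av (x + y) \<le> c"
  using av_add_max[of x y] by linarith

lemma av_diff_le: "av x \<le> c \<Longrightarrow> av y \<le> c \<Longrightarrow> av (x - y) \<le> c"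
  using av_add_le[of x c "- y"] by simp

lemma av_add_less: "av x < c \<Longrightarrow> av y < c \<Longrightarrow> av (x + y) < c"
  using av_add_max[of x y] by linarith

lemma av_sum_le:
  assumes "0 \<le> c" "\<And>i. i \<in> A \<Longrightarrow> av (f i) \<le> c"
  shows "av (\<Sum>i\<in>A. f i) \<le> c"
  using assms(2) by (induction A rule: infinite_finite_induct) (auto intro: av_add_le simp: assms(1))

lemma av_eq_if_close: "av (x - y) < av x \<Longrightarrow> av y = av x"
  using av_add_max[of y "x - y"] av_add_max[of x "- (x - y)"] by (simp only: av_minus) simp

lemma av_of_nat_le_1: "av (of_nat n) \<le> 1"
  by (induction n) (auto intro: av_add_le)

lemma av_of_int_le_1: "av (of_int i) \<le> 1"
proof (cases "i \<ge> 0")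
  case True
  then show ?thesis using av_of_nat_le_1[of "nat i"] by simp
next
  case False
  then have "of_int i = - (of_nat (nat (- i)) :: 'k)" by simp
  then show ?thesis using av_of_nat_le_1[of "nat (- i)"] by (metis av_minus)
qed

text \<open>Otherwise every nonzero rational has value 1. An element of \<open>F\<close> of value
  above 1 satisfies a rational polynomial, whose leading term would then strictly dominate all
  others and could not cancel. The least positive integer of value below 1 is prime, since a proper
  factorization would give it value 1.\<close>

lemma ex_prime_lt_1: "\<exists>p. prime p \<and> av (of_nat p) < 1"
proof -
  have "\<exists>n\<ge>1. av (of_nat n :: 'k) < 1"
  proof (rule ccontr)
    assume "\<not> ?thesis"
    then have nat1: "av (of_nat n :: 'k) = 1" if "n \<ge> 1" for n
      using av_of_nat_le_1[of n] that by (metis order_le_less)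
    have int1: "av (of_int i :: 'k) = 1" if "i \<noteq> 0" for i
    proof (cases "i \<ge> 0")
      case True
      then show ?thesis using nat1[of "nat i"] that by simp
    next
      case False
      then have "of_int i = - (of_nat (nat (- i)) :: 'k)" by simp
      moreover have "av (of_nat (nat (- i)) :: 'k) = 1" using False by (intro nat1) linarith
      ultimately show ?thesis by (metis av_minus)
    qed
    have rat1: "av (of_rat q :: 'k) \<le> 1" "q \<noteq> 0 \<Longrightarrow> av (of_rat q :: 'k) = 1" for q
    proof -
      obtain a b where ab: "quotient_of q = (a, b)" by force
      have b: "b > 0" and q: "q = of_int a / of_int b" using quotient_of_denom_pos[OF ab] quotient_of_div[OF ab] by auto
      have "av (of_rat q :: 'k) = av (of_int a :: 'k)" using int1[of b] b unfolding q by (simp add: of_rat_divide av_divide)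
      then show "av (of_rat q :: 'k) \<le> 1" "q \<noteq> 0 \<Longrightarrow> av (of_rat q :: 'k) = 1" using av_of_int_le_1[of a] int1[of a] q by auto
    qed
    obtain x where x: "x \<in> F" "x \<noteq> 0" "av x \<noteq> 1" using completion by (auto simp: completion_at_place_def av_def)
    have "\<exists>y\<in>F. av y > 1"
    proof (cases "av x > 1")
      case False
      then have "av (inverse x) > 1" using x by (simp add: av_inverse one_less_inverse)
      then show ?thesis using x F by (auto simp: number_field_def)
    qed (use x in auto)
    then obtain y where y: "y \<in> F" "av y > 1" by blast
    obtain P :: "rat poly" where P: "P \<noteq> 0" "poly (map_poly of_rat P) y = 0"
      using number_field_algebraic[OF F y(1)] by metis
    define n where "n = degree P"
    have sum0: "(\<Sum>i\<le>n. of_rat (coeff P i) * y ^ i) = 0"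
      using P(2) by (simp add: poly_altdef degree_map_poly coeff_map_poly n_def)
    have lc: "av (of_rat (coeff P n)) = 1" using rat1(2)[of "coeff P n"] P(1) by (simp add: n_def)
    have "n \<noteq> 0"
    proof
      assume "n = 0"
      then have "(of_rat (coeff P n) :: 'k) = 0" using sum0 by simp
      then show False using lc by simp
    qed
    then obtain m where m: "n = Suc m" by (cases n) auto
    have "of_rat (coeff P n) * y ^ n = - (\<Sum>i\<le>m. of_rat (coeff P i) * y ^ i)"
      using sum0 unfolding m by (simp add: eq_neg_iff_add_eq_0 add.commute)
    then have "av y ^ n = av (\<Sum>i\<le>m. of_rat (coeff P i) * y ^ i)" using lc by (metis av_minus av_mult av_power mult_1)
    also have "\<dots> \<le> av y ^ m"
    proof (rule av_sum_le)
      fix i assume "i \<in> {..m}"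
      then have "av (of_rat (coeff P i) * y ^ i) \<le> 1 * av y ^ m"
        unfolding av_mult av_power using rat1(1) y by (intro mult_mono power_increasing) auto
      then show "av (of_rat (coeff P i) * y ^ i) \<le> av y ^ m" by simp
    qed simp
    finally show False using y power_strict_increasing[of m n "av y"] m by simp
  qed
  then have ex: "\<exists>n. n \<ge> 1 \<and> av (of_nat n :: 'k) < 1" by blast
  define p where "p = (LEAST n. n \<ge> 1 \<and> av (of_nat n :: 'k) < 1)"
  have p: "p \<ge> 1" "av (of_nat p :: 'k) < 1" using LeastI_ex[OF ex] by (auto simp: p_def)
  have least: "av (of_nat n :: 'k) = 1" if "n \<ge> 1" "n < p" for n
    using not_less_Least[of n "\<lambda>n. n \<ge> 1 \<and> av (of_nat n :: 'k) < 1"] that av_of_nat_le_1[of n] by (auto simp: p_def)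
  have "prime p"
    unfolding prime_nat_iff
  proof (intro conjI allI impI)
    show "1 < p" using p by (cases "p = 1") auto
    fix m assume "m dvd p"
    then obtain l where l: "p = m * l" by (auto simp: dvd_def)
    show "m = 1 \<or> m = p"
    proof (rule ccontr)
      assume *: "\<not> (m = 1 \<or> m = p)"
      have "m \<ge> 1" "l \<ge> 1" using l p by (auto simp: Suc_le_eq intro: gr0I)
      moreover have "m < p" "l < p" using * l \<open>m \<ge> 1\<close> \<open>l \<ge> 1\<close> p by (auto simp: dvd_def nat_less_le)
      ultimately have "av (of_nat m :: 'k) = 1" "av (of_nat l :: 'k) = 1" using least by auto
      then have "av (of_nat p :: 'k) = 1" by (simp add: l av_mult)
      then show False using p by simp
    qed
  qed
  then show ?thesis using p by blast
qed

text \<open>This is the field of p-adic numbers. The closure properties below are proved by rational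
  approximation.\<close>

definition L :: "'k set" where "L = closure \<rat>"

lemma L_iff: "y \<in> L \<longleftrightarrow> (\<forall>\<epsilon>>0. \<exists>q::rat. av (y - of_rat q) < \<epsilon>)"
  unfolding L_def closure_approachable by (auto simp: dist_av av_commute[of y] Rats_def)

lemma of_rat_L: "of_rat q \<in> L" unfolding L_iff by (metis diff_self av_0)

lemma of_int_L: "of_int i \<in> L" using of_rat_L[of "of_int i"] by simp

lemma L_closed: "closed L" by (simp add: L_def)

lemma L_add: assumes "x \<in> L" "y \<in> L" shows "x + y \<in> L"
  unfolding L_iff
proof (intro allI impI)
  fix \<epsilon> :: real assume \<epsilon>: "\<epsilon> > 0"
  obtain q r where "av (x - of_rat q) < \<epsilon>" "av (y - of_rat r) < \<epsilon>" using assms \<epsilon> unfolding L_iff by blast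
  then have "av ((x - of_rat q) + (y - of_rat r)) < \<epsilon>" by (rule av_add_less)
  then show "\<exists>q. av (x + y - of_rat q) < \<epsilon>" by (intro exI[of _ "q + r"]) (simp add: of_rat_add algebra_simps)
qed

lemma L_minus: assumes "x \<in> L" shows "- x \<in> L"
  unfolding L_iff
proof (intro allI impI)
  fix \<epsilon> :: real assume \<epsilon>: "\<epsilon> > 0"
  obtain q where "av (x - of_rat q) < \<epsilon>" using assms \<epsilon> unfolding L_iff by blast
  then show "\<exists>q. av (- x - of_rat q) < \<epsilon>"
    using av_minus[of "x - of_rat q"] by (intro exI[of _ "- q"]) (simp add: of_rat_minus)
qed

lemma L_mult: assumes "x \<in> L" "y \<in> L" shows "x * y \<in> L"
  unfolding L_iff
proof (intro allI impI)
  fix \<epsilon> :: real assume \<epsilon>: "\<epsilon> > 0"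
  have y1: "0 < av y + 1" "0 < av x + 1 + 1" using av_nonneg[of y] av_nonneg[of x] by linarith+
  obtain q where q: "av (x - of_rat q) < min 1 (\<epsilon> / (av y + 1))"
    using assms(1) \<epsilon> y1 unfolding L_iff by (metis divide_pos_pos min_less_iff_conj zero_less_one)
  obtain r where r: "av (y - of_rat r) < \<epsilon> / (av x + 1 + 1)"
    using assms(2) \<epsilon> y1 unfolding L_iff by (metis divide_pos_pos)
  have aq: "av (of_rat q) \<le> av x + 1" using av_diff[of x "x - of_rat q"] q by simp
  have "av ((x - of_rat q) * y) < \<epsilon>"
  proof -
    have "av (x - of_rat q) * av y \<le> \<epsilon> / (av y + 1) * av y" using q by (intro mult_right_mono) auto
    also have "\<dots> < \<epsilon>" using \<epsilon> y1 by (simp add: field_simps)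
    finally show ?thesis by (simp add: av_mult)
  qed
  moreover have "av (of_rat q * (y - of_rat r)) < \<epsilon>"
  proof -
    have "av (of_rat q) * av (y - of_rat r) \<le> (av x + 1) * (\<epsilon> / (av x + 1 + 1))" using aq r by (intro mult_mono) auto
    also have "\<dots> < \<epsilon>" using \<epsilon> y1 by (simp add: field_simps)
    finally show ?thesis by (simp add: av_mult)
  qed
  ultimately have "av ((x - of_rat q) * y + of_rat q * (y - of_rat r)) < \<epsilon>" by (rule av_add_less)
  then show "\<exists>q. av (x * y - of_rat q) < \<epsilon>" by (intro exI[of _ "q * r"]) (simp add: of_rat_mult algebra_simps)
qed

lemma L_inverse: assumes x: "x \<in> L" shows "inverse x \<in> L"
proof (cases "x = 0")
  case True
  then show ?thesis using x by simp
next
  case False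
  show ?thesis
    unfolding L_iff
  proof (intro allI impI)
    fix \<epsilon> :: real assume \<epsilon>: "\<epsilon> > 0"
    have "0 < min (av x) (\<epsilon> * (av x * av x))" using False \<epsilon> by simp
    then obtain q where q: "av (x - of_rat q) < min (av x) (\<epsilon> * (av x * av x))" using x unfolding L_iff by blast
    have aq: "av (of_rat q) = av x" by (rule av_eq_if_close) (use q in simp)
    then have q0: "(of_rat q :: 'k) \<noteq> 0" using False av_eq_0 by metis
    have "inverse x - inverse (of_rat q) = - (x - of_rat q) / (x * of_rat q)" using False q0 by (simp add: field_simps)
    then have "av (inverse x - inverse (of_rat q)) = av (x - of_rat q) / (av x * av x)"
      by (simp only: av_divide av_minus av_mult aq)
    also have "\<dots> < \<epsilon>" using q False by (simp add: divide_less_eq)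
    finally show "\<exists>q. av (inverse x - of_rat q) < \<epsilon>" by (intro exI[of _ "inverse q"]) (simp add: of_rat_inverse)
  qed
qed

lemma L_diff: "x \<in> L \<Longrightarrow> y \<in> L \<Longrightarrow> x - y \<in> L" using L_add[of x "- y"] L_minus by simp

lemma L_divide: "x \<in> L \<Longrightarrow> y \<in> L \<Longrightarrow> x / y \<in> L" by (simp add: divide_inverse L_mult L_inverse)

lemma L_sum: "(\<And>i. i \<in> A \<Longrightarrow> f i \<in> L) \<Longrightarrow> (\<Sum>i\<in>A. f i) \<in> L"
  using of_int_L[of 0] by (induction A rule: infinite_finite_induct) (auto intro: L_add)

lemma L_0: "0 \<in> L" and L_1: "1 \<in> L" using of_int_L[of 0] of_int_L[of 1] by auto

end

locale padic_field = nonarch_field F for F :: "'k::{field_char_0, complete_space} set" +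
  fixes p :: nat and \<rho> :: real
  assumes prime_p: "prime p" and \<rho>_def: "\<rho> = av (of_nat p :: 'k)" and \<rho>_lt_1: "\<rho> < 1"
begin

lemma \<rho>_pos: "0 < \<rho>" using prime_gt_0_nat[OF prime_p] by (simp add: \<rho>_def)

lemma av_p: "av (of_nat p) = \<rho>" by (simp add: \<rho>_def)

lemma prime_int_p: "prime (int p)" using prime_p by simp

lemma bezout_prime:
  assumes "\<not> int p dvd i"
  obtains u v where "u * int p ^ n + v * i = 1"
proof -
  have "coprime (int p) i" using prime_int_p assms by (rule prime_imp_coprime)
  then have "coprime (int p ^ n) i" by simp
  then have "gcd (int p ^ n) i = 1" by (simp add: coprime_iff_gcd_eq_1)
  then show ?thesis using bezout_int[of "int p ^ n" i] that by metis
qed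

text \<open>If \<open>i\<close> had value below 1, the relation u p + v i = 1 would give 1 a value
  below 1.\<close>

lemma av_int_unit:
  assumes "\<not> int p dvd i" shows "av (of_int i) = 1"
proof (rule ccontr)
  assume "av (of_int i) \<noteq> 1"
  then have lt: "av (of_int i) < 1" using av_of_int_le_1[of i] by simp
  obtain u v where uv: "u * int p ^ 1 + v * i = 1" by (rule bezout_prime[OF assms])
  have l: "av (of_int a * x) < 1" if "av x < 1" for a and x :: 'k
    using mult_right_mono[OF av_of_int_le_1[of a], of "av x"] that by (simp add: av_mult)
  have "av (of_int u * of_nat p + of_int v * of_int i) < 1"
    by (intro av_add_less l) (use lt \<rho>_lt_1 av_p in auto)
  moreover have "of_int u * of_nat p + of_int v * of_int i = (of_int (u * int p ^ 1 + v * i) :: 'k)" by simp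
  ultimately show False unfolding uv by simp
qed

lemma av_int_le_\<rho>: "av (of_int i) \<le> \<rho> \<longleftrightarrow> int p dvd i"
proof
  show "av (of_int i) \<le> \<rho> \<Longrightarrow> int p dvd i" using av_int_unit[of i] \<rho>_lt_1 by fastforce
  assume "int p dvd i"
  then obtain j where "i = int p * j" by (auto simp: dvd_def)
  then show "av (of_int i) \<le> \<rho>" using mult_left_mono[OF av_of_int_le_1[of j], of \<rho>] \<rho>_pos by (simp add: av_mult av_p)
qed

lemma residue_char: "residue_char TYPE('k) = p"
  unfolding residue_char_def
proof (rule the_equality)
  show "prime p \<and> dist (of_nat p :: 'k) 0 < 1" using prime_p \<rho>_lt_1 by (simp add: \<rho>_def av_def)
  fix q assume q: "prime q \<and> dist (of_nat q :: 'k) 0 < 1"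
  have "int p dvd int q"
  proof (rule ccontr)
    assume "\<not> ?thesis"
    then have "av (of_int (int q)) = 1" by (rule av_int_unit)
    then show False using q by (simp add: av_def)
  qed
  then show "q = p" using q prime_p primes_dvd_imp_eq[of p q] by simp
qed

lemma int_decompose:
  assumes "(i::int) \<noteq> 0"
  obtains j n where "i = int p ^ n * j" "\<not> int p dvd j"
proof -
  have "\<not> is_unit (int p)" using prime_gt_1_nat[OF prime_p] by simp
  then show ?thesis using multiplicity_decompose'[of i "int p"] assms that by metis
qed

lemma av_int_le_power: "av (of_int i) \<le> \<rho> ^ n \<Longrightarrow> int p ^ n dvd i"
proof (cases "i = 0")
  case False
  then obtain j m where i: "i = int p ^ m * j" "\<not> int p dvd j" by (rule int_decompose)
  assume "av (of_int i) \<le> \<rho> ^ n"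
  then have "\<rho> ^ m \<le> \<rho> ^ n" using i av_int_unit[OF i(2)] by (simp add: av_mult av_power av_p)
  then have "n \<le> m" using \<rho>_pos \<rho>_lt_1 by (meson not_less power_strict_decreasing)
  then show "int p ^ n dvd i" using i by (simp add: le_imp_power_dvd)
qed simp

text \<open>A rational approximation of \<open>y\<close> is p-integral, so its denominator is prime
  to \<open>p\<close> and can be inverted modulo \<open>p\<close>.\<close>

lemma L_near_int:
  assumes y: "y \<in> L" "av y \<le> 1"
  obtains i where "av (y - of_int i) \<le> \<rho>"
proof -
  obtain q where q: "av (y - of_rat q) < \<rho>" using y(1) \<rho>_pos unfolding L_iff by blast
  obtain u v where uv: "quotient_of q = (u, v)" by force
  have v: "v > 0" "coprime u v" and quv: "q = of_int u / of_int v"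
    using quotient_of_denom_pos[OF uv] quotient_of_coprime[OF uv] quotient_of_div[OF uv] by auto
  have "av (of_rat q) \<le> 1" using av_diff_le[of y 1 "y - of_rat q"] y(2) q \<rho>_lt_1 by simp
  have "\<not> int p dvd v"
  proof
    assume pv: "int p dvd v"
    then have "\<not> int p dvd u" using v(2) prime_int_p by (meson coprime_common_divisor not_prime_unit)
    then have "av (of_rat q :: 'k) = 1 / av (of_int v :: 'k)" using av_int_unit by (simp add: quv of_rat_divide av_divide)
    moreover have "av (of_int v :: 'k) < 1" using av_int_le_\<rho>[of v] pv \<rho>_lt_1 by simp
    moreover have "0 < av (of_int v :: 'k)" using v by simp
    ultimately show False using \<open>av (of_rat q) \<le> 1\<close> by (simp add: divide_le_eq)
  qed
  then obtain a b where ab: "a * int p ^ 1 + b * v = 1" by (rule bezout_prime)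
  have av_v: "av (of_int v :: 'k) = 1" using \<open>\<not> int p dvd v\<close> by (rule av_int_unit)
  have "av (of_rat q - of_int (u * b) :: 'k) \<le> \<rho>"
  proof -
    have "(of_rat q - of_int (u * b) :: 'k) = of_int u * of_int (1 - b * v) / of_int v"
      using v by (simp add: quv of_rat_divide field_simps)
    then have "av (of_rat q - of_int (u * b) :: 'k) = av (of_int u :: 'k) * av (of_int (1 - b * v) :: 'k)"
      by (simp only: av_divide av_mult av_v div_by_1)
    also have "1 - b * v = a * int p" using ab by simp
    also have "av (of_int u :: 'k) * av (of_int (a * int p) :: 'k) \<le> 1 * \<rho>"
      by (intro mult_mono av_of_int_le_1) (use av_int_le_\<rho>[of "a * int p"] in auto)
    finally show ?thesis by simp
  qed
  then have "av ((y - of_rat q) + (of_rat q - of_int (u * b))) \<le> \<rho>" using q by (intro av_add_le) auto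
  then show ?thesis using that[of "u * b"] by simp
qed

section \<open>A basis over the p-adic numbers\<close>

text \<open>Linear independence of the classes of \<open>X\<close> over the field with
  \<open>p\<close> elements, in the ring of integers modulo \<open>p\<close>; the value
  \<open>\<rho>\<close> is that of \<open>p\<close>, so being at most \<open>\<rho>\<close> means
  divisible by \<open>p\<close>. Taking \<open>X\<close> inside \<open>F\<close> lets the rational
  dimension of \<open>F\<close> bound its size.\<close>

definition mod_independent :: "'k set \<Rightarrow> bool" where
  "mod_independent X \<longleftrightarrow> finite X \<and> X \<subseteq> F \<and> (\<forall>x\<in>X. av x \<le> 1) \<and>
    (\<forall>a::'k \<Rightarrow> int. av (\<Sum>x\<in>X. of_int (a x) * x) \<le> \<rho> \<longrightarrow> (\<forall>x\<in>X. int p dvd a x))"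

text \<open>Descent: the coefficients are divisible by \<open>p\<close>, and the relation divided by
  \<open>p\<close> is of the same kind. Hence they are divisible by every power of
  \<open>p\<close>.\<close>

lemma mod_independent_int_relation:
  assumes X: "mod_independent X" and rel: "(\<Sum>x\<in>X. of_int (a x) * x) = 0" and x: "x \<in> X"
  shows "a x = 0"
proof (rule ccontr)
  assume "a x \<noteq> 0"
  have div: "\<forall>x\<in>X. int p ^ n dvd a x" if "(\<Sum>x\<in>X. of_int (a x) * x) = 0" for n a
    using that
  proof (induction n arbitrary: a)
    case (Suc n)
    have pd: "int p dvd a x" if "x \<in> X" for x
      using X Suc.prems \<rho>_pos that by (auto simp: mod_independent_def)
    have eq: "a x = int p * (a x div int p)" if "x \<in> X" for x using pd[OF that] by simp
    have "(\<Sum>x\<in>X. of_int (a x) * x) = (\<Sum>x\<in>X. of_nat p * (of_int (a x div int p) * x))"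
    proof (rule sum.cong)
      fix x assume "x \<in> X"
      then have "(of_int (a x) :: 'k) = of_int (int p * (a x div int p))" using eq by metis
      then show "of_int (a x) * x = of_nat p * (of_int (a x div int p) * x)" by (simp add: mult.assoc)
    qed simp
    then have "of_nat p * (\<Sum>x\<in>X. of_int (a x div int p) * x) = 0" using Suc.prems by (simp add: sum_distrib_left)
    then have "(\<Sum>x\<in>X. of_int (a x div int p) * x) = 0" using prime_gt_0_nat[OF prime_p] by simp
    from Suc.IH[OF this] have "\<forall>x\<in>X. int p ^ n dvd a x div int p" .
    then show ?case using eq by (metis mult_dvd_mono dvd_refl power_Suc)
  qed simp
  let ?n = "nat \<bar>a x\<bar>"
  have "int p ^ ?n dvd a x" using div[OF rel] x by blast
  then have "int p ^ ?n \<le> \<bar>a x\<bar>" using \<open>a x \<noteq> 0\<close> by (metis abs_of_nonneg dvd_imp_le_int of_nat_0_le_iff zero_le_power)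
  moreover have "?n < p ^ ?n" using prime_gt_1_nat[OF prime_p] by (simp add: power_gt_expt)
  then have "int ?n < int p ^ ?n" by (metis of_nat_less_iff of_nat_power)
  ultimately show False by simp
qed

lemma common_denominator:
  assumes "finite X"
  shows "\<exists>D::int. D \<noteq> 0 \<and> (\<forall>x\<in>X. \<exists>i::int. u x * of_int D = (of_int i :: rat))"
  using assms
proof (induction X)
  case empty
  then show ?case by (intro exI[of _ 1]) auto
next
  case (insert y X)
  then obtain D :: int where D: "D \<noteq> 0" "\<And>x. x \<in> X \<Longrightarrow> \<exists>i::int. u x * of_int D = (of_int i :: rat)" by blast
  obtain a b where ab: "quotient_of (u y) = (a, b)" by force
  have b: "b > 0" and q: "u y = of_int a / of_int b" using quotient_of_denom_pos[OF ab] quotient_of_div[OF ab] by auto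
  have "u y * of_int (D * b) = of_int (a * D)" using b by (simp add: q)
  then have "\<exists>i::int. u y * of_int (D * b) = of_int i" by blast
  moreover have "\<exists>i::int. u x * of_int (D * b) = (of_int i :: rat)" if "x \<in> X" for x
  proof -
    obtain i :: int where "u x * of_int D = (of_int i :: rat)" using D(2)[OF \<open>x \<in> X\<close>] by blast
    then have "u x * of_int (D * b) = of_int (i * b)" by (simp add: mult.assoc[symmetric])
    then show ?thesis by blast
  qed
  ultimately show ?case using D(1) b by (intro exI[of _ "D * b"]) (auto simp del: of_int_mult)
qed

lemma mod_independent_rat_independent:
  assumes X: "mod_independent X"
  shows "rat_vs.independent X"
proof
  assume dep: "rat_vs.dependent X"
  have fin: "finite X" using X by (simp add: mod_independent_def)
  obtain u where u: "(\<Sum>v\<in>X. of_rat (u v) * v) = 0" "\<exists>v\<in>X. u v \<noteq> 0" using dep rat_vs.dependent_finite[OF fin] by auto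
  obtain D :: int where D: "D \<noteq> 0" "\<And>x. x \<in> X \<Longrightarrow> \<exists>i::int. u x * of_int D = (of_int i :: rat)" using common_denominator[OF fin, of u] by blast
  then obtain i :: "'k \<Rightarrow> int" where i: "\<And>x. x \<in> X \<Longrightarrow> u x * of_int D = of_int (i x)" by metis
  have "(\<Sum>x\<in>X. of_int (i x) * x) = (\<Sum>x\<in>X. of_int D * (of_rat (u x) * x))"
  proof (rule sum.cong)
    fix x assume "x \<in> X"
    then have "(of_int (i x) :: 'k) = of_rat (u x * of_int D)" using i by (metis of_rat_of_int_eq)
    then show "of_int (i x) * x = of_int D * (of_rat (u x) * x)" by (simp add: of_rat_mult mult_ac)
  qed simp
  also have "\<dots> = 0" using u(1) by (simp flip: sum_distrib_left)
  finally have "i x = 0" if "x \<in> X" for x using mod_independent_int_relation[OF X _ that] by blast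
  then show False using i u(2) D(1) by fastforce
qed

text \<open>Clearing denominators turns rational relations into integral ones, so these sets are
  rationally independent and of bounded size.\<close>

lemma ex_maximal_mod_independent:
  obtains X where "mod_independent X" "\<And>Y. mod_independent Y \<Longrightarrow> card Y \<le> card X"
proof -
  obtain n where n: "\<And>X. X \<subseteq> F \<Longrightarrow> rat_vs.independent X \<Longrightarrow> finite X \<and> card X \<le> n"
    using rat_independent_bound[OF F] by blast
  have "mod_independent {}" by (simp add: mod_independent_def)
  moreover have "\<forall>Y. mod_independent Y \<longrightarrow> card Y \<le> n"
  proof (intro allI impI)
    fix Y assume Y: "mod_independent Y"
    then have "Y \<subseteq> F" by (simp add: mod_independent_def)
    then show "card Y \<le> n" using n[OF _ mod_independent_rat_independent[OF Y]] by simp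
  qed
  ultimately have "\<exists>X. mod_independent X \<and> (\<forall>Y. mod_independent Y \<longrightarrow> card Y \<le> card X)"
    using Lattices_Big.ex_has_greatest_nat[of mod_independent "{}" card "Suc n"] by (simp add: less_Suc_eq_le)
  then show ?thesis using that by blast
qed

text \<open>A maximal independent set spans the integers modulo \<open>p\<close>.\<close>

lemma maximal_mod_independent_generates:
  assumes X: "mod_independent X" and max: "\<And>Y. mod_independent Y \<Longrightarrow> card Y \<le> card X" and y: "av y \<le> 1"
  shows "\<exists>a::'k \<Rightarrow> int. (\<forall>x. 0 \<le> a x \<and> a x < int p) \<and> av (y - (\<Sum>x\<in>X. of_int (a x) * x)) \<le> \<rho>"
proof -
  have fin: "finite X" and XF: "X \<subseteq> F" and X1: "\<And>x. x \<in> X \<Longrightarrow> av x \<le> 1" using X by (auto simp: mod_independent_def)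
  \<comment> \<open>Coefficients may be reduced to digits below \<open>p\<close>. There are finitely
    many of them, which later gives total boundedness.\<close>
  have redp: "\<exists>a::'k \<Rightarrow> int. (\<forall>x. 0 \<le> a x \<and> a x < int p) \<and> av (z - (\<Sum>x\<in>X. of_int (a x) * x)) \<le> \<rho>"
    if c: "av (z - (\<Sum>x\<in>X. of_int (c x) * x)) \<le> \<rho>" for z and c :: "'k \<Rightarrow> int"
  proof (intro exI conjI allI)
    let ?a = "\<lambda>x. c x mod int p"
    show "0 \<le> ?a x" "?a x < int p" for x using prime_gt_0_nat[OF prime_p] by auto
    have "av (\<Sum>x\<in>X. of_int (c x - ?a x) * x) \<le> \<rho>"
    proof (rule av_sum_le)
      fix x assume "x \<in> X"
      have "av (of_int (c x - ?a x) :: 'k) * av x \<le> \<rho> * 1"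
        using X1[OF \<open>x \<in> X\<close>] av_int_le_\<rho>[of "c x - ?a x"] \<rho>_pos by (intro mult_mono) (auto simp: mod_eq_dvd_iff[symmetric])
      then show "av (of_int (c x - ?a x) * x) \<le> \<rho>" by (simp only: av_mult mult_1_right)
    qed (use \<rho>_pos in simp)
    from av_add_le[OF c this] show "av (z - (\<Sum>x\<in>X. of_int (?a x) * x)) \<le> \<rho>"
      by (simp add: algebra_simps sum_subtractf)
  qed
  \<comment> \<open>Maximality concerns subsets of \<open>F\<close> only, so \<open>y\<close> is
    replaced by an element of \<open>F\<close> in the same class modulo \<open>p\<close>.\<close>
  obtain z where z: "z \<in> F" "dist z y < \<rho>"
    using dense \<rho>_pos closure_approachable[of y F] by auto
  have zy: "av (y - z) \<le> \<rho>" using z by (simp add: dist_av av_commute)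
  have z1: "av z \<le> 1" using av_diff_le[of y 1 "y - z"] y zy \<rho>_lt_1 by simp
  have "\<exists>c::'k \<Rightarrow> int. av (z - (\<Sum>x\<in>X. of_int (c x) * x)) \<le> \<rho>"
  proof (cases "z \<in> X")
    case True
    have "(\<Sum>x\<in>X. of_int (if x = z then 1 else 0) * x) = (\<Sum>x\<in>X. if x = z then x else 0)"
      by (intro sum.cong) auto
    also have "\<dots> = z" using True fin by simp
    finally show ?thesis using \<rho>_pos by (intro exI[of _ "\<lambda>x. if x = z then 1 else 0"]) simp
  next
    case False
    have "\<not> mod_independent (insert z X)" using max[of "insert z X"] False fin by auto
    then obtain a :: "'k \<Rightarrow> int" where a: "av (\<Sum>x\<in>insert z X. of_int (a x) * x) \<le> \<rho>" "\<exists>x\<in>insert z X. \<not> int p dvd a x"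
      using fin XF X1 z z1 unfolding mod_independent_def by auto
    let ?S = "\<Sum>x\<in>X. of_int (a x) * x"
    have az: "av (of_int (a z) * z + ?S) \<le> \<rho>" using a(1) False fin by simp
    \<comment> \<open>Otherwise the term of \<open>z\<close> could be dropped, and independence of
      \<open>X\<close> would make all coefficients divisible by \<open>p\<close>. Being prime to
      \<open>p\<close>, the coefficient can be inverted modulo \<open>p\<close> and \<open>z\<close>
      expressed through \<open>X\<close>.\<close>
    have "\<not> int p dvd a z"
    proof
      assume pz: "int p dvd a z"
      then have "av (of_int (a z) :: 'k) * av z \<le> \<rho> * 1" using z1 av_int_le_\<rho>[of "a z"] \<rho>_pos by (intro mult_mono) auto
      then have "av ((of_int (a z) * z + ?S) - of_int (a z) * z) \<le> \<rho>" using az by (intro av_diff_le) (simp_all add: av_mult)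
      then have "\<forall>x\<in>X. int p dvd a x" using X by (simp add: mod_independent_def)
      then show False using a(2) pz by auto
    qed
    then obtain u b where ub: "u * int p ^ 1 + b * a z = 1" by (rule bezout_prime)
    have "av (of_int b * (of_int (a z) * z + ?S)) \<le> \<rho>"
      using mult_mono[OF av_of_int_le_1[of b] az] by (simp add: av_mult)
    moreover have "av (of_int (u * int p) * z) \<le> \<rho>"
      using mult_mono[of "av (of_int (u * int p) :: 'k)" \<rho> "av z" 1] av_int_le_\<rho>[of "u * int p"] z1 \<rho>_pos
      by (simp only: av_mult) auto
    ultimately have "av (of_int b * (of_int (a z) * z + ?S) + of_int (u * int p) * z) \<le> \<rho>" by (rule av_add_le)
    also have "of_int b * (of_int (a z) * z + ?S) + of_int (u * int p) * z = of_int (u * int p ^ 1 + b * a z) * z + of_int b * ?S"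
      by (simp add: algebra_simps)
    also have "\<dots> = z - (\<Sum>x\<in>X. of_int (- (b * a x)) * x)"
      unfolding ub by (simp add: sum_distrib_left sum_negf mult_ac)
    finally show ?thesis by (intro exI[of _ "\<lambda>x. - (b * a x)"])
  qed
  then obtain c :: "'k \<Rightarrow> int" where "av (z - (\<Sum>x\<in>X. of_int (c x) * x)) \<le> \<rho>" ..
  from av_add_le[OF zy this] have "av (y - (\<Sum>x\<in>X. of_int (c x) * x)) \<le> \<rho>" by simp
  then show ?thesis by (rule redp)
qed

end

locale padic_basis = padic_field F p \<rho> for F :: "'k::{field_char_0, complete_space} set" and p \<rho> +
  fixes X :: "'k set"
  assumes X: "mod_independent X"
    and digits: "av y \<le> 1 \<Longrightarrow> \<exists>a::'k \<Rightarrow> int. (\<forall>x. 0 \<le> a x \<and> a x < int p) \<and> av (y - (\<Sum>x\<in>X. of_int (a x) * x)) \<le> \<rho>"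
begin

lemma finite_X: "finite X" and X_le_1: "x \<in> X \<Longrightarrow> av x \<le> 1"
  using X by (auto simp: mod_independent_def)

text \<open>The \<open>p\<close>-adic digit expansion with respect to \<open>X\<close>.\<close>

lemma integral_coordinates:
  assumes y: "av y \<le> 1"
  shows "\<exists>\<alpha>. (\<forall>x. \<alpha> x \<in> L \<and> av (\<alpha> x) \<le> 1) \<and> y = (\<Sum>x\<in>X. \<alpha> x * x)"
proof -
  have "\<exists>a::'k \<Rightarrow> int. av y \<le> 1 \<longrightarrow> av (y - (\<Sum>x\<in>X. of_int (a x) * x)) \<le> \<rho>" for y
    using digits[of y] by blast
  then obtain dg :: "'k \<Rightarrow> 'k \<Rightarrow> int" where dg: "\<And>y. av y \<le> 1 \<Longrightarrow> av (y - (\<Sum>x\<in>X. of_int (dg y x) * x)) \<le> \<rho>"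
    by metis
  define rm where "rm y = (y - (\<Sum>x\<in>X. of_int (dg y x) * x)) / of_nat p" for y
  have p0: "(of_nat p :: 'k) \<noteq> 0" using prime_gt_0_nat[OF prime_p] by simp
  have rm_eq: "y = (\<Sum>x\<in>X. of_int (dg y x) * x) + of_nat p * rm y" for y using p0 by (simp add: rm_def)
  have rm1: "av (rm y) \<le> 1" if "av y \<le> 1" for y
    using dg[OF that] \<rho>_pos by (simp add: rm_def av_divide av_p)
  define r where "r n = (rm ^^ n) y" for n
  have r1: "av (r n) \<le> 1" for n by (induction n) (auto simp: r_def y rm1)
  define s where "s N x = (\<Sum>n<N. of_int (dg (r n) x) * of_nat p ^ n :: 'k)" for N x
  \<comment> \<open>Here \<open>s N x\<close> holds the leading \<open>N\<close> digits of the
    coordinate at \<open>x\<close>, and \<open>r N\<close> is the integral remainder.\<close>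
  have exp: "y = (\<Sum>x\<in>X. s N x * x) + of_nat p ^ N * r N" for N
  proof (induction N)
    case 0
    then show ?case by (simp add: s_def r_def)
  next
    case (Suc N)
    have "r N = (\<Sum>x\<in>X. of_int (dg (r N) x) * x) + of_nat p * r (Suc N)" using rm_eq[of "r N"] by (simp add: r_def)
    then have "y = (\<Sum>x\<in>X. s N x * x) + of_nat p ^ N * ((\<Sum>x\<in>X. of_int (dg (r N) x) * x) + of_nat p * r (Suc N))" using Suc.IH by metis
    also have "\<dots> = (\<Sum>x\<in>X. s (Suc N) x * x) + of_nat p ^ Suc N * r (Suc N)"
      by (simp add: s_def sum_distrib_left algebra_simps sum.distrib)
    finally show ?case .
  qed
  have tail: "av (s M x - s N x) \<le> \<rho> ^ N" if "N \<le> M" for M N x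
  proof -
    have "s M x - s N x = (\<Sum>n\<in>{N..<M}. of_int (dg (r n) x) * of_nat p ^ n)"
      using sum_diff_nat_ivl[of 0 N M "\<lambda>n. of_int (dg (r n) x) * of_nat p ^ n :: 'k"] that by (simp add: s_def atLeast0LessThan)
    also have "av \<dots> \<le> \<rho> ^ N"
    proof (rule av_sum_le)
      fix n assume n: "n \<in> {N..<M}"
      have "av (of_int (dg (r n) x) :: 'k) * \<rho> ^ n \<le> 1 * \<rho> ^ N"
        using n \<rho>_pos \<rho>_lt_1 by (intro mult_mono av_of_int_le_1 power_decreasing) auto
      then show "av (of_int (dg (r n) x) * of_nat p ^ n) \<le> \<rho> ^ N" by (simp add: av_mult av_power av_p)
    qed (use \<rho>_pos in simp)
    finally show ?thesis .
  qed
  have small: "\<exists>N. \<rho> ^ N < \<epsilon>" if "\<epsilon> > 0" for \<epsilon> using real_arch_pow_inv[OF that \<rho>_lt_1] .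
  have "convergent (\<lambda>N. s N x)" for x
  proof (rule Cauchy_convergent, rule CauchyI')
    fix \<epsilon> :: real assume "\<epsilon> > 0"
    then obtain N where N: "\<rho> ^ N < \<epsilon>" using small by blast
    have "dist (s m x) (s n x) < \<epsilon>" if "m \<ge> N" "n > m" for m n
    proof -
      have "av (s n x - s m x) \<le> \<rho> ^ m" using that by (intro tail) auto
      also have "\<dots> \<le> \<rho> ^ N" using that \<rho>_pos \<rho>_lt_1 by (intro power_decreasing) auto
      finally show ?thesis using N by (simp add: dist_av av_commute)
    qed
    then show "\<exists>N. \<forall>m\<ge>N. \<forall>n>m. dist (s m x) (s n x) < \<epsilon>" by blast
  qed
  then have "\<forall>x. \<exists>l. (\<lambda>N. s N x) \<longlonglongrightarrow> l" by (simp add: convergent_def)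
  then obtain \<alpha> where \<alpha>: "\<And>x. (\<lambda>N. s N x) \<longlonglongrightarrow> \<alpha> x" by metis
  have close: "av (\<alpha> x - s N x) \<le> \<rho> ^ N" for x N
  proof -
    have "(\<lambda>M. dist (s M x) (s N x)) \<longlonglongrightarrow> dist (\<alpha> x) (s N x)" by (intro tendsto_dist \<alpha> tendsto_const)
    then have "dist (\<alpha> x) (s N x) \<le> \<rho> ^ N"
      by (rule LIMSEQ_le_const2) (use tail[of N _ x] in \<open>auto simp: dist_av\<close>)
    then show ?thesis by (simp add: dist_av)
  qed
  have "\<alpha> x \<in> L" for x
  proof (rule closed_sequentially[OF L_closed _ \<alpha>])
    show "s N x \<in> L" for N
      unfolding s_def by (intro L_sum L_mult) (use of_int_L of_int_L[of "int p ^ _"] in auto)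
  qed
  moreover have "av (\<alpha> x) \<le> 1" for x using close[of x 0] by (simp add: s_def)
  moreover have "y = (\<Sum>x\<in>X. \<alpha> x * x)"
  proof -
    have bd: "av (y - (\<Sum>x\<in>X. \<alpha> x * x)) \<le> \<rho> ^ N" for N
    proof -
      have "y - (\<Sum>x\<in>X. \<alpha> x * x) = of_nat p ^ N * r N - (\<Sum>x\<in>X. (\<alpha> x - s N x) * x)"
        using exp[of N] by (simp add: algebra_simps sum_subtractf)
      moreover have "av (of_nat p ^ N * r N) \<le> \<rho> ^ N"
        using mult_left_mono[OF r1[of N], of "\<rho> ^ N"] \<rho>_pos by (simp add: av_mult av_power av_p)
      moreover have "av (\<Sum>x\<in>X. (\<alpha> x - s N x) * x) \<le> \<rho> ^ N"
      proof (rule av_sum_le)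
        fix x assume "x \<in> X"
        then show "av ((\<alpha> x - s N x) * x) \<le> \<rho> ^ N"
          using mult_mono[OF close[of x N] X_le_1[of x]] \<rho>_pos by (simp add: av_mult)
      qed (use \<rho>_pos in simp)
      ultimately show ?thesis by (simp only: av_diff_le)
    qed
    have "av (y - (\<Sum>x\<in>X. \<alpha> x * x)) = 0"
    proof (rule ccontr)
      assume "av (y - (\<Sum>x\<in>X. \<alpha> x * x)) \<noteq> 0"
      then have "av (y - (\<Sum>x\<in>X. \<alpha> x * x)) > 0" using av_nonneg by (metis order_le_less)
      then obtain N where "\<rho> ^ N < av (y - (\<Sum>x\<in>X. \<alpha> x * x))" using small by blast
      then show False using bd[of N] by simp
    qed
    then show ?thesis by simp
  qed
  ultimately show ?thesis by (intro exI[of _ \<alpha>] conjI allI)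
qed

text \<open>Dividing by a coefficient of largest value makes all coefficients integral and one of
  them 1. Approximating them by integers gives a relation modulo \<open>p\<close> in which that
  coefficient would be divisible by \<open>p\<close>.\<close>

lemma coordinates_independent:
  assumes \<alpha>: "\<And>x. x \<in> X \<Longrightarrow> \<alpha> x \<in> L" and rel: "(\<Sum>x\<in>X. \<alpha> x * x) = 0" and x: "x \<in> X"
  shows "\<alpha> x = 0"
proof (rule ccontr)
  assume nz: "\<alpha> x \<noteq> 0"
  let ?m = "Max ((\<lambda>z. av (\<alpha> z)) ` X)"
  have "?m \<in> (\<lambda>z. av (\<alpha> z)) ` X" using finite_X x by (intro Max_in) auto
  then obtain x0 where x0: "x0 \<in> X" "?m = av (\<alpha> x0)" by auto
  have max: "av (\<alpha> z) \<le> av (\<alpha> x0)" if "z \<in> X" for z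
    unfolding x0(2)[symmetric] using finite_X that by (intro Max_ge) auto
  have pos: "0 < av (\<alpha> x0)" using max[OF x] nz av_pos[of "\<alpha> x"] by linarith
  define \<beta> where "\<beta> z = \<alpha> z / \<alpha> x0" for z
  have \<beta>: "\<beta> z \<in> L" "av (\<beta> z) \<le> 1" if "z \<in> X" for z
    using \<alpha>[OF that] \<alpha>[OF x0(1)] max[OF that] pos by (simp_all add: \<beta>_def L_divide av_divide)
  have "\<exists>i::int. z \<in> X \<longrightarrow> av (\<beta> z - of_int i) \<le> \<rho>" for z using L_near_int \<beta> by blast
  then obtain i :: "'k \<Rightarrow> int" where i: "\<And>z. z \<in> X \<Longrightarrow> av (\<beta> z - of_int (i z)) \<le> \<rho>" by metis
  have "(\<Sum>z\<in>X. \<beta> z * z) = (\<Sum>z\<in>X. \<alpha> z * z) / \<alpha> x0" by (simp add: \<beta>_def sum_divide_distrib)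
  then have "(\<Sum>z\<in>X. of_int (i z) * z) = - (\<Sum>z\<in>X. (\<beta> z - of_int (i z)) * z)"
    using rel by (simp add: left_diff_distrib sum_subtractf)
  also have "av \<dots> \<le> \<rho>"
    unfolding av_minus
  proof (rule av_sum_le)
    fix z assume "z \<in> X"
    then show "av ((\<beta> z - of_int (i z)) * z) \<le> \<rho>"
      using mult_mono[OF i[of z] X_le_1[of z]] \<rho>_pos by (simp add: av_mult)
  qed (use \<rho>_pos in simp)
  finally have "int p dvd i x0" using X x0 by (simp add: mod_independent_def)
  then have "av (of_int (i x0)) \<le> \<rho>" by (simp add: av_int_le_\<rho>)
  moreover have "\<beta> x0 = 1" using pos by (simp add: \<beta>_def)
  ultimately have "av (1 :: 'k) \<le> \<rho>" using av_add_le[of "1 - of_int (i x0)" \<rho> "of_int (i x0)"] i[OF x0(1)] by simp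
  then show False using \<rho>_lt_1 by simp
qed

text \<open>A power of \<open>p\<close> moves any element into the ring of integers, where the digit
  expansion applies.\<close>

lemma basis_X: "basis_over L X"
  unfolding basis_over_def
proof (intro conjI allI)
  show "finite X" by (rule finite_X)
  fix y :: 'k
  have "\<exists>n. av (of_nat p ^ n * y) \<le> 1"
  proof (cases "y = 0")
    case False
    then obtain n where "\<rho> ^ n < 1 / av y" using real_arch_pow_inv[of "1 / av y" \<rho>] \<rho>_lt_1 by auto
    then have "av (of_nat p ^ n * y) \<le> 1" using False by (simp add: av_mult av_power av_p less_divide_eq)
    then show ?thesis ..
  qed simp
  then obtain n where "av (of_nat p ^ n * y) \<le> 1" ..
  from integral_coordinates[OF this] obtain \<alpha> where \<alpha>: "\<And>x. \<alpha> x \<in> L" "of_nat p ^ n * y = (\<Sum>x\<in>X. \<alpha> x * x)" by blast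
  have p0: "(of_nat p ^ n :: 'k) \<noteq> 0" using prime_gt_0_nat[OF prime_p] by simp
  show "\<exists>!c. (\<forall>b\<in>X. c b \<in> L) \<and> (\<forall>b. b \<notin> X \<longrightarrow> c b = 0) \<and> y = (\<Sum>b\<in>X. c b * b)"
  proof (rule ex1I)
    let ?c = "\<lambda>b. if b \<in> X then \<alpha> b / of_nat p ^ n else 0"
    have pL: "of_nat p ^ n \<in> L" using of_int_L[of "int p ^ n"] by simp
    have "(\<Sum>b\<in>X. ?c b * b) = (\<Sum>b\<in>X. \<alpha> b * b) / of_nat p ^ n" by (simp add: sum_divide_distrib)
    also have "\<dots> = of_nat p ^ n * y / of_nat p ^ n" by (simp only: \<alpha>(2))
    also have "\<dots> = y" using p0 by (rule nonzero_mult_div_cancel_left)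
    finally have "y = (\<Sum>b\<in>X. ?c b * b)" by (rule sym)
    then show "(\<forall>b\<in>X. ?c b \<in> L) \<and> (\<forall>b. b \<notin> X \<longrightarrow> ?c b = 0) \<and> y = (\<Sum>b\<in>X. ?c b * b)"
      using \<alpha>(1) pL by (auto intro: L_divide)
    fix c assume c: "(\<forall>b\<in>X. c b \<in> L) \<and> (\<forall>b. b \<notin> X \<longrightarrow> c b = 0) \<and> y = (\<Sum>b\<in>X. c b * b)"
    have "c b - ?c b = 0" if "b \<in> X" for b
    proof (rule coordinates_independent[OF _ _ that])
      show "c b - ?c b \<in> L" if "b \<in> X" for b using c \<alpha>(1) pL that by (auto intro!: L_diff L_divide)
      have "(\<Sum>b\<in>X. (c b - ?c b) * b) = (\<Sum>b\<in>X. c b * b) - (\<Sum>b\<in>X. ?c b * b)"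
        by (simp only: left_diff_distrib sum_subtractf)
      also have "(\<Sum>b\<in>X. c b * b) = y" using c by simp
      also have "y - (\<Sum>b\<in>X. ?c b * b) = 0" using \<open>y = (\<Sum>b\<in>X. ?c b * b)\<close> by (simp only: right_minus_eq)
      finally show "(\<Sum>b\<in>X. (c b - ?c b) * b) = 0" .
    qed
    then have "c b = ?c b" for b using c by (cases "b \<in> X") auto
    then show "c = ?c" by (rule ext)
  qed
qed

end

section \<open>The trace\<close>

context padic_basis
begin

text \<open>The basis that the choice in \<open>field_trace\<close> picks, about which only
  \<open>basis_over\<close> is known. The basis \<open>X\<close> remains in use because integral
  elements have integral coordinates in it.\<close>

definition W :: "'k set" where "W = (SOME B. basis_over L B)"

lemma basis_W: "basis_over L W"
  unfolding W_def using basis_X by (rule someI)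

lemma finite_W: "finite W" using basis_W by (simp add: basis_over_def)

lemma coords_W:
  "b \<in> W \<Longrightarrow> coords_over L W x b \<in> L" "b \<notin> W \<Longrightarrow> coords_over L W x b = 0" "x = (\<Sum>b\<in>W. coords_over L W x b * b)"
proof -
  have "\<exists>!c. (\<forall>b\<in>W. c b \<in> L) \<and> (\<forall>b. b \<notin> W \<longrightarrow> c b = 0) \<and> x = (\<Sum>b\<in>W. c b * b)"
    using basis_W unfolding basis_over_def by blast
  from theI'[OF this, folded coords_over_def]
  show "b \<in> W \<Longrightarrow> coords_over L W x b \<in> L" "b \<notin> W \<Longrightarrow> coords_over L W x b = 0" "x = (\<Sum>b\<in>W. coords_over L W x b * b)"
    by blast+
qed

lemma coords_W_unique:
  assumes "\<And>b. b \<in> W \<Longrightarrow> c b \<in> L" "\<And>b. b \<notin> W \<Longrightarrow> c b = 0" "x = (\<Sum>b\<in>W. c b * b)"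
  shows "coords_over L W x = c"
proof -
  have "\<exists>!c. (\<forall>b\<in>W. c b \<in> L) \<and> (\<forall>b. b \<notin> W \<longrightarrow> c b = 0) \<and> x = (\<Sum>b\<in>W. c b * b)"
    using basis_W unfolding basis_over_def by blast
  then show ?thesis unfolding coords_over_def by (rule the1_equality) (use assms in blast)
qed

lemma coords_W_add: "coords_over L W (x + y) = (\<lambda>b. coords_over L W x b + coords_over L W y b)"
proof (rule coords_W_unique)
  show "x + y = (\<Sum>b\<in>W. (coords_over L W x b + coords_over L W y b) * b)"
    unfolding distrib_right sum.distrib by (rule arg_cong2[where f="(+)"]) (rule coords_W(3))+
qed (auto intro: L_add coords_W simp: coords_W(2))

lemma coords_W_scale:
  assumes "l \<in> L"
  shows "coords_over L W (l * x) = (\<lambda>b. l * coords_over L W x b)"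
proof (rule coords_W_unique)
  show "l * x = (\<Sum>b\<in>W. (l * coords_over L W x b) * b)"
    unfolding mult.assoc sum_distrib_left[symmetric] by (rule arg_cong[where f="(*) l"]) (rule coords_W(3))
qed (use assms in \<open>auto intro: L_mult coords_W simp: coords_W(2)\<close>)

lemma coords_W_basis:
  assumes "b \<in> W"
  shows "coords_over L W b b = 1"
proof -
  have "coords_over L W b = (\<lambda>z. if z = b then 1 else 0)"
  proof (rule coords_W_unique)
    have "(\<Sum>z\<in>W. (if z = b then 1 else 0) * z) = (\<Sum>z\<in>W. if z = b then z else 0)" by (intro sum.cong) auto
    also have "\<dots> = b" using assms finite_W by simp
    finally show "b = (\<Sum>z\<in>W. (if z = b then 1 else 0) * z)" by (rule sym)
  qed (use assms L_0 L_1 in auto)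
  then show ?thesis by simp
qed

definition Tr :: "'k \<Rightarrow> 'k" where "Tr x = (\<Sum>b\<in>W. coords_over L W (x * b) b)"

lemma field_trace_eq_Tr: "field_trace (closure \<rat>) x = Tr x"
  by (simp add: field_trace_def Tr_def W_def L_def Let_def)

lemma Tr_L: "Tr x \<in> L"
  unfolding Tr_def by (intro L_sum coords_W)

lemma Tr_add: "Tr (x + y) = Tr x + Tr y"
  by (simp add: Tr_def distrib_right coords_W_add sum.distrib)

lemma Tr_scale: "l \<in> L \<Longrightarrow> Tr (l * x) = l * Tr x"
  by (simp add: Tr_def mult.assoc coords_W_scale sum_distrib_left)

text \<open>The degree over the p-adic numbers; being nonzero in characteristic 0, it makes the
  trace nontrivial.\<close>

lemma Tr_1: "Tr 1 = of_nat (card W)"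
  by (simp add: Tr_def coords_W_basis)

lemma card_W: "card W \<noteq> 0"
proof
  assume "card W = 0"
  then have "W = {}" using finite_W by simp
  then show False using coords_W(3)[of 1] by simp
qed

lemma Tr_sum: "Tr (\<Sum>i\<in>A. f i) = (\<Sum>i\<in>A. Tr (f i))"
proof -
  have Tr_0: "Tr 0 = 0" using Tr_add[of 0 0] by simp
  show ?thesis by (induction A rule: infinite_finite_induct) (simp_all add: Tr_0 Tr_add)
qed

text \<open>An integral element has integral coordinates in \<open>X\<close> and the trace is linear
  over \<open>L\<close>, so the traces of the finitely many elements of \<open>X\<close> bound
  it.\<close>

lemma Tr_bounded: "\<exists>C\<ge>0. \<forall>y. av y \<le> 1 \<longrightarrow> av (Tr y) \<le> C"
proof (intro exI[of _ "\<Sum>x\<in>X. av (Tr x)"] conjI allI impI)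
  show nn: "0 \<le> (\<Sum>x\<in>X. av (Tr x))" by (intro sum_nonneg) simp
  fix y assume "av y \<le> 1"
  from integral_coordinates[OF this] obtain \<alpha> where
    \<alpha>_L_1: "\<forall>x. \<alpha> x \<in> L \<and> av (\<alpha> x) \<le> 1" and y: "y = (\<Sum>x\<in>X. \<alpha> x * x)" by (elim exE conjE)
  have \<alpha>: "\<alpha> x \<in> L" "av (\<alpha> x) \<le> 1" for x using \<alpha>_L_1 by simp_all
  have "Tr y = (\<Sum>x\<in>X. \<alpha> x * Tr x)" unfolding y by (simp add: Tr_sum Tr_scale \<alpha>(1))
  also have "av \<dots> \<le> (\<Sum>x\<in>X. av (Tr x))"
  proof (rule av_sum_le[OF nn])
    fix x assume "x \<in> X"
    have "av (\<alpha> x * Tr x) \<le> 1 * av (Tr x)" unfolding av_mult by (intro mult_right_mono \<alpha>(2)) simp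
    also have "\<dots> \<le> (\<Sum>x\<in>X. av (Tr x))" using member_le_sum[OF \<open>x \<in> X\<close> _ finite_X, of "\<lambda>x. av (Tr x)"] by simp
    finally show "av (\<alpha> x * Tr x) \<le> (\<Sum>x\<in>X. av (Tr x))" .
  qed
  finally show "av (Tr y) \<le> (\<Sum>x\<in>X. av (Tr x))" .
qed

end

section \<open>The p-adic fractional part\<close>

context padic_field
begin

lemma L_near_int_power:
  assumes y: "y \<in> L" "av y \<le> 1"
  shows "\<exists>i. av (y - of_int i) \<le> \<rho> ^ n"
proof (induction n)
  case 0
  show ?case using y by (intro exI[of _ 0]) simp
next
  case (Suc n)
  then obtain i where i: "av (y - of_int i) \<le> \<rho> ^ n" ..
  have p0: "(of_nat p :: 'k) \<noteq> 0" using prime_gt_0_nat[OF prime_p] by simp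
  define z where "z = (y - of_int i) / of_nat p ^ n"
  have yz: "y - of_int i = of_nat p ^ n * z" using p0 by (simp add: z_def)
  have pL: "of_nat p ^ n \<in> L" using of_int_L[of "int p ^ n"] by simp
  have zL: "z \<in> L" unfolding z_def by (intro L_divide L_diff y of_int_L pL)
  have z1: "av z \<le> 1" using i \<rho>_pos by (simp add: z_def av_divide av_power av_p)
  obtain j where j: "av (z - of_int j) \<le> \<rho>" using L_near_int[OF zL z1] .
  have "y - of_int (i + int p ^ n * j) = of_nat p ^ n * (z - of_int j)" using yz by (simp add: algebra_simps)
  also have "av \<dots> \<le> \<rho> ^ Suc n"
    using mult_left_mono[OF j, of "\<rho> ^ n"] \<rho>_pos by (simp add: av_mult av_power av_p mult.commute)
  finally show ?case by blast
qed

definition p_fraction :: "rat \<Rightarrow> bool" where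
  "p_fraction r \<longleftrightarrow> (\<exists>a n. r = of_int a / of_nat p ^ n)"

lemma p_fractionI: "p_fraction (of_int a / of_nat p ^ n)"
  by (auto simp: p_fraction_def)

lemma p_fraction_add:
  assumes "p_fraction r" "p_fraction s" shows "p_fraction (r + s)"
proof -
  obtain a n b m where *: "r = of_int a / of_nat p ^ n" "s = of_int b / of_nat p ^ m" using assms by (auto simp: p_fraction_def)
  have "r + s = of_int (a * int p ^ m + b * int p ^ n) / of_nat p ^ (n + m)"
    using prime_gt_0_nat[OF prime_p] by (simp add: * field_simps power_add)
  then show ?thesis by (metis p_fractionI)
qed

lemma p_fraction_minus: assumes "p_fraction r" shows "p_fraction (- r)"
proof -
  obtain a n where "r = of_int a / of_nat p ^ n" using assms by (auto simp: p_fraction_def)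
  then have "- r = of_int (- a) / of_nat p ^ n" by simp
  then show ?thesis by (metis p_fractionI)
qed

lemma p_fraction_integral:
  assumes "p_fraction r" "av (of_rat r) \<le> 1"
  obtains j :: int where "r = of_int j"
proof -
  obtain a n where r: "r = of_int a / of_nat p ^ n" using assms by (auto simp: p_fraction_def)
  have "av (of_rat r :: 'k) = av (of_int a :: 'k) / \<rho> ^ n"
    by (simp add: r of_rat_divide of_rat_power av_divide av_power av_p)
  then have "av (of_int a :: 'k) \<le> \<rho> ^ n" using assms(2) \<rho>_pos by simp
  then have "int p ^ n dvd a" by (rule av_int_le_power)
  then obtain j where "a = int p ^ n * j" by (auto simp: dvd_def)
  then have "r = of_int j" using prime_gt_0_nat[OF prime_p] by (simp add: r)
  then show ?thesis by (rule that)
qed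

text \<open>A power p^n makes \<open>y\<close> integral, and p^n y is then an integer
  \<open>i\<close> up to p^n times an integral element. The rational i/p^n minus its floor is the
  representative. Two representatives differ by a p-fraction that is p-integral, so by an integer of
  absolute value below 1.\<close>

lemma frac_part_ex1:
  assumes y: "y \<in> L"
  shows "\<exists>!r. (\<exists>a n. r = of_int a / of_nat (residue_char TYPE('k)) ^ n) \<and> 0 \<le> r \<and> r < 1 \<and> dist y (of_rat r) \<le> 1"
  unfolding residue_char p_fraction_def[symmetric] dist_av
proof (rule ex_ex1I)
  have p0: "(of_nat p :: 'k) \<noteq> 0" using prime_gt_0_nat[OF prime_p] by simp
  have "\<exists>n. av (of_nat p ^ n * y) \<le> 1"
  proof (cases "y = 0")
    case False
    then obtain n where "\<rho> ^ n < 1 / av y" using real_arch_pow_inv[of "1 / av y" \<rho>] \<rho>_lt_1 by auto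
    then have "av (of_nat p ^ n * y) \<le> 1" using False by (simp add: av_mult av_power av_p less_divide_eq)
    then show ?thesis ..
  qed simp
  then obtain n where n: "av (of_nat p ^ n * y) \<le> 1" ..
  have pL: "of_nat p ^ n * y \<in> L" using L_mult[OF _ y] of_int_L[of "int p ^ n"] by simp
  obtain i where i: "av (of_nat p ^ n * y - of_int i) \<le> \<rho> ^ n" using L_near_int_power[OF pL n] by blast
  define s :: rat where "s = of_int i / of_nat p ^ n"
  define r where "r = s + - of_int \<lfloor>s\<rfloor>"
  have "y - of_rat s = (of_nat p ^ n * y - of_int i) / of_nat p ^ n"
    using p0 by (simp add: s_def of_rat_divide of_rat_power field_simps)
  then have ys: "av (y - of_rat s) \<le> 1" using i \<rho>_pos by (simp add: av_divide av_power av_p)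
  have "av ((y - of_rat s) + of_int \<lfloor>s\<rfloor>) \<le> 1" by (intro av_add_le ys av_of_int_le_1)
  then have "av (y - of_rat r) \<le> 1" by (simp add: r_def of_rat_diff algebra_simps)
  moreover have "p_fraction r"
    unfolding r_def using p_fractionI[of "- \<lfloor>s\<rfloor>" 0] p_fractionI[of i n] by (intro p_fraction_add) (auto simp: s_def)
  moreover have "0 \<le> r" "r < 1" unfolding r_def by linarith+
  ultimately show "\<exists>r. p_fraction r \<and> 0 \<le> r \<and> r < 1 \<and> av (y - of_rat r) \<le> 1" by blast
  fix r s assume r: "p_fraction r \<and> 0 \<le> r \<and> r < 1 \<and> av (y - of_rat r) \<le> 1"
    and s: "p_fraction s \<and> 0 \<le> s \<and> s < 1 \<and> av (y - of_rat s) \<le> 1"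
  have "av ((y - of_rat s) - (y - of_rat r)) \<le> 1" by (rule av_diff_le) (use r s in auto)
  then have "av (of_rat (r + - s)) \<le> 1" by (simp add: of_rat_diff)
  moreover have "p_fraction (r + - s)" using r s by (intro p_fraction_add p_fraction_minus) auto
  ultimately obtain j :: int where j: "r + - s = of_int j" using p_fraction_integral by blast
  have "- 1 < r + - s" "r + - s < 1" using r s by linarith+
  then have "j = 0" unfolding j by linarith
  then show "r = s" using j by simp
qed

lemma frac_part_props:
  assumes "y \<in> L"
  shows "p_fraction (frac_part y)" "0 \<le> frac_part y" "frac_part y < 1" "av (y - of_rat (frac_part y)) \<le> 1"
  using theI'[OF frac_part_ex1[OF assms], folded frac_part_def]
  unfolding residue_char p_fraction_def[symmetric] dist_av by blast+

lemma frac_part_eqI: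
  assumes "y \<in> L" "p_fraction r" "0 \<le> r" "r < 1" "av (y - of_rat r) \<le> 1"
  shows "frac_part y = r"
  unfolding frac_part_def
  by (rule the1_equality[OF frac_part_ex1[OF assms(1)]])
    (use assms in \<open>simp add: residue_char dist_av flip: p_fraction_def\<close>)

text \<open>The defect of additivity is a p-fraction and p-integral, hence an ordinary integer,
  which the exponential does not see.\<close>

lemma frac_part_add:
  assumes "x \<in> L" "y \<in> L"
  obtains j :: int where "frac_part (x + y) = frac_part x + frac_part y + of_int j"
proof -
  let ?d = "frac_part (x + y) + - (frac_part x + frac_part y)"
  note f = frac_part_props[OF assms(1)] frac_part_props[OF assms(2)] frac_part_props[OF L_add[OF assms]]
  have "p_fraction ?d" using f by (intro p_fraction_add p_fraction_minus) auto
  moreover have "av (((x - of_rat (frac_part x)) + (y - of_rat (frac_part y))) - (x + y - of_rat (frac_part (x + y)))) \<le> 1"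
    by (rule av_diff_le[OF av_add_le]) (rule f)+
  then have "av (of_rat ?d) \<le> 1" by (simp add: of_rat_add of_rat_diff of_rat_minus algebra_simps)
  ultimately obtain j :: int where "?d = of_int j" using p_fraction_integral by blast
  then show ?thesis by (intro that[of j]) (simp add: algebra_simps)
qed

lemma frac_part_integral: "y \<in> L \<Longrightarrow> av y \<le> 1 \<Longrightarrow> frac_part y = 0"
  using p_fractionI[of 0 0] by (intro frac_part_eqI) auto

lemma frac_part_inverse_p: "frac_part (inverse (of_nat p :: 'k)) = 1 / of_nat p"
proof (rule frac_part_eqI)
  show "inverse (of_nat p :: 'k) \<in> L" using L_inverse[OF of_int_L[of "int p"]] by simp
  show "p_fraction (1 / of_nat p)" using p_fractionI[of 1 1] by simp
  show "1 / of_nat p < (1 :: rat)" using prime_gt_1_nat[OF prime_p] by simp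
  show "av (inverse (of_nat p :: 'k) - of_rat (1 / of_nat p)) \<le> 1" by (simp add: of_rat_divide inverse_eq_divide)
qed simp

end

section \<open>The additive character at a finite place\<close>

context padic_basis
begin

lemma place_char_eq: "place_char (x :: 'k) = exp (2 * of_real pi * \<i> * of_rat (frac_part (Tr x)))"
  using nonarch by (simp add: place_char_def field_trace_eq_Tr)

lemma of_rat_complex: "(of_rat r :: complex) = of_real (of_rat r)"
proof -
  obtain a b where "quotient_of r = (a, b)" by force
  then have "r = of_int a / of_int b" by (rule quotient_of_div)
  then show ?thesis by (simp add: of_rat_divide)
qed

lemma place_char_norm: "cmod (place_char (x :: 'k)) = 1"
proof -
  have "place_char x = exp (\<i> * of_real (2 * pi * of_rat (frac_part (Tr x))))"
    by (simp add: place_char_eq of_rat_complex mult_ac)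
  then show ?thesis by (simp only: norm_exp_i_times)
qed

lemma place_char_add: "place_char (x + y :: 'k) = place_char x * place_char y"
proof -
  obtain j :: int where j: "frac_part (Tr x + Tr y) = frac_part (Tr x) + frac_part (Tr y) + of_int j"
    using frac_part_add[OF Tr_L Tr_L] .
  have "exp (2 * of_real pi * \<i> * of_int j) = 1" unfolding exp_eq_1 by (auto intro!: exI[of _ j])
  then show ?thesis by (simp add: place_char_eq Tr_add j of_rat_add distrib_left exp_add)
qed

text \<open>The trace is linear over \<open>L\<close> and bounded on integral elements, so on a high
  power of \<open>p\<close> times the integers it takes p-integral values, whose fractional part is
  0.\<close>

lemma place_char_near_0: "\<exists>\<delta>>0. \<forall>x. av x \<le> \<delta> \<longrightarrow> place_char x = 1"
proof -
  obtain C where C: "C \<ge> 0" "\<And>y. av y \<le> 1 \<Longrightarrow> av (Tr y) \<le> C" using Tr_bounded by blast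
  have C1: "C + 1 > 0" using C by linarith
  obtain n where n: "\<rho> ^ n < 1 / (C + 1)" using real_arch_pow_inv[of "1 / (C + 1)" \<rho>] \<rho>_lt_1 C1 by auto
  have p0: "(of_nat p ^ n :: 'k) \<noteq> 0" using prime_gt_0_nat[OF prime_p] by simp
  have pL: "of_nat p ^ n \<in> L" using of_int_L[of "int p ^ n"] by simp
  have "place_char x = 1" if "av x \<le> \<rho> ^ n" for x
  proof -
    let ?y = "x / of_nat p ^ n"
    have "av ?y \<le> 1" using that \<rho>_pos by (simp add: av_divide av_power av_p)
    then have "av (Tr ?y) \<le> C" by (rule C)
    have "x = of_nat p ^ n * ?y" using p0 by simp
    then have "Tr x = of_nat p ^ n * Tr ?y" using Tr_scale[OF pL] by metis
    then have "av (Tr x) = \<rho> ^ n * av (Tr ?y)" by (simp add: av_mult av_power av_p)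
    also have "\<dots> \<le> 1 / (C + 1) * C" using n \<open>av (Tr ?y) \<le> C\<close> C C1 by (intro mult_mono) auto
    also have "\<dots> \<le> 1" using C1 by (simp add: divide_le_eq)
    finally have "frac_part (Tr x) = 0" by (rule frac_part_integral[OF Tr_L])
    then show ?thesis by (simp add: place_char_eq)
  qed
  then show ?thesis using \<rho>_pos by (intro exI[of _ "\<rho> ^ n"]) simp
qed

text \<open>At the inverse of p times the degree the trace is 1/p, so the character takes the value
  exp(2 pi i / p).\<close>

lemma place_char_nontrivial: "\<exists>x::'k. place_char x \<noteq> 1"
proof -
  have c0: "(of_nat (card W) :: 'k) \<noteq> 0" using card_W by simp
  let ?l = "inverse (of_nat p * of_nat (card W)) :: 'k"
  have "?l \<in> L" using L_inverse[OF of_int_L[of "int p * int (card W)"]] by simp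
  then have "Tr (?l * 1) = ?l * Tr 1" by (rule Tr_scale)
  also have "\<dots> = inverse (of_nat p)" using c0 by (simp add: Tr_1)
  finally have "frac_part (Tr ?l) = 1 / of_nat p" by (simp only: mult_1_right frac_part_inverse_p)
  then have e: "place_char ?l = exp (2 * of_real pi * \<i> * (1 / of_nat p))" by (simp add: place_char_eq of_rat_divide)
  have "place_char ?l \<noteq> 1"
  proof
    assume "place_char ?l = 1"
    then obtain n :: int where "2 * pi / real p = 2 * of_int n * pi" unfolding e exp_eq_1 by auto
    then have "(2 * pi) * (1 / real p) = (2 * pi) * of_int n" by (simp add: mult_ac)
    then have "1 / real p = of_int n" by (simp only: mult_cancel_left) simp
    then have "1 = real_of_int (n * int p)" using prime_gt_0_nat[OF prime_p] by (simp add: field_simps)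
    then have "n * int p = 1" by (metis of_int_eq_1_iff)
    then have "int p dvd 1" by (metis dvd_triv_right)
    then show False using prime_gt_1_nat[OF prime_p] by simp
  qed
  then show ?thesis ..
qed

lemma place_char_continuous: "continuous_on UNIV (place_char :: 'k \<Rightarrow> complex)"
  unfolding continuous_on_iff
proof (intro ballI allI impI)
  obtain \<delta> where \<delta>: "\<delta> > 0" "\<And>x. av x \<le> \<delta> \<Longrightarrow> place_char x = 1" using place_char_near_0 by blast
  fix x :: 'k and \<epsilon> :: real assume "\<epsilon> > 0"
  have "dist (place_char y) (place_char x) < \<epsilon>" if "dist y x < \<delta>" for y
  proof -
    have "place_char (x + (y - x)) = place_char x * place_char (y - x)" by (rule place_char_add)
    moreover have "place_char (y - x) = 1" using that by (intro \<delta>(2)) (simp add: dist_av)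
    ultimately show ?thesis using \<open>\<epsilon> > 0\<close> by simp
  qed
  then show "\<exists>d>0. \<forall>y\<in>UNIV. dist y x < d \<longrightarrow> dist (place_char y) (place_char x) < \<epsilon>"
    using \<delta>(1) by blast
qed

end

section \<open>Compactness, uniformizer and the normalized absolute value\<close>

lemma power_int_eq_exp:
  fixes x :: real
  assumes "0 < x"
  shows "x powi k = exp (of_int k * ln x)"
  using powr_real_of_int'[of x k] assms by (simp add: powr_def)

context padic_basis
begin

text \<open>Expansions with \<open>n\<close> digits in the basis \<open>X\<close>: finitely many,
  and with error of value at most \<open>\<rho> ^ n\<close>.\<close>

lemma finite_net: "\<exists>K. finite K \<and> (\<forall>y. av y \<le> 1 \<longrightarrow> (\<exists>k\<in>K. av (y - k) \<le> \<rho> ^ n))"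
proof (induction n)
  case 0
  show ?case by (intro exI[of _ "{0}"]) simp
next
  case (Suc n)
  then obtain K where K: "finite K" "\<And>y. av y \<le> 1 \<Longrightarrow> \<exists>k\<in>K. av (y - k) \<le> \<rho> ^ n" by blast
  let ?A = "PiE X (\<lambda>_. {0..<int p})"
  let ?s = "\<lambda>a. \<Sum>x\<in>X. of_int (a x) * x :: 'k"
  let ?K = "(\<lambda>(k, a). k + of_nat p ^ n * ?s a) ` (K \<times> ?A)"
  have p0: "(of_nat p ^ n :: 'k) \<noteq> 0" using prime_gt_0_nat[OF prime_p] by simp
  have "finite ?K" using K(1) finite_X by (intro finite_imageI finite_cartesian_product finite_PiE) auto
  moreover have "\<exists>k\<in>?K. av (y - k) \<le> \<rho> ^ Suc n" if y: "av y \<le> 1" for y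
  proof -
    obtain k where k: "k \<in> K" "av (y - k) \<le> \<rho> ^ n" using K(2)[OF y] by blast
    define z where "z = (y - k) / of_nat p ^ n"
    have yz: "y - k = of_nat p ^ n * z" using p0 by (simp add: z_def)
    have "av z \<le> 1" using k \<rho>_pos by (simp add: z_def av_divide av_power av_p)
    from digits[OF this] obtain a :: "'k \<Rightarrow> int" where a: "\<forall>x. 0 \<le> a x \<and> a x < int p" "av (z - ?s a) \<le> \<rho>" by (elim exE conjE)
    have sa: "?s (restrict a X) = ?s a" by (intro sum.cong) auto
    have "y - (k + of_nat p ^ n * ?s a) = of_nat p ^ n * (z - ?s a)" using yz by (simp add: algebra_simps)
    then have "av (y - (k + of_nat p ^ n * ?s (restrict a X))) = \<rho> ^ n * av (z - ?s a)"
      by (simp only: sa av_mult av_power av_p)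
    also have "\<dots> \<le> \<rho> ^ Suc n" using mult_left_mono[OF a(2), of "\<rho> ^ n"] \<rho>_pos by (simp add: mult.commute)
    finally have "av (y - (k + of_nat p ^ n * ?s (restrict a X))) \<le> \<rho> ^ Suc n" .
    moreover have "restrict a X \<in> ?A" using a(1) by auto
    ultimately show ?thesis using k(1) by (intro bexI[of _ "k + of_nat p ^ n * ?s (restrict a X)"] image_eqI[of _ _ "(k, restrict a X)"]) auto
  qed
  ultimately show ?case by blast
qed

lemma compact_cball_1: "compact (cball (0::'k) 1)"
  unfolding compact_eq_totally_bounded complete_eq_closed
proof (intro conjI allI impI)
  show "closed (cball (0::'k) 1)" by simp
  fix \<epsilon> :: real assume "\<epsilon> > 0"
  then obtain n where n: "\<rho> ^ n < \<epsilon>" using real_arch_pow_inv[OF _ \<rho>_lt_1] by blast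
  obtain K where K: "finite K" "\<And>y. av y \<le> 1 \<Longrightarrow> \<exists>k\<in>K. av (y - k) \<le> \<rho> ^ n" using finite_net[of n] by blast
  have "cball 0 1 \<subseteq> (\<Union>k\<in>K. ball k \<epsilon>)"
  proof
    fix y :: 'k assume "y \<in> cball 0 1"
    then have "av y \<le> 1" by (simp add: av_def dist_commute)
    then obtain k where "k \<in> K" "av (y - k) \<le> \<rho> ^ n" using K(2) by blast
    then show "y \<in> (\<Union>k\<in>K. ball k \<epsilon>)" using n by (intro UN_I[of k]) (auto simp: dist_av av_commute)
  qed
  then show "\<exists>K. finite K \<and> cball (0::'k) 1 \<subseteq> (\<Union>k\<in>K. ball k \<epsilon>)" using K(1) by blast
qed

text \<open>An element of value at least \<open>\<rho>\<close> has the same value as any point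
  within \<open>\<rho> ^ 2\<close>, so a finite net shows that only finitely many values lie between
  \<open>\<rho>\<close> and 1. The value of \<open>p\<close> is one of them, so there is a
  largest.\<close>

lemma ex_largest_below_1: "\<exists>\<pi>. av \<pi> < 1 \<and> \<pi> \<noteq> 0 \<and> (\<forall>x. av x < 1 \<longrightarrow> av x \<le> av \<pi>)"
proof -
  obtain K where K: "finite K" "\<And>y. av y \<le> 1 \<Longrightarrow> \<exists>k\<in>K. av (y - k) \<le> \<rho> ^ 2" using finite_net[of 2] by blast
  let ?S = "av ` {x. \<rho> \<le> av x \<and> av x < 1}"
  have "?S \<subseteq> av ` K"
  proof
    fix r assume "r \<in> ?S"
    then obtain x where x: "r = av x" "\<rho> \<le> av x" "av x < 1" by auto
    then obtain k where k: "k \<in> K" "av (x - k) \<le> \<rho> ^ 2" using K(2)[of x] by auto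
    have "\<rho> * \<rho> < 1 * \<rho>" using \<rho>_pos \<rho>_lt_1 by (intro mult_strict_right_mono) auto
    then have "av k = av x" using k(2) x(2) by (intro av_eq_if_close) (simp add: power2_eq_square)
    then show "r \<in> av ` K" using x(1) k(1) by (metis imageI)
  qed
  then have fin: "finite ?S" using K(1) finite_subset by blast
  have "\<rho> \<in> ?S" using \<rho>_lt_1 by (intro image_eqI[of _ _ "of_nat p"]) (simp_all add: av_p)
  then have "Max ?S \<in> ?S" "\<rho> \<le> Max ?S" using fin by (auto intro: Max_in Max_ge)
  then obtain \<pi> where \<pi>: "av \<pi> = Max ?S" "\<rho> \<le> av \<pi>" "av \<pi> < 1" by auto
  have "av x \<le> av \<pi>" if "av x < 1" for x
  proof (cases "\<rho> \<le> av x")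
    case True
    then show ?thesis unfolding \<pi>(1) using fin that by (intro Max_ge) auto
  qed (use \<pi>(2) in linarith)
  moreover have "\<pi> \<noteq> 0" using \<pi>(2) \<rho>_pos by auto
  ultimately show ?thesis using \<pi>(3) by blast
qed

end

locale local_field = padic_basis F p \<rho> X for F :: "'k::{field_char_0, complete_space} set" and p \<rho> X +
  fixes \<pi> :: 'k and \<theta> :: real
  assumes \<pi>_lt_1: "av \<pi> < 1" and \<pi>_nonzero: "\<pi> \<noteq> 0" and \<pi>_max: "av x < 1 \<Longrightarrow> av x \<le> av \<pi>" and \<theta>_def: "\<theta> = av \<pi>"
begin

lemma \<theta>: "0 < \<theta>" "\<theta> < 1" "ln \<theta> < 0"
  using \<pi>_lt_1 \<pi>_nonzero by (simp_all add: \<theta>_def)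

lemma mem_cball: "(x::'k) \<in> cball 0 1 \<longleftrightarrow> av x \<le> 1" and mem_ball: "(x::'k) \<in> ball 0 1 \<longleftrightarrow> av x < 1"
  by (simp_all add: av_def dist_commute)

lemma uniformizer_\<pi>: "uniformizer \<pi>"
  unfolding uniformizer_def
proof (intro conjI \<pi>_nonzero subset_antisym subsetI)
  fix x :: 'k assume "x \<in> ball 0 1"
  then have "av (x / \<pi>) \<le> 1" using \<pi>_max[of x] \<pi>_nonzero by (simp only: mem_ball av_divide) simp
  then show "x \<in> (\<lambda>x. \<pi> * x) ` cball 0 1" using \<pi>_nonzero by (intro image_eqI[of _ _ "x / \<pi>"]) (simp_all only: mem_cball, simp)
next
  fix x assume "x \<in> (\<lambda>x. \<pi> * x) ` cball 0 1"
  then obtain z where z: "x = \<pi> * z" "z \<in> cball 0 1" by blast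
  have "av \<pi> * av z \<le> av \<pi> * 1" using z(2) by (intro mult_left_mono) (simp_all only: mem_cball, simp)
  then show "x \<in> ball 0 1" using \<pi>_lt_1 by (simp only: mem_ball z(1) av_mult)
qed

lemma uniformizer_av:
  assumes "uniformizer u" shows "av u = \<theta>"
proof -
  have u: "ball 0 1 = (\<lambda>x. u * x) ` cball 0 1" using assms by (simp add: uniformizer_def)
  have "u * 1 \<in> ball 0 1" unfolding u by (rule imageI) (simp only: mem_cball av_1)
  then have "av u \<le> \<theta>" unfolding mem_ball \<theta>_def by (intro \<pi>_max) simp
  moreover have "\<pi> \<in> (\<lambda>x. u * x) ` cball 0 1" unfolding u[symmetric] mem_ball by (rule \<pi>_lt_1)
  then obtain z where z: "\<pi> = u * z" "z \<in> cball 0 1" by blast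
  have "av u * av z \<le> av u * 1" using z(2) by (intro mult_left_mono) (simp_all only: mem_cball, simp)
  then have "\<theta> \<le> av u" unfolding \<theta>_def z(1) av_mult by simp
  ultimately show ?thesis by simp
qed

lemma \<theta>_powi_inj: "\<theta> powi k = \<theta> powi m \<longleftrightarrow> k = m"
  using \<theta> by (simp add: power_int_eq_exp)

lemma \<theta>_powi_le: "\<theta> powi k \<le> \<theta> powi m \<longleftrightarrow> m \<le> k"
  using \<theta> by (simp add: power_int_eq_exp mult_le_cancel_right)

lemma av_powi: "av (x powi k) = av x powi k"
  by (cases "k \<ge> 0") (simp_all add: power_int_def av_power av_inverse)

text \<open>Dividing by a suitable power of \<open>\<pi>\<close> brings the value above
  \<open>\<theta>\<close> and up to 1; since no value lies strictly between \<open>\<theta>\<close>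
  and 1, it equals 1.\<close>

lemma av_discrete:
  assumes "x \<noteq> 0"
  obtains k where "av x = \<theta> powi k"
proof
  define t where "t = ln (av x) / ln \<theta>"
  have avx: "av x = exp (t * ln \<theta>)" using assms \<theta> by (simp add: t_def)
  let ?z = "x / \<pi> powi \<lfloor>t\<rfloor>"
  have "av ?z = exp (t * ln \<theta> - of_int \<lfloor>t\<rfloor> * ln \<theta>)"
    using \<theta> by (simp add: av_divide av_powi avx power_int_eq_exp exp_diff flip: \<theta>_def)
  then have z: "av ?z = exp ((t - of_int \<lfloor>t\<rfloor>) * ln \<theta>)" by (simp add: left_diff_distrib)
  have "\<not> av ?z < 1"
  proof
    assume "av ?z < 1"
    then have "av ?z \<le> exp (ln \<theta>)" using \<pi>_max \<theta> by (simp add: \<theta>_def)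
    then have "(t - of_int \<lfloor>t\<rfloor>) * ln \<theta> \<le> 1 * ln \<theta>" unfolding z by simp
    then have "1 \<le> t - of_int \<lfloor>t\<rfloor>" using \<theta>(3) by (simp only: mult_le_cancel_right)
    then show False by linarith
  qed
  then have "0 \<le> (t - of_int \<lfloor>t\<rfloor>) * ln \<theta>" unfolding z by simp
  then have "t - of_int \<lfloor>t\<rfloor> \<le> 0" using \<theta>(3) by (simp add: zero_le_mult_iff)
  then have "t = of_int \<lfloor>t\<rfloor>" by linarith
  then show "av x = \<theta> powi \<lfloor>t\<rfloor>" using avx \<theta> by (simp add: power_int_eq_exp)
qed

lemma place_ord_eq:
  assumes "av x = \<theta> powi k" shows "place_ord x = k"
  unfolding place_ord_def av_def[symmetric]
proof (rule the_equality)
  show "\<exists>u. uniformizer u \<and> av x = av u powi k" using uniformizer_\<pi> assms \<theta>_def by blast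
  fix m assume "\<exists>u. uniformizer u \<and> av x = av u powi m"
  then obtain u where "uniformizer u" "av x = av u powi m" by blast
  then have "\<theta> powi m = \<theta> powi k" using uniformizer_av assms by simp
  then show "m = k" by (simp only: \<theta>_powi_inj)
qed

definition q :: nat where "q = residue_card TYPE('k)"

lemma residue_class_eq: "ball (x::'k) 1 = ball y 1 \<longleftrightarrow> av (x - y) < 1"
proof
  assume "ball x 1 = ball y 1"
  then have "x \<in> ball y 1" by (metis centre_in_ball zero_less_one)
  then show "av (x - y) < 1" by (simp add: dist_av av_commute)
next
  assume *: "av (x - y) < 1"
  have sub: "ball (u::'k) 1 \<subseteq> ball v 1" if "av (v - u) < 1" for u v
  proof
    fix z :: 'k assume "z \<in> ball u 1"
    then have "av ((v - u) + (u - z)) < 1" using that by (intro av_add_less) (simp_all add: dist_av)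
    then show "z \<in> ball v 1" by (simp add: dist_av)
  qed
  show "ball x 1 = ball y 1" using sub[of x y] sub[of y x] * av_commute[of x y] by auto
qed

text \<open>The residue classes are finite in number by the net of level 1; one representative is
  picked from each.\<close>

lemma ex_residues:
  obtains R where "finite R" "card R = q" "\<And>r. r \<in> R \<Longrightarrow> av r \<le> 1"
    "\<And>x. av x \<le> 1 \<Longrightarrow> \<exists>r\<in>R. av (x - r) < 1" "\<And>r s. r \<in> R \<Longrightarrow> s \<in> R \<Longrightarrow> av (r - s) < 1 \<Longrightarrow> r = s"
proof -
  let ?f = "\<lambda>x::'k. ball x 1"
  obtain K where K: "finite K" "\<And>y. av y \<le> 1 \<Longrightarrow> \<exists>k\<in>K. av (y - k) \<le> \<rho> ^ 1" using finite_net[of 1] by blast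
  have "?f ` cball 0 1 \<subseteq> ?f ` K"
  proof
    fix B assume "B \<in> ?f ` cball 0 1"
    then obtain x where x: "B = ball x 1" "x \<in> cball 0 1" by (elim imageE)
    have "av x \<le> 1" using x(2) by (simp only: mem_cball)
    then obtain k where k: "k \<in> K" "av (x - k) \<le> \<rho>" using K(2)[of x] by (metis power_one_right)
    have "ball x 1 = ball k 1" unfolding residue_class_eq using k(2) \<rho>_lt_1 by linarith
    then show "B \<in> ?f ` K" using x(1) k(1) by (metis imageI)
  qed
  then have fin: "finite (?f ` cball 0 1)" using K(1) finite_surj by blast
  have "\<exists>R. R \<subseteq> cball 0 1 \<and> inj_on ?f R \<and> ?f ` cball 0 1 = ?f ` R"
    by (rule iffD1[OF subset_image_inj subset_refl])
  then obtain R where R: "R \<subseteq> cball 0 1" "inj_on ?f R" "?f ` cball 0 1 = ?f ` R" by (elim exE conjE)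
  show ?thesis
  proof
    show "finite R" using fin unfolding R(3) finite_image_iff[OF R(2)] .
    show "card R = q" using R card_image[OF R(2)] by (simp add: q_def residue_card_def)
    show "av r \<le> 1" if "r \<in> R" for r using R(1) that mem_cball by blast
    show "\<exists>r\<in>R. av (x - r) < 1" if "av x \<le> 1" for x
    proof -
      have "?f x \<in> ?f ` R" unfolding R(3)[symmetric] using that mem_cball by blast
      then obtain r where "ball x 1 = ball r 1" "r \<in> R" by (elim imageE)
      then show ?thesis unfolding residue_class_eq by blast
    qed
    show "r = s" if "r \<in> R" "s \<in> R" "av (r - s) < 1" for r s
      using R(2) that residue_class_eq[of r s] by (auto dest: inj_onD)
  qed
qed

lemma q_ge_2: "2 \<le> q"
proof -
  obtain R where R: "finite R" "card R = q" "\<And>x. av x \<le> 1 \<Longrightarrow> \<exists>r\<in>R. av (x - r) < 1"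
    using ex_residues by metis
  obtain r s where r: "r \<in> R" "av (0 - r) < 1" and s: "s \<in> R" "av (1 - s) < 1" using R(3)[of 0] R(3)[of 1] by auto
  have "r \<noteq> s"
  proof
    assume "r = s"
    then have "av ((1 - s) - (0 - r)) < 1" using av_add_less[of "1 - s" 1 "- (0 - r)"] r(2) s(2) by simp
    then show False using \<open>r = s\<close> by simp
  qed
  then have "card {r, s} = 2" by simp
  then show ?thesis using card_mono[OF R(1), of "{r, s}"] r s R(2) by simp
qed

lemma ln_q_pos: "0 < ln (real q)" using q_ge_2 by simp

text \<open>Chosen so that the \<open>\<sigma>\<close>-th power of \<open>\<theta>\<close> is 1/q:
  it converts the given metric into the normalized absolute value.\<close>

definition \<sigma> :: real where "\<sigma> = - ln (real q) / ln \<theta>"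

lemma \<sigma>_pos: "0 < \<sigma>"
  unfolding \<sigma>_def by (rule divide_neg_neg) (use ln_q_pos \<theta> in auto)

lemma normalized_abs_powi:
  assumes "av x = \<theta> powi k" "x \<noteq> 0"
  shows "normalized_abs x = real q powi (- k)"
  using nonarch assms place_ord_eq[OF assms(1)] by (simp add: normalized_abs_def q_def)

lemma normalized_abs_eq: "normalized_abs (x::'k) = av x powr \<sigma>"
proof (cases "x = 0")
  case True
  then show ?thesis using nonarch by (simp add: normalized_abs_def)
next
  case False
  then obtain k where k: "av x = \<theta> powi k" by (rule av_discrete)
  have "ln (av x) = of_int k * ln \<theta>" using \<theta> by (simp add: k power_int_eq_exp)
  then have "av x powr \<sigma> = exp (\<sigma> * (of_int k * ln \<theta>))" using False by (simp add: powr_def)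
  also have "\<sigma> * (of_int k * ln \<theta>) = of_int (- k) * ln (real q)" using \<theta>(3) by (simp add: \<sigma>_def)
  finally show ?thesis using normalized_abs_powi[OF k False] q_ge_2 by (simp add: power_int_eq_exp)
qed

lemma normalized_abs_le: "normalized_abs x \<le> normalized_abs y \<longleftrightarrow> av x \<le> av y"
proof
  show "av x \<le> av y \<Longrightarrow> normalized_abs x \<le> normalized_abs y"
    unfolding normalized_abs_eq using \<sigma>_pos by (intro powr_mono2) auto
  show "normalized_abs x \<le> normalized_abs y \<Longrightarrow> av x \<le> av y"
    unfolding normalized_abs_eq using \<sigma>_pos powr_less_mono2[of \<sigma> "av y" "av x"] by (meson av_nonneg linorder_not_le)
qed

lemma normalized_abs_\<pi>: "normalized_abs (\<pi> powi k) = real q powi (- k)"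
  using \<pi>_nonzero by (intro normalized_abs_powi) (simp_all add: av_powi \<theta>_def)

lemma normalized_abs_nonneg: "0 \<le> normalized_abs (x::'k)" by (simp add: normalized_abs_eq)

lemma normalized_abs_ball: "{x::'k. normalized_abs x \<le> real q powi (- k)} = {x. av x \<le> \<theta> powi k}"
  using normalized_abs_le[of _ "\<pi> powi k"] by (simp add: normalized_abs_\<pi> av_powi \<theta>_def)

end

section \<open>Haar measure at a finite place\<close>

locale local_haar = local_field F p \<rho> X \<pi> \<theta>
  for F :: "'k::{field_char_0, complete_space} set" and p \<rho> X \<pi> \<theta> +
  fixes M :: "'k measure"
  assumes haar: "haar_measure M"
begin

lemma sets_M: "sets M = sets borel" using haar by (simp add: haar_measure_def)

lemma space_M: "space M = UNIV" using sets_eq_imp_space_eq[OF sets_M] by simp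

lemma translate_measurable: "(+) (a::'k) \<in> borel \<rightarrow>\<^sub>M borel"
  by (rule measurable_add_of_pair[OF measurable_diff_pair]) auto

lemma M_translate: "distr M borel ((+) a) = M"
  using haar by (simp add: haar_measure_def)

lemma emeasure_translate:
  assumes "A \<in> sets borel"
  shows "emeasure M {x. a + x \<in> A} = emeasure M A"
proof -
  have "emeasure M A = emeasure (distr M borel ((+) a)) A" by (simp only: M_translate)
  also have "\<dots> = emeasure M ((+) a -` A \<inter> space M)"
    by (rule emeasure_distr) (use assms translate_measurable in \<open>simp_all add: measurable_cong_sets[OF sets_M]\<close>)
  finally show ?thesis by (simp add: space_M vimage_def)
qed

lemma av_measurable: "av \<in> borel_measurable borel"
  unfolding av_def[abs_def] by (intro borel_measurable_continuous_onI continuous_intros)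

lemma av_le_borel: "{x. av x \<le> r} \<in> sets borel"
  using av_measurable by measurable

text \<open>A ball is the disjoint union of \<open>q\<close> translates of the next smaller one, one
  for each residue class.\<close>

lemma volume_step: "emeasure M {x. av x \<le> \<theta> powi k} = ennreal (real q) * emeasure M {x. av x \<le> \<theta> powi (k + 1)}"
proof -
  obtain R where R: "finite R" "card R = q" "\<And>r. r \<in> R \<Longrightarrow> av r \<le> 1"
    "\<And>x. av x \<le> 1 \<Longrightarrow> \<exists>r\<in>R. av (x - r) < 1" "\<And>r s. r \<in> R \<Longrightarrow> s \<in> R \<Longrightarrow> av (r - s) < 1 \<Longrightarrow> r = s"
    using ex_residues by metis
  have \<theta>0: "0 < \<theta> powi k" "\<theta> powi (k + 1) = \<theta> powi k * \<theta>" using \<theta> by (simp_all add: power_int_add)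
  define u where "u = \<pi> powi k"
  have u: "u \<noteq> 0" "av u = \<theta> powi k" using \<pi>_nonzero by (simp_all add: u_def av_powi \<theta>_def)
  let ?G = "\<lambda>r. {x. av (x - u * r) \<le> \<theta> powi (k + 1)}"
  have G: "?G r = {x. - (u * r) + x \<in> {x. av x \<le> \<theta> powi (k + 1)}}" for r by simp
  have G_sets: "?G r \<in> sets borel" for r
    unfolding G using measurable_sets[OF translate_measurable[of "- (u * r)"] av_le_borel[of "\<theta> powi (k + 1)"]]
    by (simp add: vimage_def)
  have G_vol: "emeasure M (?G r) = emeasure M {x. av x \<le> \<theta> powi (k + 1)}" for r
    unfolding G by (rule emeasure_translate[OF av_le_borel])
  have "{x. av x \<le> \<theta> powi k} = (\<Union>r\<in>R. ?G r)"
  proof (intro subset_antisym subsetI)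
    fix x assume "x \<in> {x. av x \<le> \<theta> powi k}"
    then have "av (x / u) \<le> 1" using \<theta>0 by (simp add: av_divide u)
    then obtain r where r: "r \<in> R" "av (x / u - r) < 1" using R(4) by blast
    have "x - u * r = u * (x / u - r)" using u by (simp add: right_diff_distrib)
    then have "av (x - u * r) = \<theta> powi k * av (x / u - r)" by (simp only: av_mult u)
    also have "\<dots> \<le> \<theta> powi k * \<theta>" using \<pi>_max[OF r(2)] \<theta>0 by (intro mult_left_mono) (auto simp: \<theta>_def)
    finally show "x \<in> (\<Union>r\<in>R. ?G r)" using r \<theta>0 by auto
  next
    fix x assume "x \<in> (\<Union>r\<in>R. ?G r)"
    then obtain r where r: "r \<in> R" "av (x - u * r) \<le> \<theta> powi (k + 1)" by blast
    have "\<theta> powi (k + 1) \<le> \<theta> powi k" by (simp only: \<theta>_powi_le)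
    moreover have "av (u * r) \<le> \<theta> powi k" using R(3)[OF r(1)] \<theta>0 by (simp add: av_mult u)
    ultimately have "av ((x - u * r) + u * r) \<le> \<theta> powi k" using r(2) by (intro av_add_le) linarith+
    then show "x \<in> {x. av x \<le> \<theta> powi k}" by simp
  qed
  moreover have "disjoint_family_on ?G R"
    unfolding disjoint_family_on_def
  proof (intro ballI impI equals0I)
    fix r s x assume rs: "r \<in> R" "s \<in> R" "r \<noteq> s" and x: "x \<in> ?G r \<inter> ?G s"
    have "av ((x - u * s) - (x - u * r)) \<le> \<theta> powi (k + 1)" by (rule av_diff_le) (use x in auto)
    then have "av (u * (r - s)) \<le> \<theta> powi k * \<theta>" unfolding \<theta>0(2) by (simp add: algebra_simps)
    then have "av (r - s) \<le> \<theta>" using \<theta>0 by (simp add: av_mult u)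
    then show False using R(5)[OF rs(1,2)] rs(3) \<theta>(2) by linarith
  qed
  ultimately have "emeasure M {x. av x \<le> \<theta> powi k} = (\<Sum>r\<in>R. emeasure M (?G r))"
    using sum_emeasure[of ?G R M] G_sets R(1) by (simp add: sets_M image_subset_iff)
  also have "\<dots> = ennreal (real q) * emeasure M {x. av x \<le> \<theta> powi (k + 1)}"
    by (simp add: G_vol R(2) ennreal_of_nat_eq_real_of_nat)
  finally show ?thesis .
qed

definition m0 :: real where "m0 = measure M {x. av x \<le> 1}"

lemma unit_ball: "{x. av x \<le> 1} = cball 0 1"
  by (rule set_eqI) (simp only: mem_cball mem_Collect_eq)

lemma emeasure_unit_ball: "emeasure M {x. av x \<le> 1} = ennreal m0" and m0_pos: "0 < m0"
proof -
  have "emeasure M {x. av x \<le> 1} < \<infinity>"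
    using haar compact_cball_1 unfolding unit_ball by (simp add: haar_measure_def)
  then show *: "emeasure M {x. av x \<le> 1} = ennreal m0" unfolding m0_def by (intro emeasure_eq_ennreal_measure) simp
  have "open (ball (0::'k) 1)" "ball (0::'k) 1 \<noteq> {}" by auto
  then have "0 < emeasure M (ball 0 1)" using haar by (auto simp: haar_measure_def)
  also have "\<dots> \<le> emeasure M {x. av x \<le> 1}" unfolding unit_ball by (rule emeasure_mono) (auto simp: sets_M)
  finally show "0 < m0" unfolding * by simp
qed

lemma volume: "emeasure M {x. av x \<le> \<theta> powi k} = ennreal (real q powi (- k) * m0)"
proof (induction k rule: int_induct[where k=0])
  case base
  then show ?case using emeasure_unit_ball by simp
next
  case (step1 i)
  have "real q powi (- (i + 1)) = 1 / real q * real q powi (- i)" using q_ge_2 by (simp add: power_int_diff)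
  then have "ennreal (real q powi (- (i + 1)) * m0) = ennreal (1 / real q) * ennreal (real q powi (- i) * m0)"
    using m0_pos by (simp add: ennreal_mult'[symmetric] mult.assoc)
  also have "\<dots> = ennreal (1 / real q) * (ennreal (real q) * emeasure M {x. av x \<le> \<theta> powi (i + 1)})"
    using step1(2) volume_step[of i] by simp
  also have "\<dots> = emeasure M {x. av x \<le> \<theta> powi (i + 1)}"
    using q_ge_2 by (simp add: mult.assoc[symmetric] ennreal_mult'[symmetric])
  finally show ?case by simp
next
  case (step2 i)
  have "real q powi (- (i - 1)) = real q * real q powi (- i)"
    using q_ge_2 power_int_add_1'[of "real q" "- i"] by (simp add: add.commute)
  then show ?case using step2(2) volume_step[of "i - 1"] m0_pos by (simp add: ennreal_mult'[symmetric] mult.assoc)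
qed

lemma normalized_abs_values:
  assumes "(x::'k) \<noteq> 0"
  obtains k where "normalized_abs x = real q powi k" "av x = \<theta> powi (- k)"
proof -
  obtain k where k: "av x = \<theta> powi k" using av_discrete[OF assms] .
  then show ?thesis using normalized_abs_powi[OF k assms] by (intro that[of "- k"]) simp_all
qed

lemma q_powi_le: "real q powi k \<le> real q powi m \<longleftrightarrow> k \<le> m"
  using q_ge_2 ln_q_pos by (simp add: power_int_eq_exp mult_le_cancel_right)

lemma volume_N: "emeasure M {x. normalized_abs x \<le> real q powi k} = ennreal (real q powi k * m0)"
  using normalized_abs_ball[of "- k"] volume[of "- k"] by simp

lemma normed_haar: "normed_haar M normalized_abs (real q * m0)"
proof
  have unit: "emeasure M {x. normalized_abs x \<le> 1} = ennreal m0" using volume_N[of 0] by simp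
  show "sets M = sets borel" by (rule sets_M)
  show "distr M borel ((+) a) = M" for a by (rule M_translate)
  show "(\<lambda>(x, y). x - y) \<in> borel \<Otimes>\<^sub>M borel \<rightarrow>\<^sub>M (borel :: 'k measure)" by (rule measurable_diff_pair)
  show "(\<lambda>(x, y). x * y) \<in> borel \<Otimes>\<^sub>M borel \<rightarrow>\<^sub>M (borel :: 'k measure)" by (rule measurable_mult_pair)
  show "{0 :: 'k} \<in> sets borel" by simp
  show "normalized_abs \<in> borel_measurable (borel :: 'k measure)"
    unfolding normalized_abs_eq[abs_def] using av_measurable by measurable
  show "0 \<le> normalized_abs (x::'k)" for x by (rule normalized_abs_nonneg)
  show "normalized_abs (x::'k) = 0 \<longleftrightarrow> x = 0" for x by (simp add: normalized_abs_eq)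
  show "normalized_abs (x * y :: 'k) = normalized_abs x * normalized_abs y" for x y
    by (simp add: normalized_abs_eq av_mult powr_mult)
  show "normalized_abs (x + y :: 'k) \<le> 2 * (normalized_abs x + normalized_abs y)" for x y
  proof -
    have "normalized_abs (x + y) \<le> normalized_abs x \<or> normalized_abs (x + y) \<le> normalized_abs y"
      unfolding normalized_abs_le using av_add_max[of x y] by linarith
    then show ?thesis using normalized_abs_nonneg[of x] normalized_abs_nonneg[of y] by auto
  qed
  show "0 < emeasure M {x. normalized_abs x \<le> 1}" unfolding unit using m0_pos by simp
  show "emeasure M {x. normalized_abs x \<le> normalized_abs a} = ennreal (normalized_abs a) * emeasure M {x. normalized_abs x \<le> 1}"
    if a: "a \<noteq> 0" for a :: 'k
  proof -
    obtain k where k: "normalized_abs a = real q powi k" "av a = \<theta> powi (- k)" using normalized_abs_values[OF a] .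
    show ?thesis unfolding k(1) unit volume_N by (rule ennreal_mult) (use m0_pos in auto)
  qed
  show "0 \<le> real q * m0" using m0_pos by simp
  show "emeasure M {x. normalized_abs x \<le> r} \<le> ennreal (real q * m0 * r)" if r: "0 < r" for r
  proof -
    \<comment> \<open>The radius is rounded up to a power of \<open>q\<close>, which costs the
      factor \<open>q\<close> in the volume constant.\<close>
    define k where "k = \<lceil>ln r / ln (real q)\<rceil>"
    have "ln r \<le> of_int k * ln (real q)" using ln_q_pos le_of_int_ceiling[of "ln r / ln (real q)"] unfolding k_def by (simp only: pos_divide_le_eq)
    then have "exp (ln r) \<le> real q powi k" using q_ge_2 by (simp add: power_int_eq_exp del: exp_ln)
    then have rk: "r \<le> real q powi k" using r by simp
    have "of_int k - 1 < ln r / ln (real q)" unfolding k_def by linarith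
    then have "(of_int k - 1) * ln (real q) < ln r" using ln_q_pos by (simp only: pos_less_divide_eq)
    then have "exp (of_int k * ln (real q)) \<le> exp (ln (real q) + ln r)" by (simp add: left_diff_distrib)
    then have kr: "real q powi k \<le> real q * r" using r q_ge_2 by (simp add: power_int_eq_exp exp_add)
    have "emeasure M {x. normalized_abs x \<le> r} \<le> emeasure M {x. normalized_abs x \<le> real q powi k}"
      using rk normalized_abs_ball[of "- k"] av_le_borel by (intro emeasure_mono) (auto simp: sets_M)
    also have "\<dots> = ennreal (real q powi k * m0)" by (rule volume_N)
    also have "\<dots> \<le> ennreal (real q * m0 * r)"
      using mult_right_mono[OF kr, of m0] m0_pos by (intro ennreal_leI) (simp add: mult_ac)
    finally show ?thesis .
  qed
  show "\<bar>ln (normalized_abs t)\<bar> \<le> 4 * sqrt (normalized_abs (1 - t))" if t: "normalized_abs (1 - t) \<le> 1 / 4" for t :: 'k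
  proof -
    \<comment> \<open>An element this close to 1 is a unit, so the logarithm is 0.\<close>
    have "\<not> normalized_abs (1::'k) \<le> normalized_abs (1 - t)" using t by (simp add: normalized_abs_eq)
    then have "av t = av 1" unfolding normalized_abs_le by (intro av_eq_if_close) simp
    then show ?thesis by (simp add: normalized_abs_eq)
  qed
qed

sublocale nh: normed_haar M normalized_abs "real q * m0" by (rule normed_haar)

lemma integral_translate:
  fixes f :: "'k \<Rightarrow> complex"
  assumes "f \<in> borel_measurable borel"
  shows "(\<integral>y. f (a + y) \<partial>M) = (\<integral>y. f y \<partial>M)"
proof -
  have "(\<integral>y. f y \<partial>M) = (\<integral>y. f y \<partial>distr M borel ((+) a))" by (simp only: M_translate)
  also have "\<dots> = (\<integral>y. f (a + y) \<partial>M)"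
    by (rule integral_distr) (use assms translate_measurable in \<open>simp_all add: measurable_cong_sets[OF sets_M]\<close>)
  finally show ?thesis by (rule sym)
qed

section \<open>The logarithm as a sum of indicators of balls\<close>

definition P :: "int \<Rightarrow> 'k set" where "P n = {x. normalized_abs x \<le> real q powi n}"

text \<open>For |x| = q^m the indicator of \<open>P n\<close> at x is 1 exactly when n >= m.
  Comparing with the indicator of n >= 0 and summing over n counts \<open>m\<close>, so the total is
  m ln q, the logarithm of |x|.\<close>

definition g :: "int \<Rightarrow> 'k \<Rightarrow> real" where "g n x = ln (real q) * indicator (P n) x"

definition annihilates :: "int \<Rightarrow> 'k \<Rightarrow> bool" where
  "annihilates n z \<longleftrightarrow> (\<forall>y\<in>P n. place_char (y * z) = 1)"

definition D :: "int \<Rightarrow> 'k \<Rightarrow> real" where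
  "D n z = (if annihilates n z then ln (real q) * (real q powi n * m0) else 0)"

lemma P_borel[measurable]: "P n \<in> sets borel"
  unfolding P_def by measurable

lemma P_borel_M[measurable]: "P n \<in> sets M"
  by (simp add: sets_M P_borel)

lemma measure_P: "measure M (P n) = real q powi n * m0" and emeasure_P: "emeasure M (P n) < \<infinity>"
  using volume_N[of n] m0_pos by (simp_all add: P_def measure_def)

lemma P_add: "x \<in> P n \<Longrightarrow> y \<in> P n \<Longrightarrow> x + y \<in> P n"
  using normalized_abs_ball[of "- n"] av_add_le unfolding P_def by (simp add: set_eq_iff)

lemma P_minus: "x \<in> P n \<Longrightarrow> - x \<in> P n"
  by (simp add: P_def)

lemma P_add_iff: "h \<in> P n \<Longrightarrow> h + y \<in> P n \<longleftrightarrow> y \<in> P n"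
  using P_add[of h n y] P_add[OF P_minus[of h n], of "h + y"] by auto

lemma place_char_measurable[measurable]: "(place_char :: 'k \<Rightarrow> complex) \<in> borel_measurable borel"
  by (rule borel_measurable_continuous_onI[OF place_char_continuous])

lemma integrable_g: "integrable M (g n)"
  unfolding g_def[abs_def] using emeasure_P by (intro integrable_mult_right integrable_real_indicator) auto

text \<open>Orthogonality: the integral of a nontrivial character over the compact group \<open>P n\<close> vanishes.\<close>

lemma g_fourier: "(\<integral>y. complex_of_real (g n y) * place_char (y * z) \<partial>M) = complex_of_real (D n z)"
proof (cases "annihilates n z")
  case True
  then have "(\<lambda>y. complex_of_real (g n y) * place_char (y * z)) = (\<lambda>y. complex_of_real (g n y))"
    by (auto simp: g_def annihilates_def indicator_def)
  moreover have "(\<integral>y. g n y \<partial>M) = ln (real q) * (real q powi n * m0)"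
    by (simp add: g_def[abs_def] measure_P nh.space_M)
  ultimately show ?thesis using True by (simp add: D_def)
next
  case False
  then obtain h where h: "h \<in> P n" "place_char (h * z) \<noteq> 1" by (auto simp: annihilates_def)
  let ?f = "\<lambda>y. complex_of_real (g n y) * place_char (y * z)"
  have "?f (h + y) = place_char (h * z) * ?f y" for y
    by (simp add: g_def P_add_iff[OF h(1)] place_char_add distrib_right indicator_def)
  moreover have "?f \<in> borel_measurable borel" unfolding g_def by measurable
  ultimately have "(\<integral>y. place_char (h * z) * ?f y \<partial>M) = (\<integral>y. ?f y \<partial>M)" using integral_translate[of ?f h] by simp
  then have "place_char (h * z) * (\<integral>y. ?f y \<partial>M) = 1 * (\<integral>y. ?f y \<partial>M)" by simp
  then have "(\<integral>y. ?f y \<partial>M) = 0" using h(2) by (simp only: mult_cancel_right) simp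
  then show ?thesis using False by (simp add: D_def)
qed

lemma closed_annihilates: "closed {z. annihilates n z}"
proof -
  have "continuous_on UNIV (\<lambda>z. place_char (y * z) :: complex)" for y :: 'k
  proof (rule continuous_on_compose2[OF place_char_continuous])
    have "continuous_on UNIV ((\<lambda>(x, y). x * y :: 'k) \<circ> (\<lambda>z. (y, z)))"
      by (intro continuous_on_compose continuous_intros continuous_on_subset[OF continuous_mult]) auto
    then show "continuous_on UNIV (\<lambda>z. y * z)" by (simp add: o_def)
  qed auto
  then have "closed {z. place_char (y * z) = (1::complex)}" for y :: 'k
    by (intro closed_Collect_eq continuous_on_const)
  then have "closed (\<Inter>y\<in>P n. {z. place_char (y * z) = (1::complex)})" by (intro closed_INT) auto
  moreover have "(\<Inter>y\<in>P n. {z. place_char (y * z) = (1::complex)}) = {z. annihilates n z}" by (auto simp: annihilates_def)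
  ultimately show ?thesis by simp
qed

lemma D_measurable: "D n \<in> borel_measurable borel"
proof -
  have "{z. annihilates n z} \<in> sets borel" by (rule borel_closed[OF closed_annihilates])
  moreover have "D n = (\<lambda>z. ln (real q) * (real q powi n * m0) * indicator {z. annihilates n z} z)"
    by (auto simp: D_def indicator_def)
  ultimately show ?thesis by simp
qed

definition \<xi>\<^sub>0 :: 'k where "\<xi>\<^sub>0 = (SOME x. place_char x \<noteq> 1)"

lemma place_char_\<xi>\<^sub>0: "place_char \<xi>\<^sub>0 \<noteq> 1"
  unfolding \<xi>\<^sub>0_def using place_char_nontrivial by (rule someI_ex)

lemma \<xi>\<^sub>0_nonzero: "\<xi>\<^sub>0 \<noteq> 0"
proof
  assume "\<xi>\<^sub>0 = 0"
  moreover obtain \<delta> where "\<delta> > 0" "\<And>x. av x \<le> \<delta> \<Longrightarrow> place_char x = 1" using place_char_near_0 by blast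
  ultimately have "place_char \<xi>\<^sub>0 = 1" by simp
  then show False using place_char_\<xi>\<^sub>0 by contradiction
qed

text \<open>In a larger ball the point \<open>\<xi>\<^sub>0 / x\<close> would lie, and there the
  character takes the value at \<open>\<xi>\<^sub>0\<close>, which is not 1.\<close>

lemma annihilates_imp_less:
  assumes "annihilates n x" "x \<noteq> 0"
  shows "real q powi n < normalized_abs \<xi>\<^sub>0 / normalized_abs x"
proof (rule ccontr)
  assume "\<not> ?thesis"
  then have "normalized_abs (\<xi>\<^sub>0 / x) \<le> real q powi n"
    by (simp add: divide_inverse nh.N_mult nh.N_inverse)
  then have "place_char (\<xi>\<^sub>0 / x * x) = 1" using assms(1) by (simp only: annihilates_def P_def mem_Collect_eq)
  then show False using place_char_\<xi>\<^sub>0 assms(2) by simp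
qed

definition C where "C = 2 * (ln (real q) * m0) * normalized_abs \<xi>\<^sub>0"

lemma C_nonneg: "0 \<le> C"
  using ln_q_pos m0_pos normalized_abs_nonneg by (simp add: C_def)

text \<open>Only radii up to a power q^K = |\<open>\<xi>\<^sub>0\<close>| / |x| contribute, each by
  a multiple of its radius. The geometric series with ratio 1/q at most 1/2 is at most twice its
  largest term.\<close>

lemma D_bound:
  assumes x: "x \<noteq> 0"
  shows "(\<integral>\<^sup>+n. ennreal (D n x) \<partial>count_space UNIV) \<le> ennreal (C / normalized_abs x)"
proof -
  obtain a where a: "normalized_abs x = real q powi a" "av x = \<theta> powi (- a)" using normalized_abs_values[OF x] .
  obtain b where b: "normalized_abs \<xi>\<^sub>0 = real q powi b" "av \<xi>\<^sub>0 = \<theta> powi (- b)" using normalized_abs_values[OF \<xi>\<^sub>0_nonzero] .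
  have q0: "real q \<noteq> 0" "1 < real q" using q_ge_2 by auto
  have quot: "normalized_abs \<xi>\<^sub>0 / normalized_abs x = real q powi (b - a)" using q0 by (simp add: a b power_int_diff)
  define A where "A = ln (real q) * m0"
  have A: "0 \<le> A" using ln_q_pos m0_pos by (simp add: A_def)
  let ?K = "b - a"
  have "0 \<le> m0 * (ln (real q) * real q powi n)" for n using m0_pos ln_q_pos by (intro mult_nonneg_nonneg) auto
  then have "D n x \<le> A * real q powi n" "n \<notin> {..?K} \<Longrightarrow> D n x = 0" for n
    using annihilates_imp_less[OF _ x, of n] A q0 q_powi_le[of ?K n] unfolding quot by (auto simp: D_def A_def mult_ac)
  then have "(\<integral>\<^sup>+n. ennreal (D n x) \<partial>count_space UNIV) \<le> (\<integral>\<^sup>+n. ennreal (A * real q powi n) * indicator {..?K} n \<partial>count_space UNIV)"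
    by (intro nn_integral_mono) (auto simp: indicator_def intro: ennreal_leI)
  also have "\<dots> = (\<integral>\<^sup>+n. ennreal (A * real q powi n) \<partial>count_space {..?K})"
    by (rule nn_integral_count_space_indicator[symmetric]) (simp add: NO_MATCH_def)
  also have "\<dots> = (\<integral>\<^sup>+j. ennreal (A * real q powi (?K - int j)) \<partial>count_space UNIV)"
  proof (rule nn_integral_bij_count_space[symmetric])
    show "bij_betw (\<lambda>j. ?K - int j) UNIV {..?K}"
      by (rule bij_betwI[where g="\<lambda>n. nat (?K - n)"]) auto
  qed
  also have "\<dots> = (\<Sum>j. ennreal (A * real q powi ?K * (1 / real q) ^ j))"
    unfolding nn_integral_count_space_nat using q0 by (simp add: power_int_diff power_divide)
  also have "\<dots> = ennreal (A * real q powi ?K * (1 / (1 - 1 / real q)))"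
  proof (rule suminf_ennreal_eq)
    show "0 \<le> A * real q powi ?K * (1 / real q) ^ j" for j using A by simp
    show "(\<lambda>j. A * real q powi ?K * (1 / real q) ^ j) sums (A * real q powi ?K * (1 / (1 - 1 / real q)))"
      using q0 by (intro sums_mult geometric_sums) simp
  qed
  also have "\<dots> \<le> ennreal (A * real q powi ?K * 2)"
  proof (intro ennreal_leI mult_left_mono)
    have "1 / 2 \<le> 1 - 1 / real q" using q_ge_2 by (simp add: field_simps)
    then show "1 / (1 - 1 / real q) \<le> 2" by (simp add: divide_le_eq)
  qed (use A in auto)
  also have "A * real q powi ?K * 2 = C / normalized_abs x" unfolding quot[symmetric] C_def A_def by simp
  finally show ?thesis .
qed

lemma log_decomposition:
  "log_decomposition M (real q * m0) (count_space UNIV) (\<lambda>n::int. if 0 \<le> n then ln (real q) else 0) g D C"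
proof -
  interpret cs: sigma_finite_measure "count_space (UNIV :: int set)" by (rule sigma_finite_measure_count_space)
  \<comment> \<open>The differences are supported on the finitely many integers between 0 and
    \<open>m\<close> and have a constant sign there, so sum and absolute sum are immediate.\<close>
  have steps: "(if 0 \<le> n then ln (real q) else 0) - g n x =
      (if 0 \<le> m then ln (real q) * indicator {0..<m} n else - (ln (real q) * indicator {m..<0} n))"
    if "normalized_abs x = real q powi m" for x n m
    using q_powi_le[of m n] by (auto simp: g_def P_def that indicator_def)
  have ln_powi: "ln (real q powi m) = of_int m * ln (real q)" for m
    using q_ge_2 by (simp add: power_int_eq_exp)
  show ?thesis
  proof
    show "(place_char :: 'k \<Rightarrow> complex) \<in> borel_measurable borel" by measurable
    show "cmod (place_char (x :: 'k)) = 1" for x by (rule place_char_norm)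
    show "place_char (x + y :: 'k) = place_char x * place_char y" for x y by (rule place_char_add)
    show "(\<lambda>n::int. if 0 \<le> n then ln (real q) else 0) \<in> borel_measurable (count_space UNIV)" by simp
    show "(\<lambda>(t, x). g t x) \<in> borel_measurable (count_space UNIV \<Otimes>\<^sub>M borel)"
    proof (rule measurable_pair_measure_countable1)
      show "(\<lambda>x. case (n, x) of (n, x) \<Rightarrow> g n x) \<in> borel_measurable borel" for n
        unfolding g_def by simp
    qed simp
    show "(\<lambda>(t, x). D t x) \<in> borel_measurable (count_space UNIV \<Otimes>\<^sub>M borel)"
      by (rule measurable_pair_measure_countable1) (simp_all add: D_measurable)
    show "integrable M (g n)" for n by (rule integrable_g)
    show "(\<integral>\<^sup>+n. ennreal \<bar>(if 0 \<le> n then ln (real q) else 0) - g n x\<bar> \<partial>count_space UNIV) \<le> ennreal \<bar>ln (normalized_abs x)\<bar>"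
      if "x \<noteq> 0" for x
    proof -
      obtain m where m: "normalized_abs x = real q powi m" "av x = \<theta> powi (- m)" using normalized_abs_values[OF \<open>x \<noteq> 0\<close>] .
      define S where "S = (if 0 \<le> m then {0..<m} else {m..<0})"
      have S: "finite S" "real (card S) = \<bar>of_int m\<bar>" by (auto simp: S_def)
      have "ennreal \<bar>(if 0 \<le> n then ln (real q) else 0) - g n x\<bar> = ennreal (ln (real q)) * indicator S n" for n
        unfolding steps[OF m(1)] S_def using ln_q_pos by (auto simp: indicator_def)
      then have "(\<integral>\<^sup>+n. ennreal \<bar>(if 0 \<le> n then ln (real q) else 0) - g n x\<bar> \<partial>count_space UNIV) = ennreal (ln (real q)) * of_nat (card S)"
        using S by (simp add: nn_integral_cmult_indicator)
      also have "\<dots> = ennreal \<bar>ln (normalized_abs x)\<bar>"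
        using S(2) ln_q_pos by (simp add: m(1) ln_powi abs_mult ennreal_mult'[symmetric] ennreal_of_nat_eq_real_of_nat mult.commute)
      finally show ?thesis by simp
    qed
    show "(\<integral>n. (if 0 \<le> n then ln (real q) else 0) - g n x \<partial>count_space UNIV) = ln (normalized_abs x)" if "x \<noteq> 0" for x
    proof -
      obtain m where m: "normalized_abs x = real q powi m" "av x = \<theta> powi (- m)" using normalized_abs_values[OF \<open>x \<noteq> 0\<close>] .
      show ?thesis unfolding steps[OF m(1)] by (cases "0 \<le> m") (simp_all add: m(1) ln_powi measure_count_space)
    qed
    show "0 \<le> D n x" for n x using ln_q_pos m0_pos by (simp add: D_def)
    show "D n (- x) = D n x" for n x
    proof -
      have "annihilates n z" if "annihilates n (- z)" for z
        unfolding annihilates_def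
      proof
        fix y assume "y \<in> P n"
        then have "place_char (- y * - z) = 1" using that P_minus by (simp only: annihilates_def)
        then show "place_char (y * z) = 1" by simp
      qed
      from this[of x] this[of "- x"] show ?thesis by (auto simp: D_def)
    qed
    show "(\<integral>y. complex_of_real (g n y) * place_char (y * x) \<partial>M) = complex_of_real (D n x)" for n x by (rule g_fourier)
    show "0 \<le> C" by (rule C_nonneg)
    show "(\<integral>\<^sup>+n. ennreal (D n x) \<partial>count_space UNIV) \<le> ennreal (C / normalized_abs x)" if "x \<noteq> 0" for x by (rule D_bound[OF that])
  qed
qed

sublocale ld: log_decomposition M "real q * m0" "count_space UNIV" "\<lambda>n::int. if 0 \<le> n then ln (real q) else 0" g D C
  by (rule log_decomposition)

end

section \<open>Schwartz-Bruhat functions at a finite place\<close>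

lemma compactly_supported_bounded:
  fixes f :: "'a::topological_space \<Rightarrow> complex"
  assumes "continuous_on UNIV f" "compact C" "\<And>x. x \<notin> C \<Longrightarrow> f x = 0"
  shows "\<exists>B. \<forall>x. cmod (f x) \<le> B"
proof -
  have "compact (f ` C)" using assms(1,2) by (intro compact_continuous_image continuous_on_subset[OF assms(1)]) auto
  then obtain B where B: "\<And>z. z \<in> f ` C \<Longrightarrow> cmod z \<le> B" using compact_imp_bounded bounded_iff by metis
  have "cmod (f x) \<le> max B 0" for x using B[of "f x"] assms(3)[of x] by (cases "x \<in> C") auto
  then show ?thesis by blast
qed

context local_haar
begin

lemma locally_constant_continuous:
  fixes f :: "'k \<Rightarrow> complex"
  assumes "\<And>x. \<exists>\<epsilon>>0. \<forall>y. dist x y < \<epsilon> \<longrightarrow> f y = f x"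
  shows "continuous_on UNIV f"
  unfolding continuous_on_iff using assms by (metis dist_commute dist_self)

lemma continuous_normalized_abs: "continuous_on UNIV (normalized_abs :: 'k \<Rightarrow> real)"
proof -
  have "continuous_on UNIV (\<lambda>x. av x powr \<sigma>)"
    unfolding av_def using \<sigma>_pos by (intro continuous_on_powr' continuous_intros) auto
  then show ?thesis by (simp add: normalized_abs_eq[abs_def])
qed

text \<open>Compactness makes local constancy uniform, so \<open>f\<close> is invariant under small
  translations. For large frequencies some small translation multiplies the Fourier integral by a
  number other than 1, so the transform vanishes far out.\<close>

lemma locally_constant_compact_admissible:
  fixes f :: "'k \<Rightarrow> complex"
  assumes lc: "\<And>x. \<exists>\<epsilon>>0. \<forall>y. dist x y < \<epsilon> \<longrightarrow> f y = f x"
    and S: "compact S" "\<And>x. x \<notin> S \<Longrightarrow> f x = 0"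
    and inv: "inv_fourier M (fourier M f) = f"
  shows "fourier_admissible M f"
proof -
  have cont: "continuous_on UNIV f" using lc by (rule locally_constant_continuous)
  then have f[measurable]: "f \<in> borel_measurable borel" by (rule borel_measurable_continuous_onI)
  then have fM: "f \<in> borel_measurable M" by (simp add: measurable_cong_sets[OF sets_M])
  obtain B1 where B1: "\<And>x. cmod (f x) \<le> B1" using compactly_supported_bounded[OF cont S] by blast
  have "\<exists>B. \<forall>x. cmod (complex_of_real ((normalized_abs x)\<^sup>2) * f x) \<le> B"
  proof (rule compactly_supported_bounded[OF _ S(1)])
    show "continuous_on UNIV (\<lambda>x. complex_of_real ((normalized_abs x)\<^sup>2) * f x)"
      by (intro continuous_intros cont continuous_normalized_abs)
  qed (simp add: S(2))
  then obtain B2 where "\<And>x. cmod (complex_of_real ((normalized_abs x)\<^sup>2) * f x) \<le> B2" by blast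
  then have B2: "(normalized_abs x)\<^sup>2 * cmod (f x) \<le> B2" for x by (simp add: norm_mult norm_power)
  define B where "B = max B1 B2"
  have B: "cmod (f x) \<le> B" "(normalized_abs x)\<^sup>2 * cmod (f x) \<le> B" for x
    using B1[of x] B2[of x] by (auto simp: B_def)
  have int: "integrable M f" by (rule ld.admissible_bounds(1)[OF fM B])
  define I where "I = (\<integral>y. cmod (f y) \<partial>M)"
  have F1: "cmod (fourier M f \<xi>) \<le> I" for \<xi>
  proof -
    have "cmod (fourier M f \<xi>) \<le> (\<integral>y. cmod (f y * place_char (- (\<xi> * y))) \<partial>M)"
      unfolding fourier_def by (rule integral_norm_bound)
    then show ?thesis by (simp add: I_def norm_mult place_char_norm)
  qed
  \<comment> \<open>A Lebesgue number for the cover of \<open>S\<close> by the open level sets of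
    \<open>f\<close>. If neither \<open>y\<close> nor \<open>h + y\<close> lies in \<open>S\<close>,
    both values are 0.\<close>
  have "\<exists>\<delta>>0. \<forall>h. av h < \<delta> \<longrightarrow> (\<forall>y. f (h + y) = f y)"
  proof -
    let ?G = "range (\<lambda>c. f -` {c})"
    have "open (f -` {c})" for c
      unfolding open_dist
    proof
      fix x assume x: "x \<in> f -` {c}"
      obtain \<epsilon> where \<epsilon>: "\<epsilon> > 0" "\<And>y. dist x y < \<epsilon> \<Longrightarrow> f y = f x" using lc by blast
      have "y \<in> f -` {c}" if "dist y x < \<epsilon>" for y using \<epsilon>(2)[of y] that x by (simp add: dist_commute)
      then show "\<exists>\<epsilon>>0. \<forall>y. dist y x < \<epsilon> \<longrightarrow> y \<in> f -` {c}" using \<epsilon>(1) by blast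
    qed
    then have op: "\<And>U. U \<in> ?G \<Longrightarrow> open U" by blast
    have "S \<subseteq> \<Union>?G" by blast
    then obtain \<delta> where \<delta>: "\<delta> > 0" "\<And>x. x \<in> S \<Longrightarrow> \<exists>U\<in>?G. ball x \<delta> \<subseteq> U"
      using Heine_Borel_lemma[OF S(1) _ op] by metis
    have near: "f z = f x" if xS: "x \<in> S" and xz: "dist x z < \<delta>" for x z
    proof -
      obtain c where c: "ball x \<delta> \<subseteq> f -` {c}" using \<delta>(2)[OF xS] by blast
      have "x \<in> ball x \<delta>" "z \<in> ball x \<delta>" using \<delta>(1) xz by simp_all
      then show ?thesis using c by blast
    qed
    have "f (h + y) = f y" if h: "av h < \<delta>" for h y
    proof -
      have d: "dist y (h + y) < \<delta>" "dist (h + y) y < \<delta>" using h by (simp_all add: dist_av)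
      consider "y \<in> S" | "h + y \<in> S" | "y \<notin> S" "h + y \<notin> S" by blast
      then show ?thesis
      proof cases
        case 1
        then show ?thesis using near[OF _ d(1)] by simp
      next
        case 2
        then show ?thesis using near[OF _ d(2)] by simp
      qed (simp add: S(2))
    qed
    then show ?thesis using \<delta>(1) by blast
  qed
  then obtain \<delta> where \<delta>: "\<delta> > 0" "\<And>h y. av h < \<delta> \<Longrightarrow> f (h + y) = f y" by blast
  define r where "r = av \<xi>\<^sub>0 / \<delta>"
  have vanish: "fourier M f \<xi> = 0" if \<xi>: "r < av \<xi>" for \<xi>
  proof -
    have "0 \<le> r" using \<delta>(1) by (simp add: r_def)
    then have \<xi>0: "\<xi> \<noteq> 0" using \<xi> by auto
    \<comment> \<open>Translation by this \<open>h\<close> multiplies the integrand by the value of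
      the character at \<open>\<xi>\<^sub>0\<close>, which is not 1.\<close>
    define h where "h = - \<xi>\<^sub>0 / \<xi>"
    have "av h = av \<xi>\<^sub>0 / av \<xi>" by (simp only: h_def av_divide av_minus)
    also have "\<dots> < \<delta>" using \<xi> \<delta>(1) \<xi>0 by (simp add: r_def field_simps)
    finally have h: "f (h + y) = f y" for y by (rule \<delta>(2))
    have \<xi>h: "- (\<xi> * h) = \<xi>\<^sub>0" using \<xi>0 by (simp add: h_def)
    let ?G = "\<lambda>y. f y * place_char (- (\<xi> * y))"
    have "?G (h + y) = place_char \<xi>\<^sub>0 * ?G y" for y
    proof -
      have "- (\<xi> * (h + y)) = - (\<xi> * h) + - (\<xi> * y)" by (simp add: distrib_left)
      then show ?thesis by (simp only: h place_char_add \<xi>h mult_ac)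
    qed
    moreover have "?G \<in> borel_measurable borel" by measurable
    ultimately have "(\<integral>y. place_char \<xi>\<^sub>0 * ?G y \<partial>M) = (\<integral>y. ?G y \<partial>M)" using integral_translate[of ?G h] by simp
    then have "place_char \<xi>\<^sub>0 * fourier M f \<xi> = 1 * fourier M f \<xi>" by (simp add: fourier_def)
    then show ?thesis using place_char_\<xi>\<^sub>0 by (simp only: mult_cancel_right) simp
  qed
  have F2: "(normalized_abs \<xi>)\<^sup>2 * cmod (fourier M f \<xi>) \<le> (r powr \<sigma>)\<^sup>2 * I" for \<xi>
  proof (cases "r < av \<xi>")
    case True
    have "0 \<le> I" by (simp add: I_def)
    then show ?thesis using vanish[OF True] by simp
  next
    case False
    then have "normalized_abs \<xi> \<le> r powr \<sigma>"
      unfolding normalized_abs_eq using \<sigma>_pos by (intro powr_mono2) auto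
    then show ?thesis using F1[of \<xi>] normalized_abs_nonneg[of \<xi>] by (intro mult_mono power_mono) auto
  qed
  have "\<exists>B. \<forall>\<xi>. cmod (fourier M f \<xi>) \<le> B \<and> (normalized_abs \<xi>)\<^sup>2 * cmod (fourier M f \<xi>) \<le> B"
    using F1 F2 by (intro exI[of _ "max I ((r powr \<sigma>)\<^sup>2 * I)"]) (simp add: le_max_iff_disj)
  then show ?thesis unfolding fourier_admissible_def using fM B inv by blast
qed

text \<open>Away from 0 the ultrametric inequality makes the absolute value itself locally constant;
  near 0 the function vanishes.\<close>

lemma log_mult_locally_constant:
  fixes f :: "'k \<Rightarrow> complex"
  assumes lc: "\<And>x. \<exists>\<epsilon>>0. \<forall>y. dist x y < \<epsilon> \<longrightarrow> f y = f x" and \<epsilon>: "\<epsilon> > 0" "\<forall>x\<in>ball 0 \<epsilon>. f x = 0"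
  shows "\<exists>\<delta>>0. \<forall>y. dist x y < \<delta> \<longrightarrow> log_mult f y = log_mult f x"
proof (cases "x = 0")
  case True
  then show ?thesis using \<epsilon> by (intro exI[of _ \<epsilon>]) (auto simp: log_mult_def)
next
  case False
  obtain \<delta> where \<delta>: "\<delta> > 0" "\<And>y. dist x y < \<delta> \<Longrightarrow> f y = f x" using lc by blast
  show ?thesis
  proof (intro exI[of _ "min \<delta> (av x)"] conjI allI impI)
    show "0 < min \<delta> (av x)" using \<delta>(1) False by simp
    fix y assume y: "dist x y < min \<delta> (av x)"
    then have "av y = av x" by (intro av_eq_if_close) (simp add: dist_av)
    then show "log_mult f y = log_mult f x" using \<delta>(2)[of y] y by (simp add: log_mult_def normalized_abs_eq)
  qed
qed

lemma schwartz_bruhat_iff: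
  fixes f :: "'k \<Rightarrow> complex"
  shows "schwartz_bruhat f \<longleftrightarrow> (\<forall>x. \<exists>\<epsilon>>0. \<forall>y. dist x y < \<epsilon> \<longrightarrow> f y = f x) \<and> (\<exists>C. compact C \<and> (\<forall>x. x \<notin> C \<longrightarrow> f x = 0))"
  using nonarch by (simp add: schwartz_bruhat_def)

lemma nonarch_commutator_bounded:
  assumes M: "self_dual_haar_measure M"
  shows "(\<exists>C. \<forall>\<phi>\<in>schwartz_bruhat_off_zero.
            conductor_commutator M \<phi> \<in> L2 M \<and>
            L2_norm M (conductor_commutator M \<phi>) \<le> C * L2_norm M \<phi>) \<and>
         (\<exists>T. L2_bounded_operator M T \<and> L2_hermitian M T \<and>
            (\<forall>\<phi>\<in>schwartz_bruhat_off_zero. AE x in M. T \<phi> x = conductor_commutator M \<phi> x))"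
proof (rule ld.commutator_bounded)
  have adm: "fourier_admissible M f" if f: "schwartz_bruhat f" for f
  proof -
    obtain S where "compact S" "\<And>x. x \<notin> S \<Longrightarrow> f x = 0" using f unfolding schwartz_bruhat_iff by blast
    moreover have "inv_fourier M (fourier M f) = f" using M f by (simp add: self_dual_haar_measure_def)
    moreover have "\<exists>\<epsilon>>0. \<forall>y. dist x y < \<epsilon> \<longrightarrow> f y = f x" for x using f by (simp add: schwartz_bruhat_iff)
    ultimately show ?thesis by (intro locally_constant_compact_admissible)
  qed
  fix \<phi> :: "'k \<Rightarrow> complex" assume "\<phi> \<in> schwartz_bruhat_off_zero"
  then obtain \<epsilon> where \<epsilon>: "\<epsilon> > 0" "\<forall>x\<in>ball 0 \<epsilon>. \<phi> x = 0" and sb: "schwartz_bruhat \<phi>"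
    by (auto simp: schwartz_bruhat_off_zero_def)
  obtain S where S: "compact S" "\<And>x. x \<notin> S \<Longrightarrow> \<phi> x = 0" using sb unfolding schwartz_bruhat_iff by blast
  have lc: "\<exists>\<epsilon>>0. \<forall>y. dist x y < \<epsilon> \<longrightarrow> \<phi> y = \<phi> x" for x using sb by (simp add: schwartz_bruhat_iff)
  have "schwartz_bruhat (log_mult \<phi>)"
    unfolding schwartz_bruhat_iff
  proof (intro conjI allI exI[of _ S])
    show "\<exists>\<delta>>0. \<forall>y. dist x y < \<delta> \<longrightarrow> log_mult \<phi> y = log_mult \<phi> x" for x by (rule log_mult_locally_constant[OF lc \<epsilon>])
    show "compact S" by (rule S)
    show "x \<notin> S \<longrightarrow> log_mult \<phi> x = 0" for x using S(2)[of x] by (simp add: log_mult_def)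
  qed
  then show "fourier_admissible M \<phi> \<and> fourier_admissible M (log_mult \<phi>)" using adm sb by blast
qed

end

section \<open>Both kinds of places together\<close>

text \<open>The prime, the lifted basis and the uniformizer are auxiliary choices made from their
  existence lemmas; the conclusion involves none of them.\<close>

lemma finite_place_commutator_bounded:
  fixes F :: "'k::{field_char_0, complete_space} set" and M :: "'k measure"
  assumes nonarch_place: "finite_place TYPE('k)" and F: "completion_at_place F" and M: "self_dual_haar_measure M"
  shows "(\<exists>C. \<forall>\<phi>\<in>schwartz_bruhat_off_zero.
            conductor_commutator M \<phi> \<in> L2 M \<and>
            L2_norm M (conductor_commutator M \<phi>) \<le> C * L2_norm M \<phi>) \<and>
         (\<exists>T. L2_bounded_operator M T \<and> L2_hermitian M T \<and>
            (\<forall>\<phi>\<in>schwartz_bruhat_off_zero. AE x in M. T \<phi> x = conductor_commutator M \<phi> x))"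
proof -
  interpret nonarch_field F using F nonarch_place by unfold_locales
  obtain p where p: "prime p" "av (of_nat p) < 1" using ex_prime_lt_1 by blast
  interpret padic_field F p "av (of_nat p)" using p by unfold_locales simp_all
  obtain X where X: "mod_independent X" "\<And>Y. mod_independent Y \<Longrightarrow> card Y \<le> card X"
    using ex_maximal_mod_independent by metis
  interpret padic_basis F p "av (of_nat p)" X
    by unfold_locales (use X maximal_mod_independent_generates[OF X] in simp_all)
  obtain \<pi> where \<pi>: "av \<pi> < 1" "\<pi> \<noteq> 0" "\<And>x. av x < 1 \<Longrightarrow> av x \<le> av \<pi>" using ex_largest_below_1 by blast
  interpret local_haar F p "av (of_nat p)" X \<pi> "av \<pi>" M
    using \<pi> M by unfold_locales (simp_all add: self_dual_haar_measure_def)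
  show ?thesis by (rule nonarch_commutator_bounded[OF M])
qed

theorem mainTheorem4:
  fixes F :: "'k::{field_char_0, complete_space} set"
    and M :: "'k measure"
  assumes "completion_at_place F"
    and "self_dual_haar_measure M"
  shows "(\<exists>C. \<forall>\<phi>\<in>schwartz_bruhat_off_zero.
            conductor_commutator M \<phi> \<in> L2 M \<and>
            L2_norm M (conductor_commutator M \<phi>) \<le> C * L2_norm M \<phi>) \<and>
         (\<exists>T. L2_bounded_operator M T \<and> L2_hermitian M T \<and>
            (\<forall>\<phi>\<in>schwartz_bruhat_off_zero. AE x in M. T \<phi> x = conductor_commutator M \<phi> x))"
proof (cases "finite_place TYPE('k)")
  case True
  then show ?thesis using assms by (rule finite_place_commutator_bounded)
next
  case False
  then show ?thesis using assms by (rule arch_commutator_bounded)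
qed

end
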